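(* Let $m$ be a square-free positive integer such that the ring of integers $\mathcal{O}_{-m}$ of $\mathbb{Q}(\sqrt{-m})$ has unit group $\{\pm 1\}$, and let $\Gamma$ be a finite index subgroup of $\mathrm{PSL}_2(\mathcal{O}_{-m})$. For $n\in\{2,3\}$, denote by $\lambda_{2n}$ the number of conjugacy classes of cyclic subgroups of order $n$ in $\Gamma$, and by $\lambda_{2n}^*$ the number of conjugacy classes of those among them which are contained in a dihedral subgroup of order $2n$ in $\Gamma$. Then $$ H^d_{\rm CR}\left([\mathcal{H}^3_{\mathbb{C}} / \Gamma] \right) \cong H^d\left(\mathcal{H}^3_{\mathbb{R}} / \Gamma; \mathbb{Q} \right) \oplus \begin{cases} \mathbb{Q}^{\lambda_4 +2\lambda_6 -\lambda_6^*}, & d=2, \\ \mathbb{Q}^{\lambda_4-\lambda_4^* +2\lambda_6 -\lambda_6^*}, & d=3, \\ 0, & \text{otherwise}. \end{cases}$$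
   Context: Action on complex hyperbolic space: the group $\mathrm{PSL}_2(\mathbb{C})$ is the group of orientation preserving isometries of real hyperbolic 3-space $\mathcal{H}^3_{\mathbb{R}}$. In the Kleinian model $\mathcal{H}^3_{\mathbb{R}}=\{[y_0:y_1:y_2:y_3]\in \mathbb{P}(\mathbb{R}^4) \mid y_0^2-y_1^2-y_2^2-y_3^2>0\}$ this group is $\mathrm{PSO}(1,3)$, and the isometry between the upper half-space model and the Kleinian model yields an isomorphism $\mathrm{PSL}_2(\mathbb{C})\cong \mathrm{PSO}(1,3)$. Complex hyperbolic 3-space is $\mathcal{H}^3_{\mathbb{C}}=\{[z_0:z_1:z_2:z_3]\in \mathbb{P}(\mathbb{C}^4) \mid |z_0|^2-|z_1|^2-|z_2|^2-|z_3|^2>0\}$; via $\mathrm{PSO}(1,3)\hookrightarrow \mathrm{PSU}(1,3)$, subgroups of $\mathrm{PSL}_2(\mathbb{C})$ act on $\mathcal{H}^3_{\mathbb{C}}$ by biholomorphisms. $[\mathcal{H}^3_{\mathbb{C}}/\Gamma]$ denotes the resulting complex orbifold. Chen--Ruan orbifold cohomology: let a discrete group $\Gamma$ act properly discontinuously by biholomorphisms on a complex manifold $Y$ of dimension $D$. For $g\in\Gamma$ let $Y^g$ be its fixed point set and $C_\Gamma(g)$ its centralizer. For $g$ of finite order and $y\in Y^g$, let $e^{2\pi i r_1},\dots,e^{2\pi i r_D}$ with $r_j\in[0,1)\cap\mathbb{Q}$ be the eigenvalues of $g$ on $T_yY$; the degree shifting number is $\mathrm{shift}(g,y)=\sum_j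 r_j$. It is constant on connected components of $Y^g$, and it is written $\mathrm{shift}(g)$ (in the case at hand $Y^g$ is connected). Let $T\subset\Gamma$ be a set of representatives of the conjugacy classes of elements of finite order. Then the graded vector space is $$H^d_{\rm CR}([Y/\Gamma]) := \bigoplus_{g\in T} H^{d-2\,\mathrm{shift}(g)}\left(Y^g/C_\Gamma(g);\mathbb{Q}\right).$$ The dihedral group of order $4$ is $\mathbb{Z}/2\times\mathbb{Z}/2$; the dihedral group of order $6$ is the symmetric group on three symbols. *)

theory Defs
  imports
    "HOL-Computational_Algebra.Squarefree"
    "HOL-Analysis.Analysis"
    "HOL-Homology.Homology_Groups"
    "HOL-Algebra.AbelCoset"
    "HOL-Algebra.Module"
    "HOL-Algebra.Elementary_Groups"
    "HOL-Algebra.Sym_Groups"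
    "HOL-Algebra.Group_Action"
begin

section \<open>Vector spaces over the rationals\<close>

text \<open>The fields \<^const>\<open>mult\<close> and \<^const>\<open>one\<close> of a module record carry no meaning;
  they are left undefined throughout.\<close>

definition rat_module :: "(rat, rat) module" where
  "rat_module =
     \<lparr>carrier = UNIV, mult = undefined, one = undefined, zero = 0, add = (+), smult = (*)\<rparr>"

definition trivial_module :: "'a \<Rightarrow> (rat, 'a) module" where
  "trivial_module z =
     \<lparr>carrier = {z}, mult = undefined, one = undefined, zero = z, add = (\<lambda>_ _. z), smult = (\<lambda>_ _. z)\<rparr>"

definition direct_sum :: "'i set \<Rightarrow> ('i \<Rightarrow> (rat, 'a) module) \<Rightarrow> (rat, 'i \<Rightarrow> 'a) module" where
  "direct_sum I M =
     \<lparr>carrier = {f \<in> Pi\<^sub>E I (\<lambda>i. carrier (M i)). finite {i \<in> I. f i \<noteq> \<zero>\<^bsub>M i\<^esub>}},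
      mult = undefined, one = undefined,
      zero = (\<lambda>i\<in>I. \<zero>\<^bsub>M i\<^esub>),
      add = (\<lambda>f g. \<lambda>i\<in>I. f i \<oplus>\<^bsub>M i\<^esub> g i),
      smult = (\<lambda>r f. \<lambda>i\<in>I. r \<odot>\<^bsub>M i\<^esub> f i)\<rparr>"

definition direct_sum2 :: "(rat, 'a) module \<Rightarrow> (rat, 'b) module \<Rightarrow> (rat, 'a \<times> 'b) module" where
  "direct_sum2 M N =
     \<lparr>carrier = carrier M \<times> carrier N, mult = undefined, one = undefined,
      zero = (\<zero>\<^bsub>M\<^esub>, \<zero>\<^bsub>N\<^esub>),
      add = (\<lambda>x y. (fst x \<oplus>\<^bsub>M\<^esub> fst y, snd x \<oplus>\<^bsub>N\<^esub> snd y)),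
      smult = (\<lambda>r x. (r \<odot>\<^bsub>M\<^esub> fst x, r \<odot>\<^bsub>N\<^esub> snd x))\<rparr>"

definition rat_space :: "nat \<Rightarrow> (rat, nat \<Rightarrow> rat) module" where
  "rat_space k = direct_sum {..<k} (\<lambda>_. rat_module)"

definition module_isomorphic :: "(rat, 'a) module \<Rightarrow> (rat, 'b) module \<Rightarrow> bool" where
  "module_isomorphic M N \<longleftrightarrow>
     (\<exists>h. bij_betw h (carrier M) (carrier N) \<and>
          (\<forall>x\<in>carrier M. \<forall>y\<in>carrier M. h (x \<oplus>\<^bsub>M\<^esub> y) = h x \<oplus>\<^bsub>N\<^esub> h y) \<and>
          (\<forall>r. \<forall>x\<in>carrier M. h (r \<odot>\<^bsub>M\<^esub> x) = r \<odot>\<^bsub>N\<^esub> h x))"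

definition quotient_module :: "(rat, 'a) module \<Rightarrow> 'a set \<Rightarrow> (rat, 'a set) module" where
  "quotient_module M B =
     \<lparr>carrier = A_RCOSETS M B, mult = undefined, one = undefined, zero = B,
      add = set_add M,
      smult = (\<lambda>r A. \<Union>x\<in>A. a_r_coset M B (r \<odot>\<^bsub>M\<^esub> x))\<rparr>"


section \<open>Singular cohomology with rational coefficients\<close>

definition cochain_module :: "nat \<Rightarrow> 'a topology \<Rightarrow> (rat, 'a chain \<Rightarrow> rat) module" where
  "cochain_module p X =
     \<lparr>carrier = {u \<in> extensional (singular_chain_set p X).
         \<forall>a\<in>singular_chain_set p X. \<forall>b\<in>singular_chain_set p X. u (a + b) = u a + u b},
      mult = undefined, one = undefined,
      zero = (\<lambda>a\<in>singular_chain_set p X. 0),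
      add = (\<lambda>u v. \<lambda>a\<in>singular_chain_set p X. u a + v a),
      smult = (\<lambda>r u. \<lambda>a\<in>singular_chain_set p X. r * u a)\<rparr>"

definition coboundary :: "nat \<Rightarrow> 'a topology \<Rightarrow> ('a chain \<Rightarrow> rat) \<Rightarrow> 'a chain \<Rightarrow> rat" where
  "coboundary p X u = (\<lambda>a\<in>singular_chain_set (Suc p) X. u (chain_boundary (Suc p) a))"

definition cocycles :: "nat \<Rightarrow> 'a topology \<Rightarrow> ('a chain \<Rightarrow> rat) set" where
  "cocycles p X =
     {u \<in> carrier (cochain_module p X). coboundary p X u = \<zero>\<^bsub>cochain_module (Suc p) X\<^esub>}"

fun coboundaries :: "nat \<Rightarrow> 'a topology \<Rightarrow> ('a chain \<Rightarrow> rat) set" where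
  "coboundaries 0 X = {\<zero>\<^bsub>cochain_module 0 X\<^esub>}"
| "coboundaries (Suc p) X = coboundary p X ` carrier (cochain_module p X)"

definition singular_cohomology :: "nat \<Rightarrow> 'a topology \<Rightarrow> (rat, ('a chain \<Rightarrow> rat) set) module" where
  "singular_cohomology p X =
     quotient_module (cochain_module p X \<lparr>carrier := cocycles p X\<rparr>) (coboundaries p X)"

text \<open>Cohomology in an arbitrary real degree; it vanishes unless the degree is a natural number.\<close>

definition cohomology :: "real \<Rightarrow> 'a topology \<Rightarrow> (rat, ('a chain \<Rightarrow> rat) set) module" where
  "cohomology q X =
     (if q \<in> \<nat> then singular_cohomology (nat \<lfloor>q\<rfloor>) X else trivial_module {})"


section \<open>Quotient spaces\<close>

definition quotient_topology :: "'a topology \<Rightarrow> ('a \<Rightarrow> 'b) \<Rightarrow> 'b topology" where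
  "quotient_topology X f =
     topology (\<lambda>U. U \<subseteq> f ` topspace X \<and> openin X {x \<in> topspace X. f x \<in> U})"

lemma openin_quotient_topology:
  "openin (quotient_topology X f) U \<longleftrightarrow>
     U \<subseteq> f ` topspace X \<and> openin X {x \<in> topspace X. f x \<in> U}"
proof -
  have "istopology (\<lambda>U. U \<subseteq> f ` topspace X \<and> openin X {x \<in> topspace X. f x \<in> U})"
    unfolding istopology_def
  proof (intro conjI allI impI)
    fix S T
    assume S: "S \<subseteq> f ` topspace X \<and> openin X {x \<in> topspace X. f x \<in> S}"
      and T: "T \<subseteq> f ` topspace X \<and> openin X {x \<in> topspace X. f x \<in> T}"
    show "S \<inter> T \<subseteq> f ` topspace X" using S by blast
    have "{x \<in> topspace X. f x \<in> S \<inter> T} =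
        {x \<in> topspace X. f x \<in> S} \<inter> {x \<in> topspace X. f x \<in> T}" by blast
    then show "openin X {x \<in> topspace X. f x \<in> S \<inter> T}" using S T by auto
  next
    fix K
    assume K: "\<forall>U\<in>K. U \<subseteq> f ` topspace X \<and> openin X {x \<in> topspace X. f x \<in> U}"
    show "\<Union>K \<subseteq> f ` topspace X" using K by blast
    have "{x \<in> topspace X. f x \<in> \<Union>K} = (\<Union>U\<in>K. {x \<in> topspace X. f x \<in> U})" by blast
    then show "openin X {x \<in> topspace X. f x \<in> \<Union>K}" using K by auto
  qed
  then show ?thesis by (simp add: quotient_topology_def)
qed

lemma topspace_quotient_topology: "topspace (quotient_topology X f) = f ` topspace X"
proof
  show "topspace (quotient_topology X f) \<subseteq> f ` topspace X"
    using openin_quotient_topology[of X f "topspace (quotient_topology X f)"] by simp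
  have "{x \<in> topspace X. f x \<in> f ` topspace X} = topspace X" by blast
  then have "openin (quotient_topology X f) (f ` topspace X)"
    by (simp add: openin_quotient_topology)
  then show "f ` topspace X \<subseteq> topspace (quotient_topology X f)"
    by (rule openin_subset)
qed

lemma quotient_map_quotient_topology: "quotient_map X (quotient_topology X f) f"
  by (auto simp: quotient_map_def topspace_quotient_topology openin_quotient_topology)

definition orbit_space :: "('g, 'm) monoid_scheme \<Rightarrow> ('g \<Rightarrow> 'y \<Rightarrow> 'y) \<Rightarrow> 'y topology \<Rightarrow> 'y set topology" where
  "orbit_space G act Y = quotient_topology Y (orbit G act)"


section \<open>Chen--Ruan cohomology\<close>

text \<open>The complex manifold is given by its topology \<open>Y\<close> together with a global holomorphic chart
  \<open>chart\<close>, a homeomorphism onto an open subset of \<open>\<complex>\<^sup>n\<close>; the group \<open>G\<close> acts through \<open>act\<close>. The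
  differential of \<open>g\<close> at a fixed point \<open>y\<close> is computed in this chart, which identifies \<open>T\<^sub>y Y\<close>
  with \<open>\<complex>\<^sup>n\<close>.\<close>

definition tangent_action ::
  "'y topology \<Rightarrow> ('g \<Rightarrow> 'y \<Rightarrow> 'y) \<Rightarrow> ('y \<Rightarrow> complex ^ 'n) \<Rightarrow> 'g \<Rightarrow> 'y \<Rightarrow> complex ^ 'n \<Rightarrow> complex ^ 'n" where
  "tangent_action Y act chart g y =
     frechet_derivative (\<lambda>w. chart (act g (inv_into (topspace Y) chart w))) (at (chart y))"

text \<open>The eigenvalues of an automorphism of finite order are counted with multiplicity;
  since it is diagonalisable, the multiplicity is the complex dimension of the eigenspace. An
  eigenvalue \<open>e\<^bsup>2\<pi>ir\<^esup>\<close> with \<open>r \<in> [0,1)\<close> has \<open>Arg2pi\<close> equal to \<open>2\<pi>r\<close>.\<close>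

definition eigenspace :: "(complex ^ 'n \<Rightarrow> complex ^ 'n) \<Rightarrow> complex \<Rightarrow> (complex ^ 'n) set" where
  "eigenspace L \<mu> = {v. L v = \<mu> *s v}"

definition degree_shift ::
  "'y topology \<Rightarrow> ('g \<Rightarrow> 'y \<Rightarrow> 'y) \<Rightarrow> ('y \<Rightarrow> complex ^ 'n) \<Rightarrow> 'g \<Rightarrow> 'y \<Rightarrow> real" where
  "degree_shift Y act chart g y =
     (let L = tangent_action Y act chart g y in
      \<Sum>\<mu> | eigenspace L \<mu> \<noteq> {0}. real (vec.dim (eigenspace L \<mu>)) * (Arg2pi \<mu> / (2 * pi)))"

definition fixed_set :: "'y topology \<Rightarrow> ('g \<Rightarrow> 'y \<Rightarrow> 'y) \<Rightarrow> 'g \<Rightarrow> 'y set" where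
  "fixed_set Y act g = {y \<in> topspace Y. act g y = y}"

text \<open>For connected fixed point sets the degree shift does not depend on the base point.\<close>

definition degree_shift_of ::
  "'y topology \<Rightarrow> ('g \<Rightarrow> 'y \<Rightarrow> 'y) \<Rightarrow> ('y \<Rightarrow> complex ^ 'n) \<Rightarrow> 'g \<Rightarrow> real" where
  "degree_shift_of Y act chart g = degree_shift Y act chart g (SOME y. y \<in> fixed_set Y act g)"

definition centralizer :: "('g, 'm) monoid_scheme \<Rightarrow> 'g \<Rightarrow> 'g set" where
  "centralizer G g = {h \<in> carrier G. h \<otimes>\<^bsub>G\<^esub> g = g \<otimes>\<^bsub>G\<^esub> h}"

definition finite_order_elements :: "('g, 'm) monoid_scheme \<Rightarrow> 'g set" where
  "finite_order_elements G = {g \<in> carrier G. \<exists>k>0. g [^]\<^bsub>G\<^esub> (k::nat) = \<one>\<^bsub>G\<^esub>}"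

definition torsion_representatives :: "('g, 'm) monoid_scheme \<Rightarrow> 'g set \<Rightarrow> bool" where
  "torsion_representatives G T \<longleftrightarrow>
     T \<subseteq> finite_order_elements G \<and>
     (\<forall>g\<in>finite_order_elements G. \<exists>!t. t \<in> T \<and>
        (\<exists>h\<in>carrier G. t = h \<otimes>\<^bsub>G\<^esub> g \<otimes>\<^bsub>G\<^esub> inv\<^bsub>G\<^esub> h))"

definition chen_ruan_cohomology ::
  "('g, 'm) monoid_scheme \<Rightarrow> 'y topology \<Rightarrow> ('g \<Rightarrow> 'y \<Rightarrow> 'y) \<Rightarrow> ('y \<Rightarrow> complex ^ 'n) \<Rightarrow> 'g set \<Rightarrow> int
    \<Rightarrow> (rat, 'g \<Rightarrow> ('y set chain \<Rightarrow> rat) set) module" where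
  "chen_ruan_cohomology G Y act chart T d =
     direct_sum T (\<lambda>g.
       cohomology (of_int d - 2 * degree_shift_of Y act chart g)
         (orbit_space (G\<lparr>carrier := centralizer G g\<rparr>) act (subtopology Y (fixed_set Y act g))))"


section \<open>Real and complex hyperbolic 3-space\<close>

text \<open>A point of projective space is a line through the origin. The homogeneous coordinates are
  indexed by \<open>0, 1, 2, 3\<close> of the numeral type \<open>4\<close> (in which \<open>0 = 4\<close>).\<close>

lemma vector_4 [simp]:
  "(vector [a, b, c, e] :: 'a::zero ^ 4) $ 1 = a"
  "(vector [a, b, c, e] :: 'a::zero ^ 4) $ 2 = b"
  "(vector [a, b, c, e] :: 'a::zero ^ 4) $ 3 = c"
  "(vector [a, b, c, e] :: 'a::zero ^ 4) $ 0 = e"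
proof -
  have "(0::4) = 4" by simp
  then show
  "(vector [a, b, c, e] :: 'a::zero ^ 4) $ 1 = a"
  "(vector [a, b, c, e] :: 'a::zero ^ 4) $ 2 = b"
  "(vector [a, b, c, e] :: 'a::zero ^ 4) $ 3 = c"
  "(vector [a, b, c, e] :: 'a::zero ^ 4) $ 0 = e"
    by (simp_all add: vector_def)
qed

lemma forall_4_0: "(\<forall>i::4. P i) \<longleftrightarrow> P 0 \<and> P 1 \<and> P 2 \<and> P 3"
proof -
  have "(4::4) = 0" by simp
  then show ?thesis unfolding forall_4 by metis
qed

definition line :: "'a::field ^ 'n \<Rightarrow> ('a ^ 'n) set" where
  "line v = vec.span {v}"

definition real_projective_space :: "(real ^ 'n) set topology" where
  "real_projective_space = quotient_topology (top_of_set (- {0})) line"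

definition complex_projective_space :: "(complex ^ 'n) set topology" where
  "complex_projective_space = quotient_topology (top_of_set (- {0})) line"

definition real_hyperbolic_3_space :: "(real ^ 4) set topology" where
  "real_hyperbolic_3_space = subtopology real_projective_space
     {line y | y. (y $ 0)\<^sup>2 - (y $ 1)\<^sup>2 - (y $ 2)\<^sup>2 - (y $ 3)\<^sup>2 > 0}"

definition complex_hyperbolic_3_space :: "(complex ^ 4) set topology" where
  "complex_hyperbolic_3_space = subtopology complex_projective_space
     {line z | z. (cmod (z $ 0))\<^sup>2 - (cmod (z $ 1))\<^sup>2 - (cmod (z $ 2))\<^sup>2 - (cmod (z $ 3))\<^sup>2 > 0}"

text \<open>The affine chart \<open>[1:w\<^sub>1:w\<^sub>2:w\<^sub>3] \<mapsto> (w\<^sub>1,w\<^sub>2,w\<^sub>3)\<close>, which maps complex hyperbolic space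
  biholomorphically onto the open unit ball of \<open>\<complex>\<^sup>3\<close>.\<close>

definition affine_chart :: "(complex ^ 4) set \<Rightarrow> complex ^ 3" where
  "affine_chart l = (THE w. vector [w $ 1, w $ 2, w $ 3, 1] \<in> l)"

lemma affine_chart_line:
  assumes "z $ 0 \<noteq> 0"
  shows "affine_chart (line z) = vector [z $ 1 / z $ 0, z $ 2 / z $ 0, z $ 3 / z $ 0]"
  unfolding affine_chart_def
proof (rule the_equality)
  show "vector [(vector [z $ 1 / z $ 0, z $ 2 / z $ 0, z $ 3 / z $ 0] :: complex^3) $ 1,
       (vector [z $ 1 / z $ 0, z $ 2 / z $ 0, z $ 3 / z $ 0] :: complex^3) $ 2,
       (vector [z $ 1 / z $ 0, z $ 2 / z $ 0, z $ 3 / z $ 0] :: complex^3) $ 3, 1] \<in> line z"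
    using assms unfolding line_def vec.span_singleton
    by (auto intro!: image_eqI[where x = "1 / z $ 0"] simp: vec_eq_iff forall_4_0)
next
  fix w :: "complex ^ 3"
  assume "vector [w $ 1, w $ 2, w $ 3, 1] \<in> line z"
  then obtain k where "vector [w $ 1, w $ 2, w $ 3, 1] = k *s z"
    unfolding line_def vec.span_singleton by auto
  then show "w = vector [z $ 1 / z $ 0, z $ 2 / z $ 0, z $ 3 / z $ 0]"
    using assms by (simp add: vec_eq_iff forall_4_0 forall_3 field_simps)
qed


section \<open>The action of \<open>PSL\<^sub>2(\<complex>)\<close>\<close>

text \<open>For a subring \<open>R\<close> of \<open>\<complex>\<close>, the elements of \<open>PSL2 R\<close> are the cosets \<open>{A, -A}\<close>.\<close>

definition SL2 :: "complex set \<Rightarrow> (complex ^ 2 ^ 2) monoid" where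
  "SL2 R = \<lparr>carrier = {A. (\<forall>i j. A $ i $ j \<in> R) \<and> det A = 1}, mult = (**), one = mat 1\<rparr>"

definition PSL2 :: "complex set \<Rightarrow> (complex ^ 2 ^ 2) set monoid" where
  "PSL2 R = SL2 R Mod {mat 1, - mat 1}"

text \<open>Vectors of \<open>\<real>\<^sup>4\<close> correspond to Hermitian matrices; the determinant becomes the Lorentz
  form, and \<open>X \<mapsto> A X A\<^sup>*\<close> becomes a Lorentz transformation.\<close>

definition hermitian_matrix :: "real ^ 4 \<Rightarrow> complex ^ 2 ^ 2" where
  "hermitian_matrix y =
     vector [vector [complex_of_real (y $ 0 + y $ 1), Complex (y $ 2) (y $ 3)],
             vector [Complex (y $ 2) (- (y $ 3)), complex_of_real (y $ 0 - y $ 1)]]"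

definition hermitian_coords :: "complex ^ 2 ^ 2 \<Rightarrow> real ^ 4" where
  "hermitian_coords X =
     vector [Re (X $ 1 $ 1 - X $ 2 $ 2) / 2, Re (X $ 1 $ 2), Im (X $ 1 $ 2),
             Re (X $ 1 $ 1 + X $ 2 $ 2) / 2]"

definition conj_transpose :: "complex ^ 2 ^ 2 \<Rightarrow> complex ^ 2 ^ 2" where
  "conj_transpose A = (\<chi> i j. cnj (A $ j $ i))"

lemma hermitian_matrix_nth [simp]:
  "hermitian_matrix y $ 1 $ 1 = complex_of_real (y $ 0 + y $ 1)"
  "hermitian_matrix y $ 1 $ 2 = Complex (y $ 2) (y $ 3)"
  "hermitian_matrix y $ 2 $ 1 = Complex (y $ 2) (- (y $ 3))"
  "hermitian_matrix y $ 2 $ 2 = complex_of_real (y $ 0 - y $ 1)"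
  by (simp_all add: hermitian_matrix_def)

lemma hermitian_coords_nth [simp]:
  "hermitian_coords X $ 0 = Re (X $ 1 $ 1 + X $ 2 $ 2) / 2"
  "hermitian_coords X $ 1 = Re (X $ 1 $ 1 - X $ 2 $ 2) / 2"
  "hermitian_coords X $ 2 = Re (X $ 1 $ 2)"
  "hermitian_coords X $ 3 = Im (X $ 1 $ 2)"
  by (simp_all add: hermitian_coords_def)

lemma conj_transpose_nth [simp]: "conj_transpose A $ i $ j = cnj (A $ j $ i)"
  by (simp add: conj_transpose_def)

lemma hermitian_coords_matrix: "hermitian_coords (hermitian_matrix y) = y"
  by (simp add: vec_eq_iff forall_4_0)

definition lorentz_matrix :: "complex ^ 2 ^ 2 \<Rightarrow> real ^ 4 ^ 4" where
  "lorentz_matrix A =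
     matrix (\<lambda>y. hermitian_coords (A ** hermitian_matrix y ** conj_transpose A))"

lemma lorentz_matrix_vec:
  "lorentz_matrix A *v y = hermitian_coords (A ** hermitian_matrix y ** conj_transpose A)"
proof -
  have "linear (\<lambda>y. hermitian_coords (A ** hermitian_matrix y ** conj_transpose A))"
    by (rule linearI)
      (simp_all add: vec_eq_iff forall_4_0 matrix_matrix_mult_def sum_2 algebra_simps
        add_divide_distrib diff_divide_distrib)
  then show ?thesis
    by (simp add: lorentz_matrix_def matrix_works)
qed

lemma conj_transpose_mult: "conj_transpose (A ** B) = conj_transpose B ** conj_transpose A"
  by (simp add: vec_eq_iff matrix_matrix_mult_def mult.commute)

lemma hermitian_matrix_coords:
  assumes "conj_transpose X = X"
  shows "hermitian_matrix (hermitian_coords X) = X"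
proof -
  have "cnj (X $ j $ i) = X $ i $ j" for i j
    using assms by (metis conj_transpose_nth)
  from this[of 1 1] this[of 1 2] this[of 2 1] this[of 2 2] show ?thesis
    by (simp add: vec_eq_iff forall_2 complex_eq_iff field_simps)
qed

lemma lorentz_matrix_mult: "lorentz_matrix (A ** B) = lorentz_matrix A ** lorentz_matrix B"
proof -
  have "lorentz_matrix (A ** B) *v y = lorentz_matrix A ** lorentz_matrix B *v y" for y
  proof -
    have "conj_transpose (conj_transpose M) = M" for M by (simp add: vec_eq_iff)
    moreover have "conj_transpose (hermitian_matrix y) = hermitian_matrix y"
      by (simp add: vec_eq_iff forall_2 complex_eq_iff)
    ultimately have "conj_transpose (B ** hermitian_matrix y ** conj_transpose B) =
        B ** hermitian_matrix y ** conj_transpose B"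
      by (simp add: conj_transpose_mult matrix_mul_assoc)
    then show ?thesis
      by (simp add: lorentz_matrix_vec hermitian_matrix_coords conj_transpose_mult matrix_mul_assoc
          flip: matrix_vector_mul_assoc)
  qed
  then show ?thesis by (simp add: matrix_eq)
qed

lemma lorentz_matrix_uminus: "lorentz_matrix (- A) = lorentz_matrix A"
proof -
  have "lorentz_matrix (- A) *v y = lorentz_matrix A *v y" for y
    by (simp add: lorentz_matrix_vec vec_eq_iff forall_4_0 matrix_matrix_mult_def sum_2 algebra_simps)
  then show ?thesis by (simp add: matrix_eq)
qed

definition PSL2_to_PSO :: "(complex ^ 2 ^ 2) set \<Rightarrow> real ^ 4 ^ 4" where
  "PSL2_to_PSO g = the_elem (lorentz_matrix ` g)"

lemma PSL2_to_PSO_eq: "PSL2_to_PSO {A, - A} = lorentz_matrix A"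
  by (simp add: PSL2_to_PSO_def lorentz_matrix_uminus)

definition real_action :: "(complex ^ 2 ^ 2) set \<Rightarrow> (real ^ 4) set \<Rightarrow> (real ^ 4) set" where
  "real_action g l = (\<lambda>y. PSL2_to_PSO g *v y) ` l"

definition complex_action :: "(complex ^ 2 ^ 2) set \<Rightarrow> (complex ^ 4) set \<Rightarrow> (complex ^ 4) set" where
  "complex_action g l = (\<lambda>z. map_matrix complex_of_real (PSL2_to_PSO g) *v z) ` l"

text \<open>The homomorphism \<^const>\<open>lorentz_matrix\<close> is the one induced by the isometry between the upper
  half-space model and the Kleinian model: \<open>kleinian_vector\<close> represents that isometry in
  homogeneous coordinates. The hyperbolic distance \<open>\<delta>\<close> satisfies
  \<open>cosh \<delta> = \<langle>x,y\<rangle> / (\<langle>x,x\<rangle>\<langle>y,y\<rangle>)\<^bsup>1/2\<^esup>\<close> in the Kleinian model and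
  \<open>cosh \<delta> = 1 + (\<bar>z - w\<bar>\<^sup>2 + (t - s)\<^sup>2) / (2ts)\<close> in the upper half-space model.\<close>

definition upper_half_space :: "(complex \<times> real) set" where
  "upper_half_space = {(z, t). t > 0}"

definition poincare_extension :: "complex ^ 2 ^ 2 \<Rightarrow> complex \<times> real \<Rightarrow> complex \<times> real" where
  "poincare_extension A p =
     (let a = A $ 1 $ 1; b = A $ 1 $ 2; c = A $ 2 $ 1; d = A $ 2 $ 2; z = fst p; t = snd p;
          n = (cmod (c * z + d))\<^sup>2 + (cmod c)\<^sup>2 * t\<^sup>2
      in (((a * z + b) * cnj (c * z + d) + a * cnj c * of_real (t\<^sup>2)) / of_real n, t / n))"

definition kleinian_vector :: "complex \<times> real \<Rightarrow> real ^ 4" where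
  "kleinian_vector p =
     (let z = fst p; t = snd p in
      vector [((cmod z)\<^sup>2 + t\<^sup>2 - 1) / 2, Re z, Im z, ((cmod z)\<^sup>2 + t\<^sup>2 + 1) / 2])"

definition lorentz_form :: "real ^ 4 \<Rightarrow> real ^ 4 \<Rightarrow> real" where
  "lorentz_form x y = x $ 0 * y $ 0 - x $ 1 * y $ 1 - x $ 2 * y $ 2 - x $ 3 * y $ 3"


lemma kleinian_vector_nth:
  "kleinian_vector (z, t) $ 0 = ((cmod z)\<^sup>2 + t\<^sup>2 + 1) / 2"
  "kleinian_vector (z, t) $ 1 = ((cmod z)\<^sup>2 + t\<^sup>2 - 1) / 2"
  "kleinian_vector (z, t) $ 2 = Re z"
  "kleinian_vector (z, t) $ 3 = Im z"
  by (simp_all add: kleinian_vector_def Let_def)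

lemma lagrange:
  fixes a c p q :: complex and t :: real
  shows "(cmod (p * cnj q + a * cnj c * of_real (t\<^sup>2)))\<^sup>2 + t\<^sup>2 * (cmod (a * q - c * p))\<^sup>2 =
    ((cmod q)\<^sup>2 + (cmod c)\<^sup>2 * t\<^sup>2) * ((cmod p)\<^sup>2 + (cmod a)\<^sup>2 * t\<^sup>2)"
  unfolding cmod_power2 by (simp add: algebra_simps power2_eq_square)

lemma hermitian_kleinian:
  "hermitian_matrix (kleinian_vector (z, t)) =
     vector [vector [of_real ((cmod z)\<^sup>2 + t\<^sup>2), z], vector [cnj z, 1]]"
  by (simp add: vec_eq_iff forall_2 kleinian_vector_def Let_def complex_eq_iff field_simps)

lemma kleinian_vector_equivariant:
  fixes A :: "complex ^ 2 ^ 2" and z :: complex and t :: real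
  assumes "det A = 1" and "t > 0"
  defines "n \<equiv> (cmod (A $ 2 $ 1 * z + A $ 2 $ 2))\<^sup>2 + (cmod (A $ 2 $ 1))\<^sup>2 * t\<^sup>2"
  shows "n > 0"
    and "lorentz_matrix A *v kleinian_vector (z, t) = n *s kleinian_vector (poincare_extension A (z, t))"
proof -
  define a b c d where abcd: "a = A $ 1 $ 1" "b = A $ 1 $ 2" "c = A $ 2 $ 1" "d = A $ 2 $ 2"
  have det: "a * d - b * c = 1" using assms(1) by (simp add: det_2 abcd)
  show n: "n > 0"
  proof (cases "c = 0")
    case True
    then have "d \<noteq> 0" using det by auto
    then show ?thesis using True by (simp add: n_def flip: abcd)
  next
    case False
    then show ?thesis using assms(2) by (simp add: n_def add_nonneg_pos flip: abcd)
  qed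
  define N where "N = (a * z + b) * cnj (c * z + d) + a * cnj c * of_real (t\<^sup>2)"
  have "a * (c * z + d) - c * (a * z + b) = 1" using det by (simp add: algebra_simps)
  then have eq: "(cmod N)\<^sup>2 + t\<^sup>2 = n * ((cmod (a * z + b))\<^sup>2 + (cmod a)\<^sup>2 * t\<^sup>2)"
    using lagrange[of "a * z + b" "c * z + d" a c t] by (simp add: N_def n_def flip: abcd)
  have P: "poincare_extension A (z, t) = (N / of_real n, t / n)"
    by (simp add: poincare_extension_def Let_def N_def n_def flip: abcd)
  let ?X = "A ** hermitian_matrix (kleinian_vector (z, t)) ** conj_transpose A"
  have X: "?X $ 1 $ 1 = of_real ((cmod (a * z + b))\<^sup>2 + (cmod a)\<^sup>2 * t\<^sup>2)" "?X $ 1 $ 2 = N"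
    "?X $ 2 $ 2 = of_real n"
    by (simp_all add: hermitian_kleinian matrix_matrix_mult_def sum_2 N_def n_def complex_eq_iff cmod_power2
       flip: abcd) (simp_all add: algebra_simps power2_eq_square)
  have sq: "((cmod (N / of_real n))\<^sup>2 + (t / n)\<^sup>2) * n = (cmod (a * z + b))\<^sup>2 + (cmod a)\<^sup>2 * t\<^sup>2"
  proof -
    have "((cmod (N / of_real n))\<^sup>2 + (t / n)\<^sup>2) * n = ((cmod N)\<^sup>2 + t\<^sup>2) / n"
      using n by (simp add: norm_divide power_divide power2_eq_square[of n] add_divide_distrib
          distrib_right)
    then show ?thesis using n by (simp add: eq)
  qed
  define M where "M = (cmod (N / of_real n))\<^sup>2 + (t / n)\<^sup>2"
  show "lorentz_matrix A *v kleinian_vector (z, t) = n *s kleinian_vector (poincare_extension A (z, t))"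
    unfolding lorentz_matrix_vec P vec_eq_iff forall_4_0 hermitian_coords_nth X vector_smult_component
      kleinian_vector_nth sq [symmetric] M_def [symmetric]
    using n by (simp add: algebra_simps add_divide_distrib diff_divide_distrib)
qed

lemma kleinian_isometry:
  assumes "p \<in> upper_half_space" "q \<in> upper_half_space"
  shows "lorentz_form (kleinian_vector p) (kleinian_vector p) = (snd p)\<^sup>2"
   and "lorentz_form (kleinian_vector p) (kleinian_vector q) / (snd p * snd q) =
          1 + ((cmod (fst p - fst q))\<^sup>2 + (snd p - snd q)\<^sup>2) / (2 * snd p * snd q)"
proof -
  have t: "snd p > 0" "snd q > 0" using assms by (auto simp: upper_half_space_def)
  show "lorentz_form (kleinian_vector p) (kleinian_vector p) = (snd p)\<^sup>2"
    unfolding lorentz_form_def kleinian_vector_def Let_def vector_4 cmod_power2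
    by (simp add: field_simps power2_eq_square)
  have "lorentz_form (kleinian_vector p) (kleinian_vector q) =
    snd p * snd q + ((cmod (fst p - fst q))\<^sup>2 + (snd p - snd q)\<^sup>2) / 2"
    unfolding lorentz_form_def kleinian_vector_def Let_def vector_4 cmod_power2
    by (simp add: field_simps power2_eq_square)
  then show "lorentz_form (kleinian_vector p) (kleinian_vector q) / (snd p * snd q) =
          1 + ((cmod (fst p - fst q))\<^sup>2 + (snd p - snd q)\<^sup>2) / (2 * snd p * snd q)"
    using t by (simp add: add_divide_distrib mult.assoc)
qed


section \<open>Bianchi groups\<close>

definition imaginary_quadratic_integers :: "nat \<Rightarrow> complex set" where
  "imaginary_quadratic_integers m =
     {x. (\<exists>a b. x = of_rat a + of_rat b * csqrt (- of_nat m)) \<and> algebraic_int x}"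

definition units_of_subring :: "complex set \<Rightarrow> complex set" where
  "units_of_subring R = {u \<in> R. \<exists>v\<in>R. u * v = 1}"


section \<open>Conjugacy classes of cyclic subgroups\<close>

definition cyclic_subgroups :: "('g, 'm) monoid_scheme \<Rightarrow> nat \<Rightarrow> 'g set set" where
  "cyclic_subgroups G n = {C. card C = n \<and> (\<exists>g\<in>carrier G. C = generate G {g})}"

definition subgroup_conj_class :: "('g, 'm) monoid_scheme \<Rightarrow> 'g set \<Rightarrow> 'g set set" where
  "subgroup_conj_class G H = orbit G (\<lambda>g H. g <#\<^bsub>G\<^esub> H #>\<^bsub>G\<^esub> inv\<^bsub>G\<^esub> g) H"

text \<open>Dihedral groups of order \<open>2n\<close>; only \<open>n = 2\<close> and \<open>n = 3\<close> are needed.\<close>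

definition is_dihedral :: "nat \<Rightarrow> ('g, 'm) monoid_scheme \<Rightarrow> bool" where
  "is_dihedral n D \<longleftrightarrow>
     n = 2 \<and> D \<cong> integer_mod_group 2 \<times>\<times> integer_mod_group 2 \<or>
     n = 3 \<and> D \<cong> sym_group 3"

definition num_cyclic_classes :: "('g, 'm) monoid_scheme \<Rightarrow> nat \<Rightarrow> nat" where
  "num_cyclic_classes G n = card (subgroup_conj_class G ` cyclic_subgroups G n)"

definition num_dihedral_cyclic_classes :: "('g, 'm) monoid_scheme \<Rightarrow> nat \<Rightarrow> nat" where
  "num_dihedral_cyclic_classes G n =
     card (subgroup_conj_class G `
       {C \<in> cyclic_subgroups G n.
          \<exists>D. subgroup D G \<and> is_dihedral n (G\<lparr>carrier := D\<rparr>) \<and> C \<subseteq> D})"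

end

theory Submission
  imports Defs "HOL-Homology.Brouwer_Degree" "HOL-Analysis.Kronecker_Approximation_Theorem"
begin

text \<open>Scaling \<open>z\<close> so that its bilinear square is positive and shrinking the imaginary part retracts
  complex onto real hyperbolic space equivariantly, which identifies the sector of the identity. Any
  other torsion element is \<open>\<plusminus>A\<close> with \<open>A\<close> of eigenvalues \<open>\<zeta>\<close>, \<open>\<zeta>\<^sup>-\<^sup>1\<close> and trace \<open>0\<close> (order 2)
  or \<open>\<plusminus>1\<close> (order 3). Its tangent eigenvalues are \<open>1\<close>, \<open>\<zeta>\<^sup>2\<close>, \<open>\<zeta>\<^sup>-\<^sup>2\<close>, so its degree shift is \<open>1\<close>,
  and its fixed point set is a strip \<open>\<bar>Im u\<bar> < \<pi>/2\<close> on which the centraliser acts by maps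
  \<open>u \<mapsto> u + s\<close> and \<open>u \<mapsto> f - u\<close>. The lengths \<open>s\<close> form an infinite cyclic group: a Pell equation
  provides a unit commuting with \<open>A\<close>. Hence the sector has the homotopy type of a circle, or of an
  interval when there are flips. Flips only occur for elements of order 2, where they amount to
  containment in a Klein four-group. In order 3 a cyclic group contributes two conjugacy classes of
  elements, or a single one if its generator is conjugate to its inverse, that is, if the group lies
  in a dihedral group of order 6.\<close>

section \<open>Cohomology and homology\<close>

text \<open>Cohomology is formed from rational cochains on integral chains, so it is reached through
  homology, as \<open>Hom(H_p, \<rat>)\<close>. The condition on the units acts through arithmetic:
  it excludes \<open>m = 1\<close> and \<open>m = 3\<close>, and then \<open>(4 - t^2) m\<close> is
  not a square for any trace \<open>t\<close> in {-1, 0, 1}. This makes the Pell equation solvable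
  and also denies an elliptic matrix an eigenvector over the field. Moreover, triangular matrices
  can only have 1 or -1 on the diagonal. The outline passes over finiteness: the dimensions count
  conjugacy classes by \<open>card\<close>, which is meaningful only once there are finitely many
  torsion classes. Reduction theory supplies this for the full group, without unique factorisation,
  and finite index carries it over to \<open>\<Gamma>\<close>. On the topological side no
  fundamental domain appears: maps and homotopies are explicit formulas on a cone or on a strip and
  descend along quotient maps.\<close>

lemma rat_hom_extend:
  fixes B :: "('a \<Rightarrow>\<^sub>0 int) set" and f :: "('a \<Rightarrow>\<^sub>0 int) \<Rightarrow> rat"
  assumes B0: "0 \<in> B" and Bd: "\<And>x y. x \<in> B \<Longrightarrow> y \<in> B \<Longrightarrow> x - y \<in> B"
    and f: "\<And>x y. x \<in> B \<Longrightarrow> y \<in> B \<Longrightarrow> f (x + y) = f x + f y"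
  obtains F where "\<And>x y. F (x + y) = F x + F y" "\<And>x. x \<in> B \<Longrightarrow> F x = f x"
proof -
  have f0: "f 0 = 0" using f[of 0 0] B0 by simp
  have fd: "f (x - y) = f x - f y" if "x \<in> B" "y \<in> B" for x y
    using f[of "x - y" y] Bd that by simp
  \<comment> \<open>A partial homomorphism is represented by its graph, a subgroup of the product
    that meets the rational axis only in 0. Unions of chains of such graphs are then plain
    unions.\<close>
  define good where "good G \<longleftrightarrow> (0,0) \<in> G \<and> (\<forall>p\<in>G. \<forall>q\<in>G. p - q \<in> G) \<and> (\<forall>q. (0,q) \<in> G \<longrightarrow> q = 0)"
    for G :: "(('a \<Rightarrow>\<^sub>0 int) \<times> rat) set"
  define G0 where "G0 = (\<lambda>x. (x, f x)) ` B"
  have G0: "good G0"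
    unfolding good_def G0_def using B0 Bd f0 fd by (auto simp: image_iff)
  define \<A> where "\<A> = {G. good G \<and> G0 \<subseteq> G}"
  have "\<exists>M\<in>\<A>. \<forall>X\<in>\<A>. M \<subseteq> X \<longrightarrow> X = M"
  proof (rule subset_Zorn_nonempty)
    show "\<A> \<noteq> {}" using G0 by (auto simp: \<A>_def)
  next
    fix C assume C: "C \<noteq> {}" "subset.chain \<A> C"
    have CA: "C \<subseteq> \<A>" and tot: "\<And>X Y. X \<in> C \<Longrightarrow> Y \<in> C \<Longrightarrow> X \<subseteq> Y \<or> Y \<subseteq> X"
      using C(2) by (auto simp: subset.chain_def)
    have "p - q \<in> \<Union>C" if "p \<in> \<Union>C" "q \<in> \<Union>C" for p q
    proof -
      from that obtain X Y where XY: "X \<in> C" "Y \<in> C" "p \<in> X" "q \<in> Y" by auto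
      then obtain W where "W \<in> C" "p \<in> W" "q \<in> W" using tot by blast
      moreover have "good W" using CA \<open>W \<in> C\<close> by (auto simp: \<A>_def)
      ultimately have "p - q \<in> W" by (simp add: good_def)
      then show ?thesis using \<open>W \<in> C\<close> by blast
    qed
    moreover have "(0,0) \<in> \<Union>C" using C(1) CA by (force simp: good_def \<A>_def)
    moreover have "q = 0" if "(0,q) \<in> \<Union>C" for q using that CA by (auto simp: good_def \<A>_def)
    ultimately have "good (\<Union>C)" unfolding good_def by blast
    then show "\<Union>C \<in> \<A>" using C CA by (auto simp: \<A>_def)
  qed
  then obtain G where G: "good G" "G0 \<subseteq> G" and max: "\<And>X. good X \<Longrightarrow> G0 \<subseteq> X \<Longrightarrow> G \<subseteq> X \<Longrightarrow> X = G"
    by (auto simp: \<A>_def)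
  have G_0: "(0,0) \<in> G" and Gd: "\<And>p q. p \<in> G \<Longrightarrow> q \<in> G \<Longrightarrow> p - q \<in> G"
    and Gs: "\<And>q. (0,q) \<in> G \<Longrightarrow> q = 0" using G(1) by (auto simp: good_def)
  have Gm: "- p \<in> G" if "p \<in> G" for p using Gd[OF G_0 that] by (simp add: zero_prod_def[symmetric])
  have Ga: "p + q \<in> G" if "p \<in> G" "q \<in> G" for p q
    using Gd[OF that(1) Gm[OF that(2)]] by simp
  have Gcn: "(frag_cmul (int n) (fst p), of_nat n * snd p) \<in> G" if "p \<in> G" for p n
  proof (induction n)
    case 0 then show ?case using G_0 by simp
  next
    case (Suc n) then show ?case using Ga[OF that Suc] by (simp add: frag_cmul_distrib algebra_simps plus_prod_def)
  qed
  have Gc: "(frag_cmul k x, of_int k * q) \<in> G" if "(x,q) \<in> G" for x q k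
  proof (cases "k \<ge> 0")
    case True then show ?thesis using Gcn[OF that, of "nat k"] by simp
  next
    case False then show ?thesis using Gm[OF Gcn[OF that, of "nat (- k)"]] by simp
  qed
  have uniq: "q = q'" if "(x,q) \<in> G" "(x,q') \<in> G" for x q q'
    using Gs[of "q - q'"] Gd[OF that] by simp
  have dom: "\<exists>q. (x,q) \<in> G" for x
  proof -
    \<comment> \<open>Divisibility of \<rat> enters here: if a nonzero multiple of \<open>x\<close>
      already has a value, that value divided by \<open>n\<close> is the only candidate; otherwise
      any value will do, and 0 is taken.\<close>
    have "\<exists>y. \<forall>n q. (frag_cmul n x, q) \<in> G \<longrightarrow> q = of_int n * y"
    proof (cases "\<exists>n q. n \<noteq> 0 \<and> (frag_cmul n x, q) \<in> G")
      case True
      then obtain n q where nq: "n \<noteq> 0" "(frag_cmul n x, q) \<in> G" by blast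
      have "q' = of_int n' * (q / of_int n)" if "(frag_cmul n' x, q') \<in> G" for n' q'
        using uniq[OF Gc[OF nq(2), of n'], of "of_int n * q'"] Gc[OF that, of n] nq(1)
        by (simp add: mult.commute field_simps)
      then show ?thesis by blast
    next
      case False
      then have "q = of_int n * 0" if "(frag_cmul n x, q) \<in> G" for n q
        using that Gs[of q] by (cases "n = 0") auto
      then show ?thesis by blast
    qed
    then obtain y where y: "\<And>n q. (frag_cmul n x, q) \<in> G \<Longrightarrow> q = of_int n * y" by blast
    define G' where "G' = {(b + frag_cmul n x, q + of_int n * y) | b n q. (b,q) \<in> G}"
    have GG': "G \<subseteq> G'" unfolding G'_def by (force intro: exI[of _ 0])
    have "good G'"
      unfolding good_def
    proof (intro conjI ballI allI impI)
      show "(0,0) \<in> G'" using G_0 GG' by blast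
    next
      fix p q assume "p \<in> G'" "q \<in> G'"
      then obtain b n r b' n' r' where *: "(b,r) \<in> G" "(b',r') \<in> G"
         "p = (b + frag_cmul n x, r + of_int n * y)" "q = (b' + frag_cmul n' x, r' + of_int n' * y)"
        unfolding G'_def by blast
      have "p - q = ((b - b') + frag_cmul (n - n') x, (r - r') + of_int (n - n') * y)"
        using * by (simp add: frag_cmul_diff_distrib algebra_simps)
      moreover have "(b - b', r - r') \<in> G" using Gd[OF *(1,2)] by simp
      ultimately show "p - q \<in> G'" unfolding G'_def by blast
    next
      fix q assume "(0,q) \<in> G'"
      then obtain b n r where *: "(b,r) \<in> G" "b + frag_cmul n x = 0" "q = r + of_int n * y"
        unfolding G'_def by auto
      have "frag_cmul n x = - b" using *(2) by (simp add: add_eq_0_iff)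
      then have "(frag_cmul n x, - r) \<in> G" using Gm[OF *(1)] by simp
      from y[OF this] show "q = 0" using * by simp
    qed
    then have "G' = G" using max GG' G(2) by blast
    moreover have "(x, y) \<in> G'" unfolding G'_def using G_0 by (force intro: exI[of _ 1])
    ultimately show ?thesis by blast
  qed
  define F where "F x = (THE q. (x,q) \<in> G)" for x
  have F: "(x, q) \<in> G \<longleftrightarrow> F x = q" for x q
    unfolding F_def using dom[of x] uniq by (metis (no_types, lifting) the_equality)
  show thesis
  proof
    show "F (x + y) = F x + F y" for x y
      using Ga[of "(x, F x)" "(y, F y)"] F by simp
    show "F x = f x" if "x \<in> B" for x
      using that G(2) F by (auto simp: G0_def)
  qed
qed

section \<open>Rational vector spaces and their isomorphisms\<close>

definition rat_dual :: "('a, 'm) monoid_scheme \<Rightarrow> (rat, 'a \<Rightarrow> rat) module" where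
  "rat_dual G =
     \<lparr>carrier = {f \<in> extensional (carrier G).
         \<forall>x\<in>carrier G. \<forall>y\<in>carrier G. f (x \<otimes>\<^bsub>G\<^esub> y) = f x + f y},
      mult = undefined, one = undefined,
      zero = (\<lambda>x\<in>carrier G. 0),
      add = (\<lambda>f g. \<lambda>x\<in>carrier G. f x + g x),
      smult = (\<lambda>r f. \<lambda>x\<in>carrier G. r * f x)\<rparr>"

definition module_closed :: "(rat, 'a) module \<Rightarrow> bool" where
  "module_closed M \<longleftrightarrow>
     (\<forall>x\<in>carrier M. \<forall>y\<in>carrier M. x \<oplus>\<^bsub>M\<^esub> y \<in> carrier M) \<and>
     (\<forall>r. \<forall>x\<in>carrier M. r \<odot>\<^bsub>M\<^esub> x \<in> carrier M)"

lemma module_isomorphic_trans: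
  assumes "module_isomorphic M N" "module_isomorphic N P"
  shows "module_isomorphic M P"
proof -
  obtain h k where "bij_betw h (carrier M) (carrier N)" "bij_betw k (carrier N) (carrier P)"
     "\<forall>x\<in>carrier M. \<forall>y\<in>carrier M. h (x \<oplus>\<^bsub>M\<^esub> y) = h x \<oplus>\<^bsub>N\<^esub> h y"
     "\<forall>r. \<forall>x\<in>carrier M. h (r \<odot>\<^bsub>M\<^esub> x) = r \<odot>\<^bsub>N\<^esub> h x"
     "\<forall>x\<in>carrier N. \<forall>y\<in>carrier N. k (x \<oplus>\<^bsub>N\<^esub> y) = k x \<oplus>\<^bsub>P\<^esub> k y"
     "\<forall>r. \<forall>x\<in>carrier N. k (r \<odot>\<^bsub>N\<^esub> x) = r \<odot>\<^bsub>P\<^esub> k x"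
    using assms unfolding module_isomorphic_def by blast
  then show ?thesis unfolding module_isomorphic_def
    by (intro exI[of _ "k \<circ> h"]) (auto simp: bij_betw_apply intro: bij_betw_trans)
qed

lemma module_isomorphic_sym:
  assumes "module_isomorphic M N" "module_closed M"
  shows "module_isomorphic N M"
proof -
  obtain h where h: "bij_betw h (carrier M) (carrier N)"
     "\<forall>x\<in>carrier M. \<forall>y\<in>carrier M. h (x \<oplus>\<^bsub>M\<^esub> y) = h x \<oplus>\<^bsub>N\<^esub> h y"
     "\<forall>r. \<forall>x\<in>carrier M. h (r \<odot>\<^bsub>M\<^esub> x) = r \<odot>\<^bsub>N\<^esub> h x"
    using assms unfolding module_isomorphic_def by blast
  define k where "k = inv_into (carrier M) h"
  have k: "bij_betw k (carrier N) (carrier M)" unfolding k_def by (rule bij_betw_inv_into[OF h(1)])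
  have hk: "h (k y) = y" if "y \<in> carrier N" for y
    unfolding k_def using bij_betw_inv_into_right[OF h(1) that] .
  have kh: "k (h y) = y" if "y \<in> carrier M" for y
    unfolding k_def using bij_betw_inv_into_left[OF h(1) that] .
  have kc: "k y \<in> carrier M" if "y \<in> carrier N" for y using k that by (rule bij_betw_apply)
  have "k (x \<oplus>\<^bsub>N\<^esub> y) = k x \<oplus>\<^bsub>M\<^esub> k y" if "x \<in> carrier N" "y \<in> carrier N" for x y
  proof -
    have "k (h (k x \<oplus>\<^bsub>M\<^esub> k y)) = k x \<oplus>\<^bsub>M\<^esub> k y"
      using assms(2) that kc by (intro kh) (auto simp: module_closed_def)
    then show ?thesis using h(2) kc hk that by simp
  qed
  moreover have "k (r \<odot>\<^bsub>N\<^esub> x) = r \<odot>\<^bsub>M\<^esub> k x" if "x \<in> carrier N" for r x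
  proof -
    have "k (h (r \<odot>\<^bsub>M\<^esub> k x)) = r \<odot>\<^bsub>M\<^esub> k x"
      using assms(2) that kc by (intro kh) (auto simp: module_closed_def)
    then show ?thesis using h(3) kc hk that by simp
  qed
  ultimately show ?thesis unfolding module_isomorphic_def using k by blast
qed

text \<open>The first isomorphism theorem: \<open>B\<close> is the kernel of \<open>\<phi>\<close>.\<close>

lemma quotient_module_isomorphic:
  fixes M :: "(rat, 'a) module" and N :: "(rat, 'b) module"
  assumes cl: "module_closed M" 
    and sub: "\<And>x y. x \<in> carrier M \<Longrightarrow> y \<in> carrier M \<Longrightarrow> \<exists>b\<in>carrier M. x \<oplus>\<^bsub>M\<^esub> b = y"
    and onto: "\<phi> ` carrier M = carrier N"
    and add: "\<And>x y. x \<in> carrier M \<Longrightarrow> y \<in> carrier M \<Longrightarrow> \<phi> (x \<oplus>\<^bsub>M\<^esub> y) = \<phi> x \<oplus>\<^bsub>N\<^esub> \<phi> y"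
    and inj: "\<And>x y z. z \<in> carrier M \<Longrightarrow> x \<in> carrier M \<Longrightarrow> y \<in> carrier M \<Longrightarrow> 
       \<phi> z \<oplus>\<^bsub>N\<^esub> \<phi> x = \<phi> z \<oplus>\<^bsub>N\<^esub> \<phi> y \<Longrightarrow> \<phi> x = \<phi> y"
    and smult: "\<And>r x. x \<in> carrier M \<Longrightarrow> \<phi> (r \<odot>\<^bsub>M\<^esub> x) = r \<odot>\<^bsub>N\<^esub> \<phi> x"
    and coset: "\<And>x. x \<in> carrier M \<Longrightarrow> a_r_coset M B x = {y \<in> carrier M. \<phi> y = \<phi> x}"
  shows "module_isomorphic (quotient_module M B) N \<and> module_closed (quotient_module M B)"
proof -
  \<comment> \<open>By the last assumption the cosets of \<open>B\<close> are the fibres of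
    \<open>\<phi>\<close>. The quotient operations are computed on fibres; \<open>sub\<close>
    supplies the second summand when an element of a fibre is split as a sum.\<close>
  define fib where "fib x = {y \<in> carrier M. \<phi> y = \<phi> x}" for x
  have ca: "x \<oplus>\<^bsub>M\<^esub> y \<in> carrier M" and cs: "r \<odot>\<^bsub>M\<^esub> x \<in> carrier M"
    if "x \<in> carrier M" "y \<in> carrier M" for x y r
    using cl that by (auto simp: module_closed_def)
  have car: "carrier (quotient_module M B) = fib ` carrier M"
    by (auto simp: quotient_module_def A_RCOSETS_def' coset fib_def)
  have addq: "fib x \<oplus>\<^bsub>quotient_module M B\<^esub> fib y = fib (x \<oplus>\<^bsub>M\<^esub> y)" if "x \<in> carrier M" "y \<in> carrier M" for x y
  proof -
    have "fib x <+>\<^bsub>M\<^esub> fib y = fib (x \<oplus>\<^bsub>M\<^esub> y)"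
    proof (intro equalityI subsetI)
      fix z assume "z \<in> fib x <+>\<^bsub>M\<^esub> fib y"
      then obtain a b where "z = a \<oplus>\<^bsub>M\<^esub> b" "a \<in> fib x" "b \<in> fib y" by (auto simp: set_add_def')
      then show "z \<in> fib (x \<oplus>\<^bsub>M\<^esub> y)" using that add ca by (simp add: fib_def)
    next
      fix z assume z: "z \<in> fib (x \<oplus>\<^bsub>M\<^esub> y)"
      then have "\<exists>b\<in>carrier M. x \<oplus>\<^bsub>M\<^esub> b = z"
        using sub[OF that(1), of z] by (auto simp: fib_def)
      then obtain b where b: "b \<in> carrier M" "x \<oplus>\<^bsub>M\<^esub> b = z" by blast
      then have "\<phi> b = \<phi> y" using z that add by (intro inj[of x]) (auto simp: fib_def)
      then show "z \<in> fib x <+>\<^bsub>M\<^esub> fib y"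
        using b that by (auto simp: set_add_def' fib_def)
    qed
    then show ?thesis by (simp add: quotient_module_def)
  qed
  have smq: "r \<odot>\<^bsub>quotient_module M B\<^esub> fib x = fib (r \<odot>\<^bsub>M\<^esub> x)" if "x \<in> carrier M" for r x
  proof -
    have "(\<Union>y\<in>fib x. a_r_coset M B (r \<odot>\<^bsub>M\<^esub> y)) = (\<Union>y\<in>fib x. fib (r \<odot>\<^bsub>M\<^esub> x))"
    proof (rule SUP_cong[OF refl])
      fix y assume y: "y \<in> fib x"
      then have "a_r_coset M B (r \<odot>\<^bsub>M\<^esub> y) = fib (r \<odot>\<^bsub>M\<^esub> y)"
        using that cs by (subst coset) (auto simp: fib_def)
      also have "\<dots> = fib (r \<odot>\<^bsub>M\<^esub> x)" using y that by (simp add: fib_def smult)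
      finally show "a_r_coset M B (r \<odot>\<^bsub>M\<^esub> y) = fib (r \<odot>\<^bsub>M\<^esub> x)" .
    qed
    moreover have "fib x \<noteq> {}" using that by (auto simp: fib_def)
    ultimately show ?thesis by (simp add: quotient_module_def)
  qed
  have closed: "module_closed (quotient_module M B)"
    unfolding module_closed_def car using addq smq ca cs by (auto simp: image_iff)
  define h where "h A = the_elem (\<phi> ` A)" for A
  have h: "h (fib x) = \<phi> x" if "x \<in> carrier M" for x
  proof -
    have "\<phi> ` fib x = {\<phi> x}" using that by (auto simp: fib_def)
    then show ?thesis by (simp add: h_def)
  qed
  have "inj_on h (fib ` carrier M)" using h by (auto intro!: inj_onI simp: fib_def)
  moreover have "h ` fib ` carrier M = carrier N" using h onto by (force simp: image_iff)
  ultimately have "bij_betw h (carrier (quotient_module M B)) (carrier N)"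
    by (simp add: bij_betw_def car)
  then have iso: "module_isomorphic (quotient_module M B) N"
    unfolding module_isomorphic_def
    by (intro exI[of _ h]) (auto simp: car addq smq h ca cs add smult)
  show ?thesis using iso closed by blast
qed

section \<open>Universal coefficients over the rationals\<close>

lemma mult_homology_class:
  "homologous_rel_set p X {} x \<otimes>\<^bsub>homology_group (int p) X\<^esub> homologous_rel_set p X {} y =
     homologous_rel_set p X {} (x + y)"
proof -
  have "homologous_rel p X {} (x + y) b \<Longrightarrow> \<exists>r. homologous_rel p X {} x r \<and> (\<exists>s. homologous_rel p X {} y s \<and> b = r + s)" for b
    by (intro exI[of _ x] conjI exI[of _ "b - x"]) (auto simp: homologous_rel_def algebra_simps)
  then show ?thesis
    by (auto simp: mult_relative_homology_group homologous_rel_add)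
qed

lemma cochain_diff:
  assumes "u \<in> carrier (cochain_module p X)" "singular_chain p X a" "singular_chain p X b"
  shows "u (a - b) = u a - u b"
proof -
  have "u (a - b + b) = u (a - b) + u b"
    using assms singular_chain_diff[of p X a b]
    by (simp only: cochain_module_def partial_object.simps mem_Collect_eq)
  then show ?thesis by simp
qed

text \<open>Universal coefficients; there is no Ext term because \<open>\<rat>\<close> is injective.\<close>

theorem singular_cohomology_dual:
  "module_isomorphic (singular_cohomology p X) (rat_dual (homology_group (int p) X))"
  "module_closed (singular_cohomology p X)"
proof -
  define M where "M = cochain_module p X\<lparr>carrier := cocycles p X\<rparr>"
  define H where "H = homology_group (int p) X"
  define cl where "cl = homologous_rel_set p X {}"
  let ?Z = "singular_relcycle_set p X {}"
  have carH: "carrier H = cl ` ?Z"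
    by (simp add: H_def cl_def carrier_relative_homology_group)
  have multH: "cl x \<otimes>\<^bsub>H\<^esub> cl y = cl (x + y)" for x y
    unfolding H_def cl_def by (rule mult_homology_class)
  have clin: "x \<in> cl x" for x by (simp add: cl_def)
  have Z: "x \<in> ?Z \<longleftrightarrow> singular_chain p X x \<and> chain_boundary p x = 0" for x
    by (simp add: singular_cycle)
  have M: "carrier M = cocycles p X" "x \<oplus>\<^bsub>M\<^esub> y = (\<lambda>a\<in>singular_chain_set p X. x a + y a)"
     "r \<odot>\<^bsub>M\<^esub> x = (\<lambda>a\<in>singular_chain_set p X. r * x a)" for x y r
    by (simp_all add: M_def cochain_module_def)
  have coc: "u \<in> cocycles p X \<longleftrightarrow> u \<in> extensional (singular_chain_set p X) \<and>
        (\<forall>a b. singular_chain p X a \<longrightarrow> singular_chain p X b \<longrightarrow> u (a + b) = u a + u b) \<and>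
        (\<forall>d. singular_chain (Suc p) X d \<longrightarrow> u (chain_boundary (Suc p) d) = 0)" for u
    unfolding cocycles_def coboundary_def cochain_module_def
    by (auto simp: fun_eq_iff restrict_def)
  have bd: "singular_chain p X (chain_boundary (Suc p) d)" if "singular_chain (Suc p) X d" for d
    using singular_chain_boundary_alt[OF that] by simp
  have bdcyc: "chain_boundary (Suc p) d \<in> ?Z" if "singular_chain (Suc p) X d" for d
    using that bd unfolding Z by (auto intro: chain_boundary_boundary_alt)
  have cochain: "u \<in> carrier (cochain_module p X)" if "u \<in> cocycles p X" for u
    using that by (simp add: cocycles_def)
  \<comment> \<open>Evaluation of \<open>u\<close> at an arbitrary cycle of the class. A cocycle
    vanishes on boundaries, so the choice is harmless; the fact below records this.\<close>
  define \<phi> where "\<phi> u = (\<lambda>c\<in>carrier H. u (SOME z. z \<in> c))" for u :: "'a chain \<Rightarrow> rat"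
  have \<phi>: "\<phi> u (cl z) = u z" if "u \<in> cocycles p X" "z \<in> ?Z" for u z
  proof -
    define z' where "z' = (SOME z'. z' \<in> cl z)"
    have "z' \<in> cl z" unfolding z'_def using clin by (rule someI)
    then have hom: "homologous_rel p X {} z z'" by (simp add: cl_def)
    then have sc: "singular_chain p X z'" using that Z homologous_rel_singular_chain by blast
    obtain d where d: "singular_chain (Suc p) X d" "chain_boundary (Suc p) d = z - z'"
      using hom by (auto simp: homologous_rel_def singular_boundary)
    have "u (z - z') = 0" using d that coc by metis
    then have "u z' = u z" using cochain_diff[OF cochain[OF that(1)], of z z'] that sc Z by auto
    then show ?thesis using that by (simp add: \<phi>_def carH z'_def)
  qed
  have cl_iso: "module_isomorphic (quotient_module M (coboundaries p X)) (rat_dual H) \<and> 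
     module_closed (quotient_module M (coboundaries p X))"
  proof (rule quotient_module_isomorphic)
    show "module_closed M"
      unfolding module_closed_def M
      by (auto simp: coc singular_chain_add bd algebra_simps)
    show "\<exists>b\<in>carrier M. x \<oplus>\<^bsub>M\<^esub> b = y" if "x \<in> carrier M" "y \<in> carrier M" for x y
    proof (rule bexI[of _ "\<lambda>a\<in>singular_chain_set p X. y a - x a"])
      show "x \<oplus>\<^bsub>M\<^esub> (\<lambda>a\<in>singular_chain_set p X. y a - x a) = y"
        using that unfolding M coc by (auto simp: fun_eq_iff restrict_def extensional_def)
      show "(\<lambda>a\<in>singular_chain_set p X. y a - x a) \<in> carrier M"
        using that unfolding M coc by (auto simp: singular_chain_add bd)
    qed
    have addZ: "a + b \<in> ?Z" if "a \<in> ?Z" "b \<in> ?Z" for a b using that by (simp add: singular_relcycle_add)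
    have \<phi>dual: "\<phi> u \<in> carrier (rat_dual H)" if u: "u \<in> cocycles p X" for u
    proof -
      have "\<phi> u (x \<otimes>\<^bsub>H\<^esub> y) = \<phi> u x + \<phi> u y" if "x \<in> carrier H" "y \<in> carrier H" for x y
      proof -
        obtain a b where ab: "x = cl a" "y = cl b" "a \<in> ?Z" "b \<in> ?Z"
          using \<open>x \<in> carrier H\<close> \<open>y \<in> carrier H\<close> unfolding carH by blast
        have "u (a + b) = u a + u b" using u ab(3,4) unfolding Z coc by blast
        then show ?thesis using \<phi>[OF u] ab addZ by (simp only: multH)
      qed
      moreover have "\<phi> u \<in> extensional (carrier H)" by (simp add: \<phi>_def)
      ultimately show ?thesis by (simp add: rat_dual_def)
    qed
    show "\<phi> ` carrier M = carrier (rat_dual H)"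
    proof (intro equalityI subsetI)
      fix f assume f: "f \<in> carrier (rat_dual H)"
      have zd: "a - b \<in> ?Z" if "a \<in> ?Z" "b \<in> ?Z" for a b using that by (simp add: singular_relcycle_diff)
      have fa: "f (cl (a + b)) = f (cl a) + f (cl b)" if "a \<in> ?Z" "b \<in> ?Z" for a b
        using f that carH unfolding multH[symmetric] by (auto simp: rat_dual_def)
      \<comment> \<open>A functional on homology is an additive map on the cycles. Extended to all
        chains it becomes a cochain, and this is a cocycle because boundaries are
        null-homologous.\<close>
      obtain F where F: "\<And>x y. F (x + y) = F x + F y" "\<And>x. x \<in> ?Z \<Longrightarrow> F x = f (cl x)"
        by (rule rat_hom_extend[of ?Z "\<lambda>z. f (cl z)"]) (use zd fa in auto)
      define u where "u = restrict F (singular_chain_set p X)"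
      have f0: "f (cl 0) = 0" using fa[of 0 0] by simp
      have "cl (chain_boundary (Suc p) d) = cl 0" if "singular_chain (Suc p) X d" for d
        unfolding cl_def homologous_rel_set_eq using that by (auto simp: homologous_rel_def singular_boundary)
      then have "u \<in> cocycles p X"
        unfolding coc u_def using F f0 bdcyc
        by (auto simp: singular_chain_add bd)
      moreover have "\<phi> u = f"
      proof (rule extensionalityI)
        show "\<phi> u \<in> extensional (carrier H)" "f \<in> extensional (carrier H)"
          using f by (simp_all add: \<phi>_def rat_dual_def)
        show "\<phi> u x = f x" if x: "x \<in> carrier H" for x
        proof -
          obtain z where z: "x = cl z" "z \<in> ?Z" using x carH by blast
          then show ?thesis using \<phi>[OF \<open>u \<in> cocycles p X\<close> z(2)] F(2)[OF z(2)] Z by (simp add: u_def)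
        qed
      qed
      ultimately show "f \<in> \<phi> ` carrier M" by (auto simp: M)
    qed (auto simp: M \<phi>dual)
    show "\<phi> (x \<oplus>\<^bsub>M\<^esub> y) = \<phi> x \<oplus>\<^bsub>rat_dual H\<^esub> \<phi> y" if "x \<in> carrier M" "y \<in> carrier M" for x y
    proof (rule extensionalityI[of _ "carrier H"])
      have xy: "x \<oplus>\<^bsub>M\<^esub> y \<in> cocycles p X" using \<open>module_closed M\<close> that by (auto simp: module_closed_def M(1))
      show "\<phi> (x \<oplus>\<^bsub>M\<^esub> y) c = (\<phi> x \<oplus>\<^bsub>rat_dual H\<^esub> \<phi> y) c" if c: "c \<in> carrier H" for c
      proof -
        obtain z where z: "c = cl z" "z \<in> ?Z" using c carH by blast
        then have "\<phi> (x \<oplus>\<^bsub>M\<^esub> y) c = x z + y z" using \<phi>[OF xy] Z by (auto simp: M)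
        moreover have "(\<phi> x \<oplus>\<^bsub>rat_dual H\<^esub> \<phi> y) c = x z + y z"
          using z \<phi>[of x z] \<phi>[of y z] \<open>x \<in> carrier M\<close> \<open>y \<in> carrier M\<close> c by (simp add: rat_dual_def M)
        ultimately show ?thesis by simp
      qed
    qed (simp_all add: \<phi>_def rat_dual_def)
    show "\<phi> (r \<odot>\<^bsub>M\<^esub> x) = r \<odot>\<^bsub>rat_dual H\<^esub> \<phi> x" if "x \<in> carrier M" for x r
    proof (rule extensionalityI[of _ "carrier H"])
      have xy: "r \<odot>\<^bsub>M\<^esub> x \<in> cocycles p X" using \<open>module_closed M\<close> that by (auto simp: module_closed_def M(1))
      show "\<phi> (r \<odot>\<^bsub>M\<^esub> x) c = (r \<odot>\<^bsub>rat_dual H\<^esub> \<phi> x) c" if c: "c \<in> carrier H" for c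
      proof -
        obtain z where z: "c = cl z" "z \<in> ?Z" using c carH by blast
        then have "\<phi> (r \<odot>\<^bsub>M\<^esub> x) c = r * x z" using \<phi>[OF xy] Z by (auto simp: M)
        moreover have "(r \<odot>\<^bsub>rat_dual H\<^esub> \<phi> x) c = r * x z"
          using z \<phi>[of x z] \<open>x \<in> carrier M\<close> c by (simp add: rat_dual_def M)
        ultimately show ?thesis by simp
      qed
    qed (simp_all add: \<phi>_def rat_dual_def)
    show "\<phi> x = \<phi> y" if "\<phi> z \<oplus>\<^bsub>rat_dual H\<^esub> \<phi> x = \<phi> z \<oplus>\<^bsub>rat_dual H\<^esub> \<phi> y" for x y z
    proof (rule extensionalityI[of _ "carrier H"])
      show "\<phi> x c = \<phi> y c" if "c \<in> carrier H" for c
        using that fun_cong[OF \<open>\<phi> z \<oplus>\<^bsub>rat_dual H\<^esub> \<phi> x = \<phi> z \<oplus>\<^bsub>rat_dual H\<^esub> \<phi> y\<close>, of c] by (simp add: rat_dual_def)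
    qed (simp_all add: \<phi>_def)
    show "a_r_coset M (coboundaries p X) x = {y \<in> carrier M. \<phi> y = \<phi> x}" if x: "x \<in> carrier M" for x
    proof -
      have eq: "\<phi> y = \<phi> x \<longleftrightarrow> (\<forall>z\<in>?Z. y z = x z)" if "y \<in> carrier M" for y
      proof
        assume "\<phi> y = \<phi> x"
        then show "\<forall>z\<in>?Z. y z = x z" using \<phi>[of x] \<phi>[of y] x that by (metis M(1))
      next
        assume *: "\<forall>z\<in>?Z. y z = x z"
        show "\<phi> y = \<phi> x"
        proof (rule extensionalityI[of _ "carrier H"])
          show "\<phi> y c = \<phi> x c" if c: "c \<in> carrier H" for c
          proof -
            obtain z where z: "c = cl z" "z \<in> ?Z" using c carH by blast
            then show ?thesis using \<phi>[of x z] \<phi>[of y z] x \<open>y \<in> carrier M\<close> * by (simp add: M)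
          qed
        qed (simp_all add: \<phi>_def)
      qed
      have xc: "x \<in> cocycles p X" using x by (simp add: M)
      \<comment> \<open>Degree 0 is separate because its coboundaries are declared to be zero
        instead of being an image.\<close>
      have bc: "b \<in> cocycles p X \<and> (\<forall>z\<in>?Z. b z = 0)" if bb: "b \<in> coboundaries p X" for b
      proof (cases p)
        case 0
        then have "b = (\<lambda>a\<in>singular_chain_set p X. 0)" using that by (simp add: cochain_module_def)
        then show ?thesis unfolding coc using Z by (auto simp: singular_chain_add bd)
      next
        case (Suc q)
        then obtain v where v: "v \<in> carrier (cochain_module q X)" "b = coboundary q X v" using bb by auto
        have v0: "v 0 = 0" using cochain_diff[OF v(1), of 0 0] by simp
        have sb: "singular_chain q X (chain_boundary p a)" if "singular_chain p X a" for a
          using singular_chain_boundary[OF that] Suc by simp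
        show ?thesis
          unfolding coc
        proof (intro conjI allI impI ballI)
          show "b \<in> extensional (singular_chain_set p X)" using v by (simp add: coboundary_def Suc)
          show "b (a + c) = b a + b c" if "singular_chain p X a" "singular_chain p X c" for a c
            using v that sb singular_chain_add[OF that]
            by (simp add: coboundary_def cochain_module_def Suc chain_boundary_add)
          show "b (chain_boundary (Suc p) d) = 0" if "singular_chain (Suc p) X d" for d
            using v v0 bdcyc[OF that] Z by (simp add: coboundary_def Suc)
          show "b z = 0" if "z \<in> ?Z" for z using that Z v v0 by (simp add: coboundary_def Suc)
        qed
      qed
      \<comment> \<open>The step where an Ext term would arise. A cocycle that vanishes on cycles
        depends only on the boundary of a chain, hence is a map on the group of boundaries composed
        with the boundary operator, and injectivity of \<rat> extends that map to all chains. In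
        degree 0 every chain is a cycle, so nothing is left.\<close>
      have conv: "w \<in> coboundaries p X" if w: "w \<in> cocycles p X" "\<forall>z\<in>?Z. w z = 0" for w
      proof (cases p)
        case 0
        have "w = (\<lambda>a\<in>singular_chain_set p X. 0)"
          by (rule extensionalityI[of _ "singular_chain_set p X"]) (use w coc Z 0 in \<open>auto simp: chain_boundary_def\<close>)
        then show ?thesis using 0 by (simp add: cochain_module_def)
      next
        case (Suc q)
        define B where "B = chain_boundary p ` singular_chain_set p X"
        define f where "f b = w (SOME a. singular_chain p X a \<and> chain_boundary p a = b)" for b
        have f: "f (chain_boundary p a) = w a" if "singular_chain p X a" for a
        proof -
          define a' where "a' = (SOME a'. singular_chain p X a' \<and> chain_boundary p a' = chain_boundary p a)"
          have a': "singular_chain p X a'" "chain_boundary p a' = chain_boundary p a"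
            using someI[of "\<lambda>a'. singular_chain p X a' \<and> chain_boundary p a' = chain_boundary p a" a] that
            unfolding a'_def by auto
          then have "a' - a \<in> ?Z" unfolding Z using that by (simp add: singular_chain_diff chain_boundary_diff)
          then have "w (a' - a) = 0" using w by blast
          then show ?thesis using cochain_diff[OF cochain[OF w(1)] a'(1) that] by (simp add: f_def a'_def)
        qed
        have wa: "w (a + b) = w a + w b" if "singular_chain p X a" "singular_chain p X b" for a b
          using w(1) coc that by blast
        obtain F where F: "\<And>x y. F (x + y) = F x + F y" "\<And>x. x \<in> B \<Longrightarrow> F x = f x"
        proof (rule rat_hom_extend[of B f])
          show "0 \<in> B" unfolding B_def by (rule image_eqI[of _ _ 0]) auto
          show "x - y \<in> B" if "x \<in> B" "y \<in> B" for x y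
          proof -
            from \<open>x \<in> B\<close> \<open>y \<in> B\<close> obtain a b where "x = chain_boundary p a" "y = chain_boundary p b"
              "singular_chain p X a" "singular_chain p X b" unfolding B_def by auto
            then show ?thesis unfolding B_def
              by (intro image_eqI[of _ _ "a - b"]) (auto simp: chain_boundary_diff singular_chain_diff)
          qed
          show "f (x + y) = f x + f y" if "x \<in> B" "y \<in> B" for x y
          proof -
            from \<open>x \<in> B\<close> \<open>y \<in> B\<close> obtain a b where ab: "x = chain_boundary p a" "y = chain_boundary p b"
              "singular_chain p X a" "singular_chain p X b" unfolding B_def by auto
            then show ?thesis
              using f[of "a + b"] f[of a] f[of b] wa[of a b]
              by (simp add: chain_boundary_add singular_chain_add)
          qed
        qed blast
        define v where "v = restrict F (singular_chain_set q X)"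
        have sb: "singular_chain q X (chain_boundary p a)" if "singular_chain p X a" for a
          using singular_chain_boundary[OF that] Suc by simp
        have "v \<in> carrier (cochain_module q X)"
          using F by (auto simp: v_def cochain_module_def singular_chain_add)
        moreover have "coboundary q X v = w"
        proof (rule extensionalityI[of _ "singular_chain_set p X"])
          show "coboundary q X v a = w a" if "a \<in> singular_chain_set p X" for a
            using that f[of a] F(2)[of "chain_boundary p a"] sb[of a] unfolding B_def
            by (simp add: coboundary_def v_def Suc)
        qed (use w coc in \<open>auto simp: coboundary_def Suc\<close>)
        ultimately show ?thesis using Suc by auto
      qed
      have coset: "a_r_coset M (coboundaries p X) x = (\<lambda>b. b \<oplus>\<^bsub>M\<^esub> x) ` coboundaries p X"
        by (auto simp: a_r_coset_def')
      show ?thesis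
      proof (intro equalityI subsetI)
        fix y assume "y \<in> a_r_coset M (coboundaries p X) x"
        then obtain b where b: "b \<in> coboundaries p X" "y = b \<oplus>\<^bsub>M\<^esub> x" using coset by auto
        have "y \<in> carrier M" using b bc x \<open>module_closed M\<close> by (auto simp: module_closed_def M(1))
        moreover have "\<forall>z\<in>?Z. y z = x z" using b bc Z by (simp add: M)
        ultimately show "y \<in> {y \<in> carrier M. \<phi> y = \<phi> x}" using eq by auto
      next
        fix y assume "y \<in> {y \<in> carrier M. \<phi> y = \<phi> x}"
        then have y: "y \<in> carrier M" "\<forall>z\<in>?Z. y z = x z" using eq by auto
        define w where "w = (\<lambda>a\<in>singular_chain_set p X. y a - x a)"
        have "w \<in> cocycles p X" unfolding w_def using y(1) xc unfolding M coc
          by (auto simp: singular_chain_add bd)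
        moreover have "\<forall>z\<in>?Z. w z = 0" using y Z by (simp add: w_def)
        ultimately have "w \<in> coboundaries p X" by (rule conv)
        moreover have "y = w \<oplus>\<^bsub>M\<^esub> x"
          using y(1) unfolding M coc by (auto simp: w_def fun_eq_iff restrict_def extensional_def)
        ultimately show "y \<in> a_r_coset M (coboundaries p X) x" using coset by auto
      qed
    qed
  qed
  then show "module_isomorphic (singular_cohomology p X) (rat_dual (homology_group (int p) X))"
    "module_closed (singular_cohomology p X)"
    by (simp_all add: singular_cohomology_def M_def H_def)
qed

section \<open>Rational duals of the homology groups that occur\<close>

lemma rat_dual_cong:
  assumes "group G" "G \<cong> H"
  shows "module_isomorphic (rat_dual H) (rat_dual G)"
proof -
  obtain h where h: "h \<in> iso G H" using assms by (auto simp: is_iso_def)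
  have hc: "h x \<in> carrier H" if "x \<in> carrier G" for x using h that by (auto simp: iso_def hom_def)
  have hm: "h (x \<otimes>\<^bsub>G\<^esub> y) = h x \<otimes>\<^bsub>H\<^esub> h y" if "x \<in> carrier G" "y \<in> carrier G" for x y
    using h that by (auto simp: iso_def hom_def)
  have hb: "bij_betw h (carrier G) (carrier H)" using h by (simp add: iso_def)
  define k where "k = inv_into (carrier G) h"
  have hk: "h (k y) = y" if "y \<in> carrier H" for y
    unfolding k_def using bij_betw_inv_into_right[OF hb that] .
  have kh: "k (h y) = y" if "y \<in> carrier G" for y
    unfolding k_def using bij_betw_inv_into_left[OF hb that] .
  have kc: "k y \<in> carrier G" if "y \<in> carrier H" for y
    unfolding k_def using bij_betw_inv_into[OF hb] that by (rule bij_betw_apply)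
  have Gm: "x \<otimes>\<^bsub>G\<^esub> y \<in> carrier G" if "x \<in> carrier G" "y \<in> carrier G" for x y
    using assms(1) that by (simp add: group.is_monoid monoid.m_closed)
  have km: "k (x \<otimes>\<^bsub>H\<^esub> y) = k x \<otimes>\<^bsub>G\<^esub> k y" "x \<otimes>\<^bsub>H\<^esub> y \<in> carrier H" if "x \<in> carrier H" "y \<in> carrier H" for x y
    using hm[OF kc[OF that(1)] kc[OF that(2)]] hk that kh[of "k x \<otimes>\<^bsub>G\<^esub> k y"] kc hc[of "k x \<otimes>\<^bsub>G\<^esub> k y"] Gm by auto
  define \<Phi> where "\<Phi> f = (\<lambda>x\<in>carrier G. f (h x))" for f :: "_ \<Rightarrow> rat"
  define \<Psi> where "\<Psi> f = (\<lambda>x\<in>carrier H. f (k x))" for f :: "_ \<Rightarrow> rat"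
  have "bij_betw \<Phi> (carrier (rat_dual H)) (carrier (rat_dual G))"
  proof (rule bij_betwI[of _ _ _ \<Psi>])
    show "\<Phi> \<in> carrier (rat_dual H) \<rightarrow> carrier (rat_dual G)"
      by (auto simp: \<Phi>_def rat_dual_def hm hc Gm)
    show "\<Psi> \<in> carrier (rat_dual G) \<rightarrow> carrier (rat_dual H)"
      by (auto simp: \<Psi>_def rat_dual_def km kc)
    show "\<Psi> (\<Phi> x) = x" if "x \<in> carrier (rat_dual H)" for x
      using that by (intro extensionalityI[of _ "carrier H"]) (auto simp: \<Phi>_def \<Psi>_def rat_dual_def kc hk)
    show "\<Phi> (\<Psi> x) = x" if "x \<in> carrier (rat_dual G)" for x
      using that by (intro extensionalityI[of _ "carrier G"]) (auto simp: \<Phi>_def \<Psi>_def rat_dual_def hc kh)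
  qed
  moreover have "\<Phi> (x \<oplus>\<^bsub>rat_dual H\<^esub> y) = \<Phi> x \<oplus>\<^bsub>rat_dual G\<^esub> \<Phi> y" "\<Phi> (r \<odot>\<^bsub>rat_dual H\<^esub> x) = r \<odot>\<^bsub>rat_dual G\<^esub> \<Phi> x" for x y r
    by (auto simp: \<Phi>_def rat_dual_def hc fun_eq_iff restrict_def)
  ultimately show ?thesis unfolding module_isomorphic_def by blast
qed

lemma rat_dual_integer_group: "module_isomorphic (rat_dual integer_group) rat_module"
proof -
  have *: "f i = of_int i * f 1" if f: "\<And>x y. f (x + y) = f x + f y" for f :: "int \<Rightarrow> rat" and i
  proof -
    have f0: "f 0 = 0" using f[of 0 0] by simp
    have n: "f (int n) = of_nat n * f 1" for n
      by (induction n) (auto simp: f f0 algebra_simps)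
    show ?thesis
    proof (cases "i \<ge> 0")
      case True then show ?thesis using n[of "nat i"] by simp
    next
      case False
      then show ?thesis using n[of "nat (- i)"] f[of i "- i"] f0 by simp
    qed
  qed
  have "bij_betw (\<lambda>f. f 1) (carrier (rat_dual integer_group)) (carrier rat_module)"
  proof (rule bij_betwI[of _ _ _ "\<lambda>q i. of_int i * q"])
    show "(\<lambda>i. of_int i * x 1) = x" if "x \<in> carrier (rat_dual integer_group)" for x
    proof -
      have "x (i + j) = x i + x j" for i j using that by (simp add: rat_dual_def)
      then show ?thesis using *[of x] by (intro ext) metis
    qed
    show "(\<lambda>f. f 1) \<in> carrier (rat_dual integer_group) \<rightarrow> carrier rat_module" by (simp add: rat_module_def)
    show "(\<lambda>q i. of_int i * q) \<in> carrier rat_module \<rightarrow> carrier (rat_dual integer_group)"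
      by (simp add: rat_dual_def distrib_right)
  qed simp
  then show ?thesis unfolding module_isomorphic_def
    by (intro exI[of _ "\<lambda>f. f 1"]) (auto simp: rat_dual_def rat_module_def integer_group_def)
qed

lemma rat_dual_trivial:
  assumes "trivial_group G"
  obtains f where "carrier (rat_dual G) = {f}"
proof -
  have G: "group G" "carrier G = {\<one>\<^bsub>G\<^esub>}" using assms by (auto simp: trivial_group_def)
  have "carrier (rat_dual G) = {\<lambda>x\<in>carrier G. 0}"
  proof (intro equalityI subsetI)
    fix f assume f: "f \<in> carrier (rat_dual G)"
    have "f (\<one>\<^bsub>G\<^esub> \<otimes>\<^bsub>G\<^esub> \<one>\<^bsub>G\<^esub>) = f \<one>\<^bsub>G\<^esub> + f \<one>\<^bsub>G\<^esub>" using f G by (auto simp: rat_dual_def)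
    moreover have "\<one>\<^bsub>G\<^esub> \<otimes>\<^bsub>G\<^esub> \<one>\<^bsub>G\<^esub> = \<one>\<^bsub>G\<^esub>" using G by (simp add: group.is_monoid)
    ultimately have "f \<one>\<^bsub>G\<^esub> = 0" by simp
    then have "f = (\<lambda>x\<in>carrier G. 0)"
      using f by (intro extensionalityI[of _ "carrier G"]) (use G in \<open>auto simp: rat_dual_def\<close>)
    then show "f \<in> {\<lambda>x\<in>carrier G. 0}" by simp
  qed (use G in \<open>auto simp: rat_dual_def group.is_monoid\<close>)
  then show thesis using that by blast
qed

lemma module_isomorphic_singletons:
  assumes "carrier M = {a}" "module_closed M" "carrier N = {b}" "module_closed N"
  shows "module_isomorphic M N"
  unfolding module_isomorphic_def
  using assms by (intro exI[of _ "\<lambda>_. b"]) (auto simp: module_closed_def bij_betw_def)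

definition vanishes :: "(rat, 'a) module \<Rightarrow> bool" where
  "vanishes M \<longleftrightarrow> (\<exists>a. carrier M = {a})"

lemma singular_cohomology_trivial:
  assumes "trivial_group (homology_group (int p) X)"
  shows "vanishes (singular_cohomology p X)"
proof -
  obtain f where f: "carrier (rat_dual (homology_group (int p) X)) = {f}"
    using rat_dual_trivial assms by blast
  obtain h where h: "bij_betw h (carrier (singular_cohomology p X)) {f}"
    using singular_cohomology_dual(1)[of p X] f unfolding module_isomorphic_def by auto
  then have "is_singleton (carrier (singular_cohomology p X))"
    by (metis bij_betw_same_card card_1_singleton_iff is_singletonI is_singleton_altdef)
  then show ?thesis by (auto simp: is_singleton_def vanishes_def)
qed

lemma singular_cohomology_infinite_cyclic:
  assumes "homology_group (int p) X \<cong> integer_group"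
  shows "module_isomorphic (singular_cohomology p X) rat_module"
proof -
  have "integer_group \<cong> homology_group (int p) X" using assms by (simp add: group.iso_sym)
  then have "module_isomorphic (rat_dual (homology_group (int p) X)) (rat_dual integer_group)"
    by (intro rat_dual_cong) auto
  then show ?thesis
    by (rule module_isomorphic_trans[OF singular_cohomology_dual(1)
          module_isomorphic_trans[OF _ rat_dual_integer_group]])
qed

section \<open>Homotopy invariance, contractible spaces and the circle\<close>

lemma cohomology_homotopy_equivalent:
  assumes "X homotopy_equivalent_space Y"
  shows "module_isomorphic (cohomology q X) (cohomology q Y)"
proof (cases "q \<in> \<nat>")
  case True
  define p where "p = nat \<lfloor>q\<rfloor>"
  have "homology_group (int p) Y \<cong> homology_group (int p) X"
    using homotopy_equivalent_space_imp_isomorphic_homology_groups[OF assms] by (simp add: group.iso_sym)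
  then have "module_isomorphic (rat_dual (homology_group (int p) X)) (rat_dual (homology_group (int p) Y))"
    by (intro rat_dual_cong) auto
  then have "module_isomorphic (singular_cohomology p X) (singular_cohomology p Y)"
    by (rule module_isomorphic_trans[OF singular_cohomology_dual(1) module_isomorphic_trans
          [OF _ module_isomorphic_sym[OF singular_cohomology_dual]]])
  then show ?thesis using True by (simp add: cohomology_def p_def)
next
  case False
  then show ?thesis
    by (simp add: cohomology_def) (rule module_isomorphic_singletons, auto simp: trivial_module_def module_closed_def)
qed

lemma cohomology_contractible:
  assumes "contractible_space X" "topspace X \<noteq> {}"
  shows "module_isomorphic (cohomology 0 X) rat_module" "q \<noteq> 0 \<Longrightarrow> vanishes (cohomology q X)"
proof -
  have "path_connected_space X" using assms contractible_imp_path_connected_space by blast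
  then have "homology_group 0 X \<cong> integer_group"
    using assms isomorphic_integer_zeroth_homology_group by blast
  then show "module_isomorphic (cohomology 0 X) rat_module"
    using singular_cohomology_infinite_cyclic[of 0 X] by (simp add: cohomology_def)
  show "vanishes (cohomology q X)" if "q \<noteq> 0"
  proof (cases "q \<in> \<nat>")
    case True
    then obtain p where p: "q = of_nat p" by (auto simp: Nats_def)
    have "trivial_group (homology_group (int p) X)"
      using trivial_reduced_homology_group_contractible_space[OF assms(1), of "int p"] p that
      by (simp add: un_reduced_homology_group)
    then show ?thesis using p singular_cohomology_trivial[of p X] by (simp add: cohomology_def)
  qed (simp add: cohomology_def vanishes_def trivial_module_def)
qed

text \<open>Reduced homology of the circle settles degree 1 and the higher degrees; degree 0 rests
  on path connectedness. This is a hypothesis here because it is derived later, from the quotient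
  map of the line onto the circle.\<close>

lemma cohomology_circle:
  assumes "X homotopy_equivalent_space nsphere 1" "path_connected_space (nsphere 1)"
  shows "q = 0 \<or> q = 1 \<Longrightarrow> module_isomorphic (cohomology q X) rat_module"
    "q \<noteq> 0 \<Longrightarrow> q \<noteq> 1 \<Longrightarrow> vanishes (cohomology q X)"
proof -
  have iso: "homology_group p X \<cong> homology_group p (nsphere 1)" for p
    using assms(1) by (rule homotopy_equivalent_space_imp_isomorphic_homology_groups)
  have "homology_group 0 (nsphere 1) \<cong> integer_group"
    using assms(2) nonempty_nsphere[of 1] by (intro isomorphic_integer_zeroth_homology_group) auto
  then have 0: "homology_group 0 X \<cong> integer_group" using iso iso_trans by blast
  have 1: "homology_group 1 X \<cong> integer_group"
    using iso[of 1] iso_trans reduced_homology_group_nsphere(1)[of 1] by (simp add: un_reduced_homology_group) blast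
  show "module_isomorphic (cohomology q X) rat_module" if "q = 0 \<or> q = 1"
    using that singular_cohomology_infinite_cyclic[of 0 X] singular_cohomology_infinite_cyclic[of 1 X] 0 1
    by (auto simp: cohomology_def)
  show "vanishes (cohomology q X)" if "q \<noteq> 0" "q \<noteq> 1"
  proof (cases "q \<in> \<nat>")
    case True
    then obtain p where p: "q = of_nat p" by (auto simp: Nats_def)
    have "trivial_group (homology_group (int p) (nsphere 1))"
      using reduced_homology_group_nsphere(2)[of "int p" 1] p that
      by (simp add: un_reduced_homology_group)
    then have "trivial_group (homology_group (int p) X)"
      using iso isomorphic_group_triviality by (metis group_relative_homology_group)
    then show ?thesis using p singular_cohomology_trivial[of p X] by (simp add: cohomology_def)
  qed (simp add: cohomology_def vanishes_def trivial_module_def)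
qed

section \<open>Pell's equation\<close>

text \<open>The root of a natural number is an algebraic integer, so a rational root would be an
  integer.\<close>

lemma sqrt_irrational_of_nonsquare:
  fixes D :: nat
  assumes "\<nexists>r. D = r\<^sup>2"
  shows "sqrt D \<notin> \<rat>"
proof
  assume "sqrt D \<in> \<rat>"
  moreover have "algebraic_int (sqrt (real D))"
    by (intro algebraic_int_sqrt int_imp_algebraic_int) auto
  ultimately have "sqrt D \<in> \<int>" by (rule rational_algebraic_int_is_int[rotated])
  then obtain r :: int where r: "sqrt D = of_int r" by (auto simp: Ints_def)
  have "real D = (sqrt D)\<^sup>2" by simp
  also have "\<dots> = of_int (r\<^sup>2)" by (simp add: r)
  finally have "int D = r\<^sup>2" by linarith
  then have "D = (nat \<bar>r\<bar>)\<^sup>2" by (metis nat_int nat_power_eq abs_ge_zero power2_abs)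
  then show False using assms by blast
qed

text \<open>Infinitely many good approximations \<open>h / k\<close> to the root have norms
  \<open>h^2 - D k^2\<close> in a bounded range. By the pigeonhole principle two of them have the
  same norm \<open>N\<close> and are congruent modulo \<open>N\<close>; their quotient is then
  integral of norm 1.\<close>

theorem pell_solution:
  fixes D :: nat
  assumes "\<nexists>r. D = r\<^sup>2"
  obtains a b :: int where "b \<noteq> 0" "a\<^sup>2 - int D * b\<^sup>2 = 1"
proof -
  define q where "q = sqrt (real D)"
  have q0: "q \<ge> 0" and qq: "q\<^sup>2 = real D" by (simp_all add: q_def)
  have irr: "q \<notin> \<rat>" unfolding q_def by (rule sqrt_irrational_of_nonsquare[OF assms])
  define S where "S = approx_set q"
  have inf: "infinite S" using irr rational_iff_finite_approx_set unfolding S_def by blast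
  have S: "k > 0 \<and> \<bar>of_int h - of_int k * q\<bar> < 1 / of_int k" if "(h,k) \<in> S" for h k
  proof -
    have k: "k > 0" and "\<bar>q - of_int h / of_int k\<bar> < 1 / (of_int k)\<^sup>2"
      using that by (auto simp: S_def approx_set_def)
    then have "of_int k * \<bar>q - of_int h / of_int k\<bar> < of_int k * (1 / (of_int k)\<^sup>2)"
      by (intro mult_strict_left_mono) auto
    also have "of_int k * \<bar>q - of_int h / of_int k\<bar> = \<bar>of_int k * (q - of_int h / of_int k)\<bar>"
      using k by (simp add: abs_mult)
    also have "of_int k * (q - of_int h / of_int k) = of_int k * q - of_int h"
      using k by (simp add: field_simps)
    finally show ?thesis using k by (simp add: power2_eq_square abs_minus_commute)
  qed
  define n where "n = (\<lambda>(h, k). h\<^sup>2 - int D * k\<^sup>2)"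
  \<comment> \<open>The norm factors as \<open>(h - k q) (h + k q)\<close>. The first factor is
    below \<open>1 / k\<close> and the second at most \<open>k (2 q + 1)\<close>, which gives the
    bound \<open>2 q + 1\<close>.\<close>
  define M where "M = \<lceil>2 * q + 1\<rceil>"
  have nb: "\<bar>n p\<bar> \<le> M" if "p \<in> S" for p
  proof -
    obtain h k where p: "p = (h,k)" by force
    have k: "k \<ge> 1" and b: "\<bar>of_int h - of_int k * q\<bar> < 1 / of_int k" using S[of h k] that p by auto
    have k': "real_of_int k \<ge> 1" using k by simp
    have "1 / real_of_int k \<le> 1" using k' by simp
    have "\<bar>of_int h + of_int k * q\<bar> \<le> \<bar>of_int h - of_int k * q\<bar> + 2 * of_int k * q"
      using mult_nonneg_nonneg[OF order_trans[OF zero_le_one k'] q0] by linarith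
    also have "\<dots> \<le> 1 + 2 * of_int k * q" using b \<open>1 / real_of_int k \<le> 1\<close> by simp
    also have "\<dots> \<le> of_int k * (2 * q + 1)" using k' by (simp add: algebra_simps)
    finally have "\<bar>of_int h - of_int k * q\<bar> * \<bar>of_int h + of_int k * q\<bar> \<le> 1 / of_int k * (of_int k * (2 * q + 1))"
      using b k' q0 by (intro mult_mono) auto
    also have "\<dots> = 2 * q + 1" using k' by simp
    also have "\<bar>of_int h - of_int k * q\<bar> * \<bar>of_int h + of_int k * q\<bar> = \<bar>of_int (n p)\<bar>"
      unfolding abs_mult[symmetric] by (simp add: n_def p algebra_simps power2_eq_square flip: qq)
    finally show ?thesis unfolding M_def by linarith
  qed
  \<comment> \<open>The pigeonhole data: the norm and both entries modulo the norm. Irrationality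
    makes the norms nonzero, so the residues are bounded.\<close>
  define f where "f p = (n p, fst p mod \<bar>n p\<bar>, snd p mod \<bar>n p\<bar>)" for p
  have n0: "n p \<noteq> 0" if "p \<in> S" for p
  proof
    assume "n p = 0"
    obtain h k where p: "p = (h,k)" by force
    have k: "k > 0" using S[of h k] that p by auto
    have "(real_of_int h)\<^sup>2 = (of_int k * q)\<^sup>2"
      using \<open>n p = 0\<close> by (simp add: n_def p power_mult_distrib qq)
        (metis mult.commute of_int_mult of_int_of_nat_eq of_int_power)
    then have "real_of_int h = of_int k * q \<or> real_of_int h = - (of_int k * q)"
      by (simp only: power2_eq_iff)
    then have "q = of_int h / of_int k \<or> q = - (of_int h / of_int k)"
      using k by (auto simp: field_simps)
    moreover have "real_of_int h / of_int k \<in> \<rat>" by simp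
    ultimately show False using irr by (metis Rats_minus_iff)
  qed
  have "f ` S \<subseteq> {-M..M} \<times> {0..M} \<times> {0..M}"
  proof
    fix y assume "y \<in> f ` S"
    then obtain p where p: "p \<in> S" "y = f p" by blast
    have "\<bar>n p\<bar> > 0" using n0[OF p(1)] by simp
    then have "0 \<le> j mod \<bar>n p\<bar>" "j mod \<bar>n p\<bar> < \<bar>n p\<bar>" for j
      by (rule pos_mod_sign, rule pos_mod_bound)
    then have "0 \<le> j mod \<bar>n p\<bar>" "j mod \<bar>n p\<bar> \<le> M" for j
      using nb[OF p(1)] by (auto intro: order_trans[OF less_imp_le])
    then show "y \<in> {-M..M} \<times> {0..M} \<times> {0..M}"
      using nb[OF p(1)] unfolding p(2) f_def by auto
  qed
  then have "finite (f ` S)" by (rule finite_subset) auto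
  then obtain p0 where "p0 \<in> S" "infinite {p \<in> S. f p = f p0}"
    using pigeonhole_infinite[OF inf, of f] by blast
  then have "infinite ({p \<in> S. f p = f p0} - {p0})" by simp
  then have "{p \<in> S. f p = f p0} - {p0} \<noteq> {}" by (metis finite.emptyI)
  then obtain p1 where "p1 \<in> S" "f p1 = f p0" "p1 \<noteq> p0" by blast
  obtain h k where hk: "p0 = (h,k)" by force
  obtain h' k' where hk': "p1 = (h',k')" by force
  define N where "N = n p0"
  have N: "N = h\<^sup>2 - int D * k\<^sup>2" "N = h'\<^sup>2 - int D * k'\<^sup>2" "N \<noteq> 0"
    using \<open>f p1 = f p0\<close> n0 \<open>p0 \<in> S\<close> by (auto simp: N_def n_def f_def hk hk')
  have "h' mod \<bar>N\<bar> = h mod \<bar>N\<bar>" "k' mod \<bar>N\<bar> = k mod \<bar>N\<bar>"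
    using \<open>f p1 = f p0\<close> by (auto simp: f_def N_def hk hk')
  then have "N dvd h' - h" "N dvd k' - k" by (simp_all add: mod_eq_dvd_iff)
  then obtain u v where uv: "h' = h + N * u" "k' = k + N * v"
    by (metis add_diff_cancel_left' dvdE diff_add_cancel add.commute)
  have k: "k > 0" "k' > 0" using S[of h k] S[of h' k'] \<open>p0 \<in> S\<close> \<open>p1 \<in> S\<close> hk hk' by auto
  \<comment> \<open>With \<open>N\<close> the common norm, \<open>a + b q\<close> is
    \<open>(h + k q) (h' - k' q) / N\<close>, the quotient of the two approximations. The
    congruences modulo \<open>N\<close> make both coordinates integral.\<close>
  define a where "a = 1 + h * u - int D * k * v"
  define b where "b = k * u - h * v"
  have a: "h * h' - int D * k * k' = N * a"
    unfolding uv a_def by (subst (1) N(1)) (simp add: N(1) algebra_simps power2_eq_square)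
  have b: "k * h' - h * k' = N * b" unfolding uv b_def by (simp add: algebra_simps)
  have "N\<^sup>2 * (a\<^sup>2 - int D * b\<^sup>2) = (N * a)\<^sup>2 - int D * (N * b)\<^sup>2"
    by (simp add: algebra_simps power2_eq_square)
  also have "\<dots> = (h\<^sup>2 - int D * k\<^sup>2) * (h'\<^sup>2 - int D * k'\<^sup>2)"
    unfolding a[symmetric] b[symmetric] by (simp add: algebra_simps power2_eq_square)
  also have "\<dots> = N\<^sup>2" using N(1,2) by (simp add: power2_eq_square)
  finally have ab: "a\<^sup>2 - int D * b\<^sup>2 = 1" using N(3) by simp
  moreover have "b \<noteq> 0"
  proof
    \<comment> \<open>Vanishing of \<open>b\<close> means that the pairs are proportional; equal
      norms and positive denominators then make them equal.\<close>
    assume "b = 0"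
    then have e: "k * h' = h * k'" using b by simp
    have "N * k'\<^sup>2 = (h * k')\<^sup>2 - int D * k\<^sup>2 * k'\<^sup>2" unfolding N(1) by (simp add: algebra_simps power2_eq_square)
    also have "\<dots> = N * k\<^sup>2" unfolding e[symmetric] N(2) by (simp add: algebra_simps power2_eq_square)
    finally have "k'\<^sup>2 = k\<^sup>2" using N(3) by simp
    then have "k' = k" using k by (simp add: power2_eq_iff)
    then show False using e k \<open>p1 \<noteq> p0\<close> hk hk' by simp
  qed
  ultimately show thesis using that by blast
qed

section \<open>The ring of integers of an imaginary quadratic field\<close>

text \<open>All powers of the denominator \<open>v\<close> divide \<open>N\<close>. The exponent
  \<open>N\<close> is already too large unless \<open>v = 1\<close>, because
  \<open>2 ^ N > N\<close>.\<close>

lemma rat_of_bounded_denominators: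
  fixes q :: rat
  assumes "N > 0" "\<And>k. of_nat N * q ^ k \<in> \<int>"
  shows "q \<in> \<int>"
proof -
  obtain u v where uv: "quotient_of q = (u, v)" by force
  have v: "v > 0" "coprime u v" and q: "q = of_int u / of_int v"
    using uv quotient_of_denom_pos quotient_of_coprime quotient_of_div by auto
  have "v ^ k dvd int N" for k
  proof -
    obtain z where "of_nat N * q ^ k = of_int z" using assms(2)[of k] by (auto simp: Ints_def)
    then have "(of_int (int N * u ^ k) :: rat) = of_int (z * v ^ k)"
      using v by (simp add: q power_divide field_simps)
    then have "int N * u ^ k = z * v ^ k" by (simp only: of_int_eq_iff)
    then have "v ^ k dvd int N * u ^ k" by simp
    moreover have "coprime (v ^ k) (u ^ k)" using v(2) by (simp add: coprime_commute)
    ultimately show ?thesis by (simp add: coprime_dvd_mult_left_iff)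
  qed
  from this[of N] have "v ^ N \<le> int N" using assms(1) by (intro zdvd_imp_le) auto
  have "v = 1"
  proof (rule ccontr)
    assume "v \<noteq> 1"
    then have "(2::int) ^ N \<le> v ^ N" using v(1) by (intro power_mono) auto
    moreover have "int N < 2 ^ N" using of_nat_less_two_power by blast
    ultimately show False using \<open>v ^ N \<le> int N\<close> by linarith
  qed
  then show ?thesis using q by simp
qed

locale imaginary_quadratic =
  fixes m :: nat
  assumes m_pos: "m > 0"
begin

definition \<delta> :: complex where "\<delta> = \<i> * of_real (sqrt (real m))"

abbreviation R :: "complex set" where "R \<equiv> imaginary_quadratic_integers m"

definition K :: "complex set" where "K = {of_rat a + of_rat b * \<delta> | a b. True}"

text \<open>This is \<open>\<int>[\<delta>]\<close>, which may be smaller than the full ring of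
  integers \<open>R\<close>. It has an explicit basis and serves as the yardstick for
  denominators.\<close>

definition order :: "complex set" where "order = {of_int a + of_int b * \<delta> | a b. True}"

lemma of_rat_complex [simp]: "Re (of_rat a) = of_rat a" "Im (of_rat a) = 0"
proof -
  have "(of_rat a :: complex) = of_real (of_rat a)" by (cases a) (simp add: of_rat_rat)
  then show "Re (of_rat a) = of_rat a" "Im (of_rat a) = 0" by simp_all
qed

lemma \<delta>_sq: "\<delta> * \<delta> = - of_nat m"
proof -
  have "\<delta> * \<delta> = (\<i> * \<i>) * of_real (sqrt (real m) * sqrt (real m))" unfolding \<delta>_def by (simp only: of_real_mult mult_ac)
  then show ?thesis by simp
qed

lemma \<delta>_Re_Im [simp]: "Re \<delta> = 0" "Im \<delta> = sqrt (real m)" "cnj \<delta> = - \<delta>"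
  by (simp_all add: \<delta>_def)

lemma R_iff: "x \<in> R \<longleftrightarrow> x \<in> K \<and> algebraic_int x"
proof -
  have "csqrt (- of_nat m) = \<delta>"
    using csqrt_of_real_nonpos[of "- real m"] by (simp add: \<delta>_def)
  then show ?thesis by (auto simp: imaginary_quadratic_integers_def K_def)
qed

lemma order_mult: "x \<in> order \<Longrightarrow> y \<in> order \<Longrightarrow> x * y \<in> order"
proof -
  assume "x \<in> order" "y \<in> order"
  then obtain a b c d where "x = of_int a + of_int b * \<delta>" "y = of_int c + of_int d * \<delta>" by (auto simp: order_def)
  then have "x * y = of_int (a * c) + of_int (b * d) * (\<delta> * \<delta>) + of_int (a * d + b * c) * \<delta>"
    by (simp add: algebra_simps)
  also have "\<dots> = of_int (a * c - b * d * int m) + of_int (a * d + b * c) * \<delta>"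
    by (simp add: \<delta>_sq algebra_simps)
  finally show ?thesis unfolding order_def by blast
qed

lemma order_add: "x \<in> order \<Longrightarrow> y \<in> order \<Longrightarrow> x + y \<in> order"
proof -
  assume "x \<in> order" "y \<in> order"
  then obtain a b c d where "x = of_int a + of_int b * \<delta>" "y = of_int c + of_int d * \<delta>" by (auto simp: order_def)
  then have "x + y = of_int (a + c) + of_int (b + d) * \<delta>" by (simp add: algebra_simps)
  then show ?thesis unfolding order_def by blast
qed

lemma order_of_int: "of_int a \<in> order" unfolding order_def by (rule CollectI) (rule exI[of _ a], rule exI[of _ 0], simp)

lemma order_sum: "(\<And>i. i \<in> I \<Longrightarrow> f i \<in> order) \<Longrightarrow> sum f I \<in> order"
  by (induction I rule: infinite_finite_induct) (use order_of_int[of 0] order_add in auto)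

lemma order_power: "x \<in> order \<Longrightarrow> x ^ k \<in> order"
  by (induction k) (use order_of_int[of 1] order_mult in auto)

lemma K_multiple_in_order:
  assumes "x \<in> K" shows "\<exists>N>0. of_nat N * x \<in> order"
proof -
  obtain a b where x: "x = of_rat a + of_rat b * \<delta>" using assms by (auto simp: K_def)
  obtain u v where uv: "quotient_of a = (u, v)" by force
  obtain u' v' where uv': "quotient_of b = (u', v')" by force
  have v: "v > 0" "v' > 0" "a = of_int u / of_int v" "b = of_int u' / of_int v'"
    using uv uv' quotient_of_denom_pos quotient_of_div by auto
  have "(of_rat a :: complex) = of_int u / of_int v" "(of_rat b :: complex) = of_int u' / of_int v'"
    by (simp_all add: v(3,4) of_rat_divide)
  then have "of_nat (nat (v * v')) * x = of_int (u * v') + of_int (u' * v) * \<delta>"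
    using v(1,2) by (simp add: x field_simps)
  then have "of_nat (nat (v * v')) * x \<in> order" unfolding order_def by blast
  then show ?thesis using v(1,2) by (intro exI[of _ "nat (v * v')"]) auto
qed

text \<open>All powers of \<open>x\<close> lie in one lattice \<open>order / N\<close>. For elements
  of the field this is equivalent to integrality, and unlike a monic equation it passes to sums and
  products directly; the ring structure of \<open>R\<close> is obtained through it.\<close>

definition bounded_den :: "complex \<Rightarrow> bool" where
  "bounded_den x \<longleftrightarrow> (\<exists>N>0. \<forall>k. of_nat N * x ^ k \<in> order)"

lemma bounded_den_algebraic_int:
  assumes "x \<in> K" "algebraic_int x"
  shows "bounded_den x"
proof -
  obtain p where p: "lead_coeff p = 1" "\<forall>i. Polynomial.coeff p i \<in> \<int>" "poly p x = 0"
    using assms(2) by (auto simp: algebraic_int.simps)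
  obtain D where D: "D > 0" "of_nat D * x \<in> order" using K_multiple_in_order[OF assms(1)] by blast
  define n where "n = degree p"
  \<comment> \<open>The monic equation expresses a power of exponent at least \<open>n\<close> by
    lower ones, so the factor \<open>D ^ n\<close>, which clears the exponents below
    \<open>n\<close>, clears them all.\<close>
  have rec: "x ^ (n + j) = - (\<Sum>i<n. Polynomial.coeff p i * x ^ (i + j))" for j
  proof -
    have "0 = poly p x * x ^ j" using p by simp
    also have "poly p x = (\<Sum>i<n. Polynomial.coeff p i * x ^ i) + x ^ n"
      by (simp add: poly_altdef lessThan_Suc_atMost[symmetric] n_def p(1))
    finally show ?thesis by (simp add: algebra_simps power_add sum_distrib_left sum_distrib_right eq_neg_iff_add_eq_0)
  qed
  have "of_nat (D ^ n) * x ^ k \<in> order" for k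
  proof (induction k rule: less_induct)
    case (less k)
    show ?case
    proof (cases "k < n")
      case True
      have "of_nat (D ^ n) * x ^ k = of_int (int (D ^ (n - k))) * (of_nat D * x) ^ k"
        using True by (simp add: power_mult_distrib flip: power_add)
      then show ?thesis using order_mult[OF order_of_int order_power[OF D(2)], of "int (D ^ (n - k))" k] by simp
    next
      case False
      then obtain j where k: "k = n + j" by (metis le_Suc_ex not_less)
      have "of_nat (D ^ n) * x ^ k = (\<Sum>i<n. (- Polynomial.coeff p i) * (of_nat (D ^ n) * x ^ (i + j)))"
        unfolding k rec by (simp add: sum_distrib_left sum_negf algebra_simps)
      also have "\<dots> \<in> order"
      proof (rule order_sum)
        fix i assume "i \<in> {..<n}"
        then have "of_nat (D ^ n) * x ^ (i + j) \<in> order" using less k by simp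
        moreover obtain z where "Polynomial.coeff p i = of_int z" using p(2) Ints_cases by blast
        ultimately show "(- Polynomial.coeff p i) * (of_nat (D ^ n) * x ^ (i + j)) \<in> order"
          using order_mult[OF order_of_int[of "- z"]] by simp
      qed
      finally show ?thesis .
    qed
  qed
  then show ?thesis unfolding bounded_den_def using D(1) by (intro exI[of _ "D ^ n"]) auto
qed

lemma bounded_den_mult:
  assumes "bounded_den x" "bounded_den y" shows "bounded_den (x * y)"
proof -
  obtain N N' where N: "N > 0" "N' > 0" "\<And>k. of_nat N * x ^ k \<in> order" "\<And>k. of_nat N' * y ^ k \<in> order"
    using assms by (auto simp: bounded_den_def)
  have "of_nat (N * N') * (x * y) ^ k \<in> order" for k
    using order_mult[OF N(3)[of k] N(4)[of k]] by (simp add: power_mult_distrib mult_ac)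
  then show ?thesis unfolding bounded_den_def using N by (intro exI[of _ "N * N'"]) auto
qed

lemma bounded_den_add:
  assumes "bounded_den x" "bounded_den y" shows "bounded_den (x + y)"
proof -
  obtain N N' where N: "N > 0" "N' > 0" "\<And>k. of_nat N * x ^ k \<in> order" "\<And>k. of_nat N' * y ^ k \<in> order"
    using assms by (auto simp: bounded_den_def)
  have "of_nat (N * N') * (x + y) ^ k \<in> order" for k
  proof -
    have "of_nat (N * N') * (x + y) ^ k =
       (\<Sum>i\<le>k. of_int (int (k choose i)) * ((of_nat N * x ^ i) * (of_nat N' * y ^ (k - i))))"
      by (simp add: binomial_ring sum_distrib_left mult_ac)
    also have "\<dots> \<in> order" by (intro order_sum order_mult order_of_int N)
    finally show ?thesis .
  qed
  then show ?thesis unfolding bounded_den_def using N by (intro exI[of _ "N * N'"]) auto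
qed

lemma bounded_den_cnj: "bounded_den x \<Longrightarrow> bounded_den (cnj x)"
proof -
  have *: "cnj y \<in> order" if y: "y \<in> order" for y
  proof -
    obtain a b where "y = of_int a + of_int b * \<delta>" using y by (auto simp: order_def)
    then have "cnj y = of_int a + of_int (- b) * \<delta>" by simp
    then show ?thesis unfolding order_def by blast
  qed
  assume "bounded_den x"
  then obtain N where N: "N > 0" "\<And>k. of_nat N * x ^ k \<in> order" by (auto simp: bounded_den_def)
  have "of_nat N * cnj x ^ k \<in> order" for k using *[OF N(2)[of k]] by simp
  then show ?thesis using N(1) unfolding bounded_den_def by blast
qed



lemma real_bounded_den_int:
  assumes "x \<in> K" "bounded_den x" "Im x = 0"
  shows "x \<in> \<int>"
proof -
  obtain a b where x: "x = of_rat a + of_rat b * \<delta>" using assms by (auto simp: K_def)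
  have "b = 0" using assms(3) m_pos by (simp add: x)
  then have xa: "x = of_rat a" using x by simp
  obtain N where N: "N > 0" "\<And>k. of_nat N * x ^ k \<in> order" using assms by (auto simp: bounded_den_def)
  have "of_nat N * a ^ k \<in> \<int>" for k
  proof -
    obtain u v where "of_nat N * x ^ k = of_int u + of_int v * \<delta>" using N(2)[of k] by (auto simp: order_def)
    moreover have "of_nat N * x ^ k = (of_rat (of_nat N * a ^ k) :: complex)"
      by (simp add: xa of_rat_mult of_rat_power)
    ultimately have e: "(of_rat (of_nat N * a ^ k) :: complex) = of_int u + of_int v * \<delta>" by simp
    from arg_cong[OF e, of Re] have "real_of_rat (of_nat N * a ^ k) = of_int u" by simp
    then have "of_nat N * a ^ k = of_int u" by (metis of_rat_eq_iff of_rat_of_int_eq)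
    then show ?thesis by simp
  qed
  then have "a \<in> \<int>" using N(1) rat_of_bounded_denominators by blast
  then show ?thesis unfolding xa by (auto elim!: Ints_cases)
qed

lemma K_cnj: "x \<in> K \<Longrightarrow> cnj x \<in> K"
proof -
  assume "x \<in> K"
  then obtain a b where "x = of_rat a + of_rat b * \<delta>" by (auto simp: K_def)
  then have "cnj x = of_rat a + of_rat (- b) * \<delta>" by (simp add: of_rat_minus complex_eq_iff)
  then show ?thesis unfolding K_def by blast
qed

lemma K_add: "x \<in> K \<Longrightarrow> y \<in> K \<Longrightarrow> x + y \<in> K"
proof -
  assume "x \<in> K" "y \<in> K"
  then obtain a b c d where "x = of_rat a + of_rat b * \<delta>" "y = of_rat c + of_rat d * \<delta>" by (auto simp: K_def)
  then have "x + y = of_rat (a + c) + of_rat (b + d) * \<delta>" by (simp add: of_rat_add algebra_simps)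
  then show ?thesis unfolding K_def by blast
qed

lemma K_mult: "x \<in> K \<Longrightarrow> y \<in> K \<Longrightarrow> x * y \<in> K"
proof -
  assume "x \<in> K" "y \<in> K"
  then obtain a b c d where "x = of_rat a + of_rat b * \<delta>" "y = of_rat c + of_rat d * \<delta>" by (auto simp: K_def)
  then have "x * y = of_rat (a * c) + of_rat (b * d) * (\<delta> * \<delta>) + of_rat (a * d + b * c) * \<delta>"
    by (simp add: of_rat_add of_rat_mult algebra_simps)
  also have "\<dots> = of_rat (a * c - b * d * of_nat m) + of_rat (a * d + b * c) * \<delta>"
    by (simp add: \<delta>_sq of_rat_diff of_rat_mult)
  finally show ?thesis unfolding K_def by blast
qed

text \<open>For the reverse direction, the trace and the norm of \<open>x\<close> are real with
  bounded denominators, hence rational integers, and they are the coefficients of a monic quadratic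
  equation for \<open>x\<close>.\<close>

lemma R_iff_bounded_den: "x \<in> R \<longleftrightarrow> x \<in> K \<and> bounded_den x"
proof
  assume "x \<in> R"
  then show "x \<in> K \<and> bounded_den x" using R_iff bounded_den_algebraic_int by blast
next
  assume x: "x \<in> K \<and> bounded_den x"
  have "x + cnj x \<in> \<int>"
    using x by (intro real_bounded_den_int K_add K_cnj bounded_den_add bounded_den_cnj) auto
  moreover have "x * cnj x \<in> \<int>"
    using x by (intro real_bounded_den_int K_mult K_cnj bounded_den_mult bounded_den_cnj) auto
  ultimately obtain t n where tn: "x + cnj x = of_int t" "x * cnj x = of_int n" by (auto elim!: Ints_cases)
  have "algebraic_int x"
  proof (rule algebraic_int.intros)
    show "poly [:of_int n, - of_int t, 1:] x = 0"
      unfolding tn[symmetric] by (simp add: algebra_simps)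
    show "\<forall>i. Polynomial.coeff [:of_int n, - of_int t, 1 :: complex:] i \<in> \<int>"
      by (auto simp: coeff_pCons split: nat.splits)
  qed simp
  then show "x \<in> R" using x R_iff by blast
qed

lemma R_add: "x \<in> R \<Longrightarrow> y \<in> R \<Longrightarrow> x + y \<in> R"
  and R_mult: "x \<in> R \<Longrightarrow> y \<in> R \<Longrightarrow> x * y \<in> R"
  and R_cnj: "x \<in> R \<Longrightarrow> cnj x \<in> R"
  by (simp_all add: R_iff_bounded_den K_add K_mult K_cnj bounded_den_add bounded_den_mult bounded_den_cnj)

lemma order_subset_R: "x \<in> order \<Longrightarrow> x \<in> R"
proof -
  assume x: "x \<in> order"
  then obtain a b where "x = of_int a + of_int b * \<delta>" by (auto simp: order_def)
  then have "x = of_rat (of_int a) + of_rat (of_int b) * \<delta>" by simp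
  then have "x \<in> K" unfolding K_def by blast
  moreover have "bounded_den x" unfolding bounded_den_def using order_power[OF x] by (intro exI[of _ 1]) auto
  ultimately show ?thesis by (simp add: R_iff_bounded_den)
qed

lemma R_of_int [simp]: "of_int a \<in> R" by (intro order_subset_R order_of_int)
lemma R_0 [simp]: "0 \<in> R" and R_1 [simp]: "1 \<in> R" and R_of_nat [simp]: "of_nat n \<in> R"
  using R_of_int[of 0] R_of_int[of 1] R_of_int[of "int n"] by simp_all
lemma R_minus: "x \<in> R \<Longrightarrow> - x \<in> R" using R_mult[OF R_of_int[of "-1"], of x] by simp
lemma R_diff: "x \<in> R \<Longrightarrow> y \<in> R \<Longrightarrow> x - y \<in> R" using R_add[of x "- y"] R_minus by simp
lemma R_\<delta>: "\<delta> \<in> R"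
proof -
  have "\<delta> = of_int 0 + of_int 1 * \<delta>" by simp
  then show ?thesis by (intro order_subset_R) (unfold order_def, blast)
qed

lemma R_real_int: "x \<in> R \<Longrightarrow> Im x = 0 \<Longrightarrow> x \<in> \<int>"
  by (auto simp: R_iff_bounded_den intro: real_bounded_den_int)

lemma R_trace_norm:
  assumes "x \<in> R"
  obtains t n :: int where "2 * Re x = of_int t" "(cmod x)\<^sup>2 = of_int n"
proof -
  have "x + cnj x \<in> \<int>" using assms by (intro R_real_int R_add R_cnj) auto
  moreover have "x * cnj x \<in> \<int>" using assms by (intro R_real_int R_mult R_cnj) auto
  ultimately obtain t n where "x + cnj x = of_int t" "x * cnj x = of_int n" by (auto elim!: Ints_cases)
  then have "2 * Re x = of_int t" "(Re x)\<^sup>2 + (Im x)\<^sup>2 = of_int n"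
    by (simp_all add: complex_eq_iff complex_mult_cnj)
  then show thesis using that by (simp add: cmod_power2)
qed

text \<open>Trace and norm are integers bounded in terms of \<open>C\<close>. They determine the
  real part and the square of the imaginary part, which leaves only the sign \<open>e\<close>
  open.\<close>

lemma finite_R_bounded: "finite {x \<in> R. cmod x \<le> C}"
proof -
  let ?S = "(\<lambda>(t, n, e). Complex (of_int t / 2) (of_int e * sqrt (of_int n - (of_int t / 2)\<^sup>2))) `
     ({- \<lceil>2 * C\<rceil>..\<lceil>2 * C\<rceil>} \<times> {0..\<lceil>C\<^sup>2\<rceil>} \<times> {-1..1})"
  have "{x \<in> R. cmod x \<le> C} \<subseteq> ?S"
  proof
    fix x assume "x \<in> {x \<in> R. cmod x \<le> C}"
    then have x: "x \<in> R" "cmod x \<le> C" by auto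
    obtain t n :: int where tn: "2 * Re x = of_int t" "(cmod x)\<^sup>2 = of_int n" by (rule R_trace_norm[OF x(1)])
    have "\<bar>Re x\<bar> \<le> C" using abs_Re_le_cmod[of x] x(2) by linarith
    then have t: "t \<in> {- \<lceil>2 * C\<rceil>..\<lceil>2 * C\<rceil>}" using tn(1) by simp linarith
    have "(cmod x)\<^sup>2 \<le> C\<^sup>2" using x(2) by (intro power_mono) auto
    then have n: "n \<in> {0..\<lceil>C\<^sup>2\<rceil>}" using tn(2) by (simp, metis le_of_int_ceiling of_int_le_iff order_trans zero_le_power2 of_int_0_le_iff)
    have "(Im x)\<^sup>2 = of_int n - (of_int t / 2)\<^sup>2" using tn by (simp add: cmod_power2 flip: tn(1))
    then have "\<bar>Im x\<bar> = sqrt (of_int n - (of_int t / 2)\<^sup>2)" by (metis real_sqrt_abs)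
    then have "x = Complex (of_int t / 2) (of_int (if Im x \<ge> 0 then 1 else -1) * sqrt (of_int n - (of_int t / 2)\<^sup>2))"
      using tn(1) by (auto simp: complex_eq_iff)
    then show "x \<in> ?S" using t n
      by (intro image_eqI[of _ _ "(t, n, if Im x \<ge> 0 then 1 else -1)"]) auto
  qed
  then show ?thesis by (rule finite_subset) auto
qed

text \<open>A replacement for Euclidean division, which \<open>R\<close> may not admit: not
  \<open>z\<close> itself but a multiple of it by some \<open>k\<close> of bounded size is close to
  \<open>R\<close>. Dirichlet's theorem approximates both coordinates of \<open>z\<close> with
  respect to 1 and \<open>\<delta>\<close> at once.\<close>

lemma R_approx:
  obtains N where "N > 0" "\<And>z. \<exists>k q. 0 < k \<and> k \<le> N \<and> q \<in> R \<and> cmod (of_nat k * z - q) \<le> 1 / 2"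
proof -
  \<comment> \<open>Errors below \<open>1 / M\<close> in the two coordinates amount to at most
    \<open>(1 + sqrt m) / M\<close> in modulus, which is to be at most 1/2. Two coordinates let the
    multiplier range up to the square of \<open>M\<close>.\<close>
  define M where "M = nat \<lceil>2 * (1 + sqrt m)\<rceil>"
  have M: "real M \<ge> 2 * (1 + sqrt m)" unfolding M_def by linarith
  have "2 * (1 + sqrt m) > 0" by (simp add: add_pos_nonneg)
  then have M0: "M > 0" using M by (metis less_le_trans of_nat_0_less_iff)
  have "\<exists>k q. 0 < k \<and> k \<le> M\<^sup>2 \<and> q \<in> R \<and> cmod (of_nat k * z - q) \<le> 1 / 2" for z
  proof -
    define \<theta> where "\<theta> i = (if i = 0 then Re z else Im z / sqrt m)" for i :: nat
    obtain k p where kp: "0 < k" "k \<le> int (M ^ 2)" "\<And>i. i < 2 \<Longrightarrow> \<bar>of_int k * \<theta> i - of_int (p i)\<bar> < 1 / M"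
      by (rule Dirichlet_approx_simult[OF M0, of 2 \<theta>]) blast
    define q where "q = of_int (p 0) + of_int (p 1) * \<delta>"
    have "q \<in> order" unfolding q_def order_def by blast
    then have q: "q \<in> R" by (rule order_subset_R)
    have sm: "sqrt m > 0" using m_pos by simp
    have "cmod (of_nat (nat k) * z - q) \<le> \<bar>Re (of_nat (nat k) * z - q)\<bar> + \<bar>Im (of_nat (nat k) * z - q)\<bar>"
      by (rule cmod_le)
    also have "Re (of_nat (nat k) * z - q) = of_int k * \<theta> 0 - of_int (p 0)"
      using kp(1) by (simp add: q_def \<theta>_def)
    also have "Im (of_nat (nat k) * z - q) = sqrt m * (of_int k * \<theta> 1 - of_int (p 1))"
      using kp(1) sm by (simp add: q_def \<theta>_def field_simps)
    also have "\<bar>of_int k * \<theta> 0 - of_int (p 0)\<bar> + \<bar>sqrt m * (of_int k * \<theta> 1 - of_int (p 1))\<bar>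
        \<le> 1 / M + sqrt m * (1 / M)"
      unfolding abs_mult using kp(3)[of 0] kp(3)[of 1] by (intro add_mono mult_mono) auto
    also have "\<dots> = (1 + sqrt m) / M" by (simp add: add_divide_distrib)
    also have "\<dots> \<le> 1 / 2" using M M0 by (simp add: field_simps)
    finally show ?thesis using q kp(1,2) by (intro exI[of _ "nat k"] exI[of _ q]) (auto simp: nat_le_iff)
  qed
  then show thesis using that[of "M\<^sup>2"] M0 by simp
qed

lemma R_cover: "\<exists>q\<in>R. cmod (z - q) \<le> 1 + sqrt m"
proof -
  define q where "q = of_int \<lfloor>Re z\<rfloor> + of_int \<lfloor>Im z / sqrt m\<rfloor> * \<delta>"
  have sm: "sqrt m > 0" using m_pos by simp
  have "cmod (z - q) \<le> \<bar>Re (z - q)\<bar> + \<bar>Im (z - q)\<bar>" by (rule cmod_le)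
  also have "Im (z - q) = sqrt m * (Im z / sqrt m - of_int \<lfloor>Im z / sqrt m\<rfloor>)"
    using sm by (simp add: q_def field_simps)
  also have "\<bar>Re (z - q)\<bar> + \<bar>sqrt m * (Im z / sqrt m - of_int \<lfloor>Im z / sqrt m\<rfloor>)\<bar> \<le> 1 + sqrt m * 1"
    unfolding abs_mult by (intro add_mono mult_mono) (auto simp: q_def, linarith+)
  finally have "cmod (z - q) \<le> 1 + sqrt m" by simp
  moreover have "q \<in> order" unfolding q_def order_def by blast
  ultimately show ?thesis using order_subset_R by blast
qed

end

locale bianchi = imaginary_quadratic +
  assumes m_squarefree: "squarefree m"
    and R_units: "units_of_subring R = {1, -1}"
begin

lemma unit_cases:
  assumes "x \<in> R" "y \<in> R" "x * y = 1" shows "x = 1 \<or> x = -1"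
proof -
  have "x \<in> units_of_subring R" using assms by (auto simp: units_of_subring_def)
  then show ?thesis using R_units by auto
qed

lemma m_not_1: "m \<noteq> 1"
proof
  assume "m = 1"
  then have "\<delta> = \<i>" unfolding \<delta>_def by simp
  then have "\<i> = 1 \<or> \<i> = -1" using unit_cases[of \<i> "- \<i>"] R_\<delta> R_minus by auto
  then show False by (simp add: complex_eq_iff)
qed

text \<open>For \<open>m = 3\<close> the sixth root of unity \<open>\<omega>\<close> would be a
  further unit.\<close>

lemma m_not_3: "m \<noteq> 3"
proof
  assume m: "m = 3"
  define \<omega> where "\<omega> = 1 / 2 + \<delta> / 2"
  have c: "cnj \<omega> = 1 / 2 - \<delta> / 2" by (simp add: \<omega>_def)
  have "\<omega> * cnj \<omega> = (1 - \<delta> * \<delta>) / 4" unfolding c unfolding \<omega>_def by (simp add: field_simps)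
  then have p: "\<omega> * cnj \<omega> = 1" unfolding \<delta>_sq by (simp add: m)
  have s: "\<omega> + cnj \<omega> = 1" unfolding c unfolding \<omega>_def by simp
  have "algebraic_int \<omega>"
  proof (rule algebraic_int.intros)
    have "\<omega> * \<omega> - (\<omega> + cnj \<omega>) * \<omega> + \<omega> * cnj \<omega> = 0" by (simp add: algebra_simps)
    then show "poly [:1, - 1, 1:] \<omega> = 0" unfolding p s by (simp add: algebra_simps)
    show "\<forall>i. Polynomial.coeff [:1, - 1, 1 :: complex:] i \<in> \<int>"
      by (auto simp: coeff_pCons split: nat.splits)
  qed simp
  moreover have "\<omega> = of_rat (1 / 2) + of_rat (1 / 2) * \<delta>" by (simp add: \<omega>_def of_rat_divide)
  ultimately have "\<omega> \<in> R" unfolding R_iff K_def by blast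
  then have "\<omega> = 1 \<or> \<omega> = -1" using unit_cases p R_cnj by blast
  then have "Im \<omega> = 0" by auto
  then show False using m_pos by (simp add: \<omega>_def)
qed

text \<open>As \<open>m\<close> is square-free, \<open>4 m\<close> is a square only for
  \<open>m = 1\<close> and \<open>3 m\<close> only for \<open>m = 3\<close>, and these two fields
  have extra roots of unity. The values of \<open>k\<close> are \<open>4 - t^2\<close> for the
  traces \<open>t\<close> that occur.\<close>

lemma discriminant_nonsquare:
  assumes "k = 3 \<or> k = 4" shows "\<nexists>r. k * m = r\<^sup>2"
proof
  assume "\<exists>r. k * m = r\<^sup>2"
  then obtain r where r: "k * m = r\<^sup>2" by blast
  show False
  proof (cases "k = 4")
    case True
    then have "2 dvd r\<^sup>2" using r by (metis dvd_mult2 dvd_refl mult_2_right numeral_Bit0 dvd_triv_right mult.commute dvdI mult_2 )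
    then have "2 dvd r" by (metis prime_dvd_power two_is_prime_nat)
    then obtain u where "r = 2 * u" by blast
    then have "m = u\<^sup>2" using r True by (simp add: power2_eq_square)
    then have "u\<^sup>2 dvd m" by simp
    then have "u = 1" using m_squarefree by (auto simp: squarefree_def)
    then show False using \<open>m = u\<^sup>2\<close> m_not_1 by simp
  next
    case False
    then have k: "k = 3" using assms by simp
    then have "3 dvd r\<^sup>2" using r by (metis dvd_triv_left)
    moreover have "prime (3::nat)" by simp
    ultimately have "3 dvd r" using prime_dvd_power by blast
    then obtain u where u: "r = 3 * u" by blast
    then have m: "m = 3 * u\<^sup>2" using r k by (simp add: power2_eq_square)
    then have "u\<^sup>2 dvd m" by simp
    then have "u = 1" using m_squarefree by (auto simp: squarefree_def)
    then show False using m m_not_3 by simp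
  qed
qed

end

section \<open>Two-by-two matrices\<close>

abbreviation mat2 :: "complex \<Rightarrow> complex \<Rightarrow> complex \<Rightarrow> complex \<Rightarrow> complex ^ 2 ^ 2" where
  "mat2 a b c d \<equiv> vector [vector [a, b], vector [c, d]]"

lemma mat2_eq_iff:
  "(A :: complex ^ 2 ^ 2) = B \<longleftrightarrow>
     A$1$1 = B$1$1 \<and> A$1$2 = B$1$2 \<and> A$2$1 = B$2$1 \<and> A$2$2 = B$2$2"
  by (auto simp: vec_eq_iff forall_2)

lemma mult2_nth: "((A :: complex ^ 2 ^ 2) ** B) $ i $ j = A$i$1 * B$1$j + A$i$2 * B$2$j"
  by (simp add: matrix_matrix_mult_def sum_2)

lemma mat_nth2 [simp]:
  "(mat x :: complex ^ 2 ^ 2) $ 1 $ 1 = x" "(mat x :: complex ^ 2 ^ 2) $ 1 $ 2 = 0"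
  "(mat x :: complex ^ 2 ^ 2) $ 2 $ 1 = 0" "(mat x :: complex ^ 2 ^ 2) $ 2 $ 2 = x"
  by (simp_all add: mat_def)

text \<open>The adjugate. It inverts matrices of determinant 1 and, having no denominators, keeps
  entries in \<open>R\<close> also when the determinant is not a unit.\<close>

definition adj2 :: "complex ^ 2 ^ 2 \<Rightarrow> complex ^ 2 ^ 2" where
  "adj2 A = mat2 (A$2$2) (- A$1$2) (- A$2$1) (A$1$1)"

lemma adj2_nth [simp]:
  "adj2 A $ 1 $ 1 = A$2$2" "adj2 A $ 1 $ 2 = - A$1$2" "adj2 A $ 2 $ 1 = - A$2$1" "adj2 A $ 2 $ 2 = A$1$1"
  by (simp_all add: adj2_def)

lemma adj2_mult: "adj2 A ** A = mat (det A)" "A ** adj2 A = mat (det A)"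
  by (simp_all add: mat2_eq_iff mult2_nth det_2 algebra_simps)

lemma det_adj2 [simp]: "det (adj2 A) = det A"
  by (simp add: det_2)

lemma SL2_carrier: "A \<in> carrier (SL2 S) \<longleftrightarrow>
   A$1$1 \<in> S \<and> A$1$2 \<in> S \<and> A$2$1 \<in> S \<and> A$2$2 \<in> S \<and> det A = 1"
  by (auto simp: SL2_def forall_2)

section \<open>Elliptic matrices over the ring of integers\<close>

text \<open>\<open>elliptic_form A Q \<zeta> t\<close> diagonalises \<open>A\<close> as \<open>Q diag(\<zeta>, \<zeta>\<inverse>) Q\<inverse>\<close>; here
  \<open>\<zeta>\<inverse> = cnj \<zeta>\<close>, and \<open>t\<close> is the trace.\<close>

definition elliptic_form :: "complex ^ 2 ^ 2 \<Rightarrow> complex ^ 2 ^ 2 \<Rightarrow> complex \<Rightarrow> int \<Rightarrow> bool" where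
  "elliptic_form A Q \<zeta> t \<longleftrightarrow> det Q = 1 \<and> cmod \<zeta> = 1 \<and> \<zeta>\<^sup>2 \<noteq> 1 \<and> \<zeta> + cnj \<zeta> = of_int t \<and> t \<in> {-1, 0, 1} \<and>
     A ** Q = Q ** mat2 \<zeta> 0 0 (cnj \<zeta>) \<and> A$2$1 \<noteq> 0 \<and> A$1$1 + A$2$2 = of_int t"

lemma unit_circle_cnj: "cmod z = 1 \<Longrightarrow> z * cnj z = 1"
  by (metis complex_norm_square of_real_1 one_power2)

lemma unit_circle_sq_ne_1:
  assumes "cmod z = 1" shows "z\<^sup>2 = 1 \<longleftrightarrow> Im z = 0"
proof
  assume "z\<^sup>2 = 1" then show "Im z = 0" by (auto simp: power2_eq_1_iff)
next
  assume "Im z = 0"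
  then have "z = of_real (Re z)" by (simp add: complex_eq_iff)
  moreover from this assms have "(Re z)\<^sup>2 = 1" by (metis norm_of_real power2_abs one_power2)
  ultimately show "z\<^sup>2 = 1" by (metis of_real_power of_real_1)
qed

context imaginary_quadratic
begin

lemma R_sum_mult: "a \<in> R \<Longrightarrow> b \<in> R \<Longrightarrow> c \<in> R \<Longrightarrow> d \<in> R \<Longrightarrow> a * b + c * d \<in> R"
  by (intro R_add R_mult)

lemma SL2_mult_closed: "A \<in> carrier (SL2 R) \<Longrightarrow> B \<in> carrier (SL2 R) \<Longrightarrow> A ** B \<in> carrier (SL2 R)"
  by (simp add: SL2_carrier mult2_nth det_mul R_sum_mult)

lemma SL2_adj2_closed: "A \<in> carrier (SL2 R) \<Longrightarrow> adj2 A \<in> carrier (SL2 R)"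
  by (simp add: SL2_carrier R_minus)

text \<open>Hermite reduction: every unimodular image of the lattice \<open>R \<oplus> R\<close> in \<open>\<complex>\<^sup>2\<close> contains a
  nonzero vector of bounded length. A shortest vector \<open>v\<close> spans a line whose ideal of entries has
  a small element \<open>\<epsilon> = det(v, w)\<close>, because dividing \<open>v\<close> by the smallest such element cannot shorten it;
  then \<open>w\<close> is reduced modulo \<open>v\<close> by simultaneous approximation.\<close>

lemma short_vector_exists:
  obtains C where "\<And>\<alpha> \<beta> \<gamma> \<epsilon>. \<alpha> * \<epsilon> - \<beta> * \<gamma> = 1 \<Longrightarrow>
     \<exists>x\<in>R. \<exists>y\<in>R. (x, y) \<noteq> (0, 0) \<and> (cmod (\<alpha> * x + \<beta> * y))\<^sup>2 + (cmod (\<gamma> * x + \<epsilon> * y))\<^sup>2 \<le> C"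
proof -
  obtain N where N: "N > 0" "\<And>z. \<exists>k q. 0 < k \<and> k \<le> N \<and> q \<in> R \<and> cmod (of_nat k * z - q) \<le> 1 / 2"
    using R_approx by blast
  define F where "F = (fact N :: nat)"
  \<comment> \<open>A shortest vector of squared length \<open>H\<close> will satisfy
    \<open>H^2 \<le> H^2 / 4 + N^2 F^2\<close>, whence the factor 4/3. The summand 1 ensures
    \<open>C \<le> C^2\<close>, so that \<open>H^2 \<le> C\<close> yields
    \<open>H \<le> C\<close>.\<close>
  define C where "C = 1 + 4 / 3 * (real N)\<^sup>2 * (real F)\<^sup>2"
  have C1: "C \<ge> 1" by (simp add: C_def)
  have "\<exists>x\<in>R. \<exists>y\<in>R. (x, y) \<noteq> (0, 0) \<and> (cmod (\<alpha> * x + \<beta> * y))\<^sup>2 + (cmod (\<gamma> * x + \<epsilon> * y))\<^sup>2 \<le> C"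
    if det: "\<alpha> * \<epsilon> - \<beta> * \<gamma> = 1" for \<alpha> \<beta> \<gamma> \<epsilon>
  proof -
    define p where "p x y = \<alpha> * x + \<beta> * y" for x y
    define r where "r x y = \<gamma> * x + \<epsilon> * y" for x y
    define h where "h x y = (cmod (p x y))\<^sup>2 + (cmod (r x y))\<^sup>2" for x y
    have h0: "h x y \<ge> 0" for x y by (simp add: h_def)
    have inv: "\<epsilon> * p x y - \<beta> * r x y = x" "\<alpha> * r x y - \<gamma> * p x y = y" for x y
    proof -
      have "\<epsilon> * p x y - \<beta> * r x y = (\<alpha> * \<epsilon> - \<beta> * \<gamma>) * x" by (simp add: p_def r_def algebra_simps)
      then show "\<epsilon> * p x y - \<beta> * r x y = x" by (simp add: det)
      have "\<alpha> * r x y - \<gamma> * p x y = (\<alpha> * \<epsilon> - \<beta> * \<gamma>) * y" by (simp add: p_def r_def algebra_simps)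
      then show "\<alpha> * r x y - \<gamma> * p x y = y" by (simp add: det)
    qed
    define L where "L = {(x, y). x \<in> R \<and> y \<in> R \<and> (x, y) \<noteq> (0, 0)}"
    \<comment> \<open>The minimal length is attained because only finitely many lattice vectors are
      no longer than the image of \<open>(1, 0)\<close>: by \<open>inv\<close>, a bound on the
      length bounds \<open>x\<close> and \<open>y\<close>.\<close>
    define S where "S = {(x, y) \<in> L. h x y \<le> h 1 0}"
    have "finite S"
    proof -
      define c where "c = sqrt (h 1 0)"
      define M where "M = (cmod \<alpha> + cmod \<beta> + cmod \<gamma> + cmod \<epsilon>) * c"
      have "S \<subseteq> {x \<in> R. cmod x \<le> M} \<times> {x \<in> R. cmod x \<le> M}"
      proof
        fix z assume z: "z \<in> S"
        obtain x y where xy: "z = (x, y)" by force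
        have "x \<in> R" "y \<in> R" "h x y \<le> h 1 0" using z by (auto simp: xy S_def L_def)
        have "(cmod (p x y))\<^sup>2 \<le> h 1 0" "(cmod (r x y))\<^sup>2 \<le> h 1 0"
          using \<open>h x y \<le> h 1 0\<close> by (auto simp: h_def intro: order_trans[rotated])
        then have b: "cmod (p x y) \<le> c" "cmod (r x y) \<le> c" by (auto simp: c_def intro: real_le_rsqrt)
        have c0: "c \<ge> 0" using h0 by (simp add: c_def)
        have "cmod x \<le> cmod \<epsilon> * cmod (p x y) + cmod \<beta> * cmod (r x y)"
          by (subst inv(1)[of x y, symmetric]) (metis norm_triangle_ineq4 norm_mult)
        also have "\<dots> \<le> cmod \<epsilon> * c + cmod \<beta> * c" using b by (intro add_mono mult_left_mono) auto
        also have "\<dots> \<le> M" using c0 by (simp add: M_def algebra_simps)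
        finally have "cmod x \<le> M" .
        moreover have "cmod y \<le> cmod \<alpha> * cmod (r x y) + cmod \<gamma> * cmod (p x y)"
          by (subst inv(2)[of x y, symmetric]) (metis norm_triangle_ineq4 norm_mult)
        then have "cmod y \<le> cmod \<alpha> * c + cmod \<gamma> * c"
          by (rule order_trans) (use b in \<open>intro add_mono mult_left_mono; auto\<close>)
        then have "cmod y \<le> M" by (rule order_trans) (use c0 in \<open>simp add: M_def algebra_simps\<close>)
        ultimately show "z \<in> {x \<in> R. cmod x \<le> M} \<times> {x \<in> R. cmod x \<le> M}"
          using \<open>x \<in> R\<close> \<open>y \<in> R\<close> by (simp add: xy)
      qed
      then show ?thesis by (rule finite_subset) (intro finite_cartesian_product finite_R_bounded)
    qed
    moreover have e1S: "(1, 0) \<in> S" by (simp add: S_def L_def)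
    ultimately obtain v where v: "v \<in> S" "\<And>w. w \<in> S \<Longrightarrow> (case v of (x, y) \<Rightarrow> h x y) \<le> (case w of (x, y) \<Rightarrow> h x y)"
      using ex_min_if_finite[of "(\<lambda>(x, y). h x y) ` S"] by (force simp: not_less)
    obtain v1 v2 where v12: "v = (v1, v2)" by force
    have vL: "v1 \<in> R" "v2 \<in> R" "v1 \<noteq> 0 \<or> v2 \<noteq> 0" using v(1) by (auto simp: v12 S_def L_def)
    have vmin: "h v1 v2 \<le> h x y" if "(x, y) \<in> L" for x y
    proof (cases "h x y \<le> h 1 0")
      case True then show ?thesis using v(2)[of "(x, y)"] that by (simp add: v12 S_def)
    next
      case False then show ?thesis using v(2)[OF e1S] by (simp add: v12)
    qed
    define H where "H = h v1 v2"
    have H0: "H > 0"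
    proof (rule ccontr)
      assume "\<not> H > 0"
      then have "p v1 v2 = 0" "r v1 v2 = 0" unfolding H_def h_def
        by (smt (verit) zero_le_power2 zero_less_power2 norm_eq_zero)+
      then show False using inv[of v1 v2] vL by auto
    qed
    \<comment> \<open>The ideal generated by the entries of \<open>v\<close>. It need not be
      principal; a nonzero element \<open>e\<close> of least modulus stands in for a
      generator.\<close>
    define I where "I = {a * v1 + b * v2 | a b. a \<in> R \<and> b \<in> R}"
    have IR: "x \<in> R" if "x \<in> I" for x using that vL by (auto simp: I_def R_sum_mult)
    have I12: "v1 \<in> I" "v2 \<in> I" unfolding I_def
      by (rule CollectI, rule exI[of _ 1], rule exI[of _ 0], simp, rule CollectI, rule exI[of _ 0], rule exI[of _ 1], simp)
    have Icomb: "of_nat k * x - q * y \<in> I" if xy: "x \<in> I" "y \<in> I" "q \<in> R" for k x q y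
    proof -
      obtain a b a' b' where e: "x = a * v1 + b * v2" "y = a' * v1 + b' * v2" "a \<in> R" "b \<in> R" "a' \<in> R" "b' \<in> R"
        using xy by (auto simp: I_def)
      have "of_nat k * x - q * y = (of_nat k * a - q * a') * v1 + (of_nat k * b - q * b') * v2"
        by (simp add: e algebra_simps)
      moreover have "of_nat k * a - q * a' \<in> R" "of_nat k * b - q * b' \<in> R"
        using e xy by (auto intro!: R_diff R_mult)
      ultimately show ?thesis unfolding I_def by blast
    qed
    obtain x0 where x0: "x0 \<in> I" "x0 \<noteq> 0" using I12 vL(3) by blast
    define T where "T = {x \<in> I. x \<noteq> 0 \<and> cmod x \<le> cmod x0}"
    have "finite T" by (rule finite_subset[OF _ finite_R_bounded[of "cmod x0"]]) (auto simp: T_def IR)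
    moreover have "x0 \<in> T" using x0 by (simp add: T_def)
    ultimately obtain e where e: "e \<in> T" "\<And>w. w \<in> T \<Longrightarrow> cmod e \<le> cmod w"
      using ex_min_if_finite[of "cmod ` T"] by (force simp: not_less)
    have eI: "e \<in> I" "e \<noteq> 0" using e(1) by (auto simp: T_def)
    have emin: "cmod e \<le> cmod x" if "x \<in> I" "x \<noteq> 0" for x
      using e(2)[of x] e(2)[OF \<open>x0 \<in> T\<close>] that by (cases "cmod x \<le> cmod x0") (auto simp: T_def)
    \<comment> \<open>Subtracting a close multiple of \<open>e\<close> from \<open>k x\<close>
      leaves an element of the ideal smaller than \<open>e\<close>, hence 0. The factor
      \<open>k\<close> depends on \<open>x\<close>, but every \<open>k \<le> N\<close> divides
      \<open>F\<close>, the factorial of \<open>N\<close>.\<close>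
    have div: "\<exists>u\<in>R. of_nat F * x = e * u" if x: "x \<in> I" for x
    proof -
      obtain k q where kq: "0 < k" "k \<le> N" "q \<in> R" "cmod (of_nat k * (x / e) - q) \<le> 1 / 2"
        using N(2) by blast
      have "of_nat k * x - q * e = 0"
      proof (rule ccontr)
        assume "of_nat k * x - q * e \<noteq> 0"
        then have "cmod e \<le> cmod (of_nat k * x - q * e)" using emin Icomb x eI(1) kq(3) by blast
        also have "of_nat k * x - q * e = (of_nat k * (x / e) - q) * e" using eI(2) by (simp add: field_simps)
        also have "cmod \<dots> \<le> 1 / 2 * cmod e" unfolding norm_mult using kq(4) by (intro mult_right_mono) auto
        finally show False using eI(2) by simp
      qed
      then have kx: "of_nat k * x = q * e" by simp
      have "k dvd F" unfolding F_def using kq(1,2) by (simp add: dvd_fact)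
      then obtain j where "F = k * j" by blast
      then have "of_nat F * x = e * (of_nat j * q)" using kx by (simp add: mult_ac)
      then show ?thesis using kq(3) by (intro bexI[of _ "of_nat j * q"] R_mult) auto
    qed
    obtain u1 u2 where u: "u1 \<in> R" "u2 \<in> R" "of_nat F * v1 = e * u1" "of_nat F * v2 = e * u2"
      using div[OF I12(1)] div[OF I12(2)] by blast
    have F0: "F > 0" by (simp add: F_def)
    have hsc: "h (a * x) (a * y) = (cmod a)\<^sup>2 * h x y" for a x y
    proof -
      have "p (a * x) (a * y) = a * p x y" "r (a * x) (a * y) = a * r x y" by (simp_all add: p_def r_def algebra_simps)
      then show ?thesis by (simp add: h_def norm_mult power_mult_distrib algebra_simps)
    qed
    \<comment> \<open>The vector \<open>F v / e\<close> lies in the lattice again and is no shorter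
      than \<open>v\<close>, so the modulus of \<open>e\<close> is at most \<open>F\<close>.\<close>
    have "(u1, u2) \<in> L" using u vL(3) F0 eI(2) by (auto simp: L_def)
    then have "(cmod e)\<^sup>2 * H \<le> (cmod e)\<^sup>2 * h u1 u2" unfolding H_def by (intro mult_left_mono vmin) auto
    also have "\<dots> = (real F)\<^sup>2 * H" using hsc[of e u1 u2] hsc[of "of_nat F" v1 v2] u by (simp add: H_def)
    finally have eF: "(cmod e)\<^sup>2 \<le> (real F)\<^sup>2" using H0 by simp
    obtain w1 w2 where w: "w1 \<in> R" "w2 \<in> R" "e = v1 * w2 - v2 * w1"
    proof -
      obtain a b where "e = a * v1 + b * v2" "a \<in> R" "b \<in> R" using eI(1) by (auto simp: I_def)
      then show thesis using that[of "- b" a] by (simp add: R_minus mult_ac)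
    qed
    \<comment> \<open>The Gram-Schmidt coefficient of \<open>w\<close> along \<open>v\<close>. Only
      a multiple of \<open>\<mu>\<close> is close to \<open>R\<close>, so the reduced vector is
      \<open>z = k w - q v\<close>, whose component along \<open>v\<close> has at most half the
      length of \<open>v\<close>.\<close>
    define \<mu> where "\<mu> = (p w1 w2 * cnj (p v1 v2) + r w1 w2 * cnj (r v1 v2)) / of_real H"
    obtain k q where kq: "0 < k" "k \<le> N" "q \<in> R" "cmod (of_nat k * \<mu> - q) \<le> 1 / 2"
      using N(2) by blast
    define z1 where "z1 = of_nat k * w1 - q * v1"
    define z2 where "z2 = of_nat k * w2 - q * v2"
    have dz: "v1 * z2 - v2 * z1 = of_nat k * e" by (simp add: z1_def z2_def w(3) algebra_simps)
    have "(z1, z2) \<in> L" using dz kq eI(2) w vL by (auto simp: L_def z1_def z2_def intro!: R_diff R_mult)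
    then have "H \<le> h z1 z2" using vmin by (simp add: H_def)
    then have "H * H \<le> H * h z1 z2" using H0 by simp
    \<comment> \<open>Lagrange's identity: the product of two squared lengths is the squared inner
      product plus the squared determinant. The first term is small by the reduction, and the
      determinant is \<open>k e\<close>.\<close>
    also have "\<dots> = (cmod (p z1 z2 * cnj (p v1 v2) + r z1 z2 * cnj (r v1 v2)))\<^sup>2 +
        (cmod (p v1 v2 * r z1 z2 - r v1 v2 * p z1 z2))\<^sup>2"
      unfolding H_def h_def cmod_power2 by (simp add: algebra_simps power2_eq_square)
    also have "p v1 v2 * r z1 z2 - r v1 v2 * p z1 z2 = (\<alpha> * \<epsilon> - \<beta> * \<gamma>) * (v1 * z2 - v2 * z1)"
      by (simp add: p_def r_def algebra_simps)
    also have "\<dots> = of_nat k * e" by (simp add: det dz)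
    also have "p z1 z2 * cnj (p v1 v2) + r z1 z2 * cnj (r v1 v2) = (of_nat k * \<mu> - q) * of_real H"
    proof -
      have 1: "of_real H = p v1 v2 * cnj (p v1 v2) + r v1 v2 * cnj (r v1 v2)"
        by (simp only: H_def h_def of_real_add complex_norm_square)
      have 2: "\<mu> * of_real H = p w1 w2 * cnj (p v1 v2) + r w1 w2 * cnj (r v1 v2)"
        using H0 by (simp add: \<mu>_def)
      have 3: "p z1 z2 = of_nat k * p w1 w2 - q * p v1 v2" "r z1 z2 = of_nat k * r w1 w2 - q * r v1 v2"
        by (simp_all add: p_def r_def z1_def z2_def algebra_simps)
      have "(of_nat k * \<mu> - q) * of_real H = of_nat k * (\<mu> * of_real H) - q * of_real H" by (simp add: algebra_simps)
      then show ?thesis unfolding 2 unfolding 1 3 by (simp add: algebra_simps)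
    qed
    also have "(cmod ((of_nat k * \<mu> - q) * of_real H))\<^sup>2 \<le> (1 / 2 * H)\<^sup>2"
      unfolding norm_mult using kq(4) H0 by (intro power_mono mult_mono) auto
    also have "(cmod (of_nat k * e))\<^sup>2 = (real k)\<^sup>2 * (cmod e)\<^sup>2" by (simp add: norm_mult power_mult_distrib)
    also have "\<dots> \<le> (real N)\<^sup>2 * (real F)\<^sup>2" using eF kq(2) by (intro mult_mono power_mono) auto
    finally have "H * H \<le> H * H / 4 + (real N)\<^sup>2 * (real F)\<^sup>2"
      by (simp add: power_divide power2_eq_square)
    then have "H * H \<le> C" by (simp add: C_def)
    also have "C \<le> C * C" using C1 by simp
    finally have "H \<le> C" using H0 C1 by (metis abs_le_square_iff abs_of_pos less_le_trans power2_eq_square zero_less_one)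
    then show ?thesis using vL unfolding H_def h_def p_def r_def
      by (intro bexI[of _ v1] bexI[of _ v2]) auto
  qed
  then show thesis using that by blast
qed

end

context bianchi
begin

text \<open>An element of the field with negative rational square is a rational multiple of
  \<open>\<delta>\<close>; comparison with \<open>\<delta>^2 = - m\<close> would make
  \<open>sqrt (k m)\<close> rational. The lemma rules out eigenvectors of elliptic matrices with
  entries in \<open>R\<close>.\<close>

lemma R_no_root:
  assumes "x \<in> R" "n > 0" "k = 3 \<or> k = 4"
  shows "x\<^sup>2 \<noteq> - of_nat k * of_int n ^ 2"
proof
  assume x: "x\<^sup>2 = - of_nat k * of_int n ^ 2"
  obtain a b where ab: "x = of_rat a + of_rat b * \<delta>" using assms(1) by (auto simp: R_iff K_def)
  have "Re (x\<^sup>2) = - real k * (of_int n)\<^sup>2" unfolding x by (simp add: power2_eq_square)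
  then have re: "(Re x)\<^sup>2 - (Im x)\<^sup>2 = - real k * (of_int n)\<^sup>2" by (simp add: power2_eq_square)
  have "Im (x\<^sup>2) = 0" unfolding x by (simp add: power2_eq_square)
  then have "Re x = 0 \<or> Im x = 0" by (auto simp: power2_eq_square)
  moreover have "real k * (of_int n)\<^sup>2 > 0" using assms by auto
  moreover have "(Re x)\<^sup>2 \<ge> 0" by simp
  moreover have "\<not> Im x = 0" 
  proof
    assume "Im x = 0"
    then have "(Im x)\<^sup>2 = 0" by simp
    then show False using re calculation(2,3) by linarith
  qed
  ultimately have "Re x = 0" by blast
  then have im: "(Im x)\<^sup>2 = real k * (of_int n)\<^sup>2" using re by simp
  have Imx: "Im x = of_rat b * sqrt m" using ab by simp
  have "(of_rat b * real m / of_int n)\<^sup>2 = real m * (Im x)\<^sup>2 / (of_int n)\<^sup>2"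
    unfolding Imx using m_pos by (simp add: power2_eq_square)
  also have "\<dots> = real (k * m)" unfolding im using assms(2) by simp
  finally have "\<bar>of_rat b * real m / of_int n\<bar> = sqrt (real (k * m))" by (metis real_sqrt_abs)
  moreover have "\<bar>of_rat b * real m / of_int n\<bar> \<in> \<rat>" by simp
  ultimately have "sqrt (real (k * m)) \<in> \<rat>" by simp
  then show False using sqrt_irrational_of_nonsquare discriminant_nonsquare[OF assms(3)] by blast
qed

text \<open>Finite order excludes Jordan blocks and puts the eigenvalues on the unit circle, so that
  the trace is a rational integer of modulus below 2. The lower left entry is nonzero because a
  triangular matrix over \<open>R\<close> has diagonal 1 or -1, which makes it trivial or a Jordan
  block.\<close>

lemma elliptic_form_exists:
  assumes A: "A \<in> carrier (SL2 R)" "A \<noteq> mat 1" "A \<noteq> - mat 1"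
    and k: "k > 0" "\<sigma> = 1 \<or> \<sigma> = -1" "\<And>x. ((\<lambda>x. A *v x) ^^ k) x = \<sigma> *s x"
  obtains Q \<zeta> t where "elliptic_form A Q \<zeta> t"
proof -
  define a b c d where abcd: "a = A$1$1" "b = A$1$2" "c = A$2$1" "d = A$2$2"
  have R: "a \<in> R" "b \<in> R" "c \<in> R" "d \<in> R" and det: "a * d - b * c = 1"
    using A(1) by (simp_all add: SL2_carrier abcd det_2)
  have Av: "A *v vector [x, y] = vector [a * x + b * y, c * x + d * y]" for x y
    by (simp add: vec_eq_iff forall_2 matrix_vector_mult_def sum_2 abcd)
  \<comment> \<open>On a Jordan block with eigenvalue \<open>\<epsilon>\<close> the off-diagonal
    coefficient of the \<open>n\<close>-th power is \<open>n \<epsilon>^(n-1)\<close>, written here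
    with exponent \<open>n + 1\<close> since \<open>\<epsilon>^2 = 1\<close>. It does not vanish for
    positive \<open>n\<close>.\<close>
  have unipotent: False if e: "\<epsilon> = 1 \<or> \<epsilon> = -1" and x: "A *v x = \<epsilon> *s x" and y: "A *v y = \<epsilon> *s y + x"
    and "x \<noteq> 0" for \<epsilon> :: complex and x y
  proof -
    have pow: "((\<lambda>x. A *v x) ^^ n) y = \<epsilon> ^ n *s y + (of_nat n * \<epsilon> ^ (n + 1)) *s x" for n
    proof (induction n)
      case (Suc n)
      have ee: "\<epsilon> * (\<epsilon> * z) = z" for z using e by auto
      have "((\<lambda>x. A *v x) ^^ Suc n) y = A *v (\<epsilon> ^ n *s y + (of_nat n * \<epsilon> ^ (n + 1)) *s x)" using Suc by simp
      also have "\<dots> = \<epsilon> ^ n *s (\<epsilon> *s y + x) + (of_nat n * \<epsilon> ^ (n + 1)) *s (\<epsilon> *s x)"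
        by (simp only: matrix_vector_right_distrib vector_scalar_commute x y)
      also have "\<dots> = \<epsilon> ^ Suc n *s y + (of_nat (Suc n) * \<epsilon> ^ (Suc n + 1)) *s x"
        by (simp add: vec_eq_iff algebra_simps ee)
      finally show ?case .
    qed simp
    have "((\<lambda>x. A *v x) ^^ n) x = \<epsilon> ^ n *s x" for n
      by (induction n) (auto simp: x vector_scalar_commute)
    then have "\<epsilon> ^ k *s x = \<sigma> *s x" using k(3) by metis
    then have "\<epsilon> ^ k = \<sigma>" using \<open>x \<noteq> 0\<close> by (auto simp: vec_eq_iff)
    then have "(of_nat k * \<epsilon> ^ (k + 1)) *s x = 0" using pow[of k] k(3)[of y] by simp
    then show False using \<open>x \<noteq> 0\<close> k(1) e by (auto simp: vec_eq_iff)
  qed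
  have c0: "c \<noteq> 0"
  proof
    assume c: "c = 0"
    then have "a * d = 1" using det by simp
    then have ad: "(a = 1 \<and> d = 1) \<or> (a = -1 \<and> d = -1)" using unit_cases[OF R(1,4)]
      by (metis minus_minus mult_1 mult_minus1)
    then have "b \<noteq> 0" using A(2,3) c by (auto simp: mat2_eq_iff abcd[symmetric])
    moreover have "A *v vector [b, 0] = a *s vector [b, 0]" "A *v vector [0, 1] = a *s vector [0, 1] + vector [b, 0]"
      unfolding Av using ad c by (auto simp: vec_eq_iff forall_2)
    moreover have "a = 1 \<or> a = -1" using ad by auto
    moreover have "(vector [b, 0] :: complex^2) \<noteq> 0" using \<open>b \<noteq> 0\<close> by (simp add: vec_eq_iff forall_2)
    ultimately show False using unipotent by blast
  qed
  have eig: "z ^ k = \<sigma>" if "z * z - (a + d) * z + 1 = 0" for z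
  proof -
    have "A *v vector [z - d, c] = z *s vector [z - d, c]"
      unfolding Av using that det by (simp add: vec_eq_iff forall_2 algebra_simps)
    then have "((\<lambda>x. A *v x) ^^ n) (vector [z - d, c]) = z ^ n *s vector [z - d, c]" for n
      by (induction n) (auto simp: vector_scalar_commute)
    then have "z ^ k *s vector [z - d, c] = \<sigma> *s (vector [z - d, c] :: complex^2)" using k(3) by metis
    then show ?thesis using c0 by (simp add: vec_eq_iff forall_2)
  qed
  define \<zeta> where "\<zeta> = ((a + d) + csqrt ((a + d)\<^sup>2 - 4)) / 2"
  have \<zeta>: "\<zeta> * \<zeta> - (a + d) * \<zeta> + 1 = 0"
  proof -
    have "4 * (\<zeta> * \<zeta> - (a + d) * \<zeta> + 1) = (csqrt ((a + d)\<^sup>2 - 4))\<^sup>2 - ((a + d)\<^sup>2 - 4)"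
      unfolding \<zeta>_def by (simp add: field_simps power2_eq_square)
    then have "4 * (\<zeta> * \<zeta> - (a + d) * \<zeta> + 1) = 0" by (simp only: power2_csqrt diff_self)
    then show ?thesis by (simp only: mult_eq_0_iff) simp
  qed
  have "\<zeta> ^ k = \<sigma>" by (rule eig[OF \<zeta>])
  then have "cmod \<zeta> ^ k = 1" using k(2) by (metis norm_minus_cancel norm_one norm_power)
  then have n1: "cmod \<zeta> = 1" using k(1) power_eq_imp_eq_base[of "cmod \<zeta>" k 1] by simp
  then have zc: "\<zeta> * cnj \<zeta> = 1" by (rule unit_circle_cnj)
  have tr: "a + d = \<zeta> + cnj \<zeta>"
  proof -
    have "\<zeta> * (a + d) = \<zeta> * (\<zeta> + cnj \<zeta>)" using \<zeta> zc by (simp add: algebra_simps)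
    then show ?thesis using zc by (metis mult_cancel_left mult_zero_left zero_neq_one)
  qed
  have z1: "\<zeta>\<^sup>2 \<noteq> 1"
  proof
    assume "\<zeta>\<^sup>2 = 1"
    then have e: "\<zeta> = 1 \<or> \<zeta> = -1" by (simp add: power2_eq_1_iff)
    define x :: "complex^2" where "x = vector [a - \<zeta>, c]"
    define y :: "complex^2" where "y = vector [1, 0]"
    have "A *v y = \<zeta> *s y + x" by (simp add: x_def y_def Av vec_eq_iff forall_2)
    moreover have "A *v x = \<zeta> *s x"
    proof -
      have d: "d = 2 * \<zeta> - a" using tr e by (auto simp: algebra_simps)
      have "b * c = a * d - 1" using det by (simp add: algebra_simps)
      then have "a * (a - \<zeta>) + b * c = \<zeta> * (a - \<zeta>)" using e unfolding d by (auto simp: algebra_simps)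
      moreover have "c * (a - \<zeta>) + d * c = \<zeta> * c" unfolding d by (simp add: algebra_simps)
      ultimately show ?thesis by (simp add: x_def Av vec_eq_iff forall_2)
    qed
    moreover have "x \<noteq> 0" using c0 by (simp add: x_def vec_eq_iff forall_2)
    ultimately show False using unipotent[OF e] by blast
  qed
  have "a + d \<in> \<int>" using R_real_int[OF R_add[OF R(1,4)]] tr by simp
  then obtain t where t: "a + d = of_int t" by (auto elim!: Ints_cases)
  have Re: "2 * Re \<zeta> = of_int t" using tr t by (simp add: complex_eq_iff)
  have Im0: "Im \<zeta> \<noteq> 0" using z1 unit_circle_sq_ne_1[OF n1] by simp
  have "(Re \<zeta>)\<^sup>2 + (Im \<zeta>)\<^sup>2 = 1" using n1 by (simp add: cmod_power2[symmetric])
  moreover have "(Im \<zeta>)\<^sup>2 > 0" using Im0 by simp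
  ultimately have "(Re \<zeta>)\<^sup>2 < 1" by linarith
  then have "\<bar>Re \<zeta>\<bar> < 1" by (simp add: abs_square_less_1)
  then have "\<bar>real_of_int t\<bar> < 2" using Re by linarith
  then have t3: "t \<in> {-1, 0, 1}" by auto
  \<comment> \<open>For the two roots \<open>z\<close> the columns \<open>(z - d, c)\<close> are
    eigenvectors. Their determinant is \<open>e\<close>; dividing the second column by it gives
    \<open>Q\<close> determinant 1.\<close>
  define e where "e = c * (\<zeta> - cnj \<zeta>)"
  have e0: "e \<noteq> 0" using c0 Im0 by (auto simp: e_def complex_eq_iff)
  define Q where "Q = mat2 (\<zeta> - d) ((cnj \<zeta> - d) / e) c (c / e)"
  have "det Q = 1" using e0 by (simp add: Q_def det_2 field_simps) (simp add: e_def algebra_simps)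
  moreover have "A ** Q = Q ** mat2 \<zeta> 0 0 (cnj \<zeta>)"
  proof -
    have *: "a * (z - d) + b * c = (z - d) * z" "c * (z - d) + d * c = c * z"
      if "z * z - (a + d) * z + 1 = 0" for z
    proof -
      have "a * (z - d) + b * c - (z - d) * z = - (z * z - (a + d) * z + (a * d - b * c))" by (simp add: algebra_simps)
      then show "a * (z - d) + b * c = (z - d) * z" using that det by simp
      show "c * (z - d) + d * c = c * z" by (simp add: algebra_simps)
    qed
    have "cnj \<zeta> * cnj \<zeta> - (a + d) * cnj \<zeta> + 1 = 0" unfolding tr using zc by (simp add: algebra_simps)
    from *[OF \<zeta>] *[OF this] show ?thesis
      unfolding mat2_eq_iff mult2_nth abcd[symmetric] Q_def using e0 by (simp add: field_simps)
  qed
  ultimately have "elliptic_form A Q \<zeta> t"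
    unfolding elliptic_form_def using n1 z1 t3 t c0 tr by (simp add: abcd)
  then show thesis using that by blast
qed

text \<open>The matrices commuting with \<open>A\<close> form an order in a biquadratic field; its unit of infinite order
  comes from Pell's equation for \<open>(4 - t\<^sup>2) m\<close>.\<close>

lemma elliptic_translation:
  assumes "A \<in> carrier (SL2 R)" "elliptic_form A Q \<zeta> t"
  obtains H \<alpha> where "H \<in> carrier (SL2 R)" "H ** Q = Q ** mat2 \<alpha> 0 0 (inverse \<alpha>)" "\<alpha> \<noteq> 0" "cmod \<alpha> \<noteq> 1"
proof -
  have E: "det Q = 1" "cmod \<zeta> = 1" "\<zeta>\<^sup>2 \<noteq> 1" "\<zeta> + cnj \<zeta> = of_int t" "t \<in> {-1, 0, 1}"
     "A ** Q = Q ** mat2 \<zeta> 0 0 (cnj \<zeta>)" "A$1$1 + A$2$2 = of_int t"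
    using assms(2) by (auto simp: elliptic_form_def)
  define k where "k = nat (4 - t\<^sup>2)"
  have k: "k = 3 \<or> k = 4" "of_nat k = (4 - of_int t ^ 2 :: complex)" using E(5) by (auto simp: k_def)
  obtain a b :: int where ab: "b \<noteq> 0" "a\<^sup>2 - int (k * m) * b\<^sup>2 = 1"
    by (rule pell_solution[OF discriminant_nonsquare[OF k(1)]])
  \<comment> \<open>\<open>H\<close> is \<open>a + b \<delta> (2 A - t)\<close>. The traceless
    matrix \<open>2 A - t\<close> has square \<open>t^2 - 4 = - k\<close>, and
    \<open>\<delta>^2 = - m\<close>, so \<open>\<delta> (2 A - t)\<close> is a square root of
    \<open>k m\<close> that commutes with \<open>A\<close>, and the determinant of \<open>H\<close>
    is the Pell norm.\<close>
  define H where "H = mat2 (of_int a + of_int b * \<delta> * (2 * A$1$1 - of_int t)) (of_int b * \<delta> * (2 * A$1$2))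
      (of_int b * \<delta> * (2 * A$2$1)) (of_int a + of_int b * \<delta> * (2 * A$2$2 - of_int t))"
  define f where "f z = of_int a + of_int b * \<delta> * (2 * z - of_int t)" for z
  have detA: "A$1$1 * A$2$2 - A$1$2 * A$2$1 = 1" using assms(1) by (simp add: SL2_carrier det_2)
  have norm: "(of_int a)\<^sup>2 - of_nat m * of_nat k * (of_int b)\<^sup>2 = (1 :: complex)"
  proof -
    have "(of_int (a\<^sup>2 - int (k * m) * b\<^sup>2) :: complex) = 1" unfolding ab(2) by simp
    then show ?thesis by (simp add: mult_ac)
  qed
  have prod: "f x * f y - of_int b * \<delta> * (2 * u) * (of_int b * \<delta> * (2 * v)) = 1"
    if "x + y = of_int t" "x * y - u * v = 1" for x y u v
  proof -
    have "f x * f y - of_int b * \<delta> * (2 * u) * (of_int b * \<delta> * (2 * v)) =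
      (of_int a)\<^sup>2 + of_int a * of_int b * \<delta> * (2 * (x + y) - 2 * of_int t) +
      (\<delta> * \<delta>) * (of_int b)\<^sup>2 * (4 * (x * y - u * v) - 2 * of_int t * (x + y) + (of_int t)\<^sup>2)"
      by (simp add: f_def algebra_simps power2_eq_square)
    also have "\<dots> = (of_int a)\<^sup>2 - of_nat m * of_nat k * (of_int b)\<^sup>2"
      unfolding that \<delta>_sq k(2) by (simp add: algebra_simps power2_eq_square)
    finally show ?thesis using norm by simp
  qed
  have "det H = f (A$1$1) * f (A$2$2) - of_int b * \<delta> * (2 * A$1$2) * (of_int b * \<delta> * (2 * A$2$1))"
    by (simp add: H_def det_2 f_def)
  also have "\<dots> = 1" by (rule prod[OF E(7) detA])
  finally have "det H = 1" .
  then have HR: "H \<in> carrier (SL2 R)"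
    using assms(1) R_of_int[of 2] unfolding SL2_carrier
    by (auto simp: H_def intro!: R_add R_mult R_diff R_\<delta>)
  define \<alpha> where "\<alpha> = f \<zeta>"
  have "f \<zeta> * f (cnj \<zeta>) - of_int b * \<delta> * (2 * 0) * (of_int b * \<delta> * (2 * 0)) = 1"
    using E(4) unit_circle_cnj[OF E(2)] by (intro prod) auto
  then have \<alpha>: "\<alpha> * f (cnj \<zeta>) = 1" by (simp add: \<alpha>_def)
  then have inv: "f (cnj \<zeta>) = inverse \<alpha>" "\<alpha> \<noteq> 0" by (metis inverse_unique, auto)
  have "H ** Q = Q ** mat2 \<alpha> 0 0 (f (cnj \<zeta>))"
  proof -
    have e: "A$1$1 * Q$1$1 + A$1$2 * Q$2$1 = Q$1$1 * \<zeta>" "A$1$1 * Q$1$2 + A$1$2 * Q$2$2 = Q$1$2 * cnj \<zeta>"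
       "A$2$1 * Q$1$1 + A$2$2 * Q$2$1 = Q$2$1 * \<zeta>" "A$2$1 * Q$1$2 + A$2$2 * Q$2$2 = Q$2$2 * cnj \<zeta>"
      using E(6) unfolding mat2_eq_iff mult2_nth by simp_all
    have "of_int a * x + of_int b * \<delta> * (2 * (p * x + q * y) - of_int t * x) = x * f z"
      if "p * x + q * y = x * z" for p q x y z unfolding that by (simp add: f_def algebra_simps)
    from this[OF e(1)] this[OF e(2)] show ?thesis
      using e(3,4)[unfolded add.commute[of "A$2$1 * _"], THEN \<open>\<And>p q x y z. p * x + q * y = x * z \<Longrightarrow> _\<close>]
      unfolding mat2_eq_iff mult2_nth by (simp add: H_def \<alpha>_def algebra_simps)
  qed
  \<comment> \<open>Since \<open>\<delta> (2 \<zeta> - t)\<close> is real, the eigenvalues of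
    \<open>H\<close> are real and inverse to each other. Modulus 1 would make them equal, but their
    difference is a nonzero multiple of \<open>b\<close>.\<close>
  moreover have "cmod \<alpha> \<noteq> 1"
  proof
    assume n: "cmod \<alpha> = 1"
    have tz: "of_int t = (2 * Re \<zeta>)" using E(4) by (simp add: complex_eq_iff)
    have Im0: "Im \<zeta> \<noteq> 0" using E(3) unit_circle_sq_ne_1[OF E(2)] by simp
    have fr: "f z = of_real (of_int a - 2 * of_int b * sqrt m * Im z)" if "Re z = Re \<zeta>" for z
      using that tz by (simp add: f_def complex_eq_iff)
    have "\<alpha> = of_real (of_int a - 2 * of_int b * sqrt m * Im \<zeta>)" unfolding \<alpha>_def by (rule fr) simp
    moreover from this n have "\<bar>of_int a - 2 * of_int b * sqrt m * Im \<zeta>\<bar> = 1" by (metis norm_of_real)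
    ultimately have "\<alpha> = 1 \<or> \<alpha> = -1" by (metis abs_eq_iff' of_real_1 of_real_minus abs_1)
    then have "f (cnj \<zeta>) = f \<zeta>" using inv(1) by (auto simp: \<alpha>_def)
    then have "(of_real (2 * of_int b * sqrt m * Im \<zeta>) :: complex) = - of_real (2 * of_int b * sqrt m * Im \<zeta>)"
      using fr[of \<zeta>] fr[of "cnj \<zeta>"] by simp
    then have "2 * of_int b * sqrt m * Im \<zeta> = 0" by auto
    then show False using ab(1) m_pos Im0 by simp
  qed
  ultimately show thesis using that[OF HR] inv by simp
qed

definition elliptic :: "complex ^ 2 ^ 2 \<Rightarrow> bool" where
  "elliptic A \<longleftrightarrow> A \<in> carrier (SL2 R) \<and> (\<exists>Q \<zeta> t. elliptic_form A Q \<zeta> t)"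

text \<open>Over \<open>R\<close>, a matrix \<open>A\<close> is determined up to conjugacy by its trace, by \<open>det P\<close>, and by \<open>P\<close> modulo
  \<open>det P\<close>, where \<open>P\<close> has the columns \<open>v\<close> and \<open>A v\<close>: if \<open>P' = P + (det P) E\<close> and \<open>det P' = det P\<close>,
  then \<open>P' P\<inverse> = 1 + E adj(P)\<close>.\<close>

theorem elliptic_finitely_many_classes:
  obtains \<kappa> :: "complex ^ 2 ^ 2 \<Rightarrow> complex \<times> complex \<times> complex \<times> complex \<times> complex \<times> complex"
  where "finite (\<kappa> ` {A. elliptic A})"
    "\<And>A A'. elliptic A \<Longrightarrow> elliptic A' \<Longrightarrow> \<kappa> A = \<kappa> A' \<Longrightarrow> \<exists>X\<in>carrier (SL2 R). X ** A = A' ** X"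
proof -
  obtain C where C: "\<And>\<alpha> \<beta> \<gamma> \<epsilon>. \<alpha> * \<epsilon> - \<beta> * \<gamma> = 1 \<Longrightarrow>
     \<exists>x\<in>R. \<exists>y\<in>R. (x, y) \<noteq> (0, 0) \<and> (cmod (\<alpha> * x + \<beta> * y))\<^sup>2 + (cmod (\<gamma> * x + \<epsilon> * y))\<^sup>2 \<le> C"
    using short_vector_exists by blast
  \<comment> \<open>The right factor is the companion matrix of the characteristic polynomial of
    \<open>A\<close>; the equation says that the second column of \<open>P\<close> is
    \<open>A\<close> applied to the first.\<close>
  define good where "good A P \<longleftrightarrow> P$1$1 \<in> R \<and> P$1$2 \<in> R \<and> P$2$1 \<in> R \<and> P$2$2 \<in> R \<and>
     A ** P = P ** mat2 0 (-1) 1 (A$1$1 + A$2$2) \<and> det P \<noteq> 0 \<and> cmod (det P) \<le> C" for A P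
  have ex: "\<exists>P. good A P" if ell: "elliptic A" for A
  proof -
    obtain Q \<zeta> t where A: "A \<in> carrier (SL2 R)" and E: "elliptic_form A Q \<zeta> t" using ell by (auto simp: elliptic_def)
    define a b c d where abcd: "a = A$1$1" "b = A$1$2" "c = A$2$1" "d = A$2$2"
    have R: "a \<in> R" "b \<in> R" "c \<in> R" "d \<in> R" and det: "a * d - b * c = 1"
      using A by (simp_all add: SL2_carrier abcd det_2)
    have Q: "det Q = 1" "cmod \<zeta> = 1" "A ** Q = Q ** mat2 \<zeta> 0 0 (cnj \<zeta>)" and c0: "c \<noteq> 0"
      and t: "a + d = of_int t" "t \<in> {-1,0,1}"
      using E by (auto simp: elliptic_form_def abcd)
    \<comment> \<open>The short vector is sought in eigencoordinates: \<open>(p, q)\<close> is the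
      image of \<open>(x, y)\<close> under the inverse of \<open>Q\<close>. There the determinant of
      \<open>P\<close> is \<open>p q (cnj \<zeta> - \<zeta>)\<close>, of modulus at most
      \<open>|p|^2 + |q|^2\<close>.\<close>
    have "Q$2$2 * Q$1$1 - (- Q$1$2) * (- Q$2$1) = 1" using Q(1) by (simp add: det_2 mult_ac)
    from C[OF this] obtain x y where xy: "x \<in> R" "y \<in> R" "(x, y) \<noteq> (0, 0)"
      "(cmod (Q$2$2 * x + - Q$1$2 * y))\<^sup>2 + (cmod (- Q$2$1 * x + Q$1$1 * y))\<^sup>2 \<le> C" by blast
    define p q where "p = Q$2$2 * x + - Q$1$2 * y" and "q = - Q$2$1 * x + Q$1$1 * y"
    define P where "P = mat2 x (a * x + b * y) y (c * x + d * y)"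
    have dQ: "Q$1$1 * Q$2$2 = 1 + Q$1$2 * Q$2$1" using Q(1) by (simp add: det_2 algebra_simps)
    have "Q$1$1 * p + Q$1$2 * q = (Q$1$1 * Q$2$2 - Q$1$2 * Q$2$1) * x" "Q$2$1 * p + Q$2$2 * q = (Q$1$1 * Q$2$2 - Q$1$2 * Q$2$1) * y"
      by (simp_all add: p_def q_def algebra_simps)
    then have xyQ: "x = Q$1$1 * p + Q$1$2 * q" "y = Q$2$1 * p + Q$2$2 * q" by (simp_all add: dQ)
    have "P = Q ** mat2 p (\<zeta> * p) q (cnj \<zeta> * q)"
    proof -
      have e: "a * Q$1$1 + b * Q$2$1 = Q$1$1 * \<zeta>" "a * Q$1$2 + b * Q$2$2 = Q$1$2 * cnj \<zeta>"
         "c * Q$1$1 + d * Q$2$1 = Q$2$1 * \<zeta>" "c * Q$1$2 + d * Q$2$2 = Q$2$2 * cnj \<zeta>"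
        using Q(3) unfolding mat2_eq_iff mult2_nth abcd[symmetric] by simp_all
      have "a * x + b * y = (a * Q$1$1 + b * Q$2$1) * p + (a * Q$1$2 + b * Q$2$2) * q"
           "c * x + d * y = (c * Q$1$1 + d * Q$2$1) * p + (c * Q$1$2 + d * Q$2$2) * q"
        by (simp_all add: xyQ algebra_simps)
      then show ?thesis unfolding e mat2_eq_iff mult2_nth by (simp add: P_def xyQ mult_ac)
    qed
    then have "det P = p * q * (cnj \<zeta> - \<zeta>)" by (simp add: det_mul Q(1)) (simp add: det_2 algebra_simps)
    then have "cmod (det P) = cmod p * cmod q * cmod (cnj \<zeta> - \<zeta>)" by (simp add: norm_mult)
    also have "\<dots> \<le> cmod p * cmod q * 2"
      using norm_triangle_ineq4[of "cnj \<zeta>" \<zeta>] Q(2) by (intro mult_left_mono) auto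
    also have "\<dots> \<le> (cmod p)\<^sup>2 + (cmod q)\<^sup>2"
      using sum_squares_bound[of "cmod p" "cmod q"] by simp
    also have "\<dots> \<le> C" using xy(4) by (simp add: p_def q_def)
    finally have "cmod (det P) \<le> C" .
    \<comment> \<open>Otherwise \<open>(x, y)\<close> would be an eigenvector with entries in
      \<open>R\<close>. Completing the square turns this into \<open>X^2 = - k y^2\<close>, and
      multiplying \<open>X\<close> by \<open>cnj y\<close> makes the right-hand side rational,
      contrary to \<open>R_no_root\<close>.\<close>
    moreover have "det P \<noteq> 0"
    proof
      assume "det P = 0"
      then have 0: "x * (c * x + d * y) - (a * x + b * y) * y = 0" by (simp add: P_def det_2)
      define X where "X = 2 * c * x + (d - a) * y"
      define k where "k = nat (4 - t\<^sup>2)"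
      have k: "k = 3 \<or> k = 4" "of_nat k = (4 - of_int t ^ 2 :: complex)" using t(2) by (auto simp: k_def)
      have "X\<^sup>2 = 4 * c * (x * (c * x + d * y) - (a * x + b * y) * y) + ((a + d)\<^sup>2 - 4 * (a * d - b * c)) * y\<^sup>2"
        by (simp add: X_def algebra_simps power2_eq_square)
      also have "\<dots> = - of_nat k * y\<^sup>2" unfolding 0 t(1) det k(2) by simp
      finally have X: "X\<^sup>2 = - of_nat k * y\<^sup>2" .
      have y0: "y \<noteq> 0"
      proof
        assume "y = 0"
        then show False using 0 c0 xy(3) by simp
      qed
      obtain n :: int where n: "(cmod y)\<^sup>2 = of_int n" using R_trace_norm[OF xy(2)] by metis
      have "(cmod y)\<^sup>2 > 0" using y0 by simp
      then have n0: "n > 0" using n by simp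
      have yy: "y * cnj y = of_int n" using n by (metis complex_norm_square of_real_of_int_eq)
      have "(X * cnj y)\<^sup>2 = - of_nat k * (y * cnj y)\<^sup>2" using X by (simp add: power_mult_distrib)
      then have "(X * cnj y)\<^sup>2 = - of_nat k * (of_int n)\<^sup>2" unfolding yy .
      moreover have "X * cnj y \<in> R" unfolding X_def using R xy R_of_int[of 2] by (auto intro!: R_mult R_add R_diff R_cnj)
      ultimately show False using R_no_root[OF _ n0 k(1)] by blast
    qed
    moreover have "A ** P = P ** mat2 0 (-1) 1 (a + d)"
    proof -
      have "a * (a * x + b * y) + b * (c * x + d * y) = (a + d) * (a * x + b * y) - (a * d - b * c) * x"
           "c * (a * x + b * y) + d * (c * x + d * y) = (a + d) * (c * x + d * y) - (a * d - b * c) * y"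
        by (simp_all add: algebra_simps)
      then show ?thesis unfolding det mat2_eq_iff mult2_nth abcd[symmetric] by (simp add: P_def algebra_simps)
    qed
    ultimately have "good A P" unfolding good_def using R xy
      by (simp add: P_def abcd[symmetric] R_sum_mult)
    then show ?thesis ..
  qed
  define P where "P A = (SOME P. good A P)" for A
  have P: "good A (P A)" if "elliptic A" for A unfolding P_def using ex[OF that] by (rule someI_ex)
  \<comment> \<open>The bound of \<open>R_cover\<close>: each residue class modulo \<open>e\<close>
    has a representative of modulus at most \<open>|e| \<rho>\<close>, so the entries of
    \<open>P\<close> modulo its determinant take finitely many values.\<close>
  define \<rho> where "\<rho> = 1 + sqrt m"
  define quo where "quo e x = (SOME q. q \<in> R \<and> cmod (x / e - q) \<le> \<rho>)" for e x
  have quo: "quo e x \<in> R" "cmod (x / e - quo e x) \<le> \<rho>" for e x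
    using someI_ex[of "\<lambda>q. q \<in> R \<and> cmod (x / e - q) \<le> \<rho>"] R_cover[of "x / e"] unfolding quo_def \<rho>_def by blast+
  define red where "red e x = x - e * quo e x" for e x
  have red: "red e x \<in> R" "cmod (red e x) \<le> C * \<rho>" if "e \<in> R" "e \<noteq> 0" "cmod e \<le> C" "x \<in> R" for e x
  proof -
    show "red e x \<in> R" unfolding red_def using that quo by (intro R_diff R_mult) auto
    have "red e x = e * (x / e - quo e x)" using that by (simp add: red_def field_simps)
    then have "cmod (red e x) = cmod e * cmod (x / e - quo e x)" by (simp only: norm_mult)
    also have "\<dots> \<le> C * \<rho>" using that quo(2) order_trans[OF norm_ge_zero that(3)] by (intro mult_mono) auto
    finally show "cmod (red e x) \<le> C * \<rho>" .
  qed
  define \<kappa> where "\<kappa> A = (A$1$1 + A$2$2, det (P A), red (det (P A)) (P A$1$1), red (det (P A)) (P A$1$2),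
      red (det (P A)) (P A$2$1), red (det (P A)) (P A$2$2))" for A
  have detR: "det (P A) \<in> R" if "elliptic A" for A
    using P[OF that] by (auto simp: good_def det_2 intro!: R_diff R_mult)
  let ?B = "{x \<in> R. cmod x \<le> C * \<rho>}"
  have "\<kappa> ` {A. elliptic A} \<subseteq> of_int ` {-1,0,1} \<times> {x \<in> R. cmod x \<le> C} \<times> ?B \<times> ?B \<times> ?B \<times> ?B"
  proof
    fix z assume "z \<in> \<kappa> ` {A. elliptic A}"
    then obtain A where A: "elliptic A" "z = \<kappa> A" by blast
    obtain Q \<zeta> t where "elliptic_form A Q \<zeta> t" using A by (auto simp: elliptic_def)
    then have "A$1$1 + A$2$2 \<in> of_int ` {-1,0,1}" by (auto simp: elliptic_form_def)
    then show "z \<in> of_int ` {-1,0,1} \<times> {x \<in> R. cmod x \<le> C} \<times> ?B \<times> ?B \<times> ?B \<times> ?B"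
      using P[OF A(1)] detR[OF A(1)] red by (simp add: A(2) \<kappa>_def good_def)
  qed
  then have "finite (\<kappa> ` {A. elliptic A})"
    by (rule finite_subset) (intro finite_cartesian_product finite_R_bounded finite_imageI, simp)
  moreover have "\<exists>X\<in>carrier (SL2 R). X ** A = A' ** X" if A: "elliptic A" "elliptic A'" "\<kappa> A = \<kappa> A'" for A A'
  proof -
    define e where "e = det (P A)"
    note G = P[OF A(1)] P[OF A(2)]
    have eq: "A'$1$1 + A'$2$2 = A$1$1 + A$2$2" "det (P A') = e"
      "red e (P A'$1$1) = red e (P A$1$1)" "red e (P A'$1$2) = red e (P A$1$2)"
      "red e (P A'$2$1) = red e (P A$2$1)" "red e (P A'$2$2) = red e (P A$2$2)"
      using A(3) by (auto simp: \<kappa>_def e_def)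
    have e0: "e \<noteq> 0" using G by (simp add: good_def e_def)
    define s where "s x x' = quo e x' - quo e x" for x x'
    have s: "x' = x + e * s x x'" if "red e x' = red e x" for x x'
      using that by (simp add: red_def s_def algebra_simps)
    have sR: "s x x' \<in> R" for x x' unfolding s_def by (intro R_diff quo)
    define E where "E = mat2 (s (P A$1$1) (P A'$1$1)) (s (P A$1$2) (P A'$1$2)) (s (P A$2$1) (P A'$2$1)) (s (P A$2$2) (P A'$2$2))"
    have PE: "P A' = P A + mat e ** E"
      by (simp add: mat2_eq_iff mult2_nth E_def flip: s[OF eq(3)] s[OF eq(4)] s[OF eq(5)] s[OF eq(6)])
    define X where "X = mat 1 + E ** adj2 (P A)"
    have comm: "E ** mat e = mat e ** E" by (simp add: mat2_eq_iff mult2_nth)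
    have XP: "X ** P A = P A'"
    proof -
      have "X ** P A = P A + E ** (adj2 (P A) ** P A)"
        by (simp add: X_def mat2_eq_iff mult2_nth algebra_simps)
      then show ?thesis unfolding PE adj2_mult e_def[symmetric] comm .
    qed
    have "det X * e = e" using arg_cong[OF XP, of det] by (simp add: det_mul eq(2) flip: e_def)
    then have "det X = 1" using e0 by simp
    then have "X \<in> carrier (SL2 R)"
      unfolding SL2_carrier using G(1) sR by (auto simp: X_def mult2_nth E_def good_def intro!: R_add R_mult R_diff R_minus)
    moreover have "X ** A = A' ** X"
    proof -
      have "X ** A ** P A = A' ** X ** P A"
        using G by (simp add: good_def matrix_mul_assoc[symmetric] XP eq(1)) (simp add: matrix_mul_assoc XP)
      then have "X ** A ** (P A ** adj2 (P A)) = A' ** X ** (P A ** adj2 (P A))" by (simp add: matrix_mul_assoc)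
      then show ?thesis unfolding adj2_mult using e0
        by (simp add: mat2_eq_iff mult2_nth flip: e_def)
    qed
    ultimately show ?thesis by blast
  qed
  ultimately show thesis using that by blast
qed

end

section \<open>Homotopy equivalences of quotient spaces\<close>

text \<open>All data are given upstairs and need to be right only up to the equivalence relations.
  The homotopy descends because the product of \<open>P\<close> with the unit interval is again a
  quotient map, by local compactness of the interval. On \<open>Y'\<close> the composite is the
  identity itself, so one homotopy suffices.\<close>

lemma homotopy_equivalent_quotients:
  assumes P: "quotient_map X X' P" and Q: "quotient_map Y Y' Q"
    and f: "continuous_map X Y f" and e: "continuous_map Y X e"
    and fP: "\<And>x x'. x \<in> topspace X \<Longrightarrow> x' \<in> topspace X \<Longrightarrow> P x = P x' \<Longrightarrow> Q (f x) = Q (f x')"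
    and eQ: "\<And>y y'. y \<in> topspace Y \<Longrightarrow> y' \<in> topspace Y \<Longrightarrow> Q y = Q y' \<Longrightarrow> P (e y) = P (e y')"
    and h: "continuous_map (prod_topology (top_of_set {0..1::real}) X) X h"
    and h0: "\<And>x. x \<in> topspace X \<Longrightarrow> P (h (0, x)) = P x"
    and h1: "\<And>x. x \<in> topspace X \<Longrightarrow> P (h (1, x)) = P (e (f x))"
    and hP: "\<And>s x x'. s \<in> {0..1} \<Longrightarrow> x \<in> topspace X \<Longrightarrow> x' \<in> topspace X \<Longrightarrow> P x = P x' \<Longrightarrow> P (h (s, x)) = P (h (s, x'))"
    and fe: "\<And>y. y \<in> topspace Y \<Longrightarrow> Q (f (e y)) = Q y"
  shows "X' homotopy_equivalent_space Y'"
proof -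
  have imP: "topspace X' = P ` topspace X" and imQ: "topspace Y' = Q ` topspace Y"
    using P Q by (simp_all add: quotient_imp_surjective_map)
  have fx: "f x \<in> topspace Y" if "x \<in> topspace X" for x using f that by (auto simp: continuous_map_def)
  have ey: "e y \<in> topspace X" if "y \<in> topspace Y" for y using e that by (auto simp: continuous_map_def)
  obtain f' where f': "continuous_map X' Y' f'" "\<And>x. x \<in> topspace X \<Longrightarrow> f' (P x) = Q (f x)"
    using quotient_map_lift_exists[OF P continuous_map_compose[OF f quotient_imp_continuous_map[OF Q]]] fP
    by (metis comp_apply)
  obtain e' where e': "continuous_map Y' X' e'" "\<And>y. y \<in> topspace Y \<Longrightarrow> e' (Q y) = P (e y)"
    using quotient_map_lift_exists[OF Q continuous_map_compose[OF e quotient_imp_continuous_map[OF P]]] eQ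
    by (metis comp_apply)
  let ?I = "top_of_set {0..1::real}"
  have PI: "quotient_map (prod_topology ?I X) (prod_topology ?I X') (\<lambda>(s, x). (s, P x))"
    by (intro quotient_map_prod_right P compact_imp_locally_compact_space)
      (auto simp: compact_space_subtopology Hausdorff_space_subtopology)
  obtain g where g: "continuous_map (prod_topology ?I X') X' g"
    "\<And>s x. s \<in> {0..1} \<Longrightarrow> x \<in> topspace X \<Longrightarrow> g (s, P x) = P (h (s, x))"
  proof -
    note cont = continuous_map_compose[OF h quotient_imp_continuous_map[OF P]]
    have cong: "(P \<circ> h) p = (P \<circ> h) q" if "p \<in> topspace (prod_topology ?I X)" "q \<in> topspace (prod_topology ?I X)"
        "(case p of (s, x) \<Rightarrow> (s, P x)) = (case q of (s, x) \<Rightarrow> (s, P x))" for p q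
    proof -
      obtain s x s' x' where pq: "p = (s, x)" "q = (s', x')" by force
      have "s' = s" "P x = P x'" "s \<in> {0..1}" "x \<in> topspace X" "x' \<in> topspace X"
        using that unfolding pq by simp_all
      then show ?thesis using hP[of s x x'] unfolding pq by simp
    qed
    show thesis
    proof (rule quotient_map_lift_exists[OF PI cont cong])
      fix g assume g: "continuous_map (prod_topology ?I X') X' g"
        "\<And>p. p \<in> topspace (prod_topology ?I X) \<Longrightarrow> g (case p of (s, x) \<Rightarrow> (s, P x)) = (P \<circ> h) p"
      show thesis
      proof (rule that[OF g(1)])
        show "g (s, P x) = P (h (s, x))" if "s \<in> {0..1}" "x \<in> topspace X" for s x
          using g(2)[of "(s, x)"] that by simp
      qed
    qed
  qed
  have "homotopic_with (\<lambda>_. True) X' X' id (e' \<circ> f')"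
    unfolding homotopic_with[of _ "\<lambda>_. True", simplified]
    by (intro exI[of _ g] conjI g(1)) (auto simp: imP g(2) h0 h1 f' e' fx)
  then have "homotopic_with (\<lambda>_. True) X' X' (e' \<circ> f') id" by (rule homotopic_with_symD)
  moreover have "homotopic_with (\<lambda>_. True) Y' Y' (f' \<circ> e') id"
    by (rule homotopic_with_equal) (auto intro: continuous_map_compose[OF e'(1) f'(1)] simp: imQ e' f' ey fe)
  ultimately show ?thesis unfolding homotopy_equivalent_space_def using f' e' by blast
qed

text \<open>An action by a group on a set, without the extensionality of \<^const>\<open>BijGroup\<close>.\<close>

definition acts_on :: "('g, 'm) monoid_scheme \<Rightarrow> ('g \<Rightarrow> 'y \<Rightarrow> 'y) \<Rightarrow> 'y set \<Rightarrow> bool" where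
  "acts_on G act E \<longleftrightarrow> group G \<and>
     (\<forall>x\<in>E. act \<one>\<^bsub>G\<^esub> x = x \<and> (\<forall>g\<in>carrier G. act g x \<in> E \<and>
        (\<forall>h\<in>carrier G. act (h \<otimes>\<^bsub>G\<^esub> g) x = act h (act g x))))"

lemma orbit_eq_iff:
  assumes "acts_on G act E" "x \<in> E" "y \<in> E"
  shows "orbit G act x = orbit G act y \<longleftrightarrow> (\<exists>g\<in>carrier G. y = act g x)"
proof -
  interpret group G using assms by (simp add: acts_on_def)
  have one: "act \<one>\<^bsub>G\<^esub> z = z" if "z \<in> E" for z using assms that by (auto simp: acts_on_def)
  have mult: "act (h \<otimes>\<^bsub>G\<^esub> g) z = act h (act g z)" if "z \<in> E" "g \<in> carrier G" "h \<in> carrier G" for g h z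
    using assms that by (auto simp: acts_on_def)
  show ?thesis
  proof
    assume "orbit G act x = orbit G act y"
    moreover have "y \<in> orbit G act y" unfolding orbit_def using one[OF assms(3)] by force
    ultimately show "\<exists>g\<in>carrier G. y = act g x" by (auto simp: orbit_def)
  next
    assume "\<exists>g\<in>carrier G. y = act g x"
    then obtain g where g: "g \<in> carrier G" "y = act g x" by blast
    show "orbit G act x = orbit G act y"
    proof (intro equalityI subsetI)
      fix z assume "z \<in> orbit G act x"
      then obtain h where h: "h \<in> carrier G" "z = act h x" by (auto simp: orbit_def)
      have "z = act (h \<otimes>\<^bsub>G\<^esub> inv\<^bsub>G\<^esub> g) y"
        using g h assms(2) mult[of x g "h \<otimes>\<^bsub>G\<^esub> inv\<^bsub>G\<^esub> g"] by (simp add: m_assoc)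
      then show "z \<in> orbit G act y" using g h by (auto simp: orbit_def)
    next
      fix z assume "z \<in> orbit G act y"
      then obtain h where h: "h \<in> carrier G" "z = act h y" by (auto simp: orbit_def)
      then have "z = act (h \<otimes>\<^bsub>G\<^esub> g) x" using g mult assms(2) by simp
      then show "z \<in> orbit G act x" using g h by (auto simp: orbit_def)
    qed
  qed
qed

lemma quotient_map_orbit_space: "quotient_map Y (orbit_space G act Y) (orbit G act)"
  unfolding orbit_space_def by (rule quotient_map_quotient_topology)

section \<open>Lines\<close>

lemma line_eq: "line x = range (\<lambda>k. k *s x)"
  by (simp add: line_def vec.span_singleton)

lemma line_eq_iff:
  assumes "x \<noteq> 0"
  shows "line x = line y \<longleftrightarrow> (\<exists>c. c \<noteq> 0 \<and> y = c *s x)"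
proof
  assume e: "line x = line y"
  have "y \<in> line y" unfolding line_eq by (rule range_eqI[of _ _ 1]) simp
  then obtain c where c: "y = c *s x" using e unfolding line_eq by blast
  have "x \<in> line x" unfolding line_eq by (rule range_eqI[of _ _ 1]) simp
  then obtain d where "x = d *s y" using e unfolding line_eq by blast
  then have "c \<noteq> 0" using c assms by auto
  then show "\<exists>c. c \<noteq> 0 \<and> y = c *s x" using c by blast
next
  assume "\<exists>c. c \<noteq> 0 \<and> y = c *s x"
  then obtain c where c: "c \<noteq> 0" "y = c *s x" by blast
  have "k *s x \<in> range (\<lambda>k. k *s y)" for k by (rule range_eqI[of _ _ "k / c"]) (simp add: c)
  moreover have "k *s y \<in> range (\<lambda>k. k *s x)" for k by (rule range_eqI[of _ _ "k * c"]) (simp add: c)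
  ultimately show "line x = line y" unfolding line_eq by blast
qed

lemma line_scale: "c \<noteq> 0 \<Longrightarrow> line (c *s x) = line x"
  using line_eq_iff[of x "c *s x"] by (cases "x = 0") auto

lemma matrix_image_line: "(\<lambda>z. M *v z) ` line x = line (M *v x)"
  by (auto simp: line_eq image_image vector_scalar_commute)

text \<open>Invariance under scaling makes \<open>V\<close> a saturated open set, and a quotient map
  restricts to a quotient map there.\<close>

lemma quotient_map_cone:
  fixes V :: "('a :: {field, topological_space} ^ 'n) set"
  assumes "openin (top_of_set (- {0})) V" and scale: "\<And>c z. c \<noteq> 0 \<Longrightarrow> z \<in> V \<Longrightarrow> c *s z \<in> V"
  shows "quotient_map (top_of_set V) (subtopology (quotient_topology (top_of_set (- {0})) line) (line ` V)) line"
proof -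
  let ?X = "top_of_set (- {0 :: 'a ^ 'n})"
  have V: "V \<subseteq> - {0}" using openin_subset[OF assms(1)] by simp
  have sat: "{x \<in> topspace ?X. line x \<in> line ` V} = V"
  proof (intro equalityI subsetI)
    fix x assume "x \<in> {x \<in> topspace ?X. line x \<in> line ` V}"
    then obtain y where y: "y \<in> V" "line x = line y" "x \<noteq> 0" by auto
    then obtain c where "c \<noteq> 0" "y = c *s x" using line_eq_iff by blast
    then have "x = inverse c *s y" "inverse c \<noteq> 0" by simp_all
    then show "x \<in> V" using scale y by blast
  qed (use V in auto)
  have "openin (quotient_topology ?X line) (line ` V)"
    unfolding openin_quotient_topology sat using assms(1) V by auto
  then have "quotient_map (subtopology ?X V) (subtopology (quotient_topology ?X line) (line ` V)) line"
    by (intro quotient_map_restriction quotient_map_quotient_topology sat) auto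
  moreover have "subtopology ?X V = top_of_set V"
    using V by (simp add: subtopology_subtopology Int_absorb1)
  ultimately show ?thesis by simp
qed

section \<open>The Hermitian model\<close>

definition cvec :: "real ^ 'n \<Rightarrow> complex ^ 'n" where "cvec y = (\<chi> i. of_real (y $ i))"

definition cnjv :: "complex ^ 'n \<Rightarrow> complex ^ 'n" where "cnjv z = (\<chi> i. cnj (z $ i))"

lemma cvec_nth [simp]: "cvec y $ i = of_real (y $ i)" by (simp add: cvec_def)
lemma cnjv_nth [simp]: "cnjv y $ i = cnj (y $ i)" by (simp add: cnjv_def)

text \<open>The complexification of \<open>hermitian_matrix\<close>: complex coordinates lift the
  Hermitian condition, and every two-by-two matrix arises.\<close>

definition cmat :: "complex ^ 4 \<Rightarrow> complex ^ 2 ^ 2" where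
  "cmat z = mat2 (z$0 + z$1) (z$2 + \<i> * z$3) (z$2 - \<i> * z$3) (z$0 - z$1)"

definition ccoords :: "complex ^ 2 ^ 2 \<Rightarrow> complex ^ 4" where
  "ccoords X = vector [(X$1$1 - X$2$2) / 2, (X$1$2 + X$2$1) / 2, (X$1$2 - X$2$1) / (2 * \<i>), (X$1$1 + X$2$2) / 2]"

lemma cmat_nth [simp]:
  "cmat z $ 1 $ 1 = z$0 + z$1" "cmat z $ 1 $ 2 = z$2 + \<i> * z$3"
  "cmat z $ 2 $ 1 = z$2 - \<i> * z$3" "cmat z $ 2 $ 2 = z$0 - z$1"
  by (simp_all add: cmat_def)

lemma ccoords_nth [simp]:
  "ccoords X $ 0 = (X$1$1 + X$2$2) / 2" "ccoords X $ 1 = (X$1$1 - X$2$2) / 2"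
  "ccoords X $ 2 = (X$1$2 + X$2$1) / 2" "ccoords X $ 3 = (X$1$2 - X$2$1) / (2 * \<i>)"
  by (simp_all add: ccoords_def)

lemma cmat_ccoords [simp]: "cmat (ccoords X) = X"
  by (simp add: mat2_eq_iff field_simps)

lemma ccoords_cmat [simp]: "ccoords (cmat z) = z"
  by (simp add: vec_eq_iff forall_4_0 field_simps)

lemma cmat_eq_iff: "cmat z = cmat w \<longleftrightarrow> z = w"
  by (metis ccoords_cmat)

lemma cmat_cvec: "cmat (cvec y) = hermitian_matrix y"
  by (simp add: mat2_eq_iff complex_eq_iff)

lemma conj_transpose_conj_transpose [simp]: "conj_transpose (conj_transpose A) = A"
  by (simp add: vec_eq_iff)

abbreviation cmatrix :: "complex ^ 2 ^ 2 \<Rightarrow> complex ^ 4 ^ 4" where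
  "cmatrix A \<equiv> map_matrix complex_of_real (lorentz_matrix A)"

lemma cmatrix_cvec: "cmatrix A *v cvec y = cvec (lorentz_matrix A *v y)"
  by (simp add: vec_eq_iff matrix_vector_mult_def map_matrix_def)

lemma cmatrix_cnjv: "cmatrix A *v cnjv z = cnjv (cmatrix A *v z)"
  by (simp add: vec_eq_iff matrix_vector_mult_def map_matrix_def)

text \<open>Both sides are complex linear in \<open>z\<close>, so the real case decides, where this
  is the construction of \<open>lorentz_matrix\<close>.\<close>

lemma cmat_cmatrix: "cmat (cmatrix A *v z) = A ** cmat z ** conj_transpose A"
proof -
  have real: "cmat (cmatrix A *v cvec y) = A ** cmat (cvec y) ** conj_transpose A" for y
  proof -
    have "conj_transpose (hermitian_matrix y) = hermitian_matrix y"
      by (simp add: mat2_eq_iff complex_eq_iff)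
    then have "conj_transpose (A ** hermitian_matrix y ** conj_transpose A) = A ** hermitian_matrix y ** conj_transpose A"
      by (simp add: conj_transpose_mult matrix_mul_assoc)
    then show ?thesis
      by (simp add: cmatrix_cvec cmat_cvec lorentz_matrix_vec hermitian_matrix_coords)
  qed
  define x y where "x = (\<chi> i. Re (z $ i))" and "y = (\<chi> i. Im (z $ i))"
  have z: "z = cvec x + \<i> *s cvec y"
    by (simp add: vec_eq_iff x_def y_def complex_eq_iff)
  have lin: "cmat (u + c *s v) = cmat u + mat c ** cmat v" for u v :: "complex^4" and c
    by (simp add: mat2_eq_iff mult2_nth algebra_simps)
  have "cmat (cmatrix A *v z) = cmat (cmatrix A *v cvec x + \<i> *s (cmatrix A *v cvec y))"
    unfolding z by (simp add: matrix_vector_right_distrib vector_scalar_commute)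
  also have "\<dots> = A ** cmat (cvec x) ** conj_transpose A + mat \<i> ** (A ** cmat (cvec y) ** conj_transpose A)"
    by (simp only: lin real)
  also have "\<dots> = A ** (cmat (cvec x) + mat \<i> ** cmat (cvec y)) ** conj_transpose A"
    by (simp add: mat2_eq_iff mult2_nth algebra_simps)
  also have "cmat (cvec x) + mat \<i> ** cmat (cvec y) = cmat z" by (simp only: lin z)
  finally show ?thesis .
qed

text \<open>The Hermitian form of signature (1,3) in matrix coordinates. It is the determinant
  polarised at \<open>X\<close> and \<open>conj_transpose X\<close>, up to a factor; its invariance
  under the group comes from this description.\<close>

definition herm_form :: "complex ^ 2 ^ 2 \<Rightarrow> real" where
  "herm_form X = Re (X$1$1 * cnj (X$2$2)) - ((cmod (X$1$2))\<^sup>2 + (cmod (X$2$1))\<^sup>2) / 2"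

definition cone_form :: "complex ^ 4 \<Rightarrow> real" where
  "cone_form z = (cmod (z $ 0))\<^sup>2 - (cmod (z $ 1))\<^sup>2 - (cmod (z $ 2))\<^sup>2 - (cmod (z $ 3))\<^sup>2"

text \<open>The complex quadratic extension of the Lorentz form, in contrast to the Hermitian
  \<open>cone_form\<close>. The two agree on real vectors, and in matrix coordinates this one is the
  determinant.\<close>

definition bil :: "complex ^ 4 \<Rightarrow> complex" where
  "bil z = (z$0)\<^sup>2 - (z$1)\<^sup>2 - (z$2)\<^sup>2 - (z$3)\<^sup>2"

lemma cone_form_cmat: "cone_form z = herm_form (cmat z)"
  unfolding cone_form_def herm_form_def cmod_power2
  by (simp add: algebra_simps power2_eq_square)

lemma bil_cmat: "bil z = det (cmat z)"
  by (simp add: bil_def det_2 algebra_simps power2_eq_square)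

lemma herm_form_det:
  "of_real (2 * herm_form X) = det (X + conj_transpose X) - det X - det (conj_transpose X)"
  unfolding herm_form_def cmod_power2 by (simp add: det_2 complex_eq_iff algebra_simps power2_eq_square)

lemma det_conj_transpose: "det (conj_transpose A) = cnj (det A)"
  by (simp add: det_2 mult.commute)

lemma herm_form_conj:
  assumes "det A = 1" shows "herm_form (A ** X ** conj_transpose A) = herm_form X"
proof -
  have d: "det (A ** Y ** conj_transpose A) = det Y" for Y
    using assms by (simp add: det_mul det_conj_transpose)
  have ct: "conj_transpose (A ** X ** conj_transpose A) = A ** conj_transpose X ** conj_transpose A"
    by (simp add: conj_transpose_mult matrix_mul_assoc)
  have "A ** X ** conj_transpose A + A ** conj_transpose X ** conj_transpose A =
      A ** (X + conj_transpose X) ** conj_transpose A"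
    by (simp add: mat2_eq_iff mult2_nth algebra_simps)
  then have "complex_of_real (2 * herm_form (A ** X ** conj_transpose A)) = of_real (2 * herm_form X)"
    unfolding herm_form_det ct by (simp add: d)
  then show ?thesis unfolding of_real_eq_iff by simp
qed

lemma cone_form_cmatrix: "det A = 1 \<Longrightarrow> cone_form (cmatrix A *v z) = cone_form z"
  by (simp add: cone_form_cmat cmat_cmatrix herm_form_conj)

lemma bil_cmatrix: "det A = 1 \<Longrightarrow> bil (cmatrix A *v z) = bil z"
  by (simp add: bil_cmat cmat_cmatrix det_mul det_conj_transpose)

lemma cone_form_scale: "cone_form (c *s z) = (cmod c)\<^sup>2 * cone_form z"
  by (simp add: cone_form_def norm_mult power_mult_distrib algebra_simps)

lemma cone_form_cvec: "cone_form (cvec y) = (y$0)\<^sup>2 - (y$1)\<^sup>2 - (y$2)\<^sup>2 - (y$3)\<^sup>2"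
  by (simp add: cone_form_def)

definition ccone :: "(complex ^ 4) set" where "ccone = {z. cone_form z > 0}"
definition rcone :: "(real ^ 4) set" where "rcone = {y. cvec y \<in> ccone}"

lemma ccone_nonzero: "z \<in> ccone \<Longrightarrow> z $ 0 \<noteq> 0" "z \<in> ccone \<Longrightarrow> z \<noteq> 0"
proof -
  show "z \<in> ccone \<Longrightarrow> z $ 0 \<noteq> 0"
    by (auto simp: ccone_def cone_form_def not_less) (smt (verit) zero_le_power2)
  then show "z \<in> ccone \<Longrightarrow> z \<noteq> 0" by auto
qed

lemma rcone_nonzero: "y \<in> rcone \<Longrightarrow> y \<noteq> 0"
  using ccone_nonzero(1)[of "cvec y"] by (auto simp: rcone_def)

lemma ccone_scale: "c \<noteq> 0 \<Longrightarrow> z \<in> ccone \<Longrightarrow> c *s z \<in> ccone"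
  by (simp add: ccone_def cone_form_scale)

lemma cvec_scale: "cvec (c *s y) = of_real c *s cvec y"
  by (simp add: vec_eq_iff)

lemma rcone_scale: "c \<noteq> 0 \<Longrightarrow> y \<in> rcone \<Longrightarrow> c *s y \<in> rcone"
  by (simp add: rcone_def ccone_scale cvec_scale)

lemma ccone_cmatrix: "det A = 1 \<Longrightarrow> cmatrix A *v z \<in> ccone \<longleftrightarrow> z \<in> ccone"
  by (simp add: ccone_def cone_form_cmatrix)

lemma rcone_lorentz: "det A = 1 \<Longrightarrow> lorentz_matrix A *v y \<in> rcone \<longleftrightarrow> y \<in> rcone"
  by (simp add: rcone_def ccone_cmatrix flip: cmatrix_cvec)

lemma open_ccone: "open ccone"
  unfolding ccone_def cone_form_def
  by (intro open_Collect_less continuous_intros)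

lemma continuous_cvec: "continuous_on S cvec"
  unfolding cvec_def by (intro continuous_intros)

lemma open_rcone: "open rcone"
proof -
  have "rcone = cvec -` ccone" by (auto simp: rcone_def)
  then show ?thesis using continuous_cvec[of UNIV] open_ccone continuous_open_vimage
    by (metis continuous_on_open_vimage open_UNIV Int_UNIV_right)
qed

lemma complex_hyperbolic_eq:
  "complex_hyperbolic_3_space = subtopology complex_projective_space (line ` ccone)"
  unfolding complex_hyperbolic_3_space_def by (rule arg_cong2[of _ _ _ _ subtopology]) (auto simp: ccone_def cone_form_def)

lemma real_hyperbolic_eq:
  "real_hyperbolic_3_space = subtopology real_projective_space (line ` rcone)"
  unfolding real_hyperbolic_3_space_def
  by (rule arg_cong2[of _ _ _ _ subtopology]) (auto simp: rcone_def ccone_def cone_form_cvec)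

lemma quotient_map_ccone: "quotient_map (top_of_set ccone) complex_hyperbolic_3_space line"
  unfolding complex_hyperbolic_eq complex_projective_space_def
  by (rule quotient_map_cone) (use open_ccone ccone_nonzero(2) ccone_scale in \<open>auto simp: openin_open intro!: exI[of _ ccone]\<close>)

lemma quotient_map_rcone: "quotient_map (top_of_set rcone) real_hyperbolic_3_space line"
  unfolding real_hyperbolic_eq real_projective_space_def
  by (rule quotient_map_cone) (use open_rcone rcone_nonzero rcone_scale in \<open>auto simp: openin_open intro!: exI[of _ rcone]\<close>)

lemma topspace_complex_hyperbolic: "topspace complex_hyperbolic_3_space = line ` ccone"
  using quotient_imp_surjective_map[OF quotient_map_ccone] by simp

section \<open>Retracting complex onto real hyperbolic space\<close>

text \<open>For \<open>z\<close> in the cone the phase \<open>u\<close> with \<open>u\<^sup>2 b(z,z) > 0\<close> is unique up to sign, and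
  \<open>u z = x + i y\<close> with \<open>b(x,y) = 0\<close>. Shrinking \<open>y\<close> to \<open>0\<close> retracts onto the real points. In homogeneous
  coordinates this is \<open>z \<mapsto> z + s \<beta> z\<^sup>*\<close> with \<open>\<beta> = b(z,z)/\<bar>b(z,z)\<bar>\<close>, which avoids the choice of \<open>u\<close>.\<close>

definition phase :: "complex ^ 4 \<Rightarrow> complex" where "phase z = bil z / of_real (cmod (bil z))"

definition shrink :: "real \<Rightarrow> complex ^ 4 \<Rightarrow> complex ^ 4" where
  "shrink s z = z + (of_real s * phase z) *s cnjv z"

definition real_part :: "complex ^ 4 \<Rightarrow> real ^ 4" where
  "real_part z = (\<chi> i. Re (cnj (shrink 1 z $ 0) * shrink 1 z $ i))"

text \<open>By the triangle inequality, \<open>bil z = 0\<close> would bound the square of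
  coordinate 0 by the sum of the other squares. Hence the phase makes sense and is continuous on the
  cone.\<close>

lemma bil_nonzero: "z \<in> ccone \<Longrightarrow> bil z \<noteq> 0"
proof
  assume "z \<in> ccone" "bil z = 0"
  then have "(z$0)\<^sup>2 = (z$1)\<^sup>2 + (z$2)\<^sup>2 + (z$3)\<^sup>2" by (simp add: bil_def algebra_simps)
  then have "(cmod (z$0))\<^sup>2 = cmod ((z$1)\<^sup>2 + (z$2)\<^sup>2 + (z$3)\<^sup>2)" by (metis norm_power)
  also have "\<dots> \<le> (cmod (z$1))\<^sup>2 + (cmod (z$2))\<^sup>2 + (cmod (z$3))\<^sup>2"
    using norm_triangle_ineq[of "(z$1)\<^sup>2 + (z$2)\<^sup>2" "(z$3)\<^sup>2"] norm_triangle_ineq[of "(z$1)\<^sup>2" "(z$2)\<^sup>2"]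
    by (simp add: norm_power)
  finally show False using \<open>z \<in> ccone\<close> by (simp add: ccone_def cone_form_def)
qed

lemma phase_norm: "z \<in> ccone \<Longrightarrow> cmod (phase z) = 1"
  using bil_nonzero by (simp add: phase_def norm_divide)

text \<open>The cross term is \<open>2 s Re (cnj (phase z) bil z)\<close>, and the phase is chosen
  to make it \<open>2 s |bil z|\<close>. This is why shrinking with \<open>s \<ge> 0\<close> never
  leaves the cone.\<close>

lemma cone_form_shrink:
  assumes "z \<in> ccone" shows "cone_form (shrink s z) = (1 + s\<^sup>2) * cone_form z + 2 * s * cmod (bil z)"
proof -
  have *: "(cmod (a + c * cnj a))\<^sup>2 = (1 + (cmod c)\<^sup>2) * (cmod a)\<^sup>2 + 2 * Re (cnj c * a\<^sup>2)" for a c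
    unfolding cmod_power2 by (simp add: algebra_simps power2_eq_square)
  define c where "c = of_real s * phase z"
  have "cone_form (shrink s z) = (1 + (cmod c)\<^sup>2) * cone_form z + 2 * Re (cnj c * bil z)"
  proof -
    have nth: "shrink s z $ i = z $ i + c * cnj (z $ i)" for i by (simp add: shrink_def c_def)
    show ?thesis unfolding cone_form_def nth * bil_def by (simp add: algebra_simps)
  qed
  moreover have "(cmod c)\<^sup>2 = s\<^sup>2" using phase_norm[OF assms] by (simp add: c_def norm_mult power_mult_distrib)
  moreover have "cnj c * bil z = of_real (s * cmod (bil z))"
  proof -
    have "cnj (bil z) * bil z = of_real (cmod (bil z)) * of_real (cmod (bil z))"
      by (metis complex_norm_square mult.commute of_real_mult power2_eq_square)
    then show ?thesis using bil_nonzero[OF assms] by (simp add: c_def phase_def field_simps)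
  qed
  ultimately show ?thesis by simp
qed

lemma shrink_ccone: "z \<in> ccone \<Longrightarrow> s \<ge> 0 \<Longrightarrow> shrink s z \<in> ccone"
  using cone_form_shrink[of z s] by (simp add: ccone_def add_pos_nonneg)

text \<open>Scaling \<open>z\<close> by \<open>c\<close> multiplies the phase by
  \<open>c / cnj c\<close>, which compensates the conjugation in \<open>cnjv\<close>. So the
  construction is homogeneous and descends to lines.\<close>

lemma shrink_scale: "c \<noteq> 0 \<Longrightarrow> z \<in> ccone \<Longrightarrow> shrink s (c *s z) = c *s shrink s z"
proof -
  assume c: "c \<noteq> 0" and z: "z \<in> ccone"
  have b: "bil (c *s z) = c\<^sup>2 * bil z" by (simp add: bil_def power_mult_distrib algebra_simps)
  have "phase (c *s z) * cnj c = c * phase z"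
  proof -
    have "c * cnj c = of_real (cmod c) * of_real (cmod c)" by (metis complex_norm_square of_real_mult power2_eq_square)
    then have "c * c * cnj c = c * (of_real (cmod c) * of_real (cmod c))" by (simp only: mult.assoc)
    then show ?thesis using c bil_nonzero[OF z]
      by (simp add: phase_def b norm_mult norm_power power2_eq_square field_simps)
  qed
  then have "phase (c *s z) * (cnj c * x) = c * (phase z * x)" for x by (metis mult.assoc)
  then show "shrink s (c *s z) = c *s shrink s z"
    by (simp add: shrink_def vec_eq_iff algebra_simps)
qed

lemma shrink_cmatrix: "det A = 1 \<Longrightarrow> shrink s (cmatrix A *v z) = cmatrix A *v shrink s z"
  by (simp add: shrink_def phase_def bil_cmatrix matrix_vector_right_distrib vector_scalar_commute cmatrix_cnjv)

text \<open>Conjugation multiplies \<open>shrink 1 z\<close> by the constant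
  \<open>cnj (phase z)\<close>, so the ratios of its coordinates are real, and multiplying by the
  conjugate of coordinate 0 yields a real vector. That coordinate is nonzero on the cone.\<close>

lemma cvec_real_part: "z \<in> ccone \<Longrightarrow> cvec (real_part z) = cnj (shrink 1 z $ 0) *s shrink 1 z"
proof -
  assume z: "z \<in> ccone"
  define \<beta> where "\<beta> = phase z"
  have b: "\<beta> * cnj \<beta> = 1" using phase_norm[OF z] unit_circle_cnj by (simp add: \<beta>_def)
  have w: "shrink 1 z $ i = z $ i + \<beta> * cnj (z $ i)" for i by (simp add: shrink_def \<beta>_def)
  have cw: "cnj (shrink 1 z $ i) = cnj \<beta> * shrink 1 z $ i" for i
  proof -
    have "cnj \<beta> * shrink 1 z $ i = cnj \<beta> * z $ i + (\<beta> * cnj \<beta>) * cnj (z $ i)" unfolding w by (simp add: algebra_simps)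
    then show ?thesis unfolding b w by simp
  qed
  have "cnj (cnj (shrink 1 z $ 0) * shrink 1 z $ i) = cnj (shrink 1 z $ 0) * shrink 1 z $ i" for i
  proof -
    have "cnj (cnj (shrink 1 z $ 0) * shrink 1 z $ i) = shrink 1 z $ 0 * cnj (shrink 1 z $ i)"
      by (simp only: complex_cnj_mult complex_cnj_cnj)
    also have "\<dots> = cnj (shrink 1 z $ 0) * shrink 1 z $ i" by (simp only: cw mult_ac)
    finally show ?thesis .
  qed
  then have "Im (cnj (shrink 1 z $ 0) * shrink 1 z $ i) = 0" for i
    by (metis Reals_cnj_iff complex_is_Real_iff)
  then show ?thesis by (simp add: vec_eq_iff real_part_def complex_eq_iff)
qed

lemma real_part_rcone: "z \<in> ccone \<Longrightarrow> real_part z \<in> rcone"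
  unfolding rcone_def using cvec_real_part ccone_nonzero(1)[OF shrink_ccone[of z 1]]
  by (auto intro!: ccone_scale shrink_ccone)

lemma real_part_scale: 
  assumes "c \<noteq> 0" "z \<in> ccone" shows "real_part (c *s z) = (cmod c)\<^sup>2 *s real_part z"
proof -
  have "cvec (real_part (c *s z)) = (cnj c * c) *s cvec (real_part z)"
    using assms by (simp add: cvec_real_part ccone_scale shrink_scale vec_eq_iff mult_ac)
  also have "cnj c * c = of_real ((cmod c)\<^sup>2)" by (metis complex_norm_square mult.commute)
  finally have e: "cvec (real_part (c *s z)) = of_real ((cmod c)\<^sup>2) *s cvec (real_part z)" .
  have "of_real (real_part (c *s z) $ i) = complex_of_real ((cmod c)\<^sup>2 * real_part z $ i)" for i
    using arg_cong[OF e, of "\<lambda>v. v $ i"] by simp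
  then show ?thesis unfolding of_real_eq_iff by (simp add: vec_eq_iff)
qed

lemma line_cvec_cong:
  assumes "x \<noteq> 0" "y \<noteq> 0" "line (cvec x) = line (cvec y)" shows "line x = line y"
proof -
  have "cvec x \<noteq> 0" using assms(1) by (auto simp: vec_eq_iff)
  then obtain c where c: "cvec y = c *s cvec x" using assms(3) line_eq_iff by blast
  have "y $ i = Re c * x $ i" for i using arg_cong[OF c, of "\<lambda>v. Re (v $ i)"] by simp
  then have y: "y = Re c *s x" by (simp add: vec_eq_iff)
  then have "Re c \<noteq> 0" using assms(2) by auto
  then show ?thesis using y line_scale by metis
qed

lemma line_real_part_cvec:
  assumes "y \<in> rcone" shows "line (real_part (cvec y)) = line y"
proof (rule line_cvec_cong)
  have c: "cvec y \<in> ccone" using assms by (simp add: rcone_def)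
  have b: "bil (cvec y) = of_real (cone_form (cvec y))" by (simp add: bil_def cone_form_cvec)
  have "cone_form (cvec y) > 0" using c by (simp add: ccone_def)
  then have "phase (cvec y) = 1" unfolding phase_def b by simp
  then have "shrink 1 (cvec y) = 2 *s cvec y" by (simp add: shrink_def vec_eq_iff)
  then have "cvec (real_part (cvec y)) = cnj (shrink 1 (cvec y) $ 0) *s (2 *s cvec y)"
    using cvec_real_part[OF c] by metis
  then have "line (cvec (real_part (cvec y))) = line ((cnj (shrink 1 (cvec y) $ 0) * 2) *s cvec y)"
    by (simp only: vector_smult_assoc)
  also have "\<dots> = line (cvec y)"
    using ccone_nonzero(1)[OF shrink_ccone[OF c, of 1]] by (intro line_scale) auto
  finally show "line (cvec (real_part (cvec y))) = line (cvec y)" .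
qed (use assms real_part_rcone rcone_nonzero in \<open>auto simp: rcone_def\<close>)

lemma line_real_part_cmatrix:
  assumes "z \<in> ccone" "det A = 1"
  shows "line (real_part (cmatrix A *v z)) = line (lorentz_matrix A *v real_part z)"
proof (rule line_cvec_cong)
  have z': "cmatrix A *v z \<in> ccone" using assms by (simp add: ccone_cmatrix)
  note n = ccone_nonzero(1)[OF shrink_ccone[OF assms(1), of 1]] ccone_nonzero(1)[OF shrink_ccone[OF z', of 1]]
  have "line (cvec (real_part (cmatrix A *v z))) = line (cmatrix A *v shrink 1 z)"
    using n by (simp add: cvec_real_part z' line_scale) (simp add: shrink_cmatrix assms(2))
  moreover have "line (cvec (lorentz_matrix A *v real_part z)) = line (cmatrix A *v shrink 1 z)"
    using n by (simp add: cvec_real_part assms(1) line_scale vector_scalar_commute flip: cmatrix_cvec)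
  ultimately show "line (cvec (real_part (cmatrix A *v z))) = line (cvec (lorentz_matrix A *v real_part z))" by simp
  show "real_part (cmatrix A *v z) \<noteq> 0" using rcone_nonzero[OF real_part_rcone[OF z']] .
  show "lorentz_matrix A *v real_part z \<noteq> 0"
    using rcone_nonzero rcone_lorentz[OF assms(2)] real_part_rcone[OF assms(1)] by blast
qed

lemma continuous_bil: "continuous_on S bil"
  unfolding bil_def by (intro continuous_intros)

lemma continuous_phase: "continuous_on ccone phase"
  unfolding phase_def by (intro continuous_intros continuous_bil) (use bil_nonzero in auto)

lemma continuous_shrink: "continuous_on ({0..1} \<times> ccone) (\<lambda>(s, z). shrink s z)"
proof -
  have "continuous_on ({0..1} \<times> ccone) (\<lambda>p. phase (snd p))"
    by (rule continuous_on_compose2[OF continuous_phase]) (auto intro: continuous_intros)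
  then show ?thesis unfolding shrink_def cnjv_def case_prod_beta vector_scalar_mult_def by (intro continuous_intros) auto
qed

lemma continuous_real_part: "continuous_on ccone real_part"
proof -
  have "continuous_on ccone (\<lambda>z. (\<lambda>(s, z). shrink s z) (1, z))"
    by (rule continuous_on_compose2[OF continuous_shrink]) (auto intro: continuous_intros)
  then have "continuous_on ccone (\<lambda>z. shrink 1 z)" by simp
  then show ?thesis unfolding real_part_def by (intro continuous_intros)
qed

section \<open>The group \<open>PSL\<^sub>2\<close> and its actions\<close>

definition pm :: "complex ^ 2 ^ 2 \<Rightarrow> (complex ^ 2 ^ 2) set" where "pm A = {A, - A}"

lemma pm_eq_iff: "pm A = pm B \<longleftrightarrow> B = A \<or> B = - A"
  by (auto simp: pm_def doubleton_eq_iff)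

lemma complex_action_line: "complex_action (pm A) (line z) = line (cmatrix A *v z)"
  by (simp add: complex_action_def pm_def PSL2_to_PSO_eq matrix_image_line)

lemma real_action_line: "real_action (pm A) (line y) = line (lorentz_matrix A *v y)"
  by (simp add: real_action_def pm_def PSL2_to_PSO_eq matrix_image_line)

lemma lorentz_matrix_one: "lorentz_matrix (mat 1) = mat 1"
proof -
  have ct: "conj_transpose (mat 1) = mat 1" by (simp add: mat2_eq_iff)
  have "lorentz_matrix (mat 1) *v y = mat 1 *v y" for y
    by (simp add: lorentz_matrix_vec ct hermitian_coords_matrix)
  then show ?thesis by (simp add: matrix_eq)
qed

lemma cmatrix_mult: "cmatrix (A ** B) *v z = cmatrix A *v (cmatrix B *v z)"
  by (simp add: cmat_cmatrix conj_transpose_mult matrix_mul_assoc flip: cmat_eq_iff)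

lemma cmatrix_one: "cmatrix (mat 1) *v z = z"
proof -
  have ct: "conj_transpose (mat 1) = mat 1" by (simp add: mat2_eq_iff)
  show ?thesis by (simp add: cmat_cmatrix ct flip: cmat_eq_iff)
qed

section \<open>SL2 over the ring of integers modulo plus or minus the identity\<close>

context imaginary_quadratic
begin

lemma SL2_simps: "mult (SL2 R) = (**)" "one (SL2 R) = mat 1"
  by (simp_all add: SL2_def)

lemma mat1_SL2: "mat 1 \<in> carrier (SL2 R)" by (simp add: SL2_carrier det_I)

lemma uminus_SL2: "A \<in> carrier (SL2 R) \<Longrightarrow> - A \<in> carrier (SL2 R)"
  by (simp add: SL2_carrier R_minus det_2)

lemma group_SL2: "group (SL2 R)"
proof (rule groupI)
  show "\<exists>y\<in>carrier (SL2 R). y \<otimes>\<^bsub>SL2 R\<^esub> x = \<one>\<^bsub>SL2 R\<^esub>" if "x \<in> carrier (SL2 R)" for x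
    using that by (intro bexI[of _ "adj2 x"]) (auto simp: SL2_simps adj2_mult SL2_adj2_closed, simp add: SL2_carrier)
qed (auto simp: SL2_simps SL2_mult_closed mat1_SL2 matrix_mul_assoc)

lemma uminus_mult2: "(- A) ** B = - (A ** B)" "A ** (- B) = - (A ** B)" for A B :: "complex ^ 2 ^ 2"
  by (simp_all add: mat2_eq_iff mult2_nth)

lemma normal_center: "{mat 1, - mat 1} \<lhd> SL2 R"
proof -
  interpret group "SL2 R" by (rule group_SL2)
  have "subgroup {mat 1, - mat 1} (SL2 R)"
  proof (rule subgroupI)
    show "inv\<^bsub>SL2 R\<^esub> a \<in> {mat 1, - mat 1}" if "a \<in> {mat 1, - mat 1}" for a
    proof -
      have "inv\<^bsub>SL2 R\<^esub> a = a"
        using that mat1_SL2 uminus_SL2[OF mat1_SL2]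
        by (intro inv_equality) (auto simp: SL2_simps uminus_mult2)
      then show ?thesis using that by simp
    qed
  qed (auto simp: mat1_SL2 uminus_SL2 SL2_simps uminus_mult2)
  then show ?thesis
    by (rule normalI) (auto simp: r_coset_def l_coset_def SL2_simps uminus_mult2)
qed

lemma group_PSL2: "group (PSL2 R)"
  unfolding PSL2_def by (rule normal.factorgroup_is_group[OF normal_center])

lemma coset_pm: "{mat 1, - mat 1} #>\<^bsub>SL2 R\<^esub> A = pm A"
  by (auto simp: r_coset_def SL2_simps pm_def uminus_mult2)

lemma PSL2_carrier: "g \<in> carrier (PSL2 R) \<longleftrightarrow> (\<exists>A\<in>carrier (SL2 R). g = pm A)"
  by (auto simp: PSL2_def FactGroup_def RCOSETS_def coset_pm)

lemma PSL2_one: "\<one>\<^bsub>PSL2 R\<^esub> = pm (mat 1)"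
  by (simp add: PSL2_def FactGroup_def pm_def)

lemma PSL2_mult: "A \<in> carrier (SL2 R) \<Longrightarrow> B \<in> carrier (SL2 R) \<Longrightarrow> pm A \<otimes>\<^bsub>PSL2 R\<^esub> pm B = pm (A ** B)"
  using normal.rcos_sum[OF normal_center, of A B] by (simp add: PSL2_def FactGroup_def coset_pm SL2_simps)

lemma PSL2_inv: "A \<in> carrier (SL2 R) \<Longrightarrow> inv\<^bsub>PSL2 R\<^esub> (pm A) = pm (adj2 A)"
proof -
  assume A: "A \<in> carrier (SL2 R)"
  then have "det A = 1" by (simp add: SL2_carrier)
  then show ?thesis using A SL2_adj2_closed[OF A]
    by (intro group.inv_equality[OF group_PSL2]) (auto simp: PSL2_mult PSL2_one adj2_mult PSL2_carrier)
qed

text \<open>A power is described through iterates of \<open>A\<close> on vectors, the form in which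
  \<open>elliptic_form_exists\<close> takes finite order.\<close>

lemma PSL2_pow:
  assumes "A \<in> carrier (SL2 R)"
  obtains B where "B \<in> carrier (SL2 R)" "pm A [^]\<^bsub>PSL2 R\<^esub> (k::nat) = pm B" "\<And>x. B *v x = ((\<lambda>x. A *v x) ^^ k) x"
proof -
  have "\<exists>B\<in>carrier (SL2 R). pm A [^]\<^bsub>PSL2 R\<^esub> k = pm B \<and> (\<forall>x. B *v x = ((\<lambda>x. A *v x) ^^ k) x)"
  proof (induction k)
    case 0
    interpret group "PSL2 R" by (rule group_PSL2)
    show ?case using mat1_SL2 by (intro bexI[of _ "mat 1"]) (auto simp: PSL2_one)
  next
    case (Suc k)
    then obtain B where B: "B \<in> carrier (SL2 R)" "pm A [^]\<^bsub>PSL2 R\<^esub> k = pm B" "\<And>x. B *v x = ((\<lambda>x. A *v x) ^^ k) x"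
      by blast
    interpret group "PSL2 R" by (rule group_PSL2)
    show ?case using B assms SL2_mult_closed
      by (intro bexI[of _ "B ** A"]) (auto simp: PSL2_mult funpow_swap1 simp flip: matrix_vector_mul_assoc)
  qed
  then show thesis using that by blast
qed

section \<open>Actions on both hyperbolic spaces and their orbit spaces\<close>

lemma acts_on_complex:
  assumes "subgroup H (PSL2 R)"
  shows "acts_on (PSL2 R\<lparr>carrier := H\<rparr>) complex_action (line ` ccone)"
  unfolding acts_on_def
proof (intro conjI ballI)
  interpret group "PSL2 R" by (rule group_PSL2)
  show "group (PSL2 R\<lparr>carrier := H\<rparr>)" by (rule subgroup.subgroup_is_group[OF assms group_PSL2])
  have H: "\<exists>A\<in>carrier (SL2 R). g = pm A" if "g \<in> H" for g
    using subgroup.mem_carrier[OF assms that] PSL2_carrier by simp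
  fix l assume "l \<in> line ` ccone"
  then obtain z where z: "z \<in> ccone" "l = line z" by blast
  show "complex_action \<one>\<^bsub>PSL2 R\<lparr>carrier := H\<rparr>\<^esub> l = l"
    by (simp add: PSL2_one z complex_action_line cmatrix_one)
  fix g assume "g \<in> carrier (PSL2 R\<lparr>carrier := H\<rparr>)"
  then obtain A where A: "A \<in> carrier (SL2 R)" "g = pm A" using H by auto
  then show "complex_action g l \<in> line ` ccone"
    using z by (auto simp: complex_action_line SL2_carrier ccone_cmatrix)
  fix h assume "h \<in> carrier (PSL2 R\<lparr>carrier := H\<rparr>)"
  then obtain B where "B \<in> carrier (SL2 R)" "h = pm B" using H by auto
  then show "complex_action (h \<otimes>\<^bsub>PSL2 R\<lparr>carrier := H\<rparr>\<^esub> g) l = complex_action h (complex_action g l)"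
    using A z by (simp add: PSL2_mult complex_action_line cmatrix_mult)
qed

lemma acts_on_real:
  assumes "subgroup H (PSL2 R)"
  shows "acts_on (PSL2 R\<lparr>carrier := H\<rparr>) real_action (line ` rcone)"
  unfolding acts_on_def
proof (intro conjI ballI)
  interpret group "PSL2 R" by (rule group_PSL2)
  show "group (PSL2 R\<lparr>carrier := H\<rparr>)" by (rule subgroup.subgroup_is_group[OF assms group_PSL2])
  have H: "\<exists>A\<in>carrier (SL2 R). g = pm A" if "g \<in> H" for g
    using subgroup.mem_carrier[OF assms that] PSL2_carrier by simp
  fix l assume "l \<in> line ` rcone"
  then obtain y where y: "y \<in> rcone" "l = line y" by blast
  show "real_action \<one>\<^bsub>PSL2 R\<lparr>carrier := H\<rparr>\<^esub> l = l"
    by (simp add: PSL2_one y real_action_line lorentz_matrix_one)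
  fix g assume "g \<in> carrier (PSL2 R\<lparr>carrier := H\<rparr>)"
  then obtain A where A: "A \<in> carrier (SL2 R)" "g = pm A" using H by auto
  then show "real_action g l \<in> line ` rcone"
    using y by (auto simp: real_action_line SL2_carrier rcone_lorentz)
  fix h assume "h \<in> carrier (PSL2 R\<lparr>carrier := H\<rparr>)"
  then obtain B where "B \<in> carrier (SL2 R)" "h = pm B" using H by auto
  then show "real_action (h \<otimes>\<^bsub>PSL2 R\<lparr>carrier := H\<rparr>\<^esub> g) l = real_action h (real_action g l)"
    using A y by (simp add: PSL2_mult real_action_line lorentz_matrix_mult flip: matrix_vector_mul_assoc)
qed

text \<open>Both orbit spaces are taken as quotients of cones, so two points agree downstairs
  exactly if they differ by a group element and a nonzero scalar. Equivariance and homogeneity of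
  \<open>shrink\<close> and \<open>real_part\<close> then give every compatibility
  condition.\<close>

theorem orbit_spaces_homotopy_equivalent:
  assumes H: "subgroup H (PSL2 R)"
  defines "G \<equiv> PSL2 R\<lparr>carrier := H\<rparr>"
  shows "orbit_space G complex_action complex_hyperbolic_3_space homotopy_equivalent_space
    orbit_space G real_action real_hyperbolic_3_space"
proof (rule homotopy_equivalent_quotients)
  let ?P = "orbit G complex_action \<circ> line" and ?Q = "orbit G real_action \<circ> line"
  show "quotient_map (top_of_set ccone) (orbit_space G complex_action complex_hyperbolic_3_space) ?P"
    by (rule quotient_map_compose[OF quotient_map_ccone quotient_map_orbit_space])
  show "quotient_map (top_of_set rcone) (orbit_space G real_action real_hyperbolic_3_space) ?Q"
    by (rule quotient_map_compose[OF quotient_map_rcone quotient_map_orbit_space])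
  have HA: "\<exists>A. det A = 1 \<and> g = pm A" if "g \<in> carrier G" for g
    using subgroup.mem_carrier[OF H, of g] that PSL2_carrier by (auto simp: G_def SL2_carrier)
  have P: "?P z = ?P z' \<longleftrightarrow> (\<exists>g\<in>carrier G. line z' = complex_action g (line z))" if "z \<in> ccone" "z' \<in> ccone" for z z'
    using orbit_eq_iff[OF acts_on_complex[OF H]] that by (simp add: G_def)
  have Q: "?Q z = ?Q z' \<longleftrightarrow> (\<exists>g\<in>carrier G. line z' = real_action g (line z))" if "z \<in> rcone" "z' \<in> rcone" for z z'
    using orbit_eq_iff[OF acts_on_real[OF H]] that by (simp add: G_def)
  have PE: "\<exists>g A c. g \<in> carrier G \<and> g = pm A \<and> det A = 1 \<and> c \<noteq> 0 \<and> z' = c *s (cmatrix A *v z)"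
    if zz: "z \<in> ccone" "z' \<in> ccone" "?P z = ?P z'" for z z'
  proof -
    obtain g where g: "g \<in> carrier G" "line z' = complex_action g (line z)" using P zz by blast
    obtain A where A: "det A = 1" "g = pm A" using HA g by blast
    have "line (cmatrix A *v z) = line z'" using g A by (simp add: complex_action_line)
    moreover have "cmatrix A *v z \<noteq> 0" using ccone_nonzero(2) ccone_cmatrix[OF A(1)] zz by blast
    ultimately obtain c where "c \<noteq> 0" "z' = c *s (cmatrix A *v z)" using line_eq_iff by blast
    then show ?thesis using g A by blast
  qed
  show "continuous_map (top_of_set ccone) (top_of_set rcone) real_part"
    using continuous_real_part real_part_rcone by (auto simp: image_subset_iff_funcset[symmetric])
  show "continuous_map (top_of_set rcone) (top_of_set ccone) cvec"
    using continuous_cvec by (auto simp: rcone_def)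
  show "?Q (real_part z) = ?Q (real_part z')"
    if zz: "z \<in> topspace (top_of_set ccone)" "z' \<in> topspace (top_of_set ccone)" "?P z = ?P z'" for z z'
  proof -
    have z: "z \<in> ccone" "z' \<in> ccone" using zz by auto
    obtain g A c where g: "g \<in> carrier G" "g = pm A" "det A = 1" "c \<noteq> 0" "z' = c *s (cmatrix A *v z)"
      using PE[OF z zz(3)] by blast
    have "line (real_part z') = line (real_part (cmatrix A *v z))"
      using g z by (simp add: real_part_scale ccone_cmatrix line_scale)
    also have "\<dots> = real_action g (line (real_part z))"
      using g z by (simp add: line_real_part_cmatrix real_action_line)
    finally show ?thesis using Q real_part_rcone z g(1) by blast
  qed
  show "?P (cvec y) = ?P (cvec y')"
    if yy: "y \<in> topspace (top_of_set rcone)" "y' \<in> topspace (top_of_set rcone)" "?Q y = ?Q y'" for y y'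
  proof -
    have y: "y \<in> rcone" "y' \<in> rcone" using yy by auto
    obtain g where g: "g \<in> carrier G" "line y' = real_action g (line y)" using Q y yy(3) by blast
    obtain A where A: "det A = 1" "g = pm A" using HA g by blast
    have "line (lorentz_matrix A *v y) = line y'" using g A by (simp add: real_action_line)
    moreover have "lorentz_matrix A *v y \<noteq> 0" using rcone_nonzero rcone_lorentz[OF A(1)] y by blast
    ultimately obtain c where "c \<noteq> 0" "y' = c *s (lorentz_matrix A *v y)" using line_eq_iff by blast
    then have "line (cvec y') = complex_action g (line (cvec y))"
      by (simp add: A complex_action_line cvec_scale cmatrix_cvec line_scale)
    moreover have "cvec y \<in> ccone" "cvec y' \<in> ccone" using y by (auto simp: rcone_def)
    ultimately show ?thesis using P g(1) by blast
  qed
  show "continuous_map (prod_topology (top_of_set {0..1}) (top_of_set ccone)) (top_of_set ccone) (\<lambda>(s, z). shrink s z)"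
    using continuous_shrink shrink_ccone by (auto simp: prod_topology_subtopology_eu)
  show "?P ((\<lambda>(s, z). shrink s z) (0, z)) = ?P z" for z
    by (simp add: shrink_def)
  show "?P ((\<lambda>(s, z). shrink s z) (1, z)) = ?P (cvec (real_part z))" if "z \<in> topspace (top_of_set ccone)" for z
    using that ccone_nonzero(1)[OF shrink_ccone[of z 1]] by (simp add: cvec_real_part line_scale)
  show "?P ((\<lambda>(s, z). shrink s z) (s, z)) = ?P ((\<lambda>(s, z). shrink s z) (s, z'))"
    if zz: "s \<in> {0..1}" "z \<in> topspace (top_of_set ccone)" "z' \<in> topspace (top_of_set ccone)" "?P z = ?P z'" for s z z'
  proof -
    have z: "z \<in> ccone" "z' \<in> ccone" using zz by auto
    obtain g A c where g: "g \<in> carrier G" "g = pm A" "det A = 1" "c \<noteq> 0" "z' = c *s (cmatrix A *v z)"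
      using PE[OF z zz(4)] by blast
    have "line (shrink s z') = complex_action g (line (shrink s z))"
      using g z by (simp add: shrink_scale ccone_cmatrix line_scale complex_action_line shrink_cmatrix)
    moreover have "shrink s z \<in> ccone" "shrink s z' \<in> ccone" using shrink_ccone z zz(1) by auto
    ultimately have "?P (shrink s z) = ?P (shrink s z')" using P g(1) by blast
    then show ?thesis by simp
  qed
  show "?Q (real_part (cvec y)) = ?Q y" if "y \<in> topspace (top_of_set rcone)" for y
    using that by (simp add: line_real_part_cvec)
qed

lemma elliptic_of_finite_order:
  assumes bianchi: "bianchi m" and A: "A \<in> carrier (SL2 R)" "pm A \<noteq> \<one>\<^bsub>PSL2 R\<^esub>"
    and k: "k > 0" "pm A [^]\<^bsub>PSL2 R\<^esub> (k::nat) = \<one>\<^bsub>PSL2 R\<^esub>"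
  obtains Q \<zeta> t where "elliptic_form A Q \<zeta> t"
proof -
  obtain B where B: "pm A [^]\<^bsub>PSL2 R\<^esub> k = pm B" "\<And>x. B *v x = ((\<lambda>x. A *v x) ^^ k) x"
    by (rule PSL2_pow[OF A(1), of k]) blast
  have "B = mat 1 \<or> B = - mat 1" using B(1) k(2) by (auto simp: PSL2_one pm_eq_iff)
  then have "(\<forall>x. ((\<lambda>x. A *v x) ^^ k) x = 1 *s x) \<or> (\<forall>x. ((\<lambda>x. A *v x) ^^ k) x = (-1) *s x)"
  proof
    assume "B = - mat 1"
    moreover have "(- mat 1) *v x = (-1) *s x" for x :: "complex^2"
      by (simp add: vec_eq_iff forall_2 matrix_vector_mult_def sum_2)
    ultimately show ?thesis using B(2) by metis
  qed (use B(2) in auto)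
  moreover have "A \<noteq> mat 1" "A \<noteq> - mat 1" using A(2) by (auto simp: PSL2_one pm_def)
  ultimately show thesis using bianchi.elliptic_form_exists[OF bianchi A(1), of k 1] bianchi.elliptic_form_exists[OF bianchi A(1), of k "-1"] k(1) that by blast
qed

end

section \<open>Eigenspaces of a diagonalisable map\<close>

lemma eigenspace_diagonalisable:
  fixes L :: "complex ^ 'n \<Rightarrow> complex ^ 'n"
  assumes L: "Vector_Spaces.linear (*s) (*s) L"
    and B: "finite B" "vec.independent B" "vec.span B = UNIV"
    and ev: "\<And>b. b \<in> B \<Longrightarrow> L b = \<mu> b *s b"
  shows "eigenspace L c = vec.span {b \<in> B. \<mu> b = c}"
proof (intro equalityI subsetI)
  interpret L: Vector_Spaces.linear "(*s)" "(*s)" L by (rule L)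
  fix v assume v: "v \<in> eigenspace L c"
  have "v \<in> vec.span B" using B(3) by simp
  then obtain r where r: "v = (\<Sum>b\<in>B. r b *s b)" using B(1) by (auto simp: vec.span_finite)
  have "(\<Sum>b\<in>B. (r b * (\<mu> b - c)) *s b) = L v - c *s v"
    unfolding r L.sum vec.scale_sum_right sum_subtractf[symmetric]
    by (rule sum.cong[OF refl]) (simp add: L.scale ev vec_eq_iff algebra_simps)
  also have "\<dots> = 0" using v by (simp add: eigenspace_def)
  finally have "\<forall>b\<in>B. r b * (\<mu> b - c) = 0"
    using spec[OF conjunct2[OF B(2)[unfolded vec.independent_explicit]], of "\<lambda>b. r b * (\<mu> b - c)"] by simp
  then have z: "r b = 0" if "b \<in> B" "\<mu> b \<noteq> c" for b using that by auto
  have eq: "v = (\<Sum>b\<in>{b \<in> B. \<mu> b = c}. r b *s b)"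
    unfolding r by (rule sum.mono_neutral_right) (use B(1) z in auto)
  then show "v \<in> vec.span {b \<in> B. \<mu> b = c}"
    by (subst eq) (intro vec.span_sum vec.span_scale vec.span_base)
next
  interpret L: Vector_Spaces.linear "(*s)" "(*s)" L by (rule L)
  fix v assume v: "v \<in> vec.span {b \<in> B. \<mu> b = c}"
  have "vec.subspace (eigenspace L c)"
    by (auto simp: vec.subspace_def eigenspace_def L.zero L.add L.scale vec_eq_iff algebra_simps)
  moreover have "{b \<in> B. \<mu> b = c} \<subseteq> eigenspace L c" using ev by (auto simp: eigenspace_def)
  ultimately show "v \<in> eigenspace L c" using v vec.span_minimal by blast
qed

text \<open>Converts the sum over eigenvalues weighted by multiplicity, as in
  \<open>degree_shift\<close>, into a sum over an eigenbasis, where coinciding eigenvalues need no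
  case distinction.\<close>

lemma sum_eigenvalues_diagonalisable:
  fixes L :: "complex ^ 'n \<Rightarrow> complex ^ 'n" and f :: "complex \<Rightarrow> real"
  assumes L: "Vector_Spaces.linear (*s) (*s) L"
    and B: "finite B" "vec.independent B" "vec.span B = UNIV"
    and ev: "\<And>b. b \<in> B \<Longrightarrow> L b = \<mu> b *s b"
  shows "(\<Sum>c | eigenspace L c \<noteq> {0}. real (vec.dim (eigenspace L c)) * f c) = (\<Sum>b\<in>B. f (\<mu> b))"
proof -
  have span: "eigenspace L c = vec.span {b \<in> B. \<mu> b = c}" for c
    by (rule eigenspace_diagonalisable[OF L B ev])
  have dim: "vec.dim (eigenspace L c) = card {b \<in> B. \<mu> b = c}" for c
    unfolding span using vec.independent_mono[OF B(2), of "{b \<in> B. \<mu> b = c}"]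
    by (intro vec.dim_span_eq_card_independent) auto
  have "eigenspace L c \<noteq> {0} \<longleftrightarrow> c \<in> \<mu> ` B" for c
  proof
    assume "eigenspace L c \<noteq> {0}"
    then have "{b \<in> B. \<mu> b = c} \<noteq> {}" unfolding span by (metis vec.span_empty)
    then show "c \<in> \<mu> ` B" by blast
  next
    assume "c \<in> \<mu> ` B"
    then obtain b where b: "b \<in> B" "c = \<mu> b" by blast
    then have "b \<in> eigenspace L c" using ev by (simp add: eigenspace_def)
    moreover have "b \<noteq> 0" using b B(2) vec.dependent_zero by blast
    ultimately show "eigenspace L c \<noteq> {0}" by blast
  qed
  then have "(\<Sum>c | eigenspace L c \<noteq> {0}. real (vec.dim (eigenspace L c)) * f c) =
      (\<Sum>c\<in>\<mu> ` B. \<Sum>b\<in>{b \<in> B. \<mu> b = c}. f (\<mu> b))"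
    by (intro sum.cong) (auto simp: dim)
  also have "\<dots> = (\<Sum>b\<in>B. f (\<mu> b))" by (rule sum.image_gen[OF B(1), symmetric])
  finally show ?thesis .
qed

section \<open>The tangent action at a fixed point\<close>

definition hom_coords :: "complex ^ 3 \<Rightarrow> complex ^ 4" where "hom_coords w = vector [w $ 1, w $ 2, w $ 3, 1]"
definition emb_coords :: "complex ^ 3 \<Rightarrow> complex ^ 4" where "emb_coords w = vector [w $ 1, w $ 2, w $ 3, 0]"
text \<open>The differential at \<open>(1, w)\<close> of the passage from homogeneous to affine
  coordinates \<open>x_i / x_0\<close>; its kernel is the line through
  \<open>(1, w)\<close>.\<close>

definition proj_coords :: "complex ^ 3 \<Rightarrow> complex ^ 4 \<Rightarrow> complex ^ 3" where
  "proj_coords w x = vector [x $ 1 - w $ 1 * x $ 0, x $ 2 - w $ 2 * x $ 0, x $ 3 - w $ 3 * x $ 0]"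

lemma hom_coords_nth [simp]: "hom_coords w $ 0 = 1" "hom_coords w $ 1 = w $ 1" "hom_coords w $ 2 = w $ 2" "hom_coords w $ 3 = w $ 3"
  by (simp_all add: hom_coords_def)

lemma emb_coords_nth [simp]: "emb_coords w $ 0 = 0" "emb_coords w $ 1 = w $ 1" "emb_coords w $ 2 = w $ 2" "emb_coords w $ 3 = w $ 3"
  by (simp_all add: emb_coords_def)

lemma proj_coords_nth [simp]: "proj_coords w x $ 1 = x $ 1 - w $ 1 * x $ 0"
  "proj_coords w x $ 2 = x $ 2 - w $ 2 * x $ 0" "proj_coords w x $ 3 = x $ 3 - w $ 3 * x $ 0"
  by (simp_all add: proj_coords_def)

lemma affine_chart_hom [simp]: "affine_chart (line (hom_coords w)) = w"
  by (simp add: affine_chart_line vec_eq_iff forall_3)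

lemma line_hom_chart: 
  assumes "z $ 0 \<noteq> 0" shows "hom_coords (affine_chart (line z)) = inverse (z $ 0) *s z" "line (hom_coords (affine_chart (line z))) = line z"
proof -
  show "hom_coords (affine_chart (line z)) = inverse (z $ 0) *s z"
    using assms by (simp add: affine_chart_line vec_eq_iff forall_4_0 field_simps)
  then show "line (hom_coords (affine_chart (line z))) = line z" using assms by (simp add: line_scale)
qed

lemma inv_affine_chart:
  assumes "hom_coords w \<in> ccone"
  shows "inv_into (topspace complex_hyperbolic_3_space) affine_chart w = line (hom_coords w)"
proof -
  have "inj_on affine_chart (topspace complex_hyperbolic_3_space)"
  proof (rule inj_onI)
    fix l l' assume "l \<in> topspace complex_hyperbolic_3_space" "l' \<in> topspace complex_hyperbolic_3_space"
      "affine_chart l = affine_chart l'"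
    then show "l = l'" using line_hom_chart(2) ccone_nonzero(1) by (auto simp: topspace_complex_hyperbolic) metis+
  qed
  moreover have "line (hom_coords w) \<in> topspace complex_hyperbolic_3_space"
    using assms by (auto simp: topspace_complex_hyperbolic)
  ultimately show ?thesis using inv_into_f_f[of affine_chart] by (metis affine_chart_hom)
qed

text \<open>In the chart the action is the fractional linear map
  \<open>u \<mapsto> (M (1, u))_i / (M (1, u))_0\<close>. As the vector over the fixed point is
  fixed, and not merely its line, the denominator is 1 there and the quotient rule
  simplifies.\<close>

lemma tangent_action_cmatrix:
  assumes z: "z \<in> ccone" and A: "det A = 1" "cmatrix A *v z = z"
  defines "w \<equiv> affine_chart (line z)"
  shows "tangent_action complex_hyperbolic_3_space complex_action affine_chart (pm A) (line z) v =
    proj_coords w (cmatrix A *v emb_coords v)"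
proof -
  define M where "M = cmatrix A"
  have z0: "z $ 0 \<noteq> 0" using ccone_nonzero[OF z] by simp
  have hw: "hom_coords w = inverse (z $ 0) *s z" unfolding w_def by (rule line_hom_chart(1)[OF z0])
  have Mw: "M *v hom_coords w = hom_coords w" using A by (simp add: hw M_def vector_scalar_commute)

  let ?f = "\<lambda>u. affine_chart (complex_action (pm A) (inv_into (topspace complex_hyperbolic_3_space) affine_chart u))"
  define g where "g u = (\<chi> i::3. (if i = 1 then (M *v hom_coords u) $ 1 else if i = 2 then (M *v hom_coords u) $ 2
     else (M *v hom_coords u) $ 3) / (M *v hom_coords u) $ 0)" for u
  have chom: "continuous_on UNIV hom_coords"
  proof -
    have "hom_coords = (\<lambda>u. \<chi> i. if i = 1 then u $ 1 else if i = 2 then u $ 2 else if i = 3 then u $ 3 else 1)"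
      by (auto simp: fun_eq_iff vec_eq_iff forall_4_0)
    moreover have "continuous_on UNIV (\<lambda>u :: complex^3. \<chi> i :: 4. if i = 1 then u $ 1 else if i = 2 then u $ 2 else if i = 3 then u $ 3 else 1)"
    proof (rule continuous_on_vec_lambda)
      show "continuous_on UNIV (\<lambda>u :: complex^3. if i = 1 then u $ 1 else if i = 2 then u $ 2 else if i = 3 then u $ 3 else 1)" for i :: 4
        by (cases "i = 1"; cases "i = 2"; cases "i = 3") (auto intro: continuous_intros)
    qed
    ultimately show ?thesis by metis
  qed
  \<comment> \<open>The image of the chart. Outside it \<open>inv_into\<close> is not the inverse
    chart, so the derivative of the explicit \<open>g\<close> is transferred on this open set
    only.\<close>
  define S where "S = hom_coords -` ccone"
  have S: "open S" unfolding S_def using continuous_open_vimage[OF open_ccone] chom continuous_on_eq_continuous_at open_UNIV by blast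
  have wS: "w \<in> S" using z z0 by (simp add: S_def hw ccone_scale)
  have fg: "g u = ?f u" if "u \<in> S" for u
  proof -
    have c: "hom_coords u \<in> ccone" using that by (simp add: S_def)
    then have "(M *v hom_coords u) $ 0 \<noteq> 0" using ccone_nonzero(1) ccone_cmatrix[OF A(1)] by (simp add: M_def)
    then show ?thesis
      by (simp add: inv_affine_chart[OF c] complex_action_line M_def[symmetric] affine_chart_line g_def vec_eq_iff forall_3)
  qed
  have der: "((\<lambda>u. (M *v hom_coords u) $ j) has_derivative (\<lambda>v. (M *v emb_coords v) $ j)) (at w)" for j
  proof -
    have "linear (\<lambda>v. (M *v emb_coords v) $ j)"
    proof (rule linearI)
      have "emb_coords (a + b) = emb_coords a + emb_coords b" "emb_coords (r *\<^sub>R a) = of_real r *s emb_coords a" for a b r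
        by (simp_all add: vec_eq_iff forall_4_0 scaleR_conv_of_real[where 'a=complex])
      then show "(M *v emb_coords (a + b)) $ j = (M *v emb_coords a) $ j + (M *v emb_coords b) $ j"
        "(M *v emb_coords (r *\<^sub>R a)) $ j = r *\<^sub>R (M *v emb_coords a) $ j" for a b r
        by (simp_all add: matrix_vector_right_distrib vector_scalar_commute scaleR_conv_of_real[where 'a=complex])
    qed
    then have "((\<lambda>v. (M *v emb_coords v) $ j) has_derivative (\<lambda>v. (M *v emb_coords v) $ j)) (at w)"
      by (simp add: linear_conv_bounded_linear bounded_linear_imp_has_derivative)
    then have "((\<lambda>v. (M *v emb_coords v) $ j + (M *v hom_coords 0) $ j) has_derivative (\<lambda>v. (M *v emb_coords v) $ j)) (at w)"
      by (auto intro!: derivative_eq_intros)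
    moreover have "(M *v emb_coords v) $ j + (M *v hom_coords 0) $ j = (M *v hom_coords v) $ j" for v
    proof -
      have "hom_coords v = emb_coords v + hom_coords 0" by (simp add: vec_eq_iff forall_4_0)
      then show ?thesis by (simp add: matrix_vector_right_distrib)
    qed
    ultimately show ?thesis by simp
  qed
  have quot: "((\<lambda>u. (M *v hom_coords u) $ j / (M *v hom_coords u) $ 0) has_derivative
     (\<lambda>v. (M *v emb_coords v) $ j - hom_coords w $ j * (M *v emb_coords v) $ 0)) (at w)" for j
    using has_derivative_divide'[OF der[of j] der[of 0]] by (simp add: Mw)
  have "(g has_derivative (\<lambda>v. proj_coords w (M *v emb_coords v))) (at w)"
  proof -
    have bl: "bounded_linear (axis j :: complex \<Rightarrow> complex^3)" for j
      by (simp add: linear_conv_bounded_linear[symmetric] linear_iff vec_eq_iff axis_def)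
    have "((\<lambda>u. axis 1 ((M *v hom_coords u) $ 1 / (M *v hom_coords u) $ 0) + axis 2 ((M *v hom_coords u) $ 2 / (M *v hom_coords u) $ 0)
          + axis 3 ((M *v hom_coords u) $ 3 / (M *v hom_coords u) $ 0)) has_derivative
       (\<lambda>v. axis 1 ((M *v emb_coords v) $ 1 - hom_coords w $ 1 * (M *v emb_coords v) $ 0)
          + axis 2 ((M *v emb_coords v) $ 2 - hom_coords w $ 2 * (M *v emb_coords v) $ 0)
          + axis 3 ((M *v emb_coords v) $ 3 - hom_coords w $ 3 * (M *v emb_coords v) $ 0) :: complex^3)) (at w)"
      by (intro has_derivative_add bounded_linear.has_derivative[OF bl] quot)
    moreover have "axis 1 ((M *v hom_coords u) $ 1 / (M *v hom_coords u) $ 0) + axis 2 ((M *v hom_coords u) $ 2 / (M *v hom_coords u) $ 0)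
          + axis 3 ((M *v hom_coords u) $ 3 / (M *v hom_coords u) $ 0) = g u" for u
      by (simp add: vec_eq_iff forall_3 axis_def g_def)
    moreover have "axis 1 (x $ 1 - hom_coords w $ 1 * x $ 0) + axis 2 (x $ 2 - hom_coords w $ 2 * x $ 0)
          + axis 3 (x $ 3 - hom_coords w $ 3 * x $ 0) = proj_coords w x" for x
      by (simp add: vec_eq_iff forall_3 axis_def)
    ultimately show ?thesis by simp
  qed
  then have "(?f has_derivative (\<lambda>v. proj_coords w (M *v emb_coords v))) (at w)"
    by (rule has_derivative_transform_within_open[OF _ S wS fg])
  then have "(\<lambda>v. proj_coords w (M *v emb_coords v)) = frechet_derivative ?f (at w)"
    by (rule frechet_derivative_at)
  then show ?thesis unfolding tangent_action_def by (metis M_def w_def)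
qed

lemma degree_shift_identity:
  assumes "z \<in> ccone"
  shows "degree_shift complex_hyperbolic_3_space complex_action affine_chart (pm (mat 1)) (line z) = 0"
proof -
  have "tangent_action complex_hyperbolic_3_space complex_action affine_chart (pm (mat 1)) (line z) v = v" for v
    using assms by (simp add: tangent_action_cmatrix cmatrix_one det_I) (simp add: vec_eq_iff forall_3)
  then have e: "eigenspace (tangent_action complex_hyperbolic_3_space complex_action affine_chart (pm (mat 1)) (line z)) c = {v. v = c *s v}" for c
    by (simp add: eigenspace_def)
  have "real (vec.dim {v :: complex^3. v = c *s v}) * (Arg2pi c / (2 * pi)) = 0" if "{v :: complex^3. v = c *s v} \<noteq> {0}" for c
  proof -
    have "(0 :: complex^3) \<in> {v. v = c *s v}" by simp
    then have "\<exists>v :: complex^3. v = c *s v \<and> v \<noteq> 0" using that by blast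
    then obtain v :: "complex^3" where v: "v = c *s v" "v \<noteq> 0" by blast
    then obtain i where "v $ i \<noteq> 0" by (auto simp: vec_eq_iff)
    moreover have "v $ i = c * v $ i" using arg_cong[OF v(1), of "\<lambda>x. x $ i"] by simp
    ultimately have "c = 1" by simp
    then show ?thesis by (simp add: Arg2pi_of_real[of 1, simplified])
  qed
  then show ?thesis unfolding degree_shift_def Let_def e by (intro sum.neutral) auto
qed

section \<open>Coordinates adapted to an elliptic element\<close>

text \<open>Coordinates in the frame \<open>Q\<close>: for \<open>det Q = 1\<close>, a matrix
  \<open>B\<close> with \<open>B ** Q = Q ** E\<close> acts on them by
  \<open>Y \<mapsto> E ** Y ** conj_transpose E\<close>.\<close>

definition axis_coords :: "complex ^ 2 ^ 2 \<Rightarrow> complex ^ 4 \<Rightarrow> complex ^ 2 ^ 2" where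
  "axis_coords Q z = adj2 Q ** cmat z ** conj_transpose (adj2 Q)"

definition of_axis_coords :: "complex ^ 2 ^ 2 \<Rightarrow> complex ^ 2 ^ 2 \<Rightarrow> complex ^ 4" where
  "of_axis_coords Q Y = ccoords (Q ** Y ** conj_transpose Q)"

lemma mat1_conj: "conj_transpose (mat 1) = mat 1" by (simp add: mat2_eq_iff)

lemma axis_coords_inverse:
  assumes "det Q = 1"
  shows "axis_coords Q (of_axis_coords Q Y) = Y" "of_axis_coords Q (axis_coords Q z) = z"
proof -
  have 1: "adj2 Q ** Q = mat 1" "Q ** adj2 Q = mat 1" using assms by (simp_all add: adj2_mult)
  then have 2: "conj_transpose Q ** conj_transpose (adj2 Q) = mat 1" "conj_transpose (adj2 Q) ** conj_transpose Q = mat 1"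
    by (metis conj_transpose_mult mat1_conj)+
  have "adj2 Q ** (Q ** Y ** conj_transpose Q) ** conj_transpose (adj2 Q) =
      (adj2 Q ** Q) ** Y ** (conj_transpose Q ** conj_transpose (adj2 Q))" by (simp add: matrix_mul_assoc)
  then show "axis_coords Q (of_axis_coords Q Y) = Y" by (simp add: axis_coords_def of_axis_coords_def 1 2)
  have "Q ** (adj2 Q ** cmat z ** conj_transpose (adj2 Q)) ** conj_transpose Q =
      (Q ** adj2 Q) ** cmat z ** (conj_transpose (adj2 Q) ** conj_transpose Q)" by (simp add: matrix_mul_assoc)
  then show "of_axis_coords Q (axis_coords Q z) = z" by (simp add: axis_coords_def of_axis_coords_def 1 2)
qed

lemma cone_form_axis: "det Q = 1 \<Longrightarrow> cone_form (of_axis_coords Q Y) = herm_form Y"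
  by (simp add: cone_form_cmat of_axis_coords_def herm_form_conj)

lemma cmatrix_axis:
  assumes "B ** Q = Q ** E"
  shows "cmatrix B *v of_axis_coords Q Y = of_axis_coords Q (E ** Y ** conj_transpose E)"
proof -
  have "B ** (Q ** Y ** conj_transpose Q) ** conj_transpose B = (B ** Q) ** Y ** conj_transpose (B ** Q)"
    by (simp add: conj_transpose_mult matrix_mul_assoc)
  also have "\<dots> = Q ** (E ** Y ** conj_transpose E) ** conj_transpose Q"
    unfolding assms by (simp add: conj_transpose_mult matrix_mul_assoc)
  finally show ?thesis by (simp add: of_axis_coords_def cmat_cmatrix flip: cmat_eq_iff)
qed

lemma of_axis_coords_scale: "of_axis_coords Q (mat c ** Y) = c *s of_axis_coords Q Y"
proof -
  have "cmat (c *s z) = mat c ** cmat z" for z by (simp add: mat2_eq_iff mult2_nth algebra_simps)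
  then show ?thesis
    by (simp add: of_axis_coords_def flip: cmat_eq_iff) (simp add: mat2_eq_iff mult2_nth algebra_simps)
qed

lemma of_axis_coords_add: "of_axis_coords Q (X + Y) = of_axis_coords Q X + of_axis_coords Q Y"
proof -
  have "cmat (z + w) = cmat z + cmat w" for z w by (simp add: mat2_eq_iff algebra_simps)
  then show ?thesis
    by (simp add: of_axis_coords_def flip: cmat_eq_iff) (simp add: mat2_eq_iff mult2_nth algebra_simps)
qed

lemma of_axis_coords_inj: "det Q = 1 \<Longrightarrow> of_axis_coords Q X = of_axis_coords Q Y \<longleftrightarrow> X = Y"
  by (metis axis_coords_inverse(1))

text \<open>A fixed line in the cone is fixed pointwise, being diagonal in the coordinates adapted to \<open>Q\<close>.\<close>

lemma elliptic_fixed: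
  assumes E: "elliptic_form A Q \<zeta> t" and z: "z \<in> ccone"
  shows "line (cmatrix A *v z) = line z \<longleftrightarrow> (\<exists>p q. z = of_axis_coords Q (mat2 p 0 0 q))"
    and "cmatrix A *v of_axis_coords Q (mat2 p 0 0 q) = of_axis_coords Q (mat2 p 0 0 q)"
proof -
  have E': "det Q = 1" "cmod \<zeta> = 1" "\<zeta>\<^sup>2 \<noteq> 1" "A ** Q = Q ** mat2 \<zeta> 0 0 (cnj \<zeta>)"
    using E by (auto simp: elliptic_form_def)
  have zz: "\<zeta> * cnj \<zeta> = 1" using unit_circle_cnj[OF E'(2)] .
  show fix': "cmatrix A *v of_axis_coords Q (mat2 p 0 0 q) = of_axis_coords Q (mat2 p 0 0 q)" for p q
  proof -
    have "mat2 \<zeta> 0 0 (cnj \<zeta>) ** mat2 p 0 0 q ** conj_transpose (mat2 \<zeta> 0 0 (cnj \<zeta>)) = mat2 p 0 0 q"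
      using zz by (simp add: mat2_eq_iff mult2_nth mult_ac)
    then show ?thesis unfolding cmatrix_axis[OF E'(4)] by simp
  qed
  show "line (cmatrix A *v z) = line z \<longleftrightarrow> (\<exists>p q. z = of_axis_coords Q (mat2 p 0 0 q))"
  proof
    assume l: "line (cmatrix A *v z) = line z"
    obtain Y where zY: "z = of_axis_coords Q Y" using axis_coords_inverse(2)[OF E'(1)] by metis
    obtain c where c: "cmatrix A *v z = c *s z" "c \<noteq> 0"
      using l line_eq_iff[OF ccone_nonzero(2)[OF z]] by metis
    have YY: "mat2 \<zeta> 0 0 (cnj \<zeta>) ** Y ** conj_transpose (mat2 \<zeta> 0 0 (cnj \<zeta>)) = mat c ** Y"
      using c(1) unfolding zY cmatrix_axis[OF E'(4)] of_axis_coords_scale[symmetric] of_axis_coords_inj[OF E'(1)] .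
    have "herm_form Y > 0" using z by (simp add: zY ccone_def cone_form_axis E')
    \<comment> \<open>Positivity on the cone forces a nonzero corner entry. That entry is multiplied
      by \<open>\<zeta> cnj \<zeta> = 1\<close>, so the scalar \<open>c\<close> is 1; the
      off-diagonal entries are multiplied by \<open>\<zeta>^2\<close> and its inverse and must
      vanish.\<close>
    then have "Y$1$1 \<noteq> 0" by (auto simp: herm_form_def not_less) (smt (verit) sum_power2_ge_zero)
    moreover have "(\<zeta> * cnj \<zeta>) * Y$1$1 = c * Y$1$1" using YY by (simp add: mat2_eq_iff mult2_nth mult_ac)
    ultimately have "c = 1" unfolding zz by simp
    then have "\<zeta>\<^sup>2 * Y$1$2 = Y$1$2" "(cnj \<zeta>)\<^sup>2 * Y$2$1 = Y$2$1"
      using YY by (simp_all add: mat2_eq_iff mult2_nth power2_eq_square mult_ac)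
    moreover have "(cnj \<zeta>)\<^sup>2 \<noteq> 1" using E'(3) by (metis complex_cnj_cnj complex_cnj_one complex_cnj_power)
    ultimately have "Y$1$2 = 0" "Y$2$1 = 0" using E'(3) by simp_all
    then have "Y = mat2 (Y$1$1) 0 0 (Y$2$2)" by (simp add: mat2_eq_iff)
    then show "\<exists>p q. z = of_axis_coords Q (mat2 p 0 0 q)" using zY by metis
  next
    assume "\<exists>p q. z = of_axis_coords Q (mat2 p 0 0 q)"
    then show "line (cmatrix A *v z) = line z" using fix' by auto
  qed
qed

lemma elliptic_fixed_set:
  assumes "elliptic_form A Q \<zeta> t"
  shows "fixed_set complex_hyperbolic_3_space complex_action (pm A) =
     line ` {z \<in> ccone. \<exists>p q. z = of_axis_coords Q (mat2 p 0 0 q)}"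
proof (intro equalityI subsetI)
  fix l assume "l \<in> fixed_set complex_hyperbolic_3_space complex_action (pm A)"
  then obtain z where z: "z \<in> ccone" "l = line z" "line (cmatrix A *v z) = line z"
    by (auto simp: fixed_set_def topspace_complex_hyperbolic complex_action_line)
  then show "l \<in> line ` {z \<in> ccone. \<exists>p q. z = of_axis_coords Q (mat2 p 0 0 q)}"
    using elliptic_fixed(1)[OF assms z(1)] by blast
next
  fix l assume "l \<in> line ` {z \<in> ccone. \<exists>p q. z = of_axis_coords Q (mat2 p 0 0 q)}"
  then obtain z where z: "z \<in> ccone" "l = line z" "\<exists>p q. z = of_axis_coords Q (mat2 p 0 0 q)" by blast
  then show "l \<in> fixed_set complex_hyperbolic_3_space complex_action (pm A)"
    using elliptic_fixed(1)[OF assms z(1)]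
    by (auto simp only: fixed_set_def topspace_complex_hyperbolic complex_action_line mem_Collect_eq imageI)
qed

lemma diag_in_ccone: "det Q = 1 \<Longrightarrow> of_axis_coords Q (mat2 p 0 0 q) \<in> ccone \<longleftrightarrow> Re (p * cnj q) > 0"
  by (simp add: ccone_def cone_form_axis herm_form_def)

text \<open>The tangent space is \<open>\<complex>^4\<close> modulo the vector \<open>z\<close>,
  realised by \<open>\<pi>\<close>. In the frame \<open>z\<close> is \<open>diag(p, q)\<close> with
  \<open>q \<noteq> 0\<close>, so the matrix units other than the lower right one project to a
  basis, and each of them is an eigenvector. The two eigenvalues other than 1 are conjugate, and
  their arguments add up to a full turn.\<close>

lemma degree_shift_elliptic:
  assumes E: "elliptic_form A Q \<zeta> t" and A: "det A = 1"
    and l: "l \<in> fixed_set complex_hyperbolic_3_space complex_action (pm A)"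
  shows "degree_shift complex_hyperbolic_3_space complex_action affine_chart (pm A) l = 1"
proof -
  have E': "det Q = 1" "cmod \<zeta> = 1" "\<zeta>\<^sup>2 \<noteq> 1" "A ** Q = Q ** mat2 \<zeta> 0 0 (cnj \<zeta>)"
    using E by (auto simp: elliptic_form_def)
  obtain p q where pq: "of_axis_coords Q (mat2 p 0 0 q) \<in> ccone" "l = line (of_axis_coords Q (mat2 p 0 0 q))"
    using l unfolding elliptic_fixed_set[OF E] by auto
  define z where "z = of_axis_coords Q (mat2 p 0 0 q)"
  have q0: "q \<noteq> 0" using pq(1) unfolding diag_in_ccone[OF E'(1)] by auto
  have Az: "cmatrix A *v z = z" unfolding z_def by (rule elliptic_fixed(2)[OF E pq(1)])
  have zc: "z \<in> ccone" using pq(1) by (simp add: z_def)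
  have z0: "z $ 0 \<noteq> 0" by (rule ccone_nonzero(1)[OF zc])
  define w where "w = affine_chart (line z)"
  define L where "L = tangent_action complex_hyperbolic_3_space complex_action affine_chart (pm A) l"
  define \<pi> where "\<pi> = proj_coords w"
  have hw: "hom_coords w = inverse (z $ 0) *s z" unfolding w_def by (rule line_hom_chart(1)[OF z0])
  have L: "L v = \<pi> (cmatrix A *v emb_coords v)" for v
    unfolding L_def pq(2) z_def[symmetric] \<pi>_def w_def by (rule tangent_action_cmatrix[OF zc A Az])
  have \<pi>_lin: "\<pi> (x + y) = \<pi> x + \<pi> y" "\<pi> (c *s x) = c *s \<pi> x" for x y c
    by (simp_all add: \<pi>_def vec_eq_iff forall_3 algebra_simps)
  have emb_lin: "emb_coords (x + y) = emb_coords x + emb_coords y" "emb_coords (c *s x) = c *s emb_coords x" for x y c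
    by (simp_all add: vec_eq_iff forall_4_0)
  have lin: "Vector_Spaces.linear (*s) (*s) L"
    by unfold_locales (simp_all add: L emb_lin \<pi>_lin matrix_vector_right_distrib vector_scalar_commute)
  have ker: "\<pi> z = 0" using z0 unfolding \<pi>_def w_def by (simp add: affine_chart_line vec_eq_iff forall_3)
  have emb\<pi>: "emb_coords (\<pi> x) = x + (- x $ 0 * inverse (z $ 0)) *s z" for x
    using arg_cong[OF hw, of "\<lambda>v. v $ 1"] arg_cong[OF hw, of "\<lambda>v. v $ 2"] arg_cong[OF hw, of "\<lambda>v. v $ 3"] z0
    by (simp add: \<pi>_def vec_eq_iff forall_4_0)
  \<comment> \<open>Since \<open>z\<close> is fixed, the linear map on \<open>\<complex>^4\<close>
    preserves the kernel of \<open>\<pi>\<close> and induces \<open>L\<close> on the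
    quotient.\<close>
  have L\<pi>: "L (\<pi> x) = \<pi> (cmatrix A *v x)" for x
  proof -
    have "L (\<pi> x) = \<pi> (cmatrix A *v x + (- x $ 0 * inverse (z $ 0)) *s z)"
      unfolding L emb\<pi> by (simp only: matrix_vector_right_distrib vector_scalar_commute Az)
    then show ?thesis by (simp only: \<pi>_lin ker) simp
  qed
  have \<pi>0: "\<exists>c. x = c *s z" if "\<pi> x = 0" for x
  proof -
    have "emb_coords (\<pi> x) = 0" using that by (simp add: vec_eq_iff forall_4_0)
    moreover have "emb_coords (\<pi> x) = x - (x $ 0 * inverse (z $ 0)) *s z" by (simp add: emb\<pi>)
    ultimately have "x = (x $ 0 * inverse (z $ 0)) *s z" by (metis eq_iff_diff_eq_0)
    then show ?thesis by blast
  qed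
  define \<omega> where "\<omega> = \<zeta>\<^sup>2"
  define v1 v2 v3 where "v1 = \<pi> (of_axis_coords Q (mat2 1 0 0 0))" and "v2 = \<pi> (of_axis_coords Q (mat2 0 1 0 0))"
    and "v3 = \<pi> (of_axis_coords Q (mat2 0 0 1 0))"
  have comb0: "a = 0 \<and> b = 0 \<and> c = 0" if "a *s v1 + b *s v2 + c *s v3 = 0" for a b c
  proof -
    have "\<pi> (of_axis_coords Q (mat2 a b c 0)) = a *s v1 + b *s v2 + c *s v3"
    proof -
      have e: "mat2 a b c 0 = mat a ** mat2 1 0 0 0 + mat b ** mat2 0 1 0 0 + mat c ** mat2 0 0 1 0"
        by (simp add: mat2_eq_iff mult2_nth)
      show ?thesis unfolding e v1_def v2_def v3_def by (simp only: of_axis_coords_add of_axis_coords_scale \<pi>_lin)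
    qed
    then have "\<pi> (of_axis_coords Q (mat2 a b c 0)) = 0" using that by simp
    then obtain k where "of_axis_coords Q (mat2 a b c 0) = k *s z" using \<pi>0 by blast
    then have "mat2 a b c 0 = mat k ** mat2 p 0 0 q"
      unfolding z_def of_axis_coords_scale[symmetric] of_axis_coords_inj[OF E'(1)] .
    then show ?thesis using q0 by (auto simp: mat2_eq_iff mult2_nth)
  qed
  have distinct: "v1 \<noteq> v2" "v1 \<noteq> v3" "v2 \<noteq> v3"
    using comb0[of 1 "-1" 0] comb0[of 1 0 "-1"] comb0[of 0 1 "-1"] by auto
  define B where "B = {v1, v2, v3}"
  have B: "finite B" "card B = 3" using distinct by (auto simp: B_def)
  have indep: "vec.independent B"
    unfolding vec.independent_explicit
  proof (intro conjI allI impI ballI)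
    fix r v assume "(\<Sum>v\<in>B. r v *s v) = 0" and v: "v \<in> B"
    then have "r v1 *s v1 + r v2 *s v2 + r v3 *s v3 = 0" using distinct by (simp add: B_def add.assoc)
    then show "r v = 0" using comb0 v by (auto simp: B_def)
  qed (use B in auto)
  have span: "vec.span B = UNIV"
  proof -
    have "vec.dim (UNIV :: (complex^3) set) \<le> card B" unfolding vec_dim_card by (simp add: B)
    then show ?thesis using vec.card_ge_dim_independent[of B UNIV] indep by auto
  qed
  have ev: "L v1 = 1 *s v1" "L v2 = \<omega> *s v2" "L v3 = cnj \<omega> *s v3"
  proof -
    have zz: "\<zeta> * cnj \<zeta> = 1" using unit_circle_cnj[OF E'(2)] .
    have "mat2 \<zeta> 0 0 (cnj \<zeta>) ** mat2 1 0 0 0 ** conj_transpose (mat2 \<zeta> 0 0 (cnj \<zeta>)) = mat 1 ** mat2 1 0 0 0"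
      "mat2 \<zeta> 0 0 (cnj \<zeta>) ** mat2 0 1 0 0 ** conj_transpose (mat2 \<zeta> 0 0 (cnj \<zeta>)) = mat \<omega> ** mat2 0 1 0 0"
      "mat2 \<zeta> 0 0 (cnj \<zeta>) ** mat2 0 0 1 0 ** conj_transpose (mat2 \<zeta> 0 0 (cnj \<zeta>)) = mat (cnj \<omega>) ** mat2 0 0 1 0"
      using zz by (simp_all add: mat2_eq_iff mult2_nth \<omega>_def power2_eq_square)
    then show "L v1 = 1 *s v1" "L v2 = \<omega> *s v2" "L v3 = cnj \<omega> *s v3"
      unfolding v1_def v2_def v3_def L\<pi> cmatrix_axis[OF E'(4)] by (simp_all only: of_axis_coords_scale \<pi>_lin)
  qed
  define \<mu> where "\<mu> b = (if b = v1 then 1 else if b = v2 then \<omega> else cnj \<omega>)" for b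
  have "degree_shift complex_hyperbolic_3_space complex_action affine_chart (pm A) l =
      (\<Sum>c | eigenspace L c \<noteq> {0}. real (vec.dim (eigenspace L c)) * (Arg2pi c / (2 * pi)))"
    by (simp add: degree_shift_def L_def Let_def)
  also have "\<dots> = (\<Sum>b\<in>B. Arg2pi (\<mu> b) / (2 * pi))"
    by (rule sum_eigenvalues_diagonalisable[OF lin B(1) indep span])
      (use ev distinct in \<open>auto simp: \<mu>_def B_def\<close>)
  also have "\<dots> = (Arg2pi 1 + Arg2pi \<omega> + Arg2pi (cnj \<omega>)) / (2 * pi)"
    using distinct by (simp add: B_def \<mu>_def add_divide_distrib)
  finally have "degree_shift complex_hyperbolic_3_space complex_action affine_chart (pm A) l =
      (Arg2pi 1 + Arg2pi \<omega> + Arg2pi (cnj \<omega>)) / (2 * pi)" .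
  moreover have "Arg2pi 1 = 0" using Arg2pi_of_real[of 1] by simp
  moreover have "Arg2pi \<omega> + Arg2pi (cnj \<omega>) = 2 * pi"
  proof (cases "\<omega> \<in> \<real>")
    \<comment> \<open>Here \<open>\<omega> = -1\<close>: the element has order 2, and both arguments
      are \<open>pi\<close>.\<close>
    case True
    have "cmod \<omega> = 1" using E'(2) by (simp add: \<omega>_def norm_power)
    moreover obtain r where "\<omega> = of_real r" using True by (auto elim: Reals_cases)
    ultimately have "\<omega> = -1" using E'(3) by (auto simp: \<omega>_def[symmetric] abs_if split: if_splits)
    then have "Arg2pi \<omega> = pi" by (simp add: Arg2pi_eq_pi)
    then show ?thesis using True by (simp add: Arg2pi_cnj)
  next
    case False
    then show ?thesis by (simp add: Arg2pi_cnj)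
  qed
  ultimately show ?thesis by simp
qed

section \<open>Quotients of a strip\<close>

definition strip :: "complex set" where "strip = {u. \<bar>Im u\<bar> < pi / 2}"

text \<open>\<open>S\<close> and \<open>F\<close> are the translation lengths and the reflection constants of a group of maps
  \<open>u \<mapsto> \<plusminus>u + c\<close> with real \<open>c\<close>.\<close>

lemma strip_quotient_homotopy_equivalent:
  fixes S F :: "real set"
  assumes P: "quotient_map (top_of_set strip) X' P" and Q: "quotient_map euclideanreal Y' Q"
    and Prel: "\<And>u u'. u \<in> strip \<Longrightarrow> u' \<in> strip \<Longrightarrow>
       P u = P u' \<longleftrightarrow> (\<exists>s\<in>S. u' = u + of_real s) \<or> (\<exists>f\<in>F. u' = - u + of_real f)"
    and Qrel: "\<And>r r'. Q r = Q r' \<longleftrightarrow> (\<exists>s\<in>S. r' = r + s) \<or> (\<exists>f\<in>F. r' = - r + f)"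
  shows "X' homotopy_equivalent_space Y'"
proof (rule homotopy_equivalent_quotients[OF P Q])
  \<comment> \<open>The linear contraction of the imaginary part commutes with
    \<open>u \<mapsto> u + s\<close> and \<open>u \<mapsto> - u + f\<close> for real constants. So a
    quotient of the line with the same constants is a model.\<close>
  define h where "h = (\<lambda>(s :: real, u). complex_of_real (Re u) + \<i> * of_real ((1 - s) * Im u))"
  show "continuous_map (top_of_set strip) euclideanreal Re" by (auto intro: continuous_intros)
  show "continuous_map euclideanreal (top_of_set strip) of_real"
    by (auto simp: continuous_map_in_subtopology strip_def intro!: continuous_intros)
  show "Q (Re x) = Q (Re x')"
    if "x \<in> topspace (top_of_set strip)" "x' \<in> topspace (top_of_set strip)" "P x = P x'" for x x'
    using that Prel[of x x'] unfolding Qrel by auto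
  show "P (of_real y) = P (of_real y')" if "Q y = Q y'" for y y'
    using that Prel[of "of_real y" "of_real y'"] unfolding Qrel
    by (auto simp: strip_def simp flip: of_real_add of_real_minus)
  have st: "h (s, u) \<in> strip" if "s \<in> {0..1}" "u \<in> strip" for s u
  proof -
    have "\<bar>(1 - s) * Im u\<bar> \<le> 1 * \<bar>Im u\<bar>" unfolding abs_mult using that by (intro mult_right_mono) auto
    then show ?thesis using that by (simp add: h_def strip_def)
  qed
  then show "continuous_map (prod_topology (top_of_set {0..1}) (top_of_set strip)) (top_of_set strip) h"
    by (auto simp: prod_topology_subtopology_eu h_def case_prod_beta intro!: continuous_intros)
  show "P (h (0, x)) = P x" for x
  proof -
    have "h (0, x) = x" by (simp add: h_def complex_eq_iff)
    then show ?thesis by simp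
  qed
  show "P (h (1, x)) = P (of_real (Re x))" for x by (simp add: h_def)
  show "P (h (s, x)) = P (h (s, x'))"
    if "s \<in> {0..1}" "x \<in> topspace (top_of_set strip)" "x' \<in> topspace (top_of_set strip)" "P x = P x'" for s x x'
  proof -
    have x: "x \<in> strip" "x' \<in> strip" using that by auto
    have "(\<exists>s\<in>S. x' = x + of_real s) \<or> (\<exists>f\<in>F. x' = - x + of_real f)" using Prel[OF x] that by simp
    then have "(\<exists>r\<in>S. h (s, x') = h (s, x) + of_real r) \<or> (\<exists>f\<in>F. h (s, x') = - h (s, x) + of_real f)"
      by (auto simp: h_def complex_eq_iff)
    then show ?thesis using Prel[OF st[OF that(1) x(1)] st[OF that(1) x(2)]] by simp
  qed
qed simp

text \<open>One period is compact and the sphere is Hausdorff, so the restriction to it is a closed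
  surjection and thus a quotient map; this passes to the map on the whole line.\<close>

lemma quotient_map_circle:
  assumes "c > 0"
  defines "Q \<equiv> (\<lambda>r i. if i = 0 then cos (2 * pi * r / c) else if i = Suc 0 then sin (2 * pi * r / c) else 0)"
  shows "quotient_map euclideanreal (nsphere 1) Q" "Q r = Q r' \<longleftrightarrow> (\<exists>n::int. r' = r + of_int n * c)"
proof -
  have cont: "continuous_map euclideanreal (nsphere 1) Q"
  proof -
    have "continuous_map euclideanreal euclideanreal (\<lambda>r. Q r k)" for k
      using assms(1) by (cases "k = 0"; cases "k = Suc 0") (auto simp: Q_def intro!: continuous_intros)
    then show ?thesis
      unfolding nsphere continuous_map_in_subtopology continuous_map_componentwise_UNIV
      by (auto simp: Q_def)
  qed
  have "quotient_map (top_of_set {0..c}) (nsphere 1) (Q \<circ> id)"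
  proof (rule continuous_closed_imp_quotient_map)
    show c1: "continuous_map (top_of_set {0..c}) (nsphere 1) (Q \<circ> id)"
      using cont by (simp add: continuous_map_from_subtopology)
    have "Hausdorff_space (nsphere 1)"
      unfolding nsphere by (intro Hausdorff_space_subtopology) (simp add: Hausdorff_space_product_topology)
    then show "closed_map (top_of_set {0..c}) (nsphere 1) (Q \<circ> id)"
      by (intro T1_Spaces.continuous_imp_closed_map c1) (auto simp: compact_space_subtopology)
    show "(Q \<circ> id) ` topspace (top_of_set {0..c}) = topspace (nsphere 1)"
    proof
      show "(Q \<circ> id) ` topspace (top_of_set {0..c}) \<subseteq> topspace (nsphere 1)"
        using continuous_map_image_subset_topspace[OF c1] .
      show "topspace (nsphere 1) \<subseteq> (Q \<circ> id) ` topspace (top_of_set {0..c})"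
      proof
        fix x assume "x \<in> topspace (nsphere 1)"
        then have x: "(x 0)\<^sup>2 + (x (Suc 0))\<^sup>2 = 1" "\<And>i. i > 1 \<Longrightarrow> x i = 0" by (auto simp: nsphere)
        obtain \<theta> where \<theta>: "0 \<le> \<theta>" "\<theta> \<le> 2 * pi" "x 0 = cos \<theta>" "x (Suc 0) = sin \<theta>"
          using sincos_total_2pi_le[OF x(1)] by blast
        define r where "r = \<theta> * c / (2 * pi)"
        have "r \<in> {0..c}" using \<theta>(1,2) assms(1) by (simp add: r_def field_simps)
        moreover have "2 * pi * r / c = \<theta>" using assms(1) by (simp add: r_def)
        then have "Q r = x" using x(2) \<theta>(3,4) by (auto simp: Q_def fun_eq_iff)
        ultimately show "x \<in> (Q \<circ> id) ` topspace (top_of_set {0..c})" by auto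
      qed
    qed
  qed
  from quotient_map_from_composition[OF _ cont this] show "quotient_map euclideanreal (nsphere 1) Q"
    by simp
  have "Q r = Q r' \<longleftrightarrow> sin (2 * pi * r' / c) = sin (2 * pi * r / c) \<and> cos (2 * pi * r' / c) = cos (2 * pi * r / c)"
    by (auto simp: Q_def fun_eq_iff split: if_splits)
  also have "\<dots> \<longleftrightarrow> (\<exists>n::int. 2 * pi * r' / c = 2 * pi * r / c + 2 * pi * n)" by (rule sin_cos_eq_iff)
  also have "\<dots> \<longleftrightarrow> (\<exists>n::int. r' = r + of_int n * c)"
  proof -
    have "2 * pi * r' / c = 2 * pi * r / c + 2 * pi * n \<longleftrightarrow> r' = r + of_int n * c" for n :: int
    proof -
      have "2 * pi * r / c + 2 * pi * n = 2 * pi * (r + of_int n * c) / c" using assms(1) by (simp add: field_simps)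
      then show ?thesis using assms(1) by simp
    qed
    then show ?thesis by simp
  qed
  finally show "Q r = Q r' \<longleftrightarrow> (\<exists>n::int. r' = r + of_int n * c)" .
qed

lemma path_connected_nsphere_1: "path_connected_space (nsphere 1)"
  by (rule path_connected_space_quotient_map_image[OF quotient_map_circle(1)[of 1]])
    (simp_all add: path_connected_space_euclidean_subtopology[of UNIV, simplified])

text \<open>The line modulo an infinite dihedral group. The cosine is centred at
  \<open>a / 2\<close>, the fixed point of \<open>r \<mapsto> a - r\<close>, and the arc cosine
  provides a section.\<close>

lemma quotient_map_interval:
  fixes a c :: real
  assumes "c > 0"
  defines "Q \<equiv> (\<lambda>r. cos (2 * pi * (r - a / 2) / c))"
  shows "quotient_map euclideanreal (top_of_set {-1..1}) Q"
    "Q r = Q r' \<longleftrightarrow> (\<exists>n::int. r' = r + of_int n * c) \<or> (\<exists>n::int. r' = - r + (a + of_int n * c))"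
proof -
  show "quotient_map euclideanreal (top_of_set {-1..1}) Q"
  proof (rule retraction_imp_quotient_map)
    have "Q (arccos y * c / (2 * pi) + a / 2) = y" if "y \<in> {-1..1}" for y
    proof -
      have "2 * pi * (arccos y * c / (2 * pi) + a / 2 - a / 2) / c = arccos y" using assms(1) by simp
      then show ?thesis using that unfolding Q_def by (simp only:) simp
    qed
    then have "retraction_maps euclideanreal (top_of_set {-1..1}) Q (\<lambda>y. arccos y * c / (2 * pi) + a / 2)"
      unfolding retraction_maps_def using assms(1)
      by (auto simp: Q_def continuous_map_in_subtopology intro!: continuous_intros)
    then show "retraction_map euclideanreal (top_of_set {-1..1}) Q" unfolding retraction_map_def by blast
  qed
  have 1: "2 * pi * (r' - a / 2) / c = 2 * pi * (r - a / 2) / c + 2 * of_int n * pi \<longleftrightarrow> r' = r + of_int n * c" for n :: int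
  proof -
    have "2 * pi * (r - a / 2) / c + 2 * of_int n * pi = 2 * pi * (r + of_int n * c - a / 2) / c"
      using assms(1) by (simp add: field_simps)
    then show ?thesis using assms(1) by simp
  qed
  have 2: "2 * pi * (r' - a / 2) / c = - (2 * pi * (r - a / 2) / c) + 2 * of_int n * pi \<longleftrightarrow> r' = - r + (a + of_int n * c)" for n :: int
  proof -
    have "- (2 * pi * (r - a / 2) / c) + 2 * of_int n * pi = 2 * pi * (- r + (a + of_int n * c) - a / 2) / c"
      using assms(1) by (simp add: field_simps)
    then show ?thesis using assms(1) by (simp add: add_diff_eq)
  qed
  have "Q r = Q r' \<longleftrightarrow> cos (2 * pi * (r' - a / 2) / c) = cos (2 * pi * (r - a / 2) / c)" by (auto simp: Q_def)
  also have "\<dots> \<longleftrightarrow> (\<exists>n::int. r' = r + of_int n * c \<or> r' = - r + (a + of_int n * c))"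
    unfolding cos_eq 1[symmetric] 2[symmetric] Ints_def by blast
  finally show "Q r = Q r' \<longleftrightarrow> (\<exists>n::int. r' = r + of_int n * c) \<or> (\<exists>n::int. r' = - r + (a + of_int n * c))" by blast
qed

text \<open>The least positive element generates, by division with remainder; finiteness in bounded
  sets makes it exist.\<close>

lemma discrete_subgroup_cyclic:
  fixes S :: "real set"
  assumes S0: "s0 \<in> S" "s0 \<noteq> 0" and diff: "\<And>x y. x \<in> S \<Longrightarrow> y \<in> S \<Longrightarrow> x - y \<in> S"
    and fin: "\<And>M. finite {x \<in> S. \<bar>x\<bar> \<le> M}"
  obtains c where "c > 0" "S = range (\<lambda>n::int. of_int n * c)"
proof -
  have 0: "0 \<in> S" using diff[OF S0(1) S0(1)] by simp
  have neg: "- x \<in> S" if "x \<in> S" for x using diff[OF 0 that] by simp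
  have add: "x + y \<in> S" if "x \<in> S" "y \<in> S" for x y using diff[OF that(1) neg[OF that(2)]] by simp
  have natm: "of_nat n * x \<in> S" if "x \<in> S" for n x
    by (induction n) (auto simp: 0 add that distrib_right)
  have mult: "of_int n * x \<in> S" if "x \<in> S" for n x
    using natm[OF that, of "nat n"] neg[OF natm[OF that, of "nat (- n)"]] by (cases "n \<ge> 0") auto
  define T where "T = {x \<in> S. 0 < x \<and> x \<le> \<bar>s0\<bar>}"
  have "finite T" by (rule finite_subset[OF _ fin[of "\<bar>s0\<bar>"]]) (auto simp: T_def)
  moreover have "\<bar>s0\<bar> \<in> T" using S0 neg by (auto simp: T_def abs_if)
  ultimately have cT: "Min T \<in> T" and cmin: "\<And>x. x \<in> T \<Longrightarrow> Min T \<le> x" by (auto intro: Min_in)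
  define c where "c = Min T"
  have c: "c > 0" "c \<in> S" using cT by (auto simp: T_def c_def)
  have "x = of_int \<lfloor>x / c\<rfloor> * c" if "x \<in> S" for x
  proof (rule ccontr)
    assume ne: "x \<noteq> of_int \<lfloor>x / c\<rfloor> * c"
    define y where "y = x - of_int \<lfloor>x / c\<rfloor> * c"
    have "y \<in> S" unfolding y_def by (intro diff that mult c)
    have "of_int \<lfloor>x / c\<rfloor> * c \<le> x" using c(1) by (simp add: pos_le_divide_eq[symmetric])
    moreover have "x / c < of_int \<lfloor>x / c\<rfloor> + 1" by simp
    then have "x < (of_int \<lfloor>x / c\<rfloor> + 1) * c" using c(1) by (simp only: pos_divide_less_eq)
    ultimately have "0 < y" "y < c" using ne by (auto simp: y_def algebra_simps)
    moreover have "c \<le> \<bar>s0\<bar>" using cT by (simp add: T_def c_def)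
    ultimately have "y \<in> T" using \<open>y \<in> S\<close> by (simp add: T_def)
    then show False using cmin \<open>y < c\<close> by (fastforce simp: c_def)
  qed
  then have "S = range (\<lambda>n::int. of_int n * c)" using mult[OF c(2)] by blast
  then show thesis using that c(1) by blast
qed

section \<open>Axial coordinate on the fixed point set\<close>

text \<open>The ratio of the diagonal entries is \<open>exp u\<close>, and the cone condition
  \<open>Re (p cnj q) > 0\<close> becomes \<open>cos (Im u) > 0\<close>, which holds on the strip.
  The halves make the diagonal matrix unimodular.\<close>

definition axis_point :: "complex ^ 2 ^ 2 \<Rightarrow> complex \<Rightarrow> complex ^ 4" where
  "axis_point Q u = of_axis_coords Q (mat2 (exp (u / 2)) 0 0 (exp (- u / 2)))"

lemma exp_half_cnj: "exp (u / 2) * cnj (exp (- u / 2)) = exp (\<i> * of_real (Im u))"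
proof -
  have "exp (u / 2) * cnj (exp (- u / 2)) = exp (u / 2 + cnj (- u / 2))" by (simp only: exp_cnj exp_add)
  also have "u / 2 + cnj (- u / 2) = \<i> * of_real (Im u)" by (simp add: complex_eq_iff)
  finally show ?thesis .
qed

lemma axis_point_ccone: "det Q = 1 \<Longrightarrow> u \<in> strip \<Longrightarrow> axis_point Q u \<in> ccone"
  unfolding axis_point_def by (subst diag_in_ccone) (auto simp only: exp_half_cnj, simp add: Re_exp strip_def cos_gt_zero_pi abs_less_iff)

lemma exp_conj_scale:
  assumes "w \<noteq> 0"
  shows "w * exp v * cnj w = exp (v + of_real (4 * ln (cmod w)) / 2)"
    "inverse w * exp v * cnj (inverse w) = exp (v - of_real (4 * ln (cmod w)) / 2)"
proof -
  define c where "c = 4 * ln (cmod w)"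
  have "exp (c / 2) = (cmod w)\<^sup>2" using assms by (simp add: c_def exp_double)
  then have "w * cnj w = of_real (exp (c / 2))" by (simp only: complex_norm_square)
  then have a: "w * cnj w = exp (of_real c / 2)" by (simp add: exp_of_real[symmetric])
  have "w * exp v * cnj w = exp v * (w * cnj w)" by (simp only: mult_ac)
  then show "w * exp v * cnj w = exp (v + of_real (4 * ln (cmod w)) / 2)"
    unfolding a exp_add[symmetric] c_def .
  have "inverse w * exp v * cnj (inverse w) = exp v / (w * cnj w)" by (simp add: divide_inverse mult_ac)
  then show "inverse w * exp v * cnj (inverse w) = exp (v - of_real (4 * ln (cmod w)) / 2)"
    unfolding a exp_diff[symmetric] c_def .
qed

lemma axis_point_translate:
  assumes "B ** Q = Q ** mat2 \<alpha> 0 0 (inverse \<alpha>)" "\<alpha> \<noteq> 0"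
  shows "cmatrix B *v axis_point Q u = axis_point Q (u + of_real (4 * ln (cmod \<alpha>)))"
proof -
  define c where "c = complex_of_real (4 * ln (cmod \<alpha>))"
  have d: "(u + c) / 2 = u / 2 + c / 2" "- (u + c) / 2 = - u / 2 - c / 2" by (simp_all add: field_simps)
  have e: "exp ((u + c) / 2) = \<alpha> * exp (u / 2) * cnj \<alpha>"
    "exp (- (u + c) / 2) = inverse \<alpha> * exp (- u / 2) * cnj (inverse \<alpha>)"
    by (simp_all only: exp_conj_scale[OF assms(2)] c_def[symmetric] d)
  have "mat2 \<alpha> 0 0 (inverse \<alpha>) ** mat2 x 0 0 y ** conj_transpose (mat2 \<alpha> 0 0 (inverse \<alpha>)) =
     mat2 (\<alpha> * x * cnj \<alpha>) 0 0 (inverse \<alpha> * y * cnj (inverse \<alpha>))" for x y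
    by (simp add: mat2_eq_iff mult2_nth)
  then show ?thesis unfolding axis_point_def cmatrix_axis[OF assms(1)] c_def[symmetric] e by simp
qed

lemma axis_point_flip:
  assumes "B ** Q = Q ** mat2 0 \<beta> (- inverse \<beta>) 0" "\<beta> \<noteq> 0"
  shows "cmatrix B *v axis_point Q u = axis_point Q (- u + of_real (4 * ln (cmod \<beta>)))"
proof -
  define c where "c = complex_of_real (4 * ln (cmod \<beta>))"
  have d: "(- u + c) / 2 = - u / 2 + c / 2" "- (- u + c) / 2 = u / 2 - c / 2" by (simp_all add: field_simps)
  have e: "exp ((- u + c) / 2) = \<beta> * exp (- u / 2) * cnj \<beta>"
    "exp (- (- u + c) / 2) = inverse \<beta> * exp (u / 2) * cnj (inverse \<beta>)"
    by (simp_all only: exp_conj_scale[OF assms(2)] c_def[symmetric] d)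
  have "mat2 0 \<beta> (- inverse \<beta>) 0 ** mat2 x 0 0 y ** conj_transpose (mat2 0 \<beta> (- inverse \<beta>) 0) =
     mat2 (\<beta> * y * cnj \<beta>) 0 0 (inverse \<beta> * x * cnj (inverse \<beta>))" for x y
    by (simp add: mat2_eq_iff mult2_nth)
  then show ?thesis unfolding axis_point_def cmatrix_axis[OF assms(1)] c_def[symmetric] e by simp
qed

lemma continuous_affine_chart: "continuous_map complex_hyperbolic_3_space euclidean affine_chart"
proof (rule continuous_compose_quotient_map[OF quotient_map_ccone])
  have "continuous_on ccone (\<lambda>z :: complex ^ 4. \<chi> i :: 3. (if i = 1 then z $ 1 else if i = 2 then z $ 2 else z $ 3) / z $ 0)"
  proof (rule continuous_on_vec_lambda)
    show "continuous_on ccone (\<lambda>z :: complex ^ 4. (if i = 1 then z $ 1 else if i = 2 then z $ 2 else z $ 3) / z $ 0)" for i :: 3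
      by (cases "i = 1"; cases "i = 2") (auto intro!: continuous_intros simp: ccone_nonzero(1))
  qed
  moreover have "(\<chi> i :: 3. (if i = 1 then z $ 1 else if i = 2 then z $ 2 else z $ 3) / z $ 0) = (affine_chart \<circ> line) z"
    if "z \<in> ccone" for z :: "complex ^ 4"
    using ccone_nonzero(1)[OF that] by (simp add: affine_chart_line vec_eq_iff forall_3)
  ultimately have "continuous_on ccone (affine_chart \<circ> line)" by (simp cong: continuous_on_cong)
  then show "continuous_map (top_of_set ccone) euclidean (affine_chart \<circ> line)" by simp
qed

text \<open>The inverse of \<open>u \<mapsto> [axis_point Q u]\<close> on the fixed point set is \<open>Ln (p/q)\<close> in the diagonal coordinates
  \<open>p, q\<close>.\<close>

lemma quotient_map_axis_point:
  assumes E: "elliptic_form A Q \<zeta> t"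
  shows "quotient_map (top_of_set strip)
     (subtopology complex_hyperbolic_3_space (fixed_set complex_hyperbolic_3_space complex_action (pm A)))
     (\<lambda>u. line (axis_point Q u))"
    and "inj_on (\<lambda>u. line (axis_point Q u)) strip"
    and "(\<lambda>u. line (axis_point Q u)) ` strip = fixed_set complex_hyperbolic_3_space complex_action (pm A)"
proof -
  let ?F = "fixed_set complex_hyperbolic_3_space complex_action (pm A)"
  have Q: "det Q = 1" using E by (simp add: elliptic_form_def)
  define Y where "Y z = axis_coords Q z" for z
  \<comment> \<open>The ratio of the diagonal entries is unchanged by scaling, so it may be computed
    from the representative with coordinate 0 equal to 1, which the chart provides.\<close>
  define \<sigma> where "\<sigma> l = Ln (Y (hom_coords (affine_chart l)) $ 1 $ 1 / Y (hom_coords (affine_chart l)) $ 2 $ 2)" for l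
  have Yscale: "Y (c *s z) $ i $ i = c * Y z $ i $ i" for c z i
  proof -
    have "cmat (c *s z) = mat c ** cmat z" by (simp add: mat2_eq_iff mult2_nth algebra_simps)
    then have "Y (c *s z) = mat c ** Y z" by (simp add: Y_def axis_coords_def) (simp add: mat2_eq_iff mult2_nth algebra_simps)
    then show ?thesis by (simp add: matrix_matrix_mult_def mat_def if_distrib[of "\<lambda>x. x * _"] cong: if_cong)
  qed
  have \<sigma>: "\<sigma> (line (of_axis_coords Q (mat2 p 0 0 q))) = Ln (p / q)" if "of_axis_coords Q (mat2 p 0 0 q) \<in> ccone" for p q
    using ccone_nonzero(1)[OF that] by (simp add: \<sigma>_def line_hom_chart(1) Yscale) (simp add: Y_def axis_coords_inverse(1)[OF Q])
  have pq: "q \<noteq> 0 \<and> p \<noteq> 0 \<and> Re (p / q) > 0" if "of_axis_coords Q (mat2 p 0 0 q) \<in> ccone" for p q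
  proof -
    have r: "Re (p * cnj q) > 0" using that by (simp add: diag_in_ccone Q)
    then have "q \<noteq> 0" "p \<noteq> 0" by auto
    moreover have "p / q = p * cnj q / of_real ((cmod q)\<^sup>2)"
      using complex_div_cnj[of p q] by (simp only: of_real_power)
    then have "Re (p / q) = Re (p * cnj q) / (cmod q)\<^sup>2" by (metis Re_divide_of_real)
    ultimately show ?thesis using r by simp
  qed
  have fixE: "\<exists>p q. of_axis_coords Q (mat2 p 0 0 q) \<in> ccone \<and> l = line (of_axis_coords Q (mat2 p 0 0 q))" if "l \<in> ?F" for l
    using that unfolding elliptic_fixed_set[OF E] by auto
  have \<sigma>strip: "\<sigma> l \<in> strip" and sect: "line (axis_point Q (\<sigma> l)) = l" if l: "l \<in> ?F" for l
  proof -
    obtain p q where c: "of_axis_coords Q (mat2 p 0 0 q) \<in> ccone" "l = line (of_axis_coords Q (mat2 p 0 0 q))"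
      using fixE[OF l] by blast
    note p = pq[OF c(1)]
    have u: "\<sigma> l = Ln (p / q)" unfolding c(2) by (rule \<sigma>[OF c(1)])
    show "\<sigma> l \<in> strip" using p Re_Ln_pos_lt[of "p / q"] by (simp add: u strip_def)
    define u where "u = Ln (p / q)"
    have eu: "exp (u / 2) * exp (u / 2) = p / q" using p by (simp add: u_def flip: exp_add)
    have em: "exp (- u / 2) = inverse (exp (u / 2))" by (simp add: exp_minus)
    define k where "k = q * exp (u / 2)"
    have k: "k \<noteq> 0" "k * exp (u / 2) = p" "k * exp (- u / 2) = q"
      using p eu unfolding em by (simp_all add: k_def mult.assoc)
    have "mat2 p 0 0 q = mat k ** mat2 (exp (u / 2)) 0 0 (exp (- u / 2))"
      using k by (simp add: mat2_eq_iff mult2_nth)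
    then have "of_axis_coords Q (mat2 p 0 0 q) = k *s axis_point Q u"
      unfolding axis_point_def of_axis_coords_scale[symmetric] by simp
    then have "l = line (axis_point Q u)" using k(1) by (simp add: c(2) line_scale)
    then show "line (axis_point Q (\<sigma> l)) = l" using u by (simp add: u_def)
  qed
  have into: "line (axis_point Q u) \<in> ?F" and bck: "\<sigma> (line (axis_point Q u)) = u" if u: "u \<in> strip" for u
  proof -
    have c: "axis_point Q u \<in> ccone" by (rule axis_point_ccone[OF Q u])
    show "line (axis_point Q u) \<in> ?F" unfolding elliptic_fixed_set[OF E] using c by (auto simp: axis_point_def)
    have "\<sigma> (line (axis_point Q u)) = Ln (exp (u / 2) / exp (- u / 2))"
      using \<sigma> c by (simp add: axis_point_def)
    also have "exp (u / 2) / exp (- u / 2) = exp u" by (simp flip: exp_diff)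
    also have "Ln (exp u) = u" using u by (intro Ln_exp) (auto simp: strip_def)
    finally show "\<sigma> (line (axis_point Q u)) = u" .
  qed
  show inj: "inj_on (\<lambda>u. line (axis_point Q u)) strip"
    by (rule inj_on_inverseI[of _ \<sigma>]) (rule bck)
  show "(\<lambda>u. line (axis_point Q u)) ` strip = ?F"
  proof
    show "(\<lambda>u. line (axis_point Q u)) ` strip \<subseteq> ?F" using into by blast
    show "?F \<subseteq> (\<lambda>u. line (axis_point Q u)) ` strip"
    proof
      fix l assume l: "l \<in> ?F"
      show "l \<in> (\<lambda>u. line (axis_point Q u)) ` strip"
        by (rule image_eqI[of _ _ "\<sigma> l"]) (simp_all add: sect[OF l] \<sigma>strip[OF l])
    qed
  qed
  show "quotient_map (top_of_set strip) (subtopology complex_hyperbolic_3_space ?F) (\<lambda>u. line (axis_point Q u))"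
  proof (rule retraction_imp_quotient_map)
    have tF: "topspace (subtopology complex_hyperbolic_3_space ?F) = ?F" by (auto simp: fixed_set_def)
    have "continuous_map (top_of_set strip) (top_of_set ccone) (axis_point Q)"
    proof -
      have "axis_point Q = (\<lambda>u. \<chi> i. of_axis_coords Q (mat2 1 0 0 0) $ i * exp (u / 2) + of_axis_coords Q (mat2 0 0 0 1) $ i * exp (- u / 2))"
      proof
        fix u
        have e: "mat2 (exp (u / 2)) 0 0 (exp (- u / 2)) = mat (exp (u / 2)) ** mat2 1 0 0 0 + mat (exp (- u / 2)) ** mat2 0 0 0 1"
          by (simp add: mat2_eq_iff mult2_nth)
        show "axis_point Q u = (\<chi> i. of_axis_coords Q (mat2 1 0 0 0) $ i * exp (u / 2) + of_axis_coords Q (mat2 0 0 0 1) $ i * exp (- u / 2))"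
          unfolding axis_point_def e of_axis_coords_add of_axis_coords_scale by (simp add: vec_eq_iff mult.commute)
      qed
      then have "continuous_on strip (axis_point Q)" by (simp only:) (intro continuous_intros; simp)
      then show ?thesis using axis_point_ccone[OF Q] by auto
    qed
    then have "continuous_map (top_of_set strip) complex_hyperbolic_3_space (line \<circ> axis_point Q)"
      using quotient_imp_continuous_map[OF quotient_map_ccone] by (rule continuous_map_compose)
    then have 1: "continuous_map (top_of_set strip) (subtopology complex_hyperbolic_3_space ?F) (\<lambda>u. line (axis_point Q u))"
      using into by (auto simp: continuous_map_in_subtopology o_def)
    have chom: "continuous_on UNIV hom_coords"
    proof -
      have "hom_coords = (\<lambda>u. \<chi> i. if i = 1 then u $ 1 else if i = 2 then u $ 2 else if i = 3 then u $ 3 else 1)"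
        by (auto simp: fun_eq_iff vec_eq_iff forall_4_0)
      moreover have "continuous_on UNIV (\<lambda>u :: complex^3. \<chi> i :: 4. if i = 1 then u $ 1 else if i = 2 then u $ 2 else if i = 3 then u $ 3 else 1)"
      proof (rule continuous_on_vec_lambda)
        show "continuous_on UNIV (\<lambda>u :: complex^3. if i = 1 then u $ 1 else if i = 2 then u $ 2 else if i = 3 then u $ 3 else 1)" for i :: 4
          by (cases "i = 1"; cases "i = 2"; cases "i = 3") (auto intro: continuous_intros)
      qed
      ultimately show ?thesis by metis
    qed
    \<comment> \<open>The right half-plane avoids the branch cut of \<open>Ln\<close>. The condition
      also excludes a vanishing denominator, since division by 0 gives 0.\<close>
    define V where "V = {w. Re (Y (hom_coords w) $ 1 $ 1 / Y (hom_coords w) $ 2 $ 2) > 0}"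
    have "continuous_on UNIV (\<lambda>z. Y z $ i $ j)" for i j
      unfolding Y_def axis_coords_def cmat_def vector_def by (simp add: mult2_nth) (intro continuous_intros)
    then have cY: "continuous_on V (\<lambda>w. Y (hom_coords w) $ i $ j)" for i j
      by (rule continuous_on_compose2[OF _ continuous_on_subset[OF chom]]) auto
    have "continuous_on V (\<lambda>w. Ln (Y (hom_coords w) $ 1 $ 1 / Y (hom_coords w) $ 2 $ 2))"
      by (intro continuous_intros cY) (auto simp: V_def complex_nonpos_Reals_iff)
    then have "continuous_map (top_of_set V) euclidean (\<lambda>w. Ln (Y (hom_coords w) $ 1 $ 1 / Y (hom_coords w) $ 2 $ 2))" by simp
    moreover have "continuous_map (subtopology complex_hyperbolic_3_space ?F) (top_of_set V) affine_chart"
    proof -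
      have "affine_chart l \<in> V" if l: "l \<in> ?F" for l
      proof -
        obtain p q where c: "of_axis_coords Q (mat2 p 0 0 q) \<in> ccone" "l = line (of_axis_coords Q (mat2 p 0 0 q))"
          using fixE[OF l] by blast
        have "Y (hom_coords (affine_chart l)) $ 1 $ 1 / Y (hom_coords (affine_chart l)) $ 2 $ 2 = p / q"
          using ccone_nonzero(1)[OF c(1)] by (simp add: c(2) line_hom_chart(1) Yscale) (simp add: Y_def axis_coords_inverse(1)[OF Q])
        then show ?thesis using pq[OF c(1)] by (simp add: V_def)
      qed
      then show ?thesis using continuous_affine_chart
        by (auto simp: continuous_map_in_subtopology tF continuous_map_from_subtopology)
    qed
    ultimately have "continuous_map (subtopology complex_hyperbolic_3_space ?F) euclidean
       ((\<lambda>w. Ln (Y (hom_coords w) $ 1 $ 1 / Y (hom_coords w) $ 2 $ 2)) \<circ> affine_chart)" by (rule continuous_map_compose[rotated])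
    then have "continuous_map (subtopology complex_hyperbolic_3_space ?F) euclidean \<sigma>"
      unfolding \<sigma>_def[abs_def] o_def .
    then have 2: "continuous_map (subtopology complex_hyperbolic_3_space ?F) (top_of_set strip) \<sigma>"
      using \<sigma>strip by (auto simp: continuous_map_in_subtopology tF)
    show "retraction_map (top_of_set strip) (subtopology complex_hyperbolic_3_space ?F) (\<lambda>u. line (axis_point Q u))"
      unfolding retraction_map_def retraction_maps_def using 1 2 sect by (auto simp: tF)
  qed
qed

section \<open>Centralisers of elliptic elements\<close>

lemma conj_frame_mult: "B ** Q = Q ** E \<Longrightarrow> B' ** Q = Q ** E' \<Longrightarrow> (B ** B') ** Q = Q ** (E ** E')"
  by (metis matrix_mul_assoc)

lemma frame_cancel:
  fixes Q X Y :: "complex ^ 2 ^ 2"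
  assumes "det Q = 1" shows "X ** Q = Y ** Q \<longleftrightarrow> X = Y" "Q ** X = Q ** Y \<longleftrightarrow> X = Y"
proof -
  have 1: "Q ** adj2 Q = mat 1" "adj2 Q ** Q = mat 1" using assms by (simp_all add: adj2_mult)
  show "X ** Q = Y ** Q \<longleftrightarrow> X = Y" by (metis 1(1) matrix_mul_assoc matrix_mul_rid)
  show "Q ** X = Q ** Y \<longleftrightarrow> X = Y" by (metis 1(2) matrix_mul_assoc matrix_mul_lid)
qed

lemma conj_frame_adj2:
  fixes Q B E :: "complex ^ 2 ^ 2"
  assumes "det Q = 1" "det B = 1" "B ** Q = Q ** E"
  shows "adj2 B ** Q = Q ** adj2 E"
proof -
  have "det E = 1" using arg_cong[OF assms(3), of det] assms(1,2) by (simp add: det_mul)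
  have "adj2 B ** Q ** E = adj2 B ** (B ** Q)" by (simp add: assms(3) matrix_mul_assoc)
  also have "\<dots> = Q" using assms(2) by (simp add: matrix_mul_assoc adj2_mult)
  finally have "adj2 B ** Q ** (E ** adj2 E) = Q ** adj2 E" by (simp add: matrix_mul_assoc)
  then show ?thesis using \<open>det E = 1\<close> by (simp add: adj2_mult)
qed

lemma frame_exists:
  fixes Q B :: "complex ^ 2 ^ 2"
  assumes "det Q = 1" "det B = 1"
  obtains E where "B ** Q = Q ** E" "det E = 1"
proof
  have "Q ** adj2 Q = mat 1" using assms by (simp add: adj2_mult)
  then show "B ** Q = Q ** (adj2 Q ** B ** Q)" by (simp add: matrix_mul_assoc)
  show "det (adj2 Q ** B ** Q) = 1" using assms by (simp add: det_mul)
qed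

context imaginary_quadratic
begin

lemma elliptic_cases:
  assumes "elliptic_form A Q \<zeta> t"
  shows "det Q = 1" "\<zeta> * cnj \<zeta> = 1" "\<zeta> \<noteq> cnj \<zeta>" "\<zeta> \<noteq> 0" "A ** Q = Q ** mat2 \<zeta> 0 0 (cnj \<zeta>)"
    "\<zeta> + cnj \<zeta> = of_int t"
proof -
  show "det Q = 1" "A ** Q = Q ** mat2 \<zeta> 0 0 (cnj \<zeta>)" "\<zeta> + cnj \<zeta> = of_int t" using assms by (auto simp: elliptic_form_def)
  show 1: "\<zeta> * cnj \<zeta> = 1" using assms unit_circle_cnj by (auto simp: elliptic_form_def)
  then show "\<zeta> \<noteq> 0" by auto
  show "\<zeta> \<noteq> cnj \<zeta>"
  proof
    assume "\<zeta> = cnj \<zeta>"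
    then have "\<zeta>\<^sup>2 = 1" using 1 by (metis power2_eq_square)
    then show False using assms by (simp add: elliptic_form_def)
  qed
qed

text \<open>Commuting in PSL2 means commuting up to sign in SL2. With the sign + the frame matrix
  commutes with a diagonal matrix of distinct entries and is diagonal. With the sign - it is
  antidiagonal, and a nonzero antidiagonal entry requires \<open>\<zeta>\<close> and
  \<open>cnj \<zeta>\<close> to be opposite.\<close>

lemma centralizer_cases:
  assumes A: "A \<in> carrier (SL2 R)" "elliptic_form A Q \<zeta> t" and B: "B \<in> carrier (SL2 R)"
    and comm: "pm B \<otimes>\<^bsub>PSL2 R\<^esub> pm A = pm A \<otimes>\<^bsub>PSL2 R\<^esub> pm B"
  obtains \<alpha> where "\<alpha> \<noteq> 0" "B ** Q = Q ** mat2 \<alpha> 0 0 (inverse \<alpha>)"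
  | \<beta> where "\<beta> \<noteq> 0" "B ** Q = Q ** mat2 0 \<beta> (- inverse \<beta>) 0" "\<zeta> + cnj \<zeta> = 0"
proof -
  note Q = elliptic_cases[OF A(2)]
  have dB: "det B = 1" using B by (simp add: SL2_carrier)
  obtain E where E: "B ** Q = Q ** E" "det E = 1" by (rule frame_exists[OF Q(1) dB])
  let ?D = "mat2 \<zeta> 0 0 (cnj \<zeta>)"
  have BA: "(B ** A) ** Q = Q ** (E ** ?D)" by (rule conj_frame_mult[OF E(1) Q(5)])
  have AB: "(A ** B) ** Q = Q ** (?D ** E)" by (rule conj_frame_mult[OF Q(5) E(1)])
  have dE: "E$1$1 * E$2$2 - E$1$2 * E$2$1 = 1" using E(2) by (simp add: det_2)
  have "pm (B ** A) = pm (A ** B)" using comm by (simp add: PSL2_mult A B)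
  then consider "A ** B = B ** A" | "A ** B = - (B ** A)" by (auto simp: pm_eq_iff)
  then show thesis
  proof cases
    case 1
    then have "E ** ?D = ?D ** E" using BA AB frame_cancel(2)[OF Q(1)] by metis
    then have "E$1$2 * cnj \<zeta> = \<zeta> * E$1$2" "E$2$1 * \<zeta> = cnj \<zeta> * E$2$1" by (simp_all add: mat2_eq_iff mult2_nth)
    then have "E$1$2 = 0" "E$2$1 = 0" using Q(3) by (auto simp: mult.commute)
    moreover from this have "E$1$1 * E$2$2 = 1" using dE by simp
    moreover from this have "E$2$2 = inverse (E$1$1)" "E$1$1 \<noteq> 0" by (auto simp: inverse_unique)
    ultimately have "E = mat2 (E$1$1) 0 0 (inverse (E$1$1))" "E$1$1 \<noteq> 0" by (simp_all add: mat2_eq_iff)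
    then show thesis using E(1) that(1) by metis
  next
    case 2
    then have "?D ** E = - (E ** ?D)" using BA AB frame_cancel(2)[OF Q(1)] by (metis uminus_mult2)
    then have e: "\<zeta> * E$1$1 = - (\<zeta> * E$1$1)" "cnj \<zeta> * E$2$2 = - (cnj \<zeta> * E$2$2)" "\<zeta> * E$1$2 = - (cnj \<zeta> * E$1$2)"
      by (simp_all add: mat2_eq_iff mult2_nth mult.commute)
    have neg0: "x = 0" if x: "x = - x" for x :: complex
    proof -
      have "x + x = 0" by (rule eq_neg_iff_add_eq_0[THEN iffD1, OF x])
      then have "2 * x = 0" unfolding mult_2 .
      then show ?thesis by simp
    qed
    have "\<zeta> * E$1$1 = 0" "cnj \<zeta> * E$2$2 = 0" by (rule neg0[OF e(1)], rule neg0[OF e(2)])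
    then have z: "E$1$1 = 0" "E$2$2 = 0" using Q(4) by auto
    then have "E$1$2 * - E$2$1 = 1" using dE by simp
    then have b: "E$1$2 \<noteq> 0" "- E$2$1 = inverse (E$1$2)" by (auto intro: inverse_unique[symmetric])
    have "(\<zeta> + cnj \<zeta>) * E$1$2 = 0" using e(3) by (simp add: distrib_right)
    then have "\<zeta> + cnj \<zeta> = 0" using b(1) by simp
    moreover have "E = mat2 0 (E$1$2) (- inverse (E$1$2)) 0" using z arg_cong[OF b(2), of uminus] by (simp add: mat2_eq_iff)
    ultimately show thesis using E(1) b(1) that(2) by metis
  qed
qed

text \<open>In the frame of \<open>A\<close> the relation, which holds up to sign, kills the
  diagonal entries of \<open>B\<close>; for the sign - this uses \<open>t \<noteq> 0\<close>. A
  matrix of determinant 1 with zero diagonal has square -1, so an inverting element is automatically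
  an involution in PSL2.\<close>

lemma inverting_case:
  assumes A: "A \<in> carrier (SL2 R)" "elliptic_form A Q \<zeta> t" "t \<noteq> 0" and B: "B \<in> carrier (SL2 R)"
    and inv: "pm B \<otimes>\<^bsub>PSL2 R\<^esub> pm A = pm (adj2 A) \<otimes>\<^bsub>PSL2 R\<^esub> pm B"
  shows "pm B \<otimes>\<^bsub>PSL2 R\<^esub> pm B = \<one>\<^bsub>PSL2 R\<^esub>"
proof -
  note Q = elliptic_cases[OF A(2)]
  have dB: "det B = 1" "det A = 1" using A B by (simp_all add: SL2_carrier)
  obtain E where E: "B ** Q = Q ** E" "det E = 1" by (rule frame_exists[OF Q(1) dB(1)])
  let ?D = "mat2 \<zeta> 0 0 (cnj \<zeta>)" and ?D' = "mat2 (cnj \<zeta>) 0 0 \<zeta>"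
  have "adj2 ?D = ?D'" by (simp add: mat2_eq_iff)
  then have A': "adj2 A ** Q = Q ** ?D'" using conj_frame_adj2[OF Q(1) dB(2) Q(5)] by simp
  have BA: "(B ** A) ** Q = Q ** (E ** ?D)" by (rule conj_frame_mult[OF E(1) Q(5)])
  have AB: "(adj2 A ** B) ** Q = Q ** (?D' ** E)" by (rule conj_frame_mult[OF A' E(1)])
  have dE: "E$1$1 * E$2$2 - E$1$2 * E$2$1 = 1" using E(2) by (simp add: det_2)
  have "pm (B ** A) = pm (adj2 A ** B)" using inv by (simp add: PSL2_mult A B SL2_adj2_closed)
  then consider "adj2 A ** B = B ** A" | "adj2 A ** B = - (B ** A)" by (auto simp: pm_eq_iff)
  then have "E$1$1 = 0 \<and> E$2$2 = 0"
  proof cases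
    case 1
    then have "E ** ?D = ?D' ** E" using BA AB frame_cancel(2)[OF Q(1)] by metis
    then have "E$1$1 * \<zeta> = cnj \<zeta> * E$1$1" "E$2$2 * cnj \<zeta> = \<zeta> * E$2$2" by (simp_all add: mat2_eq_iff mult2_nth)
    then show ?thesis using Q(3) by (auto simp: mult.commute)
  next
    case 2
    then have "?D' ** E = - (E ** ?D)" using BA AB frame_cancel(2)[OF Q(1)] by (metis uminus_mult2)
    then have "cnj \<zeta> * E$1$1 = - (\<zeta> * E$1$1)" "\<zeta> * E$2$2 = - (cnj \<zeta> * E$2$2)" by (simp_all add: mat2_eq_iff mult2_nth mult.commute)
    then have "(\<zeta> + cnj \<zeta>) * E$1$1 = 0" "(\<zeta> + cnj \<zeta>) * E$2$2 = 0" by (simp_all add: distrib_right)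
    then show ?thesis using Q(6) A(3) by simp
  qed
  then have z: "E$1$1 = 0" "E$2$2 = 0" "E$1$2 * E$2$1 = - 1" "E$2$1 * E$1$2 = - 1"
    using dE by (auto simp: algebra_simps) (metis minus_minus mult.commute)+
  have "E ** E = - mat 1" using z by (simp add: mat2_eq_iff mult2_nth)
  then have "(B ** B) ** Q = (- mat 1) ** Q" using conj_frame_mult[OF E(1) E(1)] by (simp add: uminus_mult2)
  then have "B ** B = - mat 1" using frame_cancel(1)[OF Q(1)] by blast
  then show ?thesis using B by (simp add: PSL2_mult PSL2_one pm_eq_iff)
qed

text \<open>A diagonal matrix with entry \<open>\<alpha>\<close> multiplies \<open>p\<close> by
  \<open>|\<alpha>|^2\<close> and \<open>q\<close> by its inverse, hence
  \<open>exp u = p / q\<close> by \<open>|\<alpha>|^4\<close>; this is the origin of the 4. Up to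
  sign the value is twice the hyperbolic translation length.\<close>

definition translation_lengths :: "(complex ^ 2 ^ 2) set set \<Rightarrow> complex ^ 2 ^ 2 \<Rightarrow> real set" where
  "translation_lengths C Q = {4 * ln (cmod \<alpha>) | B \<alpha>. B \<in> carrier (SL2 R) \<and> pm B \<in> C \<and> \<alpha> \<noteq> 0 \<and>
     B ** Q = Q ** mat2 \<alpha> 0 0 (inverse \<alpha>)}"

definition flip_constants :: "(complex ^ 2 ^ 2) set set \<Rightarrow> complex ^ 2 ^ 2 \<Rightarrow> real set" where
  "flip_constants C Q = {4 * ln (cmod \<beta>) | B \<beta>. B \<in> carrier (SL2 R) \<and> pm B \<in> C \<and> \<beta> \<noteq> 0 \<and>
     B ** Q = Q ** mat2 0 \<beta> (- inverse \<beta>) 0}"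

lemma ln_cmod_mult: "x \<noteq> 0 \<Longrightarrow> y \<noteq> 0 \<Longrightarrow> 4 * ln (cmod (x * y)) = 4 * ln (cmod x) + 4 * ln (cmod y)"
  and ln_cmod_inverse: "4 * ln (cmod (inverse x)) = - (4 * ln (cmod x))"
  by (simp_all add: norm_mult ln_mult norm_inverse ln_inverse)

lemma subgroup_pm:
  assumes "subgroup C (PSL2 R)" "B \<in> carrier (SL2 R)" "B' \<in> carrier (SL2 R)" "pm B \<in> C" "pm B' \<in> C"
  shows "pm (B ** B') \<in> C" "pm (adj2 B) \<in> C"
  using subgroup.m_closed[OF assms(1,4,5)] subgroup.m_inv_closed[OF assms(1,4)] assms(2,3)
  by (simp_all add: PSL2_mult PSL2_inv)

lemma translation_lengths_diff:
  assumes C: "subgroup C (PSL2 R)" and Q: "det Q = 1"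
    and x: "x \<in> translation_lengths C Q" and y: "y \<in> translation_lengths C Q"
  shows "x - y \<in> translation_lengths C Q"
proof -
  obtain B \<alpha> where B: "B \<in> carrier (SL2 R)" "pm B \<in> C" "\<alpha> \<noteq> 0" "B ** Q = Q ** mat2 \<alpha> 0 0 (inverse \<alpha>)" "x = 4 * ln (cmod \<alpha>)"
    using x by (auto simp: translation_lengths_def)
  obtain B' \<alpha>' where B': "B' \<in> carrier (SL2 R)" "pm B' \<in> C" "\<alpha>' \<noteq> 0" "B' ** Q = Q ** mat2 \<alpha>' 0 0 (inverse \<alpha>')" "y = 4 * ln (cmod \<alpha>')"
    using y by (auto simp: translation_lengths_def)
  have d: "det B' = 1" using B'(1) by (simp add: SL2_carrier)
  have "(B ** adj2 B') ** Q = Q ** (mat2 \<alpha> 0 0 (inverse \<alpha>) ** adj2 (mat2 \<alpha>' 0 0 (inverse \<alpha>')))"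
    by (rule conj_frame_mult[OF B(4) conj_frame_adj2[OF Q d B'(4)]])
  also have "mat2 \<alpha> 0 0 (inverse \<alpha>) ** adj2 (mat2 \<alpha>' 0 0 (inverse \<alpha>')) = mat2 (\<alpha> * inverse \<alpha>') 0 0 (inverse (\<alpha> * inverse \<alpha>'))"
    by (simp add: mat2_eq_iff mult2_nth)
  finally have "(B ** adj2 B') ** Q = Q ** mat2 (\<alpha> * inverse \<alpha>') 0 0 (inverse (\<alpha> * inverse \<alpha>'))" .
  moreover have "B ** adj2 B' \<in> carrier (SL2 R)" using B(1) B'(1) by (intro SL2_mult_closed SL2_adj2_closed)
  moreover have "pm (B ** adj2 B') \<in> C" using subgroup_pm[OF C] B B' SL2_adj2_closed by blast
  moreover have "\<alpha> * inverse \<alpha>' \<noteq> 0" using B(3) B'(3) by simp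
  moreover have "x - y = 4 * ln (cmod (\<alpha> * inverse \<alpha>'))"
    using B(3) B'(3) by (subst ln_cmod_mult) (auto simp only: ln_cmod_inverse B(5) B'(5), auto)
  ultimately show ?thesis unfolding translation_lengths_def by blast
qed

text \<open>A bound on the length bounds \<open>\<alpha>\<close> and its inverse, hence the entries
  of \<open>B\<close>, which is conjugate to the diagonal matrix by the fixed \<open>Q\<close>. Only
  finitely many elements of \<open>R\<close> are available as entries.\<close>

lemma translation_lengths_finite:
  assumes Q: "det Q = 1"
  shows "finite {x \<in> translation_lengths C Q. \<bar>x\<bar> \<le> M}"
proof -
  define q where "q = cmod (Q$1$1) + cmod (Q$1$2) + cmod (Q$2$1) + cmod (Q$2$2)"
  define N where "N = q * exp (M / 4) * q + q * exp (M / 4) * q"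
  define RB where "RB = {x \<in> R. cmod x \<le> N}"
  let ?B = "(\<lambda>(a, b, c, d). mat2 a b c d) ` (RB \<times> RB \<times> RB \<times> RB)"
  let ?f = "\<lambda>B. 4 * ln (cmod ((adj2 Q ** B ** Q) $ 1 $ 1))"
  have QQ: "adj2 Q ** Q = mat 1" "Q ** adj2 Q = mat 1" using Q by (simp_all add: adj2_mult)
  have "{x \<in> translation_lengths C Q. \<bar>x\<bar> \<le> M} \<subseteq> ?f ` ?B"
  proof
    fix x assume "x \<in> {x \<in> translation_lengths C Q. \<bar>x\<bar> \<le> M}"
    then obtain B \<alpha> where B: "B \<in> carrier (SL2 R)" "\<alpha> \<noteq> 0" "B ** Q = Q ** mat2 \<alpha> 0 0 (inverse \<alpha>)" "x = 4 * ln (cmod \<alpha>)"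
      and M: "\<bar>x\<bar> \<le> M" by (auto simp: translation_lengths_def)
    have "adj2 Q ** B ** Q = (adj2 Q ** Q) ** mat2 \<alpha> 0 0 (inverse \<alpha>)" using B(3) by (simp flip: matrix_mul_assoc)
    then have \<alpha>: "(adj2 Q ** B ** Q) $ 1 $ 1 = \<alpha>" by (simp add: QQ)
    have "B ** (Q ** adj2 Q) = Q ** mat2 \<alpha> 0 0 (inverse \<alpha>) ** adj2 Q" using B(3) by (simp add: matrix_mul_assoc)
    then have BQ: "B = Q ** mat2 \<alpha> 0 0 (inverse \<alpha>) ** adj2 Q" by (simp add: QQ)
    have l: "ln (cmod \<alpha>) \<le> M / 4" "- ln (cmod \<alpha>) \<le> M / 4" using M B(4) by auto
    have b: "cmod \<alpha> \<le> exp (M / 4)" using l(1) B(2) by (metis exp_le_cancel_iff exp_ln zero_less_norm_iff)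
    have "cmod (inverse \<alpha>) = exp (- ln (cmod \<alpha>))" using B(2) by (simp add: norm_inverse exp_minus)
    then have b': "cmod (inverse \<alpha>) \<le> exp (M / 4)" using l(2) by simp
    have bound: "cmod (u * \<alpha> * v + u' * inverse \<alpha> * v') \<le> N" if "cmod u \<le> q" "cmod v \<le> q" "cmod u' \<le> q" "cmod v' \<le> q" for u v u' v'
    proof -
      have q0: "q \<ge> 0" by (simp add: q_def)
      have "cmod (u * \<alpha> * v + u' * inverse \<alpha> * v') \<le> cmod (u * \<alpha> * v) + cmod (u' * inverse \<alpha> * v')" by (rule norm_triangle_ineq)
      also have "\<dots> \<le> N" unfolding N_def norm_mult using that b b' q0 by (intro add_mono mult_mono) auto
      finally show ?thesis .
    qed
    have Qb: "cmod (Q$1$1) \<le> q" "cmod (Q$1$2) \<le> q" "cmod (Q$2$1) \<le> q" "cmod (Q$2$2) \<le> q" by (auto simp: q_def)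
    have "B$1$1 \<in> RB" "B$1$2 \<in> RB" "B$2$1 \<in> RB" "B$2$2 \<in> RB"
      using bound[of "Q$1$1" "Q$2$2" "Q$1$2" "- Q$2$1"] bound[of "Q$1$1" "- Q$1$2" "Q$1$2" "Q$1$1"]
        bound[of "Q$2$1" "Q$2$2" "Q$2$2" "- Q$2$1"] bound[of "Q$2$1" "- Q$1$2" "Q$2$2" "Q$1$1"] Qb B(1)
      unfolding RB_def SL2_carrier by (simp_all add: BQ mult2_nth)
    moreover have "B = (case (B$1$1, B$1$2, B$2$1, B$2$2) of (a, b, c, d) \<Rightarrow> mat2 a b c d)" by (simp add: mat2_eq_iff)
    ultimately have "B \<in> ?B" by blast
    then show "x \<in> ?f ` ?B" using \<alpha> B(4) by (intro image_eqI[of _ _ B]) simp_all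
  qed
  moreover have "finite (?f ` ?B)"
    by (intro finite_imageI finite_cartesian_product) (simp_all add: RB_def finite_R_bounded)
  ultimately show ?thesis by (rule finite_subset)
qed

text \<open>A flip times the inverse of another flip is a translation, so the flips, if there are
  any, form one coset of the translations.\<close>

lemma flip_constants_shift:
  assumes C: "subgroup C (PSL2 R)" and Q: "det Q = 1" and f0: "f0 \<in> flip_constants C Q"
  shows "f \<in> flip_constants C Q \<longleftrightarrow> f - f0 \<in> translation_lengths C Q"
proof -
  obtain B0 \<beta>0 where B0: "B0 \<in> carrier (SL2 R)" "pm B0 \<in> C" "\<beta>0 \<noteq> 0" "B0 ** Q = Q ** mat2 0 \<beta>0 (- inverse \<beta>0) 0" "f0 = 4 * ln (cmod \<beta>0)"
    using f0 by (auto simp: flip_constants_def)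
  have d: "det B0 = 1" using B0(1) by (simp add: SL2_carrier)
  show ?thesis
  proof
    assume "f \<in> flip_constants C Q"
    then obtain B \<beta> where B: "B \<in> carrier (SL2 R)" "pm B \<in> C" "\<beta> \<noteq> 0" "B ** Q = Q ** mat2 0 \<beta> (- inverse \<beta>) 0" "f = 4 * ln (cmod \<beta>)"
      by (auto simp: flip_constants_def)
    have "(B ** adj2 B0) ** Q = Q ** (mat2 0 \<beta> (- inverse \<beta>) 0 ** adj2 (mat2 0 \<beta>0 (- inverse \<beta>0) 0))"
      by (rule conj_frame_mult[OF B(4) conj_frame_adj2[OF Q d B0(4)]])
    also have "mat2 0 \<beta> (- inverse \<beta>) 0 ** adj2 (mat2 0 \<beta>0 (- inverse \<beta>0) 0) = mat2 (\<beta> * inverse \<beta>0) 0 0 (inverse (\<beta> * inverse \<beta>0))"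
      by (simp add: mat2_eq_iff mult2_nth)
    finally have "(B ** adj2 B0) ** Q = Q ** mat2 (\<beta> * inverse \<beta>0) 0 0 (inverse (\<beta> * inverse \<beta>0))" .
    moreover have "B ** adj2 B0 \<in> carrier (SL2 R)" using B(1) B0(1) by (intro SL2_mult_closed SL2_adj2_closed)
    moreover have "pm (B ** adj2 B0) \<in> C" using subgroup_pm[OF C] B B0 SL2_adj2_closed by blast
    moreover have "\<beta> * inverse \<beta>0 \<noteq> 0" using B(3) B0(3) by simp
    moreover have "f - f0 = 4 * ln (cmod (\<beta> * inverse \<beta>0))"
      using B(3) B0(3) by (subst ln_cmod_mult) (auto simp only: ln_cmod_inverse B(5) B0(5), auto)
    ultimately show "f - f0 \<in> translation_lengths C Q" unfolding translation_lengths_def by blast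
  next
    assume "f - f0 \<in> translation_lengths C Q"
    then obtain B \<alpha> where B: "B \<in> carrier (SL2 R)" "pm B \<in> C" "\<alpha> \<noteq> 0" "B ** Q = Q ** mat2 \<alpha> 0 0 (inverse \<alpha>)" "f - f0 = 4 * ln (cmod \<alpha>)"
      by (auto simp: translation_lengths_def)
    have "(B ** B0) ** Q = Q ** (mat2 \<alpha> 0 0 (inverse \<alpha>) ** mat2 0 \<beta>0 (- inverse \<beta>0) 0)"
      by (rule conj_frame_mult[OF B(4) B0(4)])
    also have "mat2 \<alpha> 0 0 (inverse \<alpha>) ** mat2 0 \<beta>0 (- inverse \<beta>0) 0 = mat2 0 (\<alpha> * \<beta>0) (- inverse (\<alpha> * \<beta>0)) 0"
      by (simp add: mat2_eq_iff mult2_nth)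
    finally have "(B ** B0) ** Q = Q ** mat2 0 (\<alpha> * \<beta>0) (- inverse (\<alpha> * \<beta>0)) 0" .
    moreover have "B ** B0 \<in> carrier (SL2 R)" using B(1) B0(1) by (rule SL2_mult_closed)
    moreover have "pm (B ** B0) \<in> C" using subgroup_pm[OF C] B B0 by blast
    moreover have "\<alpha> * \<beta>0 \<noteq> 0" using B(3) B0(3) by simp
    moreover have "f = 4 * ln (cmod (\<alpha> * \<beta>0))"
      using B(3,5) B0(3,5) ln_cmod_mult[of \<alpha> \<beta>0] by linarith
    ultimately show "f \<in> flip_constants C Q" unfolding flip_constants_def by blast
  qed
qed

section \<open>The homotopy type of the sector of an elliptic element\<close>

lemma power_in_finite_index:
  assumes \<Gamma>: "subgroup \<Gamma> (PSL2 R)" "finite (rcosets\<^bsub>PSL2 R\<^esub> \<Gamma>)" and h: "h \<in> carrier (PSL2 R)"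
  obtains k :: nat where "k > 0" "h [^]\<^bsub>PSL2 R\<^esub> k \<in> \<Gamma>"
proof -
  interpret group "PSL2 R" by (rule group_PSL2)
  have "range (\<lambda>n::nat. \<Gamma> #>\<^bsub>PSL2 R\<^esub> (h [^]\<^bsub>PSL2 R\<^esub> n)) \<subseteq> rcosets\<^bsub>PSL2 R\<^esub> \<Gamma>" using h by (auto simp: RCOSETS_def)
  then have "finite (range (\<lambda>n::nat. \<Gamma> #>\<^bsub>PSL2 R\<^esub> (h [^]\<^bsub>PSL2 R\<^esub> n)))" using \<Gamma>(2) by (rule finite_subset)
  then have "\<not> inj (\<lambda>n::nat. \<Gamma> #>\<^bsub>PSL2 R\<^esub> (h [^]\<^bsub>PSL2 R\<^esub> n))" using finite_imageD infinite_UNIV_nat by blast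
  then obtain i j :: nat where ij: "i < j" "\<Gamma> #>\<^bsub>PSL2 R\<^esub> (h [^]\<^bsub>PSL2 R\<^esub> i) = \<Gamma> #>\<^bsub>PSL2 R\<^esub> (h [^]\<^bsub>PSL2 R\<^esub> j)"
    unfolding inj_def by (metis nat_neq_iff)
  have "h [^]\<^bsub>PSL2 R\<^esub> j \<in> \<Gamma> #>\<^bsub>PSL2 R\<^esub> (h [^]\<^bsub>PSL2 R\<^esub> j)"
    using subgroup.one_closed[OF \<Gamma>(1)] h by (force simp: r_coset_def)
  then obtain \<gamma> where \<gamma>: "\<gamma> \<in> \<Gamma>" "h [^]\<^bsub>PSL2 R\<^esub> j = \<gamma> \<otimes>\<^bsub>PSL2 R\<^esub> h [^]\<^bsub>PSL2 R\<^esub> i"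
    unfolding ij(2)[symmetric] by (auto simp: r_coset_def)
  have "h [^]\<^bsub>PSL2 R\<^esub> j = h [^]\<^bsub>PSL2 R\<^esub> (j - i) \<otimes>\<^bsub>PSL2 R\<^esub> h [^]\<^bsub>PSL2 R\<^esub> i" using ij(1) h by (simp add: nat_pow_mult)
  then have "h [^]\<^bsub>PSL2 R\<^esub> (j - i) = \<gamma>"
    using \<gamma> h subgroup.mem_carrier[OF \<Gamma>(1) \<gamma>(1)] by simp
  then show thesis using that[of "j - i"] ij(1) \<gamma>(1) by simp
qed

lemma centralizer_subgroup:
  assumes \<Gamma>: "subgroup \<Gamma> (PSL2 R)" and g: "g \<in> \<Gamma>"
  shows "subgroup (centralizer (PSL2 R\<lparr>carrier := \<Gamma>\<rparr>) g) (PSL2 R)"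
proof -
  interpret group "PSL2 R" by (rule group_PSL2)
  have gc: "g \<in> carrier (PSL2 R)" and sub: "\<And>x. x \<in> \<Gamma> \<Longrightarrow> x \<in> carrier (PSL2 R)"
    using subgroup.mem_carrier[OF \<Gamma>] g by auto
  show ?thesis
  proof (rule subgroupI)
    show "centralizer (PSL2 R\<lparr>carrier := \<Gamma>\<rparr>) g \<noteq> {}" using g by (auto simp: centralizer_def)
    show "inv\<^bsub>PSL2 R\<^esub> a \<in> centralizer (PSL2 R\<lparr>carrier := \<Gamma>\<rparr>) g" if "a \<in> centralizer (PSL2 R\<lparr>carrier := \<Gamma>\<rparr>) g" for a
    proof -
      have a: "a \<in> \<Gamma>" "a \<otimes>\<^bsub>PSL2 R\<^esub> g = g \<otimes>\<^bsub>PSL2 R\<^esub> a" "a \<in> carrier (PSL2 R)" using that sub by (auto simp: centralizer_def)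
      have "inv\<^bsub>PSL2 R\<^esub> a \<otimes>\<^bsub>PSL2 R\<^esub> g = inv\<^bsub>PSL2 R\<^esub> a \<otimes>\<^bsub>PSL2 R\<^esub> (g \<otimes>\<^bsub>PSL2 R\<^esub> a) \<otimes>\<^bsub>PSL2 R\<^esub> inv\<^bsub>PSL2 R\<^esub> a"
        using a(3) gc by (simp add: m_assoc)
      also have "\<dots> = inv\<^bsub>PSL2 R\<^esub> a \<otimes>\<^bsub>PSL2 R\<^esub> (a \<otimes>\<^bsub>PSL2 R\<^esub> g) \<otimes>\<^bsub>PSL2 R\<^esub> inv\<^bsub>PSL2 R\<^esub> a" using a(2) by simp
      also have "\<dots> = g \<otimes>\<^bsub>PSL2 R\<^esub> inv\<^bsub>PSL2 R\<^esub> a" using a(3) gc by (simp flip: m_assoc)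
      finally show ?thesis using subgroup.m_inv_closed[OF \<Gamma> a(1)] by (simp add: centralizer_def)
    qed
    show "a \<otimes>\<^bsub>PSL2 R\<^esub> b \<in> centralizer (PSL2 R\<lparr>carrier := \<Gamma>\<rparr>) g"
      if "a \<in> centralizer (PSL2 R\<lparr>carrier := \<Gamma>\<rparr>) g" "b \<in> centralizer (PSL2 R\<lparr>carrier := \<Gamma>\<rparr>) g" for a b
    proof -
      have a: "a \<in> \<Gamma>" "a \<otimes>\<^bsub>PSL2 R\<^esub> g = g \<otimes>\<^bsub>PSL2 R\<^esub> a" "a \<in> carrier (PSL2 R)"
        and b: "b \<in> \<Gamma>" "b \<otimes>\<^bsub>PSL2 R\<^esub> g = g \<otimes>\<^bsub>PSL2 R\<^esub> b" "b \<in> carrier (PSL2 R)" using that sub by (auto simp: centralizer_def)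
      have "a \<otimes>\<^bsub>PSL2 R\<^esub> b \<otimes>\<^bsub>PSL2 R\<^esub> g = a \<otimes>\<^bsub>PSL2 R\<^esub> g \<otimes>\<^bsub>PSL2 R\<^esub> b" using a(3) b(2,3) gc by (simp add: m_assoc)
      also have "\<dots> = g \<otimes>\<^bsub>PSL2 R\<^esub> (a \<otimes>\<^bsub>PSL2 R\<^esub> b)" using a(2,3) b(3) gc by (simp add: m_assoc)
      finally show ?thesis using subgroup.m_closed[OF \<Gamma> a(1) b(1)] by (simp add: centralizer_def)
    qed
  qed (use sub in \<open>auto simp: centralizer_def\<close>)
qed

text \<open>By \<open>centralizer_cases\<close> the centraliser acts in the axial coordinate by real
  translations and flips only. Its orbits on the strip are those of an infinite cyclic or an
  infinite dihedral group with explicit constants, matching those of the circle and of the interval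
  as quotients of the line.\<close>

theorem sector_homotopy_type:
  assumes bianchi: "bianchi m" and \<Gamma>: "subgroup \<Gamma> (PSL2 R)" "finite (rcosets\<^bsub>PSL2 R\<^esub> \<Gamma>)"
    and A: "A \<in> carrier (SL2 R)" "elliptic_form A Q \<zeta> t" "pm A \<in> \<Gamma>"
  defines "C \<equiv> centralizer (PSL2 R\<lparr>carrier := \<Gamma>\<rparr>) (pm A)"
  defines "X' \<equiv> orbit_space (PSL2 R\<lparr>carrier := C\<rparr>) complex_action
     (subtopology complex_hyperbolic_3_space (fixed_set complex_hyperbolic_3_space complex_action (pm A)))"
  shows "flip_constants C Q = {} \<Longrightarrow> X' homotopy_equivalent_space nsphere 1"
    and "flip_constants C Q \<noteq> {} \<Longrightarrow> X' homotopy_equivalent_space top_of_set {-1..1::real}"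
proof -
  let ?F = "fixed_set complex_hyperbolic_3_space complex_action (pm A)"
  let ?S = "translation_lengths C Q" and ?Fl = "flip_constants C Q"
  interpret group "PSL2 R" by (rule group_PSL2)
  note Q = elliptic_cases[OF A(2)]
  have C: "subgroup C (PSL2 R)" unfolding C_def by (rule centralizer_subgroup[OF \<Gamma>(1) A(3)])
  have Cmem: "h \<in> C \<longleftrightarrow> h \<in> \<Gamma> \<and> h \<otimes>\<^bsub>PSL2 R\<^esub> pm A = pm A \<otimes>\<^bsub>PSL2 R\<^esub> h" for h by (simp add: C_def centralizer_def)
  have Cpm: "\<exists>B\<in>carrier (SL2 R). h = pm B" if "h \<in> C" for h
    using subgroup.mem_carrier[OF C that] PSL2_carrier by simp
  \<comment> \<open>A nontrivial translation within \<open>\<Gamma>\<close>: finite index puts a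
    power of the Pell unit into \<open>\<Gamma>\<close>. The power is diagonal in the frame of
    \<open>A\<close>, hence centralises it, and its eigenvalue still has modulus different from
    1.\<close>
  obtain s0 where s0: "s0 \<in> ?S" "s0 \<noteq> 0"
  proof -
    obtain H \<alpha> where H: "H \<in> carrier (SL2 R)" "H ** Q = Q ** mat2 \<alpha> 0 0 (inverse \<alpha>)" "\<alpha> \<noteq> 0" "cmod \<alpha> \<noteq> 1"
      by (rule bianchi.elliptic_translation[OF bianchi A(1,2)])
    have "pm H \<in> carrier (PSL2 R)" using H(1) PSL2_carrier by blast
    then obtain k :: nat where k: "k > 0" "pm H [^]\<^bsub>PSL2 R\<^esub> k \<in> \<Gamma>" by (rule power_in_finite_index[OF \<Gamma>])
    have "\<exists>B\<in>carrier (SL2 R). pm H [^]\<^bsub>PSL2 R\<^esub> n = pm B \<and> B ** Q = Q ** mat2 (\<alpha> ^ n) 0 0 (inverse (\<alpha> ^ n))" for n :: nat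
    proof (induction n)
      case 0
      have "mat 1 ** Q = Q ** mat2 1 0 0 1" by (simp add: mat2_eq_iff mult2_nth)
      then show ?case using mat1_SL2 by (intro bexI[of _ "mat 1"]) (auto simp: PSL2_one)
    next
      case (Suc n)
      then obtain B where B: "B \<in> carrier (SL2 R)" "pm H [^]\<^bsub>PSL2 R\<^esub> n = pm B" "B ** Q = Q ** mat2 (\<alpha> ^ n) 0 0 (inverse (\<alpha> ^ n))" by blast
      have "(B ** H) ** Q = Q ** (mat2 (\<alpha> ^ n) 0 0 (inverse (\<alpha> ^ n)) ** mat2 \<alpha> 0 0 (inverse \<alpha>))"
        by (rule conj_frame_mult[OF B(3) H(2)])
      also have "mat2 (\<alpha> ^ n) 0 0 (inverse (\<alpha> ^ n)) ** mat2 \<alpha> 0 0 (inverse \<alpha>) = mat2 (\<alpha> ^ Suc n) 0 0 (inverse (\<alpha> ^ Suc n))"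
        by (simp add: mat2_eq_iff mult2_nth mult.commute)
      finally show ?case using B H(1) SL2_mult_closed by (intro bexI[of _ "B ** H"]) (auto simp: PSL2_mult)
    qed
    then obtain B where B: "B \<in> carrier (SL2 R)" "pm H [^]\<^bsub>PSL2 R\<^esub> k = pm B" "B ** Q = Q ** mat2 (\<alpha> ^ k) 0 0 (inverse (\<alpha> ^ k))" by blast
    have "mat2 (\<alpha> ^ k) 0 0 (inverse (\<alpha> ^ k)) ** mat2 \<zeta> 0 0 (cnj \<zeta>) = mat2 \<zeta> 0 0 (cnj \<zeta>) ** mat2 (\<alpha> ^ k) 0 0 (inverse (\<alpha> ^ k))"
      by (simp add: mat2_eq_iff mult2_nth mult.commute)
    then have "(B ** A) ** Q = (A ** B) ** Q" using conj_frame_mult[OF B(3) Q(5)] conj_frame_mult[OF Q(5) B(3)] by simp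
    then have "B ** A = A ** B" using frame_cancel(1)[OF Q(1)] by blast
    then have "pm B \<in> C" using k(2) B(1,2) A(1) by (simp add: Cmem PSL2_mult)
    then have "4 * ln (cmod (\<alpha> ^ k)) \<in> ?S"
      unfolding translation_lengths_def using B(1,3) H(3) \<open>pm B \<in> C\<close> by (intro CollectI exI[of _ B] exI[of _ "\<alpha> ^ k"]) simp
    moreover have "4 * ln (cmod (\<alpha> ^ k)) \<noteq> 0" using H(3,4) k(1) by (simp add: norm_power ln_realpow)
    ultimately show thesis using that by blast
  qed
  obtain c where c: "c > 0" "?S = range (\<lambda>n::int. of_int n * c)"
    by (rule discrete_subgroup_cyclic[OF s0 translation_lengths_diff[OF C Q(1)] translation_lengths_finite[OF Q(1)]])
  have acts: "acts_on (PSL2 R\<lparr>carrier := C\<rparr>) complex_action ?F"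
  proof -
    have tF: "?F = {l \<in> line ` ccone. complex_action (pm A) l = l}" by (simp add: fixed_set_def topspace_complex_hyperbolic)
    have a\<Gamma>: "acts_on (PSL2 R\<lparr>carrier := \<Gamma>\<rparr>) complex_action (line ` ccone)" by (rule acts_on_complex[OF \<Gamma>(1)])
    have inv: "complex_action h l \<in> ?F" if h: "h \<in> C" and l: "l \<in> ?F" for h l
    proof -
      have lc: "l \<in> line ` ccone" "complex_action (pm A) l = l" using l tF by auto
      have mul: "complex_action (x \<otimes>\<^bsub>PSL2 R\<^esub> y) l = complex_action x (complex_action y l)" if "x \<in> \<Gamma>" "y \<in> \<Gamma>" for x y
        using a\<Gamma> lc(1) that unfolding acts_on_def by auto
      have "complex_action (pm A) (complex_action h l) = complex_action (pm A \<otimes>\<^bsub>PSL2 R\<^esub> h) l"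
        using mul[OF A(3)] h unfolding Cmem by simp
      also have "\<dots> = complex_action (h \<otimes>\<^bsub>PSL2 R\<^esub> pm A) l" using h by (simp add: Cmem)
      also have "\<dots> = complex_action h (complex_action (pm A) l)"
        using mul[of h "pm A"] h A(3) unfolding Cmem by simp
      finally have "complex_action (pm A) (complex_action h l) = complex_action h l" using lc(2) by simp
      moreover have "complex_action h l \<in> line ` ccone" using a\<Gamma> h lc(1) unfolding acts_on_def Cmem by auto
      ultimately show ?thesis by (simp add: tF)
    qed
    have "acts_on (PSL2 R\<lparr>carrier := C\<rparr>) complex_action (line ` ccone)" by (rule acts_on_complex[OF C])
    then show ?thesis unfolding acts_on_def using inv tF by auto
  qed
  let ?\<psi> = "\<lambda>u. line (axis_point Q u)"
  let ?P = "orbit (PSL2 R\<lparr>carrier := C\<rparr>) complex_action \<circ> ?\<psi>"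
  note ax = quotient_map_axis_point[OF A(2)]
  have P: "quotient_map (top_of_set strip) X' ?P"
    unfolding X'_def by (rule quotient_map_compose[OF ax(1) quotient_map_orbit_space])
  have mem: "?\<psi> u \<in> ?F" if "u \<in> strip" for u using ax(3) that by blast
  have inj: "?\<psi> u = ?\<psi> v \<longleftrightarrow> u = v" if "u \<in> strip" "v \<in> strip" for u v using ax(2) that by (auto simp: inj_on_def)
  have st: "u + of_real x \<in> strip" "- u + of_real x \<in> strip" if "u \<in> strip" for u x using that by (auto simp: strip_def)
  have Prel: "?P u = ?P u' \<longleftrightarrow> (\<exists>s\<in>?S. u' = u + of_real s) \<or> (\<exists>f\<in>?Fl. u' = - u + of_real f)"
    if u: "u \<in> strip" "u' \<in> strip" for u u'
  proof -
    have "?P u = ?P u' \<longleftrightarrow> (\<exists>h\<in>C. ?\<psi> u' = complex_action h (?\<psi> u))"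
      using orbit_eq_iff[OF acts mem[OF u(1)] mem[OF u(2)]] by simp
    also have "\<dots> \<longleftrightarrow> (\<exists>s\<in>?S. u' = u + of_real s) \<or> (\<exists>f\<in>?Fl. u' = - u + of_real f)"
    proof
      assume "\<exists>h\<in>C. ?\<psi> u' = complex_action h (?\<psi> u)"
      then obtain h where h: "h \<in> C" "?\<psi> u' = complex_action h (?\<psi> u)" by blast
      obtain B where B: "B \<in> carrier (SL2 R)" "h = pm B" using Cpm[OF h(1)] by blast
      have e: "?\<psi> u' = line (cmatrix B *v axis_point Q u)" using h(2) by (simp add: B(2) complex_action_line)
      have comm: "pm B \<otimes>\<^bsub>PSL2 R\<^esub> pm A = pm A \<otimes>\<^bsub>PSL2 R\<^esub> pm B" using h(1) B(2) Cmem by simp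
      show "(\<exists>s\<in>?S. u' = u + of_real s) \<or> (\<exists>f\<in>?Fl. u' = - u + of_real f)"
      proof (rule centralizer_cases[OF A(1,2) B(1) comm])
        fix \<alpha> assume a: "\<alpha> \<noteq> 0" "B ** Q = Q ** mat2 \<alpha> 0 0 (inverse \<alpha>)"
        have "4 * ln (cmod \<alpha>) \<in> ?S" unfolding translation_lengths_def using a B h(1) by blast
        moreover have "u' = u + of_real (4 * ln (cmod \<alpha>))"
          using e inj[OF u(2) st(1)[OF u(1)]] by (simp only: axis_point_translate[OF a(2,1)])
        ultimately show ?thesis by blast
      next
        fix \<beta> assume a: "\<beta> \<noteq> 0" "B ** Q = Q ** mat2 0 \<beta> (- inverse \<beta>) 0"
        have "4 * ln (cmod \<beta>) \<in> ?Fl" unfolding flip_constants_def using a B h(1) by blast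
        moreover have "u' = - u + of_real (4 * ln (cmod \<beta>))"
          using e inj[OF u(2) st(2)[OF u(1)]] by (simp only: axis_point_flip[OF a(2,1)])
        ultimately show ?thesis by blast
      qed
    next
      assume "(\<exists>s\<in>?S. u' = u + of_real s) \<or> (\<exists>f\<in>?Fl. u' = - u + of_real f)"
      then show "\<exists>h\<in>C. ?\<psi> u' = complex_action h (?\<psi> u)"
      proof
        assume "\<exists>s\<in>?S. u' = u + of_real s"
        then obtain B \<alpha> where B: "pm B \<in> C" "\<alpha> \<noteq> 0" "B ** Q = Q ** mat2 \<alpha> 0 0 (inverse \<alpha>)" "u' = u + of_real (4 * ln (cmod \<alpha>))"
          unfolding translation_lengths_def by blast
        then have "?\<psi> u' = complex_action (pm B) (?\<psi> u)"
          by (simp only: complex_action_line axis_point_translate[OF B(3,2)])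
        then show ?thesis using B(1) by blast
      next
        assume "\<exists>f\<in>?Fl. u' = - u + of_real f"
        then obtain B \<beta> where B: "pm B \<in> C" "\<beta> \<noteq> 0" "B ** Q = Q ** mat2 0 \<beta> (- inverse \<beta>) 0" "u' = - u + of_real (4 * ln (cmod \<beta>))"
          unfolding flip_constants_def by blast
        then have "?\<psi> u' = complex_action (pm B) (?\<psi> u)"
          by (simp only: complex_action_line axis_point_flip[OF B(3,2)])
        then show ?thesis using B(1) by blast
      qed
    qed
    finally show ?thesis .
  qed
  show "X' homotopy_equivalent_space nsphere 1" if "?Fl = {}"
  proof (rule strip_quotient_homotopy_equivalent[OF P quotient_map_circle(1)[OF c(1)] Prel])
    show "((\<lambda>i. if i = 0 then cos (2 * pi * r / c) else if i = Suc 0 then sin (2 * pi * r / c) else 0) =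
       (\<lambda>i. if i = 0 then cos (2 * pi * r' / c) else if i = Suc 0 then sin (2 * pi * r' / c) else 0)) \<longleftrightarrow>
      (\<exists>s\<in>?S. r' = r + s) \<or> (\<exists>f\<in>?Fl. r' = - r + f)" for r r'
      unfolding quotient_map_circle(2)[OF c(1)] \<open>?Fl = {}\<close> c(2) by auto
  qed
  show "X' homotopy_equivalent_space top_of_set {-1..1::real}" if "?Fl \<noteq> {}"
  proof -
    obtain a where a: "a \<in> ?Fl" using \<open>?Fl \<noteq> {}\<close> by blast
    have Fl: "?Fl = range (\<lambda>n::int. a + of_int n * c)"
    proof -
      have "f \<in> ?Fl \<longleftrightarrow> f \<in> range (\<lambda>n::int. a + of_int n * c)" for f
        unfolding flip_constants_shift[OF C Q(1) a] c(2) by (auto simp: diff_eq_eq add.commute)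
      then show ?thesis by blast
    qed
    show ?thesis
    proof (rule strip_quotient_homotopy_equivalent[OF P quotient_map_interval(1)[OF c(1), of a] Prel])
      show "cos (2 * pi * (r - a / 2) / c) = cos (2 * pi * (r' - a / 2) / c) \<longleftrightarrow>
        (\<exists>s\<in>?S. r' = r + s) \<or> (\<exists>f\<in>?Fl. r' = - r + f)" for r r'
        unfolding quotient_map_interval(2)[OF c(1)] Fl c(2) by auto
    qed
  qed
qed

end

section \<open>Dihedral subgroups of order four and six\<close>

text \<open>\<open>dihedral_pair n G g h\<close>: the rotation \<open>g\<close> of order \<open>n\<close> is inverted by the reflection \<open>h\<close>. For
  \<open>n = 2\<close> this says that \<open>g\<close> and \<open>h\<close> generate the Klein four-group.\<close>

definition dihedral_pair :: "nat \<Rightarrow> ('g, 'm) monoid_scheme \<Rightarrow> 'g \<Rightarrow> 'g \<Rightarrow> bool" where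
  "dihedral_pair n G g h \<longleftrightarrow> g \<in> carrier G \<and> h \<in> carrier G \<and> g \<noteq> \<one>\<^bsub>G\<^esub> \<and> g [^]\<^bsub>G\<^esub> n = \<one>\<^bsub>G\<^esub> \<and>
     h \<otimes>\<^bsub>G\<^esub> h = \<one>\<^bsub>G\<^esub> \<and> h \<otimes>\<^bsub>G\<^esub> g \<otimes>\<^bsub>G\<^esub> h = inv\<^bsub>G\<^esub> g \<and> h \<notin> (\<lambda>i. g [^]\<^bsub>G\<^esub> i) ` {..<n}"

definition dihedral_word :: "('g, 'm) monoid_scheme \<Rightarrow> 'g \<Rightarrow> 'g \<Rightarrow> nat \<times> nat \<Rightarrow> 'g" where
  "dihedral_word G g h = (\<lambda>(i, j). g [^]\<^bsub>G\<^esub> i \<otimes>\<^bsub>G\<^esub> h [^]\<^bsub>G\<^esub> j)"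

text \<open>The product of the normal forms \<open>g^i h^j\<close> by means of
  \<open>h g^i = g^(n-i) h\<close>. In natural numbers the inverse power is written with
  \<open>n - i'\<close>, and the reduction modulo \<open>n\<close> absorbs the case
  \<open>i' = 0\<close>.\<close>

definition dihedral_mult :: "nat \<Rightarrow> nat \<times> nat \<Rightarrow> nat \<times> nat \<Rightarrow> nat \<times> nat" where
  "dihedral_mult n = (\<lambda>(i, j) (i', j'). ((if j = 0 then i + i' else i + (n - i')) mod n, (j + j') mod 2))"

context group
begin

lemma pow_mod:
  assumes "g \<in> carrier G" "g [^] (n::nat) = \<one>"
  shows "g [^] (k mod n) = g [^] k"
proof -
  have "g [^] k = g [^] (k mod n + n * (k div n))" by simp
  also have "\<dots> = g [^] (k mod n) \<otimes> (g [^] n) [^] (k div n)"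
    using assms(1) by (simp only: nat_pow_mult[symmetric] nat_pow_pow)
  finally show ?thesis using assms by simp
qed

lemma order_2_or_3_pow_inj:
  assumes "g \<in> carrier G" "g \<noteq> \<one>" "g [^] n = \<one>" "n = 2 \<or> n = (3::nat)"
  shows "inj_on (\<lambda>i. g [^] i) {..<n}"
proof -
  have g2: "g [^] (2::nat) = g \<otimes> g" using assms(1) by (simp add: numeral_2_eq_2)
  have "g \<otimes> g \<noteq> \<one>" if "n = 3"
  proof
    assume "g \<otimes> g = \<one>"
    then have "g [^] (3::nat) = g" using assms(1) by (simp add: numeral_3_eq_3)
    then show False using assms that by simp
  qed
  moreover have "g \<otimes> g \<noteq> g" using assms(1,2) by (metis r_cancel_one)
  ultimately show ?thesis using assms g2
    by (auto simp: inj_on_def less_Suc_eq numeral_2_eq_2 numeral_3_eq_3)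
qed

lemma dihedral_word_mult:
  assumes D: "dihedral_pair n G g h" and n: "n > 0" and ij: "i < n" "j < 2" "i' < n" "j' < 2"
  shows "dihedral_word G g h (i, j) \<otimes> dihedral_word G g h (i', j') =
     dihedral_word G g h (dihedral_mult n (i, j) (i', j'))"
proof -
  have g: "g \<in> carrier G" and h: "h \<in> carrier G" and gn: "g [^] n = \<one>" and hh: "h \<otimes> h = \<one>" and inv: "h \<otimes> g \<otimes> h = inv g"
    using D by (auto simp: dihedral_pair_def)
  have conj: "h \<otimes> g [^] k \<otimes> h = (inv g) [^] k" for k :: nat
  proof (induction k)
    case 0 then show ?case using h hh by simp
  next
    case (Suc k)
    have "h \<otimes> g [^] Suc k \<otimes> h = (h \<otimes> g [^] k \<otimes> (h \<otimes> h)) \<otimes> g \<otimes> h" using g h hh by (simp add: m_assoc)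
    also have "\<dots> = (h \<otimes> g [^] k \<otimes> h) \<otimes> (h \<otimes> g \<otimes> h)" using g h by (simp add: m_assoc)
    finally show ?case using Suc inv by simp
  qed
  have invk: "(inv g) [^] k = g [^] (n - k)" if "k \<le> n" for k
  proof -
    have "g [^] (n - k) \<otimes> g [^] k = \<one>" using that g gn by (simp add: nat_pow_mult)
    then have "inv (g [^] k) = g [^] (n - k)" using g by (simp add: inv_equality)
    then show ?thesis using g by (simp add: nat_pow_inv)
  qed
  have hg: "h \<otimes> g [^] i' = g [^] (n - i') \<otimes> h"
  proof -
    have "h \<otimes> g [^] i' = (h \<otimes> g [^] i' \<otimes> h) \<otimes> h" using g h hh by (simp add: m_assoc)
    then show ?thesis using conj invk ij by simp
  qed
  have j: "j = 0 \<or> j = 1" "j' = 0 \<or> j' = 1" using ij by auto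
  have pm: "g [^] (k mod n) = g [^] k" for k by (rule pow_mod[OF g gn])
  have hg': "h \<otimes> (g [^] i' \<otimes> x) = g [^] (n - i') \<otimes> (h \<otimes> x)" if "x \<in> carrier G" for x
    using hg that g h by (simp flip: m_assoc)
  show ?thesis
    using j by (elim disjE)
      (use g h hh in \<open>simp_all add: dihedral_word_def dihedral_mult_def pm m_assoc hg hg' nat_pow_mult[symmetric]\<close>)
qed

lemma dihedral_word_inj:
  assumes D: "dihedral_pair n G g h" and n: "n = 2 \<or> n = 3"
  shows "inj_on (dihedral_word G g h) ({..<n} \<times> {..<2})"
proof (rule inj_onI)
  have g: "g \<in> carrier G" and h: "h \<in> carrier G" and gn: "g [^] n = \<one>" and hh: "h \<otimes> h = \<one>" and g1: "g \<noteq> \<one>"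
    and hn: "h \<notin> (\<lambda>i. g [^] i) ` {..<n}"
    using D by (auto simp: dihedral_pair_def)
  have n0: "n > 0" using n by auto
  have noth: "g [^] i \<otimes> h \<noteq> g [^] i'" if "i < n" for i i' :: nat
  proof
    assume e: "g [^] i \<otimes> h = g [^] i'"
    have "h = g [^] (n - i) \<otimes> (g [^] i \<otimes> h)" using that g h gn by (simp add: nat_pow_mult flip: m_assoc)
    also have "\<dots> = g [^] ((n - i + i') mod n)" unfolding e using g by (simp add: nat_pow_mult pow_mod[OF g gn])
    finally show False using hn n0 by auto
  qed
  fix x y assume xy: "x \<in> {..<n} \<times> {..<2::nat}" "y \<in> {..<n} \<times> {..<2::nat}" "dihedral_word G g h x = dihedral_word G g h y"
  obtain i j i' j' where e: "x = (i, j)" "y = (i', j')" by force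
  have b: "i < n" "i' < n" "j = 0 \<or> j = 1" "j' = 0 \<or> j' = 1" using xy(1,2) by (auto simp: e)
  have eq: "g [^] i \<otimes> h [^] j = g [^] i' \<otimes> h [^] j'" using xy(3) by (simp add: e dihedral_word_def)
  have "j = j'" using b(3,4) eq noth[OF b(1), of i'] noth[OF b(2), of i] g h by auto
  then have "g [^] i = g [^] i'" using eq g h by simp
  then have "i = i'" using order_2_or_3_pow_inj[OF g g1 gn n] b by (auto simp: inj_on_def)
  then show "x = y" using \<open>j = j'\<close> by (simp add: e)
qed

definition dihedral_set :: "nat \<Rightarrow> 'a \<Rightarrow> 'a \<Rightarrow> 'a set" where
  "dihedral_set n g h = dihedral_word G g h ` ({..<n} \<times> {..<2})"

lemma dihedral_mult_in: "n > 0 \<Longrightarrow> dihedral_mult n p q \<in> {..<n} \<times> {..<2}"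
  by (auto simp: dihedral_mult_def split: prod.splits)

lemma dihedral_set_subgroup:
  assumes D: "dihedral_pair n G g h" and n: "n = 2 \<or> n = 3"
  shows "subgroup (dihedral_set n g h) G"
proof -
  have n0: "n > 0" using n by auto
  have gh: "g \<in> carrier G" "h \<in> carrier G" using D by (auto simp: dihedral_pair_def)
  have sub: "dihedral_set n g h \<subseteq> carrier G" using gh by (auto simp: dihedral_set_def dihedral_word_def)
  have fin: "finite (dihedral_set n g h)" by (simp add: dihedral_set_def)
  have mult: "a \<otimes> b \<in> dihedral_set n g h" if ab: "a \<in> dihedral_set n g h" "b \<in> dihedral_set n g h" for a b
  proof -
    obtain i j i' j' where e: "a = dihedral_word G g h (i, j)" "b = dihedral_word G g h (i', j')" "i < n" "j < 2" "i' < n" "j' < 2"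
      using ab by (auto simp: dihedral_set_def)
    then show ?thesis using dihedral_word_mult[OF D n0] dihedral_mult_in[OF n0] by (simp add: dihedral_set_def)
  qed
  have one: "\<one> \<in> dihedral_set n g h"
    unfolding dihedral_set_def using n0 gh by (intro image_eqI[of _ _ "(0, 0)"]) (auto simp: dihedral_word_def)
  show ?thesis
  proof (rule subgroupI[OF sub])
    show "inv a \<in> dihedral_set n g h" if a: "a \<in> dihedral_set n g h" for a
    proof -
      have ac: "a \<in> carrier G" using a sub by blast
      \<comment> \<open>Inverses come from finiteness: left multiplication by \<open>a\<close> is
        injective on the set, hence onto, and reaches the identity.\<close>
      have "inj_on (\<lambda>x. a \<otimes> x) (dihedral_set n g h)" by (rule inj_onI) (use ac sub in \<open>simp add: subset_iff\<close>)
      moreover have "(\<lambda>x. a \<otimes> x) ` dihedral_set n g h \<subseteq> dihedral_set n g h" using mult[OF a] by blast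
      ultimately have "(\<lambda>x. a \<otimes> x) ` dihedral_set n g h = dihedral_set n g h" using fin by (simp add: endo_inj_surj)
      then obtain x where x: "x \<in> dihedral_set n g h" "a \<otimes> x = \<one>" using one by (metis imageE)
      then have "inv a = x" using ac sub by (metis inv_unique' r_inv l_inv inv_equality inv_comm subsetD)
      then show ?thesis using x by simp
    qed
  qed (use one mult in auto)
qed

end

text \<open>The multiplication of words depends only on \<open>n\<close>. The isomorphisms demanded
  by \<open>is_dihedral\<close> are thereby reduced to exhibiting pairs.\<close>

lemma dihedral_pairs_isomorphic:
  assumes "group G" "group H" and n: "n = 2 \<or> n = 3"
    and D: "dihedral_pair n G g h" "dihedral_pair n H g' h'"
    and full: "carrier G = group.dihedral_set G n g h" "carrier H = group.dihedral_set H n g' h'"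
  shows "G \<cong> H"
proof -
  interpret G: group G by fact
  interpret H: group H by fact
  let ?S = "{..<n} \<times> {..<2::nat}"
  have n0: "n > 0" using n by auto
  have bG: "bij_betw (dihedral_word G g h) ?S (carrier G)"
    using G.dihedral_word_inj[OF D(1) n] full(1) by (simp add: bij_betw_def G.dihedral_set_def)
  have bH: "bij_betw (dihedral_word H g' h') ?S (carrier H)"
    using H.dihedral_word_inj[OF D(2) n] full(2) by (simp add: bij_betw_def H.dihedral_set_def)
  define w where "w = inv_into ?S (dihedral_word G g h)"
  define \<phi> where "\<phi> = dihedral_word H g' h' \<circ> w"
  have w: "bij_betw w (carrier G) ?S" unfolding w_def by (rule bij_betw_inv_into[OF bG])
  have ww: "w (dihedral_word G g h p) = p" if "p \<in> ?S" for p
    unfolding w_def using bij_betw_inv_into_left[OF bG that] .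
  have wr: "dihedral_word G g h (w x) = x" if "x \<in> carrier G" for x
    unfolding w_def using bij_betw_inv_into_right[OF bG that] .
  have "\<phi> \<in> iso G H"
  proof (rule isoI)
    show "bij_betw \<phi> (carrier G) (carrier H)" unfolding \<phi>_def by (rule bij_betw_trans[OF w bH])
    show "\<phi> \<in> hom G H"
    proof (rule homI)
      fix x y assume xy: "x \<in> carrier G" "y \<in> carrier G"
      obtain i j where x: "w x = (i, j)" by force
      obtain i' j' where y: "w y = (i', j')" by force
      have b: "i < n" "j < 2" "i' < n" "j' < 2"
        using bij_betw_apply[OF w xy(1)] bij_betw_apply[OF w xy(2)] by (auto simp: x y)
      have "x \<otimes>\<^bsub>G\<^esub> y = dihedral_word G g h (dihedral_mult n (i, j) (i', j'))"
        using G.dihedral_word_mult[OF D(1) n0 b] wr[OF xy(1)] wr[OF xy(2)] by (simp add: x y)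
      then have "w (x \<otimes>\<^bsub>G\<^esub> y) = dihedral_mult n (i, j) (i', j')" using ww[OF G.dihedral_mult_in[OF n0]] by simp
      then show "\<phi> (x \<otimes>\<^bsub>G\<^esub> y) = \<phi> x \<otimes>\<^bsub>H\<^esub> \<phi> y"
        using H.dihedral_word_mult[OF D(2) n0 b] by (simp add: \<phi>_def x y)
      show "\<phi> x \<in> carrier H" unfolding \<phi>_def using bij_betw_apply[OF bH bij_betw_apply[OF w xy(1)]] by simp
    qed
  qed
  then show ?thesis by (rule is_isoI)
qed

lemma klein_group_pair:
  defines "V \<equiv> integer_mod_group 2 \<times>\<times> integer_mod_group 2"
  shows "group V" "dihedral_pair 2 V (1, 0) (0, 1)" "carrier V = group.dihedral_set V 2 (1, 0) (0, 1)"
    "x \<in> carrier V \<Longrightarrow> y \<in> carrier V \<Longrightarrow> x \<otimes>\<^bsub>V\<^esub> y = y \<otimes>\<^bsub>V\<^esub> x" "x \<in> carrier V \<Longrightarrow> x \<otimes>\<^bsub>V\<^esub> x = \<one>\<^bsub>V\<^esub>" "card (carrier V) = 4"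
proof -
  show g: "group V" unfolding V_def by (intro DirProd_group) auto
  interpret group V by (rule g)
  have car: "carrier V = {(0,0), (0,1), (1,0), (1,1)}" unfolding V_def by (auto simp: carrier_integer_mod_group DirProd_def)
  have mult: "(a, b) \<otimes>\<^bsub>V\<^esub> (c, d) = ((a + c) mod 2, (b + d) mod 2)" for a b c d
    unfolding V_def by (simp add: DirProd_def mult_integer_mod_group)
  have one: "\<one>\<^bsub>V\<^esub> = (0, 0)" unfolding V_def by (simp add: DirProd_def)
  show "x \<otimes>\<^bsub>V\<^esub> y = y \<otimes>\<^bsub>V\<^esub> x" if "x \<in> carrier V" "y \<in> carrier V" for x y
    by (cases x; cases y) (simp add: mult add.commute)
  show sq: "x \<otimes>\<^bsub>V\<^esub> x = \<one>\<^bsub>V\<^esub>" if "x \<in> carrier V" for x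
    using that by (auto simp: car mult one)
  show "card (carrier V) = 4" unfolding car by simp
  have inv: "inv\<^bsub>V\<^esub> (1, 0) = (1, 0)" by (rule inv_equality) (auto simp: car mult one)
  have ss: "{..<2::nat} = {0, 1}" by auto
  have p: "(1, 0) [^]\<^bsub>V\<^esub> (0::nat) = (0, 0)" "(1, 0) [^]\<^bsub>V\<^esub> (1::nat) = (1, 0)" "(0, 1) [^]\<^bsub>V\<^esub> (0::nat) = (0, 0)" "(0, 1) [^]\<^bsub>V\<^esub> (1::nat) = (0, 1)"
    by (simp_all add: one car mult)
  show "dihedral_pair 2 V (1, 0) (0, 1)"
    unfolding dihedral_pair_def inv ss image_insert p image_empty by (simp add: car mult one numeral_2_eq_2)
  have "{0, 1} \<times> {0, 1} = {(0,0), (0,1), (1,0), (1,1::nat)} \<inter> (UNIV :: (nat \<times> nat) set)" by auto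
  then show "carrier V = dihedral_set 2 (1, 0) (0, 1)"
    unfolding dihedral_set_def ss by (simp add: dihedral_word_def p[simplified] car mult one)
qed

text \<open>A 3-cycle and a transposition; their six words are distinct, and there are six
  permutations.\<close>

lemma sym_group_3_pair:
  obtains c s where "dihedral_pair 3 (sym_group 3) c s" "carrier (sym_group 3) = group.dihedral_set (sym_group 3) 3 c s"
proof -
  let ?S = "sym_group 3"
  interpret group ?S by (rule sym_group_is_group)
  define c :: "nat \<Rightarrow> nat" where "c = Transposition.transpose 1 2 \<circ> Transposition.transpose 2 3"
  define s :: "nat \<Rightarrow> nat" where "s = Transposition.transpose 1 2"
  have c: "c permutes {1..3}" unfolding c_def by (intro permutes_compose permutes_swap_id) auto
  have s: "s permutes {1..3}" unfolding s_def by (intro permutes_swap_id) auto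
  have cS: "c \<in> carrier ?S" "s \<in> carrier ?S" using c s by (simp_all add: sym_group_carrier)
  have m: "x \<otimes>\<^bsub>?S\<^esub> y = x \<circ> y" "\<one>\<^bsub>?S\<^esub> = id" for x y by (simp_all add: sym_group_mult sym_group_one)
  have p: "c [^]\<^bsub>?S\<^esub> (0::nat) = id" "c [^]\<^bsub>?S\<^esub> (1::nat) = c"
    using cS by (simp_all add: m)
  have p2: "c [^]\<^bsub>?S\<^esub> (2::nat) = c \<circ> c" unfolding Suc_1[symmetric] nat_pow_Suc p m ..
  have p3: "c [^]\<^bsub>?S\<^esub> (3::nat) = c \<circ> c \<circ> c" using nat_pow_Suc[of c 2] p2 by (simp add: m)
  have ccc: "c \<circ> c \<circ> c = id" by (auto simp: c_def fun_eq_iff Transposition.transpose_def)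
  have inv: "inv\<^bsub>?S\<^esub> c = c \<circ> c" using cS ccc by (intro inv_equality) (auto simp: m sym_group_carrier intro: permutes_compose c)
  have ss: "{..<3::nat} = {0, 1, 2}" by auto
  have e: "c 1 = 2" "c 2 = 3" "s 1 = 2" "s 2 = 1" "s 3 = 3" "c 3 = 1" by (simp_all add: c_def s_def Transposition.transpose_def)
  have D: "dihedral_pair 3 ?S c s"
    unfolding dihedral_pair_def inv ss image_insert p p2 p3 image_empty m
  proof (intro conjI)
    show "c \<noteq> id" using e(1) by (metis eq_id_iff numeral_One numeral_eq_iff semiring_norm(85))
    show "s \<circ> s = id" by (auto simp: s_def fun_eq_iff Transposition.transpose_def)
    show "s \<circ> c \<circ> s = c \<circ> c" by (auto simp: s_def c_def fun_eq_iff Transposition.transpose_def)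
    have "s 1 \<noteq> id 1" "s 2 \<noteq> c 2" "s 3 \<noteq> (c \<circ> c) 3" using e by simp_all
    then have "s \<noteq> id" "s \<noteq> c" "s \<noteq> c \<circ> c" by metis+
    then show "s \<notin> {id, c, c \<circ> c}" by blast
  qed (use cS ccc in auto)
  have "subgroup (dihedral_set 3 c s) ?S" by (rule dihedral_set_subgroup[OF D]) simp
  then have sub: "dihedral_set 3 c s \<subseteq> carrier ?S" by (rule subgroup.subset)
  have card6: "card (dihedral_set 3 c s) = 6"
    unfolding dihedral_set_def by (subst card_image[OF dihedral_word_inj[OF D]]) auto
  have car: "carrier ?S = {p. p permutes {1..3}}" by (auto simp: sym_group_carrier)
  have "card (carrier ?S) = fact 3" unfolding car by (rule card_permutations) auto
  then have "card (carrier ?S) = 6" by (simp add: fact_numeral)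
  moreover have "finite (carrier ?S)" unfolding car by (rule finite_permutations) simp
  ultimately have "dihedral_set 3 c s = carrier ?S" using sub card6 by (simp add: card_subset_eq)
  then show thesis using that[OF D] by simp
qed

lemma dihedral_pair_transfer:
  assumes "group G" "group H" "\<phi> \<in> iso G H" "dihedral_pair n G g h"
  shows "dihedral_pair n H (\<phi> g) (\<phi> h)"
proof -
  interpret G: group G by fact
  interpret H: group H by fact
  interpret group_hom G H \<phi> using assms(3) by unfold_locales (simp add: iso_def)
  have D: "g \<in> carrier G" "h \<in> carrier G" "g \<noteq> \<one>\<^bsub>G\<^esub>" "g [^]\<^bsub>G\<^esub> n = \<one>\<^bsub>G\<^esub>" "h \<otimes>\<^bsub>G\<^esub> h = \<one>\<^bsub>G\<^esub>"
    "h \<otimes>\<^bsub>G\<^esub> g \<otimes>\<^bsub>G\<^esub> h = inv\<^bsub>G\<^esub> g" "h \<notin> (\<lambda>i. g [^]\<^bsub>G\<^esub> i) ` {..<n}"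
    using assms(4) by (auto simp: dihedral_pair_def)
  have inj: "\<phi> x = \<phi> y \<longleftrightarrow> x = y" if "x \<in> carrier G" "y \<in> carrier G" for x y
    using assms(3) that by (auto simp: iso_def bij_betw_def inj_on_def)
  have p: "\<phi> g [^]\<^bsub>H\<^esub> i = \<phi> (g [^]\<^bsub>G\<^esub> i)" for i :: nat using D(1) by (simp add: hom_nat_pow)
  have "\<phi> g \<noteq> \<one>\<^bsub>H\<^esub>" using inj[of g "\<one>\<^bsub>G\<^esub>"] D by simp
  moreover have "\<phi> g [^]\<^bsub>H\<^esub> n = \<one>\<^bsub>H\<^esub>" using D by (simp add: p)
  moreover have "\<phi> h \<otimes>\<^bsub>H\<^esub> \<phi> h = \<one>\<^bsub>H\<^esub>" using D by (simp flip: hom_mult)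
  moreover have "\<phi> h \<otimes>\<^bsub>H\<^esub> \<phi> g \<otimes>\<^bsub>H\<^esub> \<phi> h = inv\<^bsub>H\<^esub> (\<phi> g)" using D by (simp flip: hom_mult hom_inv)
  moreover have "\<phi> h \<notin> (\<lambda>i. \<phi> g [^]\<^bsub>H\<^esub> i) ` {..<n}" using D inj by (auto simp: p)
  ultimately show ?thesis unfolding dihedral_pair_def using D by simp
qed

section \<open>Conjugacy classes of elements and of cyclic subgroups\<close>

lemma dihedral_pair_subgroup_iff:
  assumes "group G" "subgroup D G" "g \<in> D" "h \<in> D"
  shows "dihedral_pair n (G\<lparr>carrier := D\<rparr>) g h \<longleftrightarrow> dihedral_pair n G g h"
proof -
  interpret group G by fact
  have gh: "g \<in> carrier G" "h \<in> carrier G" using subgroup.mem_carrier[OF assms(2)] assms(3,4) by auto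
  have p: "g [^]\<^bsub>G\<lparr>carrier := D\<rparr>\<^esub> i = g [^]\<^bsub>G\<^esub> i" for i :: nat by (simp add: nat_pow_def)
  have "inv\<^bsub>G\<lparr>carrier := D\<rparr>\<^esub> g = inv\<^bsub>G\<^esub> g" by (rule m_inv_consistent[OF assms(2,3)])
  then show ?thesis unfolding dihedral_pair_def p using assms(3,4) gh by simp
qed

context group
begin

text \<open>For prime \<open>n\<close> these are the elements of order exactly \<open>n\<close>; the
  orders that occur are 2 and 3.\<close>

definition torsion :: "nat \<Rightarrow> 'a set" where
  "torsion n = {g \<in> carrier G. g \<noteq> \<one> \<and> g [^] n = \<one>}"

lemma torsionD: "g \<in> torsion n \<Longrightarrow> g \<in> carrier G" "g \<in> torsion n \<Longrightarrow> g \<noteq> \<one>" "g \<in> torsion n \<Longrightarrow> g [^] n = \<one>"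
  by (auto simp: torsion_def)

lemma torsion_2: "g \<in> torsion 2 \<Longrightarrow> g \<otimes> g = \<one>" "g \<in> torsion 2 \<Longrightarrow> inv g = g"
proof -
  assume g: "g \<in> torsion 2"
  have "g [^] Suc 1 = \<one>" using torsionD(3)[OF g] unfolding Suc_1 .
  then show "g \<otimes> g = \<one>" using torsionD(1)[OF g] by simp
  then show "inv g = g" using torsionD(1)[OF g] by (simp add: inv_equality)
qed

lemma torsion_3: "g \<in> torsion 3 \<Longrightarrow> inv g = g \<otimes> g" "g \<in> torsion 3 \<Longrightarrow> g \<otimes> g \<otimes> g = \<one>"
proof -
  assume g: "g \<in> torsion 3"
  have "g [^] Suc (Suc (Suc 0)) = \<one>" using torsionD(3)[OF g] unfolding numeral_3_eq_3 .
  then show "g \<otimes> g \<otimes> g = \<one>" using torsionD(1)[OF g] by simp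
  then show "inv g = g \<otimes> g" using torsionD(1)[OF g] by (simp add: inv_equality)
qed

lemma torsion_inv: "g \<in> torsion n \<Longrightarrow> inv g \<in> torsion n"
  by (auto simp: torsion_def nat_pow_inv inv_eq_1_iff)

lemma generate_torsion:
  assumes g: "g \<in> torsion n" and n: "n > 0"
  shows "generate G {g} = (\<lambda>i. g [^] i) ` {..<n}"
proof -
  note gt = torsionD[OF g]
  have "ord g dvd n" using gt pow_eq_id by blast
  then have "ord g \<noteq> 0" using n by auto
  then have "generate G {g} = {g [^] k | k. k \<in> (UNIV :: nat set)}" by (rule generate_pow_nat[OF gt(1)])
  also have "\<dots> = (\<lambda>i. g [^] i) ` {..<n}"
  proof
    show "{g [^] k | k. k \<in> (UNIV :: nat set)} \<subseteq> (\<lambda>i. g [^] i) ` {..<n}"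
    proof
      fix x assume "x \<in> {g [^] k | k. k \<in> (UNIV :: nat set)}"
      then obtain k :: nat where "x = g [^] k" by blast
      then have "x = g [^] (k mod n)" using pow_mod[OF gt(1,3)] by simp
      then show "x \<in> (\<lambda>i. g [^] i) ` {..<n}" using n by simp
    qed
  qed auto
  finally show ?thesis .
qed

lemma generate_torsion_2: "g \<in> torsion 2 \<Longrightarrow> generate G {g} = {\<one>, g}"
  and generate_torsion_3: "g \<in> torsion 3 \<Longrightarrow> generate G {g} = {\<one>, g, inv g}"
proof -
  have s: "{..<2::nat} = {0, Suc 0}" "{..<3::nat} = {0, Suc 0, Suc (Suc 0)}" by auto
  show "generate G {g} = {\<one>, g}" if g: "g \<in> torsion 2"
    using generate_torsion[OF g] torsionD(1)[OF g] by (simp add: s)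
  show "generate G {g} = {\<one>, g, inv g}" if g: "g \<in> torsion 3"
    using generate_torsion[OF g] torsionD(1)[OF g] by (simp add: s torsion_3(1)[OF g])
qed

lemma generate_torsion_eq_iff:
  assumes n: "n = 2 \<or> n = 3" and g: "g \<in> torsion n" "g' \<in> torsion n"
  shows "generate G {g} = generate G {g'} \<longleftrightarrow> g' = g \<or> g' = inv g"
proof -
  note gt = torsionD[OF g(1)] torsionD[OF g(2)]
  show ?thesis using n
  proof
    assume n: "n = 2"
    then have "generate G {g} = {\<one>, g}" "generate G {g'} = {\<one>, g'}" "inv g = g"
      using g generate_torsion_2 torsion_2(2) by auto
    then show ?thesis using gt(2,5) by (auto simp: doubleton_eq_iff)
  next
    assume n: "n = 3"
    have "generate G {g} = {\<one>, g, inv g}" "generate G {g'} = {\<one>, g', inv g'}" using g n generate_torsion_3 by auto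
    moreover have "{\<one>, g, inv g} = {\<one>, g', inv g'} \<longleftrightarrow> g' = g \<or> g' = inv g"
    proof
      assume "{\<one>, g, inv g} = {\<one>, g', inv g'}"
      then have "g' \<in> {\<one>, g, inv g}" by simp
      then show "g' = g \<or> g' = inv g" using gt(5) by simp
    next
      assume "g' = g \<or> g' = inv g"
      then show "{\<one>, g, inv g} = {\<one>, g', inv g'}" using gt(1) by (elim disjE) (simp_all add: insert_commute)
    qed
    ultimately show ?thesis by simp
  qed
qed

lemma cyclic_subgroups_torsion:
  assumes n: "n = 2 \<or> n = 3"
  shows "cyclic_subgroups G n = (\<lambda>g. generate G {g}) ` torsion n"
proof
  show "cyclic_subgroups G n \<subseteq> (\<lambda>g. generate G {g}) ` torsion n"
  proof
    fix C assume "C \<in> cyclic_subgroups G n"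
    then obtain g where g: "card C = n" "g \<in> carrier G" "C = generate G {g}" by (auto simp: cyclic_subgroups_def)
    then have o: "ord g = n" using generate_pow_card by simp
    have "g [^] n = \<one>" using pow_ord_eq_1[OF g(2)] o by simp
    moreover have "g \<noteq> \<one>" using o n ord_eq_1[OF g(2)] by auto
    ultimately show "C \<in> (\<lambda>g. generate G {g}) ` torsion n" using g by (auto simp: torsion_def)
  qed
  show "(\<lambda>g. generate G {g}) ` torsion n \<subseteq> cyclic_subgroups G n"
  proof
    fix C assume "C \<in> (\<lambda>g. generate G {g}) ` torsion n"
    then obtain g where g: "g \<in> torsion n" "C = generate G {g}" by blast
    have "n > 0" using n by auto
    then have "card C = n"
      using generate_torsion[OF g(1)] g(2) order_2_or_3_pow_inj[OF torsionD[OF g(1)] n] by (simp add: card_image)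
    then show "C \<in> cyclic_subgroups G n" using g torsionD(1) by (auto simp: cyclic_subgroups_def)
  qed
qed

section \<open>Conjugation of elements and of cyclic subgroups\<close>

definition conj_by :: "'a \<Rightarrow> 'a \<Rightarrow> 'a" where "conj_by x g = x \<otimes> g \<otimes> inv x"

lemma conj_by_closed [simp]: "x \<in> carrier G \<Longrightarrow> g \<in> carrier G \<Longrightarrow> conj_by x g \<in> carrier G"
  by (simp add: conj_by_def)

lemma conj_by_mult: "x \<in> carrier G \<Longrightarrow> g \<in> carrier G \<Longrightarrow> h \<in> carrier G \<Longrightarrow> conj_by x (g \<otimes> h) = conj_by x g \<otimes> conj_by x h"
proof -
  assume c: "x \<in> carrier G" "g \<in> carrier G" "h \<in> carrier G"
  have "conj_by x g \<otimes> conj_by x h = x \<otimes> g \<otimes> (inv x \<otimes> x) \<otimes> h \<otimes> inv x"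
    unfolding conj_by_def using c by (simp only: m_assoc inv_closed m_closed)
  then show ?thesis unfolding conj_by_def using c by (simp add: m_assoc)
qed

lemma conj_by_conj_by:
  "x \<in> carrier G \<Longrightarrow> y \<in> carrier G \<Longrightarrow> g \<in> carrier G \<Longrightarrow> conj_by y (conj_by x g) = conj_by (y \<otimes> x) g"
  by (simp add: conj_by_def m_assoc inv_mult_group)

lemma conj_by_one [simp]: "g \<in> carrier G \<Longrightarrow> conj_by \<one> g = g"
  by (simp add: conj_by_def)

lemma conj_by_inv_cancel [simp]: "x \<in> carrier G \<Longrightarrow> g \<in> carrier G \<Longrightarrow> conj_by (inv x) (conj_by x g) = g"
  by (simp add: conj_by_conj_by)

lemma conj_by_cancel [simp]: "x \<in> carrier G \<Longrightarrow> g \<in> carrier G \<Longrightarrow> conj_by x (conj_by (inv x) g) = g"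
  by (simp add: conj_by_conj_by)

lemma conj_by_iso: "x \<in> carrier G \<Longrightarrow> conj_by x \<in> iso G G"
proof (rule isoI)
  assume x: "x \<in> carrier G"
  show "conj_by x \<in> hom G G" using x by (intro homI) (simp_all add: conj_by_mult)
  show "bij_betw (conj_by x) (carrier G) (carrier G)"
    by (rule bij_betwI[of _ _ _ "conj_by (inv x)"]) (use x in auto)
qed

lemma conj_by_hom: "x \<in> carrier G \<Longrightarrow> group_hom G G (conj_by x)"
  using conj_by_iso by unfold_locales (simp add: iso_def)

lemma conj_by_inv: "x \<in> carrier G \<Longrightarrow> g \<in> carrier G \<Longrightarrow> conj_by x (inv g) = inv (conj_by x g)"
  by (rule group_hom.hom_inv[OF conj_by_hom])

lemma conj_by_pow: "x \<in> carrier G \<Longrightarrow> g \<in> carrier G \<Longrightarrow> conj_by x (g [^] (k::nat)) = conj_by x g [^] k"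
  by (rule group_hom.hom_nat_pow[OF conj_by_hom])

lemma conj_by_eq_one: "x \<in> carrier G \<Longrightarrow> g \<in> carrier G \<Longrightarrow> conj_by x g = \<one> \<longleftrightarrow> g = \<one>"
  using conj_by_inv_cancel[of x g] by (auto simp: conj_by_def)

lemma conj_by_torsion: "x \<in> carrier G \<Longrightarrow> g \<in> torsion n \<Longrightarrow> conj_by x g \<in> torsion n"
  by (auto simp: torsion_def conj_by_eq_one conj_by_pow[symmetric])

lemma conj_by_image: "x \<in> carrier G \<Longrightarrow> H \<subseteq> carrier G \<Longrightarrow> x <# H #> inv x = conj_by x ` H"
  by (force simp: l_coset_def r_coset_def conj_by_def)

lemma conj_by_generate:
  assumes x: "x \<in> carrier G" and g: "g \<in> torsion n" and n: "n > 0"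
  shows "x <# generate G {g} #> inv x = generate G {conj_by x g}"
proof -
  have "generate G {g} \<subseteq> carrier G" using torsionD(1)[OF g] by (intro generate_incl) simp
  then have "x <# generate G {g} #> inv x = conj_by x ` generate G {g}" by (rule conj_by_image[OF x])
  then show ?thesis
    unfolding generate_torsion[OF g n] generate_torsion[OF conj_by_torsion[OF x g] n]
    using x torsionD(1)[OF g] by (simp add: image_image conj_by_pow)
qed

lemma subgroup_conj_class_generate:
  assumes g: "g \<in> torsion n" and n: "n > 0"
  shows "subgroup_conj_class G (generate G {g}) = {generate G {conj_by x g} | x. x \<in> carrier G}"
  unfolding subgroup_conj_class_def orbit_def using conj_by_generate[OF _ g n] by (intro Collect_cong) auto

text \<open>A cyclic group of order 2 or 3 has no generators besides \<open>g\<close> and its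
  inverse, so conjugacy of the subgroups is conjugacy of generators up to inversion.\<close>

lemma subgroup_conj_class_eq_iff:
  assumes n: "n = 2 \<or> n = 3" and g: "g \<in> torsion n" "g' \<in> torsion n"
  shows "subgroup_conj_class G (generate G {g}) = subgroup_conj_class G (generate G {g'}) \<longleftrightarrow>
     (\<exists>x\<in>carrier G. g' = conj_by x g \<or> g' = inv (conj_by x g))"
proof -
  have n0: "n > 0" using n by auto
  note cl = subgroup_conj_class_generate[OF g(1) n0] subgroup_conj_class_generate[OF g(2) n0]
  note gc = torsionD(1)[OF g(1)] torsionD(1)[OF g(2)]
  show ?thesis
  proof
    assume "subgroup_conj_class G (generate G {g}) = subgroup_conj_class G (generate G {g'})"
    moreover have "generate G {g'} \<in> subgroup_conj_class G (generate G {g'})"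
      unfolding cl using gc by (intro CollectI exI[of _ \<one>]) simp
    ultimately have "generate G {g'} \<in> {generate G {conj_by x g} | x. x \<in> carrier G}" unfolding cl(1)[symmetric] by simp
    then obtain x where x: "x \<in> carrier G" "generate G {conj_by x g} = generate G {g'}" by force
    have "g' = conj_by x g \<or> g' = inv (conj_by x g)"
      by (rule generate_torsion_eq_iff[OF n conj_by_torsion[OF x(1) g(1)] g(2), THEN iffD1, OF x(2)])
    then show "\<exists>x\<in>carrier G. g' = conj_by x g \<or> g' = inv (conj_by x g)" using x(1) by blast
  next
    assume "\<exists>x\<in>carrier G. g' = conj_by x g \<or> g' = inv (conj_by x g)"
    then obtain x where x: "x \<in> carrier G" "g' = conj_by x g \<or> g' = inv (conj_by x g)" by blast
    have e: "generate G {conj_by y g'} = generate G {conj_by (y \<otimes> x) g}" if y: "y \<in> carrier G" for y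
    proof -
      have "conj_by y g' = conj_by (y \<otimes> x) g \<or> conj_by y g' = inv (conj_by (y \<otimes> x) g)"
        using x(2) by (elim disjE) (use x(1) y gc(1) in \<open>simp_all add: conj_by_inv conj_by_conj_by\<close>)
      then have "generate G {conj_by (y \<otimes> x) g} = generate G {conj_by y g'}"
        by (rule generate_torsion_eq_iff[OF n conj_by_torsion[OF m_closed[OF y x(1)] g(1)] conj_by_torsion[OF y g(2)], THEN iffD2])
      then show ?thesis by simp
    qed
    have e': "generate G {conj_by y g} = generate G {conj_by (y \<otimes> inv x) g'}" if y: "y \<in> carrier G" for y
      using e[of "y \<otimes> inv x"] y x(1) by (simp add: m_assoc)
    show "subgroup_conj_class G (generate G {g}) = subgroup_conj_class G (generate G {g'})"
      unfolding cl
    proof (rule subset_antisym; rule subsetI)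
      fix C assume "C \<in> {generate G {conj_by y g} | y. y \<in> carrier G}"
      then obtain y where "y \<in> carrier G" "C = generate G {conj_by y g}" by blast
      then show "C \<in> {generate G {conj_by y g'} | y. y \<in> carrier G}"
        using e' x(1) by (intro CollectI exI[of _ "y \<otimes> inv x"]) simp
    next
      fix C assume "C \<in> {generate G {conj_by y g'} | y. y \<in> carrier G}"
      then obtain y where "y \<in> carrier G" "C = generate G {conj_by y g'}" by blast
      then show "C \<in> {generate G {conj_by y g} | y. y \<in> carrier G}"
        using e x(1) by (intro CollectI exI[of _ "y \<otimes> x"]) simp
    qed
  qed
qed

text \<open>Words containing \<open>s\<close> are involutions, so an element of order 3 is
  \<open>c\<close> or its inverse, and \<open>s\<close> inverts both.\<close>

lemma dihedral_pair_rotation: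
  assumes D: "dihedral_pair 3 G c s" and x: "x \<in> dihedral_set 3 c s" "x \<in> torsion 3"
  shows "dihedral_pair 3 G x s"
proof -
  have cs: "c \<in> torsion 3" "s \<in> carrier G" "s \<otimes> s = \<one>" "s \<otimes> c \<otimes> s = inv c" "s \<notin> (\<lambda>i. c [^] i) ` {..<3::nat}"
    using D by (auto simp: dihedral_pair_def torsion_def)
  note cc = torsionD[OF cs(1)]
  obtain i j where ij: "x = c [^] i \<otimes> s [^] j" "i < (3::nat)" "j < (2::nat)"
    using x(1) by (auto simp: dihedral_set_def dihedral_word_def)
  have "j \<noteq> 1"
  proof
    assume j: "j = 1"
    have "x \<otimes> x = dihedral_word G c s (dihedral_mult 3 (i, 1) (i, 1))"
      using dihedral_word_mult[OF D, of i 1 i 1] ij j by (simp add: dihedral_word_def)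
    also have "\<dots> = \<one>" using ij(2) cc by (simp add: dihedral_word_def dihedral_mult_def)
    finally have "x \<otimes> x = \<one>" .
    then have "x = \<one>" using torsion_3(2)[OF x(2)] torsionD(1)[OF x(2)] by simp
    then show False using torsionD(2)[OF x(2)] by simp
  qed
  then have j: "j = 0" using ij(3) by auto
  have "i \<noteq> 0"
  proof
    assume "i = 0"
    then show False using ij(1) j torsionD(2)[OF x(2)] by simp
  qed
  then have "i = Suc 0 \<or> i = Suc (Suc 0)" using ij(2) by auto
  then have xc: "x = c \<or> x = inv c" using ij(1) j cc torsion_3(1)[OF cs(1)] by auto
  then show ?thesis
  proof
    assume x: "x = inv c"
    have "s \<otimes> inv c \<otimes> s = s \<otimes> (s \<otimes> c \<otimes> s) \<otimes> s" using cs(4) by simp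
    also have "\<dots> = (s \<otimes> s) \<otimes> c \<otimes> (s \<otimes> s)" using cs(2) cc(1) by (simp only: m_assoc m_closed)
    also have "\<dots> = inv (inv c)" using cs(3) cc(1) by simp
    finally have "s \<otimes> inv c \<otimes> s = inv (inv c)" .
    moreover have "(\<lambda>i. inv c [^] i) ` {..<3::nat} = (\<lambda>i. c [^] i) ` {..<3::nat}"
      using generate_torsion[OF cs(1)] generate_torsion[OF torsion_inv[OF cs(1)]]
        generate_torsion_eq_iff[OF _ cs(1) torsion_inv[OF cs(1)]] by simp
    ultimately show ?thesis using cs torsionD[OF torsion_inv[OF cs(1)]] unfolding x dihedral_pair_def by simp
  qed (use D in simp)
qed

text \<open>In the Klein group any further nontrivial element serves as \<open>y\<close>, because
  the group is commutative of exponent 2. In the symmetric group one standard pair is transported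
  along the isomorphism.\<close>

lemma torsion_dihedral_pair:
  assumes K: "is_dihedral n G" and x: "x \<in> torsion n"
  shows "\<exists>y. dihedral_pair n G x y"
proof -
  have "n = 2 \<and> G \<cong> integer_mod_group 2 \<times>\<times> integer_mod_group 2 \<or> n = 3 \<and> G \<cong> sym_group 3"
    using K by (simp add: is_dihedral_def)
  then show ?thesis
  proof
    let ?V = "integer_mod_group 2 \<times>\<times> integer_mod_group 2"
    assume n: "n = 2 \<and> G \<cong> ?V"
    then obtain \<phi> where \<phi>: "\<phi> \<in> iso G ?V" by (auto simp: is_iso_def)
    note V = klein_group_pair
    have \<phi>b: "bij_betw \<phi> (carrier G) (carrier ?V)" using \<phi> by (simp add: iso_def)
    have \<phi>h: "group_hom G ?V \<phi>" using \<phi> V(1) by (simp add: group_hom_def group_hom_axioms_def iso_def is_group)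
    have inj: "a = b" if "a \<in> carrier G" "b \<in> carrier G" "\<phi> a = \<phi> b" for a b
      using \<phi>b that by (auto simp: bij_betw_def inj_on_def)
    have im: "\<phi> a \<in> carrier ?V" if "a \<in> carrier G" for a using \<phi>b that bij_betw_apply by fast
    have sq: "a \<otimes> a = \<one>" if a: "a \<in> carrier G" for a
      by (rule inj) (use a V(5)[OF im[OF a]] group_hom.hom_mult[OF \<phi>h a a] group_hom.hom_one[OF \<phi>h] in auto)
    have ab: "a \<otimes> b = b \<otimes> a" if a: "a \<in> carrier G" "b \<in> carrier G" for a b
      by (rule inj) (use a V(4)[OF im[OF a(1)] im[OF a(2)]] group_hom.hom_mult[OF \<phi>h] in auto)
    have c4: "card (carrier G) = 4" using bij_betw_same_card[OF \<phi>b] V(6) by simp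
    have "\<not> carrier G \<subseteq> {\<one>, x}"
    proof
      assume "carrier G \<subseteq> {\<one>, x}"
      then have "card (carrier G) \<le> card {\<one>, x}" by (intro card_mono) auto
      also have "\<dots> \<le> 2" by (simp add: card_insert_if)
      finally show False using c4 by simp
    qed
    then obtain y where y: "y \<in> carrier G" "y \<noteq> \<one>" "y \<noteq> x" by blast
    have xc: "x \<in> torsion 2" "x \<in> carrier G" using x n torsionD by auto
    have "y \<otimes> x \<otimes> y = x" using ab[OF y(1) xc(2)] sq[OF y(1)] xc(2) y(1) by (simp add: m_assoc)
    moreover have "(\<lambda>i. x [^] i) ` {..<2::nat} = {\<one>, x}"
      using generate_torsion[OF xc(1)] generate_torsion_2[OF xc(1)] by simp
    ultimately have "dihedral_pair 2 G x y"
      unfolding dihedral_pair_def using sq[OF y(1)] y torsionD[OF xc(1)] torsion_2(2)[OF xc(1)] by simp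
    then show ?thesis using n by blast
  next
    assume n: "n = 3 \<and> G \<cong> sym_group 3"
    then have "sym_group 3 \<cong> G" by (metis iso_sym)
    then obtain \<phi> where \<phi>: "\<phi> \<in> iso (sym_group 3) G" by (auto simp: is_iso_def)
    obtain c s where cs: "dihedral_pair 3 (sym_group 3) c s" "carrier (sym_group 3) = group.dihedral_set (sym_group 3) 3 c s"
      by (rule sym_group_3_pair)
    interpret S: group "sym_group 3" by (rule sym_group_is_group)
    have \<phi>b: "bij_betw \<phi> (carrier (sym_group 3)) (carrier G)" using \<phi> by (simp add: iso_def)
    interpret h: group_hom "sym_group 3" G \<phi> using \<phi> by unfold_locales (simp add: iso_def)
    obtain z where z: "z \<in> carrier (sym_group 3)" "x = \<phi> z" 
    proof -
      have "x \<in> \<phi> ` carrier (sym_group 3)" using bij_betw_imp_surj_on[OF \<phi>b] torsionD(1)[OF x] by simp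
      then show thesis using that by blast
    qed
    have "z \<in> S.torsion 3"
    proof -
      have "z \<noteq> \<one>\<^bsub>sym_group 3\<^esub>" using torsionD(2)[OF x] z(2) h.hom_one by auto
      moreover have "\<phi> (z [^]\<^bsub>sym_group 3\<^esub> (3::nat)) = \<phi> \<one>\<^bsub>sym_group 3\<^esub>"
        using torsionD(3)[OF x] n z h.hom_nat_pow[OF z(1)] h.hom_one by simp
      then have "z [^]\<^bsub>sym_group 3\<^esub> (3::nat) = \<one>\<^bsub>sym_group 3\<^esub>"
        using \<phi>b z(1) by (auto simp: bij_betw_def inj_on_def)
      ultimately show ?thesis using z(1) by (simp add: S.torsion_def)
    qed
    then have "dihedral_pair 3 (sym_group 3) z s" using S.dihedral_pair_rotation[OF cs(1)] z(1) cs(2) by simp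
    then have "dihedral_pair 3 G x (\<phi> s)"
      using dihedral_pair_transfer[OF S.is_group is_group \<phi>] z(2) by simp
    then show ?thesis using n by blast
  qed
qed

text \<open>Trades an abstract dihedral subgroup for a single element \<open>h\<close>, the form
  that can be compared with flips of the axis and with inverting elements.\<close>

lemma contained_in_dihedral_iff:
  assumes n: "n = 2 \<or> n = 3" and g: "g \<in> torsion n"
  shows "(\<exists>D. subgroup D G \<and> is_dihedral n (G\<lparr>carrier := D\<rparr>) \<and> generate G {g} \<subseteq> D) \<longleftrightarrow>
     (\<exists>h. dihedral_pair n G g h)"
proof
  assume "\<exists>D. subgroup D G \<and> is_dihedral n (G\<lparr>carrier := D\<rparr>) \<and> generate G {g} \<subseteq> D"
  then obtain D where D: "subgroup D G" "is_dihedral n (G\<lparr>carrier := D\<rparr>)" "generate G {g} \<subseteq> D" by blast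
  interpret K: group "G\<lparr>carrier := D\<rparr>" by (rule subgroup.subgroup_is_group[OF D(1) is_group])
  have gD: "g \<in> D" using D(3) generate.incl[of g "{g}" G] by auto
  have "g \<in> K.torsion n" using torsionD[OF g] gD by (simp add: K.torsion_def nat_pow_def)
  then obtain h where h: "dihedral_pair n (G\<lparr>carrier := D\<rparr>) g h" using K.torsion_dihedral_pair[OF D(2)] by blast
  then have "h \<in> D" by (simp add: dihedral_pair_def)
  then show "\<exists>h. dihedral_pair n G g h" using h dihedral_pair_subgroup_iff[OF is_group D(1) gD] by blast
next
  assume "\<exists>h. dihedral_pair n G g h"
  then obtain h where h: "dihedral_pair n G g h" by blast
  then have gh: "g \<in> carrier G" "h \<in> carrier G" by (simp_all add: dihedral_pair_def)
  let ?D = "dihedral_set n g h"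
  have D: "subgroup ?D G" by (rule dihedral_set_subgroup[OF h n])
  interpret K: group "G\<lparr>carrier := ?D\<rparr>" by (rule subgroup.subgroup_is_group[OF D is_group])
  have n0: "n > 1" using n by auto
  have p: "dihedral_word (G\<lparr>carrier := ?D\<rparr>) g h = dihedral_word G g h" by (simp add: dihedral_word_def nat_pow_def)
  have gD: "g \<in> ?D" unfolding dihedral_set_def by (rule image_eqI[of _ _ "(1, 0)"]) (use gh n0 in \<open>auto simp: dihedral_word_def\<close>)
  have hD: "h \<in> ?D" unfolding dihedral_set_def by (rule image_eqI[of _ _ "(0, 1)"]) (use gh n0 in \<open>auto simp: dihedral_word_def\<close>)
  have KD: "dihedral_pair n (G\<lparr>carrier := ?D\<rparr>) g h" using dihedral_pair_subgroup_iff[OF is_group D gD hD] h by simp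
  have full: "carrier (G\<lparr>carrier := ?D\<rparr>) = K.dihedral_set n g h"
    unfolding K.dihedral_set_def p by (simp add: dihedral_set_def)
  have "is_dihedral n (G\<lparr>carrier := ?D\<rparr>)"
    using n
  proof
    assume n: "n = 2"
    have "G\<lparr>carrier := ?D\<rparr> \<cong> integer_mod_group 2 \<times>\<times> integer_mod_group 2"
      by (rule dihedral_pairs_isomorphic[OF K.is_group klein_group_pair(1) assms(1) KD, where g' = "(1, 0)" and h' = "(0, 1)"])
        (use full n klein_group_pair(2,3) in simp_all)
    then show ?thesis using n by (simp add: is_dihedral_def)
  next
    assume n: "n = 3"
    obtain c s where cs: "dihedral_pair 3 (sym_group 3) c s" "carrier (sym_group 3) = group.dihedral_set (sym_group 3) 3 c s"
      by (rule sym_group_3_pair)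
    have "G\<lparr>carrier := ?D\<rparr> \<cong> sym_group 3"
      by (rule dihedral_pairs_isomorphic[OF K.is_group sym_group_is_group assms(1) KD, where g' = c and h' = s]) (use full n cs in simp_all)
    then show ?thesis using n by (simp add: is_dihedral_def)
  qed
  moreover have "generate G {g} \<subseteq> ?D" by (rule generate_subgroup_incl[OF _ D]) (use gD in simp)
  ultimately show "\<exists>D. subgroup D G \<and> is_dihedral n (G\<lparr>carrier := D\<rparr>) \<and> generate G {g} \<subseteq> D" using D by blast
qed

lemma num_cyclic_classes_torsion:
  assumes n: "n = 2 \<or> n = 3"
  shows "num_cyclic_classes G n = card ((\<lambda>g. subgroup_conj_class G (generate G {g})) ` torsion n)"
    and "num_dihedral_cyclic_classes G n =
       card ((\<lambda>g. subgroup_conj_class G (generate G {g})) ` {g \<in> torsion n. \<exists>h. dihedral_pair n G g h})"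
proof -
  show "num_cyclic_classes G n = card ((\<lambda>g. subgroup_conj_class G (generate G {g})) ` torsion n)"
    unfolding num_cyclic_classes_def cyclic_subgroups_torsion[OF n] image_image ..
  have filter: "{C \<in> f ` S. P C} = f ` {g \<in> S. P (f g)}" for f :: "'a \<Rightarrow> 'a set" and S P by blast
  have "{C \<in> cyclic_subgroups G n. \<exists>D. subgroup D G \<and> is_dihedral n (G\<lparr>carrier := D\<rparr>) \<and> C \<subseteq> D}
     = (\<lambda>g. generate G {g}) ` {g \<in> torsion n. \<exists>h. dihedral_pair n G g h}"
    unfolding cyclic_subgroups_torsion[OF n] filter
    by (intro arg_cong[of _ _ "image _"] Collect_cong conj_cong refl contained_in_dihedral_iff[OF n])
  then show "num_dihedral_cyclic_classes G n =
       card ((\<lambda>g. subgroup_conj_class G (generate G {g})) ` {g \<in> torsion n. \<exists>h. dihedral_pair n G g h})"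
    unfolding num_dihedral_cyclic_classes_def by (simp add: image_image)
qed

end

section \<open>Counting representatives of torsion classes\<close>

context group
begin

lemma conj_by_dihedral_pair:
  "dihedral_pair n G g h \<Longrightarrow> x \<in> carrier G \<Longrightarrow> dihedral_pair n G (conj_by x g) (conj_by x h)"
  by (rule dihedral_pair_transfer[OF is_group is_group conj_by_iso])

lemma representative_unique:
  assumes T: "torsion_representatives G T" and t: "t \<in> T" "t' \<in> T" and x: "x \<in> carrier G" "t' = conj_by x t"
  shows "t' = t"
proof -
  have fo: "t \<in> finite_order_elements G" using T t by (auto simp: torsion_representatives_def)
  then have tc: "t \<in> carrier G" by (simp add: finite_order_elements_def)
  define P where "P s \<longleftrightarrow> s \<in> T \<and> (\<exists>h\<in>carrier G. s = h \<otimes> t \<otimes> inv h)" for s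
  have "\<exists>!s. P s" using T fo by (simp add: torsion_representatives_def P_def)
  moreover have "P t" unfolding P_def using t tc by (intro conjI bexI[of _ \<one>]) auto
  moreover have "P t'" unfolding P_def using t x by (auto simp: conj_by_def)
  ultimately show ?thesis by metis
qed

lemma representative_exists:
  assumes T: "torsion_representatives G T" and g: "g \<in> torsion n" and n: "n > 0"
  obtains x where "x \<in> carrier G" "conj_by x g \<in> T \<inter> torsion n"
proof -
  have "g \<in> finite_order_elements G" using torsionD[OF g] n by (auto simp: finite_order_elements_def)
  then have "\<exists>!s. s \<in> T \<and> (\<exists>h\<in>carrier G. s = conj_by h g)" using T by (simp add: torsion_representatives_def conj_by_def)
  then have "\<exists>s. s \<in> T \<and> (\<exists>h\<in>carrier G. s = conj_by h g)" by (rule ex1_implies_ex)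
  then obtain x where "x \<in> carrier G" "conj_by x g \<in> T" by blast
  then show thesis using that conj_by_torsion[OF _ g] by blast
qed

lemma conj_class_representatives:
  assumes T: "torsion_representatives G T" and n: "n = 2 \<or> n = 3"
  defines "\<Phi> \<equiv> \<lambda>g. subgroup_conj_class G (generate G {g})"
  shows "\<Phi> ` torsion n = \<Phi> ` (T \<inter> torsion n)"
    and "\<Phi> ` {g \<in> torsion n. \<exists>h. dihedral_pair n G g h} = \<Phi> ` {t \<in> T \<inter> torsion n. \<exists>h. dihedral_pair n G t h}"
proof -
  have n0: "n > 0" using n by auto
  have ex: "\<exists>t\<in>T \<inter> torsion n. \<Phi> t = \<Phi> g \<and> ((\<exists>h. dihedral_pair n G g h) \<longrightarrow> (\<exists>h. dihedral_pair n G t h))"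
    if g: "g \<in> torsion n" for g
  proof -
    obtain x where x: "x \<in> carrier G" "conj_by x g \<in> T \<inter> torsion n" by (rule representative_exists[OF T g n0])
    have "\<Phi> g = \<Phi> (conj_by x g)"
      unfolding \<Phi>_def using subgroup_conj_class_eq_iff[OF n g conj_by_torsion[OF x(1) g]] x(1) by blast
    then show ?thesis using x conj_by_dihedral_pair[OF _ x(1)] by metis
  qed
  show "\<Phi> ` torsion n = \<Phi> ` (T \<inter> torsion n)"
  proof (rule subset_antisym; rule subsetI)
    fix c assume "c \<in> \<Phi> ` torsion n"
    then obtain g where "g \<in> torsion n" "c = \<Phi> g" by blast
    with ex[of g] show "c \<in> \<Phi> ` (T \<inter> torsion n)" by (metis imageI)
  qed auto
  show "\<Phi> ` {g \<in> torsion n. \<exists>h. dihedral_pair n G g h} = \<Phi> ` {t \<in> T \<inter> torsion n. \<exists>h. dihedral_pair n G t h}"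
  proof (rule subset_antisym; rule subsetI)
    fix c assume "c \<in> \<Phi> ` {g \<in> torsion n. \<exists>h. dihedral_pair n G g h}"
    then obtain g where g: "g \<in> torsion n" "\<exists>h. dihedral_pair n G g h" "c = \<Phi> g" by blast
    obtain t where t: "t \<in> T \<inter> torsion n" "\<Phi> t = \<Phi> g" "\<exists>h. dihedral_pair n G t h" using ex[OF g(1)] g(2) by blast
    then show "c \<in> \<Phi> ` {t \<in> T \<inter> torsion n. \<exists>h. dihedral_pair n G t h}" unfolding g(3) t(2)[symmetric] by (intro imageI) simp
  qed auto
qed

text \<open>A group of order 2 has a single generator, so classes of elements and of subgroups
  correspond.\<close>

lemma card_representatives_2:
  assumes T: "torsion_representatives G T"
  shows "card (T \<inter> torsion 2) = num_cyclic_classes G 2"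
    and "card {t \<in> T \<inter> torsion 2. \<exists>h. dihedral_pair 2 G t h} = num_dihedral_cyclic_classes G 2"
proof -
  let ?\<Phi> = "\<lambda>g. subgroup_conj_class G (generate G {g})"
  have inj: "inj_on ?\<Phi> (T \<inter> torsion 2)"
  proof (rule inj_onI)
    fix t t' assume t: "t \<in> T \<inter> torsion 2" "t' \<in> T \<inter> torsion 2" "?\<Phi> t = ?\<Phi> t'"
    then obtain x where x: "x \<in> carrier G" "t' = conj_by x t \<or> t' = inv (conj_by x t)"
      using subgroup_conj_class_eq_iff[of 2 t t'] by auto
    have "inv (conj_by x t) = conj_by x t" using torsion_2(2)[OF conj_by_torsion[OF x(1)]] t(1) by blast
    then have "t' = conj_by x t" using x(2) by auto
    then have "t' = t" by (rule representative_unique[OF T _ _ x(1), rotated -1]) (use t in auto)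
    then show "t = t'" by simp
  qed
  show "card (T \<inter> torsion 2) = num_cyclic_classes G 2"
    using card_image[OF inj] conj_class_representatives(1)[OF T, of 2] num_cyclic_classes_torsion(1)[of 2] by simp
  have "inj_on ?\<Phi> {t \<in> T \<inter> torsion 2. \<exists>h. dihedral_pair 2 G t h}" by (rule inj_on_subset[OF inj]) auto
  from card_image[OF this] show "card {t \<in> T \<inter> torsion 2. \<exists>h. dihedral_pair 2 G t h} = num_dihedral_cyclic_classes G 2"
    using conj_class_representatives(2)[OF T, of 2] num_cyclic_classes_torsion(2)[of 2] by simp
qed

text \<open>In a general group an element inverting \<open>g\<close> may have order larger than 2;
  \<open>inv2\<close> excludes this, and for \<open>\<Gamma>\<close> it comes from
  \<open>inverting_case\<close>. Such an element is no power of \<open>g\<close>, since powers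
  commute with \<open>g\<close>.\<close>

lemma dihedral_pair_3_iff:
  assumes inv2: "\<And>g h. g \<in> torsion 3 \<Longrightarrow> h \<in> carrier G \<Longrightarrow> conj_by h g = inv g \<Longrightarrow> h \<otimes> h = \<one>"
    and g: "g \<in> torsion 3"
  shows "(\<exists>h. dihedral_pair 3 G g h) \<longleftrightarrow> (\<exists>h\<in>carrier G. conj_by h g = inv g)"
proof
  assume "\<exists>h. dihedral_pair 3 G g h"
  then obtain h where h: "h \<in> carrier G" "h \<otimes> h = \<one>" "h \<otimes> g \<otimes> h = inv g" by (auto simp: dihedral_pair_def)
  then have "inv h = h" by (simp add: inv_equality)
  then have "conj_by h g = inv g" using h(3) by (simp add: conj_by_def)
  then show "\<exists>h\<in>carrier G. conj_by h g = inv g" using h(1) by blast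
next
  assume "\<exists>h\<in>carrier G. conj_by h g = inv g"
  then obtain h where h: "h \<in> carrier G" "conj_by h g = inv g" by blast
  note gt = torsionD[OF g]
  have hh: "h \<otimes> h = \<one>" by (rule inv2[OF g h])
  then have "inv h = h" using h(1) by (simp add: inv_equality)
  then have hgh: "h \<otimes> g \<otimes> h = inv g" using h(2) by (simp add: conj_by_def)
  have "h \<notin> (\<lambda>i. g [^] i) ` {..<3::nat}"
  proof
    assume "h \<in> (\<lambda>i. g [^] i) ` {..<3::nat}"
    then obtain i :: nat where i: "h = g [^] i" by blast
    have "h \<otimes> g = g \<otimes> h" unfolding i using gt(1) by (metis nat_pow_Suc nat_pow_Suc2)
    then have "conj_by h g = g" using h(1) gt(1) by (simp add: conj_by_def m_assoc)
    then have "g \<otimes> g = \<one>" using h(2) gt(1) by (metis r_inv)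
    then have "g = \<one>" using torsion_3(2)[OF g] gt(1) by simp
    then show False using gt(2) by simp
  qed
  then show "\<exists>h. dihedral_pair 3 G g h" using gt h(1) hh hgh unfolding dihedral_pair_def by blast
qed

text \<open>The fibre of \<open>t \<mapsto> [\<langle>t\<rangle>]\<close> through \<open>t\<close> consists of \<open>t\<close> and of the representative of \<open>t\<^sup>-\<^sup>1\<close>; these
  coincide exactly for the classes that are counted by \<^const>\<open>num_dihedral_cyclic_classes\<close>.\<close>

lemma card_representatives_3:
  assumes T: "torsion_representatives G T" and fin: "finite T"
    and inv2: "\<And>g h. g \<in> torsion 3 \<Longrightarrow> h \<in> carrier G \<Longrightarrow> conj_by h g = inv g \<Longrightarrow> h \<otimes> h = \<one>"
  shows "card (T \<inter> torsion 3) + num_dihedral_cyclic_classes G 3 = 2 * num_cyclic_classes G 3"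
proof -
  define \<Phi> where "\<Phi> = (\<lambda>g. subgroup_conj_class G (generate G {g}))"
  define S where "S = T \<inter> torsion 3"
  define star where "star t \<longleftrightarrow> (\<exists>h. dihedral_pair 3 G t h)" for t
  have finS: "finite S" using fin by (simp add: S_def)
  have num: "num_cyclic_classes G 3 = card (\<Phi> ` S)" "num_dihedral_cyclic_classes G 3 = card (\<Phi> ` {t \<in> S. star t})"
    using num_cyclic_classes_torsion[of 3] conj_class_representatives[OF T, of 3] by (simp_all add: \<Phi>_def S_def star_def)
  have fibre: "\<exists>s. {u \<in> S. \<Phi> u = \<Phi> t} = {t, s} \<and> (star t \<longleftrightarrow> s = t)" if t: "t \<in> S" for t
  proof -
    have tt: "t \<in> T" "t \<in> torsion 3" "t \<in> carrier G" using t torsionD(1) by (auto simp: S_def)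
    obtain x where x: "x \<in> carrier G" "conj_by x (inv t) \<in> T \<inter> torsion 3"
      by (rule representative_exists[OF T torsion_inv[OF tt(2)]]) simp
    define s where "s = conj_by x (inv t)"
    have s: "s \<in> S" "s \<in> T" "s \<in> carrier G" using x tt(3) by (auto simp: s_def S_def)
    have ts: "inv t = conj_by (inv x) s" using x(1) tt(3) by (simp add: s_def)
    have "\<Phi> u = \<Phi> t \<longleftrightarrow> u = t \<or> u = s" if u: "u \<in> S" for u
    proof -
      have ut: "u \<in> T" "u \<in> torsion 3" using u by (auto simp: S_def)
      have "\<Phi> t = \<Phi> u \<longleftrightarrow> (\<exists>y\<in>carrier G. u = conj_by y t \<or> u = inv (conj_by y t))"
        unfolding \<Phi>_def by (rule subgroup_conj_class_eq_iff[OF _ tt(2) ut(2)]) simp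
      also have "\<dots> \<longleftrightarrow> u = t \<or> u = s"
      proof
        assume "\<exists>y\<in>carrier G. u = conj_by y t \<or> u = inv (conj_by y t)"
        then obtain y where y: "y \<in> carrier G" "u = conj_by y t \<or> u = inv (conj_by y t)" by blast
        from y(2) show "u = t \<or> u = s"
        proof
          assume "u = conj_by y t"
          then show ?thesis using representative_unique[OF T tt(1) ut(1) y(1)] by simp
        next
          assume "u = inv (conj_by y t)"
          also have "\<dots> = conj_by y (inv t)" using conj_by_inv[OF y(1) tt(3)] by simp
          also have "\<dots> = conj_by (y \<otimes> inv x) s" unfolding ts using y(1) x(1) s(3) by (simp add: conj_by_conj_by)
          finally show ?thesis using representative_unique[OF T s(2) ut(1), of "y \<otimes> inv x"] y(1) x(1) by simp
        qed
      next
        assume "u = t \<or> u = s"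
        then show "\<exists>y\<in>carrier G. u = conj_by y t \<or> u = inv (conj_by y t)"
        proof
          assume "u = t" then show ?thesis using tt(3) by (intro bexI[of _ \<one>]) auto
        next
          assume "u = s" then show ?thesis using conj_by_inv[OF x(1) tt(3)] x(1) by (auto simp: s_def)
        qed
      qed
      finally show ?thesis by auto
    qed
    then have "{u \<in> S. \<Phi> u = \<Phi> t} = {t, s}" using t s(1) by auto
    moreover have "star t \<longleftrightarrow> s = t"
    proof -
      have "star t \<longleftrightarrow> (\<exists>h\<in>carrier G. conj_by h t = inv t)"
        unfolding star_def by (rule dihedral_pair_3_iff[OF inv2 tt(2)])
      also have "\<dots> \<longleftrightarrow> s = t"
      proof
        assume "\<exists>h\<in>carrier G. conj_by h t = inv t"
        then obtain h where h: "h \<in> carrier G" "conj_by h t = inv t" by blast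
        have "s = conj_by (x \<otimes> h) t" unfolding s_def h(2)[symmetric] using h(1) x(1) tt(3) by (simp add: conj_by_conj_by)
        then show "s = t" using representative_unique[OF T tt(1) s(2), of "x \<otimes> h"] h(1) x(1) by simp
      next
        assume "s = t"
        then have "inv t = conj_by (inv x) t" using ts by simp
        then show "\<exists>h\<in>carrier G. conj_by h t = inv t" using x(1) by (intro bexI[of _ "inv x"]) auto
      qed
      finally show ?thesis .
    qed
    ultimately show ?thesis by blast
  qed
  \<comment> \<open>Each class of subgroups contributes 2: two representatives, or one
    representative and one unit from the starred count. A starred member makes its fibre a
    singleton, so the property depends on the class alone.\<close>
  have two: "card {u \<in> S. \<Phi> u = c} + (if c \<in> \<Phi> ` {t \<in> S. star t} then 1 else 0) = 2" if "c \<in> \<Phi> ` S" for c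
  proof -
    obtain t where t: "t \<in> S" "c = \<Phi> t" using \<open>c \<in> \<Phi> ` S\<close> by blast
    obtain s where s: "{u \<in> S. \<Phi> u = \<Phi> t} = {t, s}" "star t \<longleftrightarrow> s = t" using fibre[OF t(1)] by blast
    have "c \<in> \<Phi> ` {t \<in> S. star t} \<longleftrightarrow> s = t"
    proof
      assume "c \<in> \<Phi> ` {t \<in> S. star t}"
      then obtain t' where t': "t' \<in> S" "star t'" "c = \<Phi> t'" by blast
      obtain s' where s': "{u \<in> S. \<Phi> u = \<Phi> t'} = {t', s'}" "star t' \<longleftrightarrow> s' = t'" using fibre[OF t'(1)] by blast
      have "{t, s} = {t'}" using s(1) s' t'(2,3) t(2) by simp
      then show "s = t" by auto
    next
      assume "s = t"
      then show "c \<in> \<Phi> ` {t \<in> S. star t}" using s(2) t by simp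
    qed
    then show ?thesis using s(1) by (auto simp: t(2))
  qed
  have "card S = (\<Sum>t\<in>S. 1)" by simp
  also have "\<dots> = (\<Sum>c\<in>\<Phi> ` S. \<Sum>t\<in>{u \<in> S. \<Phi> u = c}. 1)" by (rule sum.image_gen[OF finS])
  finally have 1: "card S = (\<Sum>c\<in>\<Phi> ` S. card {u \<in> S. \<Phi> u = c})" by simp
  have "(\<Sum>c\<in>\<Phi> ` S. if c \<in> \<Phi> ` {t \<in> S. star t} then 1 else 0 :: nat) = card (\<Phi> ` S \<inter> \<Phi> ` {t \<in> S. star t})"
    using finS by (simp add: sum.If_cases)
  moreover have "\<Phi> ` S \<inter> \<Phi> ` {t \<in> S. star t} = \<Phi> ` {t \<in> S. star t}" by auto
  ultimately have 2: "card (\<Phi> ` {t \<in> S. star t}) = (\<Sum>c\<in>\<Phi> ` S. if c \<in> \<Phi> ` {t \<in> S. star t} then 1 else 0)" by simp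
  have "card S + card (\<Phi> ` {t \<in> S. star t}) = (\<Sum>c\<in>\<Phi> ` S. card {u \<in> S. \<Phi> u = c} + (if c \<in> \<Phi> ` {t \<in> S. star t} then 1 else 0))"
    unfolding 1 2 by (rule sum.distrib[symmetric])
  also have "\<dots> = (\<Sum>c\<in>\<Phi> ` S. 2)" by (rule sum.cong[OF refl two])
  finally show ?thesis unfolding num S_def[symmetric] by simp
qed

text \<open>Two elements of a \<open>G\<close>-conjugacy class are conjugate under \<open>H\<close> if the conjugating elements lie
  in the same coset of \<open>H\<close>.\<close>

lemma finite_index_representatives:
  assumes H: "subgroup H G" "finite (rcosets H)" and S: "S \<subseteq> carrier G"
    and \<kappa>: "finite (\<kappa> ` S)" "\<And>g g'. g \<in> S \<Longrightarrow> g' \<in> S \<Longrightarrow> \<kappa> g = \<kappa> g' \<Longrightarrow> \<exists>x\<in>carrier G. x \<otimes> g = g' \<otimes> x"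
    and rep: "\<And>g g' y. g \<in> S \<Longrightarrow> g' \<in> S \<Longrightarrow> y \<in> H \<Longrightarrow> y \<otimes> g = g' \<otimes> y \<Longrightarrow> g = g'"
  shows "finite S"
proof -
  \<comment> \<open>\<open>b g\<close> is a base point chosen for the invariant of \<open>g\<close>.
    The pair of the invariant and the coset of a conjugator from the base point will determine
    \<open>g\<close>.\<close>
  define b where "b g = inv_into S \<kappa> (\<kappa> g)" for g
  have b: "b g \<in> S" "\<kappa> (b g) = \<kappa> g" if "g \<in> S" for g
    using that by (auto simp: b_def intro: inv_into_into f_inv_into_f)
  define X where "X g = (SOME x. x \<in> carrier G \<and> x \<otimes> b g = g \<otimes> x)" for g
  have X: "X g \<in> carrier G" "X g \<otimes> b g = g \<otimes> X g" if g: "g \<in> S" for g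
  proof -
    have "\<exists>x. x \<in> carrier G \<and> x \<otimes> b g = g \<otimes> x" using \<kappa>(2)[OF b(1)[OF g] g b(2)[OF g]] by blast
    from someI_ex[OF this] show "X g \<in> carrier G" "X g \<otimes> b g = g \<otimes> X g" by (simp_all add: X_def)
  qed
  have "inj_on (\<lambda>g. (\<kappa> g, H #> X g)) S"
  proof (rule inj_onI)
    fix g g' assume g: "g \<in> S" "g' \<in> S" and "(\<kappa> g, H #> X g) = (\<kappa> g', H #> X g')"
    then have e: "\<kappa> g = \<kappa> g'" "H #> X g = H #> X g'" by auto
    have bb: "b g = b g'" using e(1) by (simp add: b_def)
    have gc: "g \<in> carrier G" "g' \<in> carrier G" "b g \<in> carrier G" using g S b(1) by auto
    have "X g' \<in> H #> X g" unfolding e(2) using subgroup.one_closed[OF H(1)] X(1)[OF g(2)] by (force simp: r_coset_def)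
    then obtain y where y: "y \<in> H" "X g' = y \<otimes> X g" by (auto simp: r_coset_def)
    have yc: "y \<in> carrier G" using subgroup.mem_carrier[OF H(1) y(1)] .
    note Xc = X(1)[OF g(1)]
    have "(y \<otimes> g) \<otimes> X g = y \<otimes> (X g \<otimes> b g)" using X(2)[OF g(1)] yc gc Xc by (simp add: m_assoc)
    also have "\<dots> = X g' \<otimes> b g'" using y(2) bb yc gc Xc by (simp add: m_assoc)
    also have "\<dots> = (g' \<otimes> y) \<otimes> X g" unfolding X(2)[OF g(2)] using y(2) yc gc Xc by (simp add: m_assoc)
    finally have "y \<otimes> g = g' \<otimes> y" using yc gc Xc by simp
    then show "g = g'" by (rule rep[OF g y(1)])
  qed
  moreover have "(\<lambda>g. (\<kappa> g, H #> X g)) ` S \<subseteq> \<kappa> ` S \<times> rcosets H" using X(1) by (auto simp: RCOSETS_def)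
  then have "finite ((\<lambda>g. (\<kappa> g, H #> X g)) ` S)" by (rule finite_subset) (use \<kappa>(1) H(2) in simp)
  ultimately show ?thesis by (rule finite_imageD[rotated])
qed

end

section \<open>Direct sums with known summands\<close>

text \<open>Finiteness of \<open>T\<close> voids the support condition, so elements are arbitrary
  families. The coordinate at \<open>t0\<close> lands in \<open>N\<close>, those in \<open>S\<close>
  are enumerated as rational coordinates, and each remaining one has a single possible
  value.\<close>

lemma direct_sum_isomorphic:
  assumes fin: "finite T" and t0: "t0 \<in> T" and S: "S \<subseteq> T - {t0}"
    and N: "module_isomorphic (M t0) N"
    and rat: "\<And>t. t \<in> S \<Longrightarrow> module_isomorphic (M t) rat_module"
    and van: "\<And>t. t \<in> T - {t0} - S \<Longrightarrow> vanishes (M t)"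
    and k: "card S = k"
  shows "module_isomorphic (direct_sum T M) (direct_sum2 N (rat_space k))"
proof -
  obtain h0 where h0: "bij_betw h0 (carrier (M t0)) (carrier N)"
    "\<And>x y. x \<in> carrier (M t0) \<Longrightarrow> y \<in> carrier (M t0) \<Longrightarrow> h0 (x \<oplus>\<^bsub>M t0\<^esub> y) = h0 x \<oplus>\<^bsub>N\<^esub> h0 y"
    "\<And>r x. x \<in> carrier (M t0) \<Longrightarrow> h0 (r \<odot>\<^bsub>M t0\<^esub> x) = r \<odot>\<^bsub>N\<^esub> h0 x"
    using N unfolding module_isomorphic_def by blast
  define Q where "Q t f \<longleftrightarrow> bij_betw f (carrier (M t)) (UNIV :: rat set) \<and>
      (\<forall>x\<in>carrier (M t). \<forall>y\<in>carrier (M t). f (x \<oplus>\<^bsub>M t\<^esub> y) = f x + f y) \<and>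
      (\<forall>r. \<forall>x\<in>carrier (M t). f (r \<odot>\<^bsub>M t\<^esub> x) = r * f x)" for t f
  have "\<forall>t\<in>S. \<exists>f. Q t f" using rat by (simp add: Q_def module_isomorphic_def rat_module_def)
  then obtain h where Q: "\<forall>t\<in>S. Q t (h t)" by (rule bchoice[THEN exE])
  have h: "bij_betw (h t) (carrier (M t)) (UNIV :: rat set)"
    "x \<in> carrier (M t) \<Longrightarrow> y \<in> carrier (M t) \<Longrightarrow> h t (x \<oplus>\<^bsub>M t\<^esub> y) = h t x + h t y"
    "x \<in> carrier (M t) \<Longrightarrow> h t (r \<odot>\<^bsub>M t\<^esub> x) = r * h t x" if "t \<in> S" for t x y r
    using bspec[OF Q that] by (simp_all add: Q_def)
  obtain z where z: "\<And>t. t \<in> T - {t0} - S \<Longrightarrow> carrier (M t) = {z t}" using van unfolding vanishes_def by metis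
  have "finite S" using S fin finite_subset by blast
  then obtain e where e: "bij_betw e {..<k} S" using ex_bij_betw_nat_finite[of S] k by (auto simp: atLeast0LessThan)
  have eS: "e i \<in> S" "e i \<in> T" "e i \<noteq> t0" if "i < k" for i using bij_betwE[OF e] S that by auto
  define F where "F f = (h0 (f t0), \<lambda>i\<in>{..<k}. h (e i) (f (e i)))" for f
  let ?C = "Pi\<^sub>E T (\<lambda>t. carrier (M t))" and ?D = "carrier N \<times> ({..<k} \<rightarrow>\<^sub>E (UNIV :: rat set))"
  have C: "carrier (direct_sum T M) = ?C" using fin by (simp add: direct_sum_def)
  have D: "carrier (direct_sum2 N (rat_space k)) = ?D"
    by (simp add: direct_sum2_def rat_space_def direct_sum_def rat_module_def)
  have mem: "f t \<in> carrier (M t)" if "f \<in> ?C" "t \<in> T" for f t using that by auto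
  have "bij_betw F ?C ?D"
    unfolding bij_betw_def
  proof (intro conjI)
    show "inj_on F ?C"
    proof (rule inj_onI)
      fix f g assume f: "f \<in> ?C" and g: "g \<in> ?C" and "F f = F g"
      then have F: "h0 (f t0) = h0 (g t0)" "(\<lambda>i\<in>{..<k}. h (e i) (f (e i))) = (\<lambda>i\<in>{..<k}. h (e i) (g (e i)))"
        by (simp_all add: F_def)
      show "f = g"
      proof (rule PiE_ext[OF f g])
        fix t assume t: "t \<in> T"
        consider "t = t0" | "t \<in> S" | "t \<in> T - {t0} - S" using t by blast
        then show "f t = g t"
        proof cases
          case 1 then show ?thesis using F(1) h0(1) mem[OF f t0] mem[OF g t0] by (auto simp: bij_betw_def inj_on_def)
        next
          case 2
          then obtain i where i: "i < k" "t = e i" using bij_betw_imp_surj_on[OF e] by blast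
          have "h t (f t) = h t (g t)" using fun_cong[OF F(2), of i] i by simp
          then show ?thesis using h(1)[OF 2] mem[OF f t] mem[OF g t] by (auto simp: bij_betw_def inj_on_def)
        next
          case 3 then show ?thesis using z[OF 3] mem[OF f t] mem[OF g t] by simp
        qed
      qed
    qed
    show "F ` ?C = ?D"
    proof (rule subset_antisym)
      show "F ` ?C \<subseteq> ?D" using mem t0 bij_betwE[OF h0(1)] by (auto simp: F_def split: if_splits)
      show "?D \<subseteq> F ` ?C"
      proof
        fix p assume "p \<in> ?D"
        then obtain n r where p: "p = (n, r)" "n \<in> carrier N" "r \<in> {..<k} \<rightarrow>\<^sub>E UNIV" by blast
        have "n \<in> h0 ` carrier (M t0)" unfolding bij_betw_imp_surj_on[OF h0(1)] by (rule p(2))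
        then obtain x0 where x0: "x0 \<in> carrier (M t0)" "h0 x0 = n" by (auto simp: image_iff)
        define f where "f = (\<lambda>t\<in>T. if t = t0 then x0 else if t \<in> S
          then inv_into (carrier (M t)) (h t) (r (inv_into {..<k} e t)) else z t)"
        have hi: "inv_into (carrier (M t)) (h t) q \<in> carrier (M t)" "h t (inv_into (carrier (M t)) (h t) q) = q" if "t \<in> S" for t q
        proof -
          have "q \<in> h t ` carrier (M t)" using bij_betw_imp_surj_on[OF h(1)[OF that]] by simp
          then show "inv_into (carrier (M t)) (h t) q \<in> carrier (M t)" "h t (inv_into (carrier (M t)) (h t) q) = q"
            by (rule inv_into_into, rule f_inv_into_f)
        qed
        have "f \<in> ?C" using x0(1) hi(1) z by (auto simp: f_def)
        moreover have "F f = p"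
        proof -
          have "h (e i) (f (e i)) = r i" if "i < k" for i
            using eS[OF that] hi(2) bij_betw_inv_into_left[OF e] that by (simp add: f_def)
          then have "(\<lambda>i\<in>{..<k}. h (e i) (f (e i))) = r" using p(3) by (auto simp: fun_eq_iff PiE_def extensional_def)
          then show ?thesis using x0(2) t0 by (simp add: F_def p(1)) (simp add: f_def)
        qed
        ultimately show "p \<in> F ` ?C" by blast
      qed
    qed
  qed
  moreover have "F (f \<oplus>\<^bsub>direct_sum T M\<^esub> g) = F f \<oplus>\<^bsub>direct_sum2 N (rat_space k)\<^esub> F g" if f: "f \<in> ?C" "g \<in> ?C" for f g
    using mem[OF f(1)] mem[OF f(2)] t0 eS h0(2) h(2)
    by (auto simp: F_def direct_sum2_def rat_space_def direct_sum_def rat_module_def fun_eq_iff)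
  moreover have "F (r \<odot>\<^bsub>direct_sum T M\<^esub> f) = r \<odot>\<^bsub>direct_sum2 N (rat_space k)\<^esub> F f" if f: "f \<in> ?C" for r f
    using mem[OF f] t0 eS h0(3) h(3)
    by (auto simp: F_def direct_sum2_def rat_space_def direct_sum_def rat_module_def fun_eq_iff)
  ultimately show ?thesis unfolding module_isomorphic_def C D by blast
qed

section \<open>Torsion in finite index subgroups\<close>

context bianchi
begin

text \<open>Equality in PSL2 can be read off, up to sign, in any common frame.\<close>

lemma pm_frame_eq_iff:
  fixes B X Q E E' :: "complex ^ 2 ^ 2"
  assumes Q: "det Q = 1" and B: "B ** Q = Q ** E" "X ** Q = Q ** E'"
  shows "pm B = pm X \<longleftrightarrow> E' = E \<or> E' = - E"
proof -
  have "X = B \<longleftrightarrow> E' = E" using frame_cancel[OF Q] B by metis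
  moreover have "X = - B \<longleftrightarrow> E' = - E"
  proof -
    have "X = - B \<longleftrightarrow> X ** Q = (- B) ** Q" using frame_cancel(1)[OF Q] by simp
    also have "\<dots> \<longleftrightarrow> Q ** E' = Q ** (- E)" using B by (simp add: uminus_mult2)
    finally show ?thesis using frame_cancel(2)[OF Q] by simp
  qed
  ultimately show ?thesis by (simp add: pm_eq_iff)
qed

lemma mat1_frame: "mat 1 ** Q = Q ** (mat 1 :: complex ^ 2 ^ 2)"
  by simp

lemma elliptic_square:
  assumes "elliptic_form A Q \<zeta> t"
  shows "\<zeta> * \<zeta> = of_int t * \<zeta> - 1" "cnj \<zeta> * cnj \<zeta> = of_int t * cnj \<zeta> - 1"
proof -
  note Q = elliptic_cases[OF assms]
  have "\<zeta> * (\<zeta> + cnj \<zeta>) = \<zeta> * \<zeta> + 1" "cnj \<zeta> * (\<zeta> + cnj \<zeta>) = cnj \<zeta> * cnj \<zeta> + 1"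
    using Q(2) by (simp_all add: distrib_left mult.commute)
  then show "\<zeta> * \<zeta> = of_int t * \<zeta> - 1" "cnj \<zeta> * cnj \<zeta> = of_int t * cnj \<zeta> - 1"
    unfolding Q(6) by (simp_all add: algebra_simps)
qed

text \<open>By \<open>\<zeta>^2 = t \<zeta> - 1\<close>, trace 0 gives
  \<open>\<zeta>^2 = -1\<close>, while the traces 1 and -1 give
  \<open>\<zeta>^3 = - t\<close>.\<close>

lemma elliptic_power:
  assumes A: "A \<in> carrier (SL2 R)" "elliptic_form A Q \<zeta> t"
  shows "t = 0 \<Longrightarrow> pm A \<otimes>\<^bsub>PSL2 R\<^esub> pm A = \<one>\<^bsub>PSL2 R\<^esub>"
    and "t \<noteq> 0 \<Longrightarrow> pm A \<otimes>\<^bsub>PSL2 R\<^esub> pm A \<otimes>\<^bsub>PSL2 R\<^esub> pm A = \<one>\<^bsub>PSL2 R\<^esub>"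
    and "pm A \<noteq> \<one>\<^bsub>PSL2 R\<^esub>"
proof -
  note Q = elliptic_cases[OF A(2)] and sq = elliptic_square[OF A(2)]
  have AA: "A ** A \<in> carrier (SL2 R)" using A(1) by (intro SL2_mult_closed)
  have f2: "(A ** A) ** Q = Q ** (mat2 \<zeta> 0 0 (cnj \<zeta>) ** mat2 \<zeta> 0 0 (cnj \<zeta>))"
    by (rule conj_frame_mult[OF Q(5) Q(5)])
  have d2: "mat2 \<zeta> 0 0 (cnj \<zeta>) ** mat2 \<zeta> 0 0 (cnj \<zeta>) = mat2 (\<zeta> * \<zeta>) 0 0 (cnj \<zeta> * cnj \<zeta>)"
    by (simp add: mat2_eq_iff mult2_nth)
  show "pm A \<otimes>\<^bsub>PSL2 R\<^esub> pm A = \<one>\<^bsub>PSL2 R\<^esub>" if t: "t = 0"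
  proof -
    have "mat2 (\<zeta> * \<zeta>) 0 0 (cnj \<zeta> * cnj \<zeta>) = - mat 1" using sq t by (simp add: mat2_eq_iff)
    then have "pm (A ** A) = pm (mat 1)"
      using pm_frame_eq_iff[OF Q(1) f2 mat1_frame] unfolding d2 by simp
    then show ?thesis using A(1) by (simp add: PSL2_mult PSL2_one)
  qed
  show "pm A \<otimes>\<^bsub>PSL2 R\<^esub> pm A \<otimes>\<^bsub>PSL2 R\<^esub> pm A = \<one>\<^bsub>PSL2 R\<^esub>" if t: "t \<noteq> 0"
  proof -
    have f3: "(A ** A ** A) ** Q = Q ** (mat2 (\<zeta> * \<zeta>) 0 0 (cnj \<zeta> * cnj \<zeta>) ** mat2 \<zeta> 0 0 (cnj \<zeta>))"
      by (rule conj_frame_mult[OF f2[unfolded d2] Q(5)])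
    have "t = 1 \<or> t = - 1" using A(2) t by (auto simp: elliptic_form_def)
    then have t2: "of_int t * of_int t = (1 :: complex)" by auto
    have cube: "x * x * x = - of_int t" if x: "x * x = of_int t * x - 1" for x :: complex
    proof -
      have "x * x * x = of_int t * (x * x) - x"
        using arg_cong[OF x, of "\<lambda>y. y * x"] by (simp add: algebra_simps)
      also have "\<dots> = (of_int t * of_int t) * x - of_int t - x" unfolding x by (simp add: algebra_simps)
      finally show ?thesis unfolding t2 by simp
    qed
    have "\<zeta> * \<zeta> * \<zeta> = - of_int t" "cnj \<zeta> * cnj \<zeta> * cnj \<zeta> = - of_int t"
      by (rule cube[OF sq(1)], rule cube[OF sq(2)])
    then have d3: "mat2 (\<zeta> * \<zeta>) 0 0 (cnj \<zeta> * cnj \<zeta>) ** mat2 \<zeta> 0 0 (cnj \<zeta>) = mat2 (- of_int t) 0 0 (- of_int t)"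
      by (simp add: mat2_eq_iff mult2_nth)
    have "mat 1 = mat2 (- of_int t) 0 0 (- of_int t) \<or> mat 1 = - mat2 (- of_int t) 0 0 (- of_int t)"
      using \<open>t = 1 \<or> t = - 1\<close> by (auto simp: mat2_eq_iff)
    then have "pm (A ** A ** A) = pm (mat 1)"
      using pm_frame_eq_iff[OF Q(1) f3 mat1_frame] unfolding d3 by simp
    then show ?thesis using A(1) AA by (simp add: PSL2_mult PSL2_one)
  qed
  show "pm A \<noteq> \<one>\<^bsub>PSL2 R\<^esub>"
  proof
    assume "pm A = \<one>\<^bsub>PSL2 R\<^esub>"
    then have "A = mat 1 \<or> A = - mat 1" by (auto simp: PSL2_one pm_eq_iff)
    then have "A $ 2 $ 1 = 0" by (auto simp: mat_def)
    then show False using A(2) by (simp add: elliptic_form_def)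
  qed
qed

context
  fixes \<Gamma> :: "(complex ^ 2 ^ 2) set set"
  assumes \<Gamma>: "subgroup \<Gamma> (PSL2 R)" and index: "finite (rcosets\<^bsub>PSL2 R\<^esub> \<Gamma>)"
begin

abbreviation P\<Gamma> where "P\<Gamma> \<equiv> PSL2 R\<lparr>carrier := \<Gamma>\<rparr>"

lemma group_P\<Gamma>: "group P\<Gamma>"
  by (rule subgroup.subgroup_is_group[OF \<Gamma> group_PSL2])

interpretation P: group P\<Gamma> by (rule group_P\<Gamma>)

lemma pow_P\<Gamma>: "g [^]\<^bsub>P\<Gamma>\<^esub> (k::nat) = g [^]\<^bsub>PSL2 R\<^esub> k"
  by (simp add: nat_pow_def)

lemma finite_order_elliptic:
  assumes "g \<in> finite_order_elements P\<Gamma>" "g \<noteq> \<one>\<^bsub>P\<Gamma>\<^esub>"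
  obtains A Q \<zeta> t where "A \<in> carrier (SL2 R)" "g = pm A" "elliptic_form A Q \<zeta> t" "pm A \<in> \<Gamma>"
proof -
  obtain k :: nat where k: "g \<in> \<Gamma>" "k > 0" "g [^]\<^bsub>PSL2 R\<^esub> k = \<one>\<^bsub>PSL2 R\<^esub>"
    using assms(1) by (auto simp: finite_order_elements_def pow_P\<Gamma>)
  obtain A where A: "A \<in> carrier (SL2 R)" "g = pm A" using subgroup.mem_carrier[OF \<Gamma> k(1)] PSL2_carrier by blast
  obtain Q \<zeta> t where "elliptic_form A Q \<zeta> t"
    by (rule elliptic_of_finite_order[OF bianchi_axioms A(1) _ k(2)]) (use assms(2) k(3) A(2) in auto)
  then show thesis using that A k(1) by simp
qed

lemma torsion_disjoint: "g \<in> P.torsion 2 \<Longrightarrow> g \<notin> P.torsion 3"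
proof
  assume g: "g \<in> P.torsion 2" "g \<in> P.torsion 3"
  have "g = \<one>\<^bsub>P\<Gamma>\<^esub>" using P.torsion_2(1)[OF g(1)] P.torsion_3(2)[OF g(2)] P.torsionD(1)[OF g(1)] P.l_one by simp
  then show False using P.torsionD(2)[OF g(1)] by simp
qed

lemma elliptic_torsion:
  assumes A: "A \<in> carrier (SL2 R)" "elliptic_form A Q \<zeta> t" "pm A \<in> \<Gamma>"
  shows "pm A \<in> P.torsion 2 \<longleftrightarrow> t = 0" "pm A \<in> P.torsion 3 \<longleftrightarrow> t \<noteq> 0"
proof -
  note pw = elliptic_power[OF A(1,2)]
  have gc': "pm A \<in> carrier P\<Gamma>" using A(3) by simp
  have p2: "pm A [^]\<^bsub>P\<Gamma>\<^esub> (2::nat) = pm A \<otimes>\<^bsub>PSL2 R\<^esub> pm A"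
    unfolding Suc_1[symmetric] P.nat_pow_Suc P.nat_pow_eone[OF gc'] by simp
  have "pm A [^]\<^bsub>P\<Gamma>\<^esub> (Suc 2) = pm A \<otimes>\<^bsub>PSL2 R\<^esub> pm A \<otimes>\<^bsub>PSL2 R\<^esub> pm A"
    unfolding P.nat_pow_Suc p2 by simp
  then have p3: "pm A [^]\<^bsub>P\<Gamma>\<^esub> (3::nat) = pm A \<otimes>\<^bsub>PSL2 R\<^esub> pm A \<otimes>\<^bsub>PSL2 R\<^esub> pm A" by simp
  have "pm A \<in> P.torsion 2" if "t = 0"
    unfolding P.torsion_def mem_Collect_eq p2 using pw(1)[OF that] pw(3) A(3) by simp
  moreover have "pm A \<in> P.torsion 3" if "t \<noteq> 0"
    unfolding P.torsion_def mem_Collect_eq p3 using pw(2)[OF that] pw(3) A(3) by simp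
  ultimately show "pm A \<in> P.torsion 2 \<longleftrightarrow> t = 0" "pm A \<in> P.torsion 3 \<longleftrightarrow> t \<noteq> 0" using torsion_disjoint by blast+
qed

lemma finite_order_torsion:
  assumes "g \<in> finite_order_elements P\<Gamma>" "g \<noteq> \<one>\<^bsub>P\<Gamma>\<^esub>"
  shows "g \<in> P.torsion 2 \<or> g \<in> P.torsion 3"
proof -
  obtain A Q \<zeta> t where A: "A \<in> carrier (SL2 R)" "g = pm A" "elliptic_form A Q \<zeta> t" "pm A \<in> \<Gamma>"
    by (rule finite_order_elliptic[OF assms])
  then show ?thesis using elliptic_torsion[OF A(1,3,4)] by blast
qed

lemma torsion_finite_order: "g \<in> P.torsion n \<Longrightarrow> n > 0 \<Longrightarrow> g \<in> finite_order_elements P\<Gamma>"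
  unfolding finite_order_elements_def P.torsion_def by blast

lemma inverting_involution:
  assumes g: "g \<in> P.torsion 3" and h: "h \<in> carrier P\<Gamma>" "P.conj_by h g = inv\<^bsub>P\<Gamma>\<^esub> g"
  shows "h \<otimes>\<^bsub>P\<Gamma>\<^esub> h = \<one>\<^bsub>P\<Gamma>\<^esub>"
proof -
  have fo: "g \<in> finite_order_elements P\<Gamma>" "g \<noteq> \<one>\<^bsub>P\<Gamma>\<^esub>" using torsion_finite_order[OF g] P.torsionD(2)[OF g] by auto
  obtain A Q \<zeta> t where A: "A \<in> carrier (SL2 R)" "g = pm A" "elliptic_form A Q \<zeta> t" "pm A \<in> \<Gamma>"
    by (rule finite_order_elliptic[OF fo])
  have t: "t \<noteq> 0" using elliptic_torsion(2)[OF A(1,3,4)] g A(2) by simp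
  have h\<Gamma>: "h \<in> \<Gamma>" using h(1) by simp
  obtain B where B: "B \<in> carrier (SL2 R)" "h = pm B" using subgroup.mem_carrier[OF \<Gamma> h\<Gamma>] PSL2_carrier by blast
  have gc: "g \<in> carrier P\<Gamma>" by (rule P.torsionD(1)[OF g])
  have "P.conj_by h g \<otimes>\<^bsub>P\<Gamma>\<^esub> h = h \<otimes>\<^bsub>P\<Gamma>\<^esub> g"
    unfolding P.conj_by_def using P.m_assoc[OF P.m_closed[OF h(1) gc] P.inv_closed[OF h(1)] h(1)] P.l_inv[OF h(1)]
      P.r_one[OF P.m_closed[OF h(1) gc]] by simp
  moreover have "inv\<^bsub>P\<Gamma>\<^esub> g = pm (adj2 A)"
    using group.m_inv_consistent[OF group_PSL2 \<Gamma>, of g] gc PSL2_inv[OF A(1)] A(2) by simp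
  ultimately have "pm B \<otimes>\<^bsub>PSL2 R\<^esub> pm A = pm (adj2 A) \<otimes>\<^bsub>PSL2 R\<^esub> pm B" using h(2) A(2) B(2) by simp
  from inverting_case[OF A(1,3) t B(1) this] show ?thesis by (simp add: B(2))
qed

text \<open>A flip is antidiagonal with square -1, hence an involution that commutes with
  \<open>pm A\<close> and differs from it. Conversely, if the partner of \<open>pm A\<close> in a
  Klein group acted as a translation, then \<open>\<alpha>^2\<close> would be 1 or -1, making it the
  identity or \<open>pm A\<close> itself.\<close>

lemma flip_constants_iff:
  assumes A: "A \<in> carrier (SL2 R)" "elliptic_form A Q \<zeta> t" "pm A \<in> \<Gamma>"
  shows "flip_constants (centralizer P\<Gamma> (pm A)) Q \<noteq> {} \<longleftrightarrow>
     pm A \<in> P.torsion 2 \<and> (\<exists>h. dihedral_pair 2 P\<Gamma> (pm A) h)"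
proof -
  note Q = elliptic_cases[OF A(2)]
  have E1: "mat 1 = mat2 1 0 0 1" by (simp add: mat2_eq_iff)
  have powers: "(\<lambda>i. pm A [^]\<^bsub>P\<Gamma>\<^esub> i) ` {..<2::nat} = {\<one>\<^bsub>P\<Gamma>\<^esub>, pm A}" if "pm A \<in> P.torsion 2"
    using P.generate_torsion[OF that] P.generate_torsion_2[OF that] by simp
  show ?thesis
  proof
    assume "flip_constants (centralizer P\<Gamma> (pm A)) Q \<noteq> {}"
    then obtain B \<beta> where B: "B \<in> carrier (SL2 R)" "pm B \<in> centralizer P\<Gamma> (pm A)" "\<beta> \<noteq> 0"
      "B ** Q = Q ** mat2 0 \<beta> (- inverse \<beta>) 0" by (auto simp: flip_constants_def)
    have B\<Gamma>: "pm B \<in> \<Gamma>" and comm: "pm B \<otimes>\<^bsub>PSL2 R\<^esub> pm A = pm A \<otimes>\<^bsub>PSL2 R\<^esub> pm B"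
      using B(2) by (simp_all add: centralizer_def)
    have "\<zeta> + cnj \<zeta> = 0"
    proof (rule centralizer_cases[OF A(1,2) B(1) comm])
      fix \<alpha> assume "B ** Q = Q ** mat2 \<alpha> 0 0 (inverse \<alpha>)"
      then have "mat2 0 \<beta> (- inverse \<beta>) 0 = mat2 \<alpha> 0 0 (inverse \<alpha>)" using B(4) frame_cancel(2)[OF Q(1)] by metis
      then show ?thesis using B(3) by (simp add: mat2_eq_iff)
    qed
    then have t: "t = 0" using Q(6) by simp
    then have g: "pm A \<in> P.torsion 2" using elliptic_torsion(1)[OF A] by simp
    have "(B ** B) ** Q = Q ** (mat2 0 \<beta> (- inverse \<beta>) 0 ** mat2 0 \<beta> (- inverse \<beta>) 0)"
      by (rule conj_frame_mult[OF B(4) B(4)])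
    also have "mat2 0 \<beta> (- inverse \<beta>) 0 ** mat2 0 \<beta> (- inverse \<beta>) 0 = - mat 1"
      using B(3) by (simp add: mat2_eq_iff mult2_nth)
    finally have "pm (B ** B) = pm (mat 1)" using pm_frame_eq_iff[OF Q(1) _ mat1_frame] by simp
    then have hh: "pm B \<otimes>\<^bsub>P\<Gamma>\<^esub> pm B = \<one>\<^bsub>P\<Gamma>\<^esub>" using B(1) by (simp add: PSL2_mult PSL2_one)
    have "pm B \<noteq> \<one>\<^bsub>P\<Gamma>\<^esub>"
      using pm_frame_eq_iff[OF Q(1) B(4) mat1_frame] by (auto simp: PSL2_one mat2_eq_iff)
    moreover have "pm B \<noteq> pm A"
      using pm_frame_eq_iff[OF Q(1) B(4) Q(5)] Q(4) by (auto simp: mat2_eq_iff)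
    ultimately have "pm B \<notin> (\<lambda>i. pm A [^]\<^bsub>P\<Gamma>\<^esub> i) ` {..<2::nat}" unfolding powers[OF g] by simp
    moreover have "pm B \<otimes>\<^bsub>P\<Gamma>\<^esub> pm A \<otimes>\<^bsub>P\<Gamma>\<^esub> pm B = inv\<^bsub>P\<Gamma>\<^esub> pm A"
    proof -
      have "pm B \<otimes>\<^bsub>P\<Gamma>\<^esub> pm A \<otimes>\<^bsub>P\<Gamma>\<^esub> pm B = pm A \<otimes>\<^bsub>P\<Gamma>\<^esub> pm B \<otimes>\<^bsub>P\<Gamma>\<^esub> pm B" using comm by simp
      also have "\<dots> = pm A \<otimes>\<^bsub>P\<Gamma>\<^esub> (pm B \<otimes>\<^bsub>P\<Gamma>\<^esub> pm B)" by (rule P.m_assoc) (use A(3) B\<Gamma> in simp_all)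
      also have "\<dots> = pm A" unfolding hh by (rule P.r_one) (use A(3) in simp)
      finally show ?thesis using P.torsion_2(2)[OF g] by simp
    qed
    ultimately have "dihedral_pair 2 P\<Gamma> (pm A) (pm B)"
      unfolding dihedral_pair_def using P.torsionD[OF g] B\<Gamma> hh by simp
    then show "pm A \<in> P.torsion 2 \<and> (\<exists>h. dihedral_pair 2 P\<Gamma> (pm A) h)" using g by blast
  next
    assume "pm A \<in> P.torsion 2 \<and> (\<exists>h. dihedral_pair 2 P\<Gamma> (pm A) h)"
    then obtain h where g: "pm A \<in> P.torsion 2" and D: "dihedral_pair 2 P\<Gamma> (pm A) h" by blast
    have h: "h \<in> carrier P\<Gamma>" "h \<otimes>\<^bsub>P\<Gamma>\<^esub> h = \<one>\<^bsub>P\<Gamma>\<^esub>" "h \<otimes>\<^bsub>P\<Gamma>\<^esub> pm A \<otimes>\<^bsub>P\<Gamma>\<^esub> h = pm A"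
      "h \<noteq> \<one>\<^bsub>P\<Gamma>\<^esub>" "h \<noteq> pm A"
      using D P.torsion_2(2)[OF g] powers[OF g] by (simp_all add: dihedral_pair_def)
    have t: "t = 0" using elliptic_torsion(1)[OF A] g by simp
    have h\<Gamma>: "h \<in> \<Gamma>" using h(1) by simp
    obtain B where B: "B \<in> carrier (SL2 R)" "h = pm B" using subgroup.mem_carrier[OF \<Gamma> h\<Gamma>] PSL2_carrier by blast
    have gc: "pm A \<in> carrier P\<Gamma>" using A(3) by simp
    have "h \<otimes>\<^bsub>P\<Gamma>\<^esub> pm A = h \<otimes>\<^bsub>P\<Gamma>\<^esub> pm A \<otimes>\<^bsub>P\<Gamma>\<^esub> (h \<otimes>\<^bsub>P\<Gamma>\<^esub> h)"
      unfolding h(2) by (rule P.r_one[symmetric]) (rule P.m_closed[OF h(1) gc])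
    also have "\<dots> = (h \<otimes>\<^bsub>P\<Gamma>\<^esub> pm A \<otimes>\<^bsub>P\<Gamma>\<^esub> h) \<otimes>\<^bsub>P\<Gamma>\<^esub> h"
      by (rule P.m_assoc[symmetric]) (rule P.m_closed[OF h(1) gc] h(1))+
    finally have comm: "h \<otimes>\<^bsub>P\<Gamma>\<^esub> pm A = pm A \<otimes>\<^bsub>P\<Gamma>\<^esub> h" unfolding h(3) .
    then have comm': "pm B \<otimes>\<^bsub>PSL2 R\<^esub> pm A = pm A \<otimes>\<^bsub>PSL2 R\<^esub> pm B" by (simp add: B(2))
    have C: "pm B \<in> centralizer P\<Gamma> (pm A)" using comm h\<Gamma> by (simp add: centralizer_def B(2))
    show "flip_constants (centralizer P\<Gamma> (pm A)) Q \<noteq> {}"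
    proof (rule centralizer_cases[OF A(1,2) B(1) comm'])
      fix \<beta> assume "\<beta> \<noteq> 0" "B ** Q = Q ** mat2 0 \<beta> (- inverse \<beta>) 0"
      then show ?thesis using B(1) C unfolding flip_constants_def by blast
    next
      fix \<alpha> assume \<alpha>: "\<alpha> \<noteq> 0" "B ** Q = Q ** mat2 \<alpha> 0 0 (inverse \<alpha>)"
      have BB: "(B ** B) ** Q = Q ** (mat2 \<alpha> 0 0 (inverse \<alpha>) ** mat2 \<alpha> 0 0 (inverse \<alpha>))"
        by (rule conj_frame_mult[OF \<alpha>(2) \<alpha>(2)])
      have "pm (B ** B) = pm (mat 1)" using h(2) B by (simp add: PSL2_mult PSL2_one)
      then have "\<alpha> * \<alpha> = 1 \<or> \<alpha> * \<alpha> = - 1"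
        using pm_frame_eq_iff[OF Q(1) BB mat1_frame] by (auto simp: mat2_eq_iff mult2_nth) (metis minus_minus)
      moreover have "\<alpha> * \<alpha> \<noteq> 1"
      proof
        assume a: "\<alpha> * \<alpha> = 1"
        then have "\<alpha> = 1 \<or> \<alpha> = - 1" by (simp add: square_eq_1_iff)
        then have "mat 1 = mat2 \<alpha> 0 0 (inverse \<alpha>) \<or> mat 1 = - mat2 \<alpha> 0 0 (inverse \<alpha>)" by (auto simp: mat2_eq_iff)
        then have "pm B = pm (mat 1)" using pm_frame_eq_iff[OF Q(1) \<alpha>(2) mat1_frame] by simp
        then show False using h(4) by (simp add: B(2) PSL2_one)
      qed
      moreover have "\<alpha> * \<alpha> \<noteq> - 1"
      proof
        assume a: "\<alpha> * \<alpha> = - 1"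
        have z: "cnj \<zeta> = - \<zeta>" using Q(6) t by (simp add: eq_neg_iff_add_eq_0 add.commute)
        have "\<zeta> * \<zeta> = - 1" using elliptic_square(1)[OF A(2)] t by simp
        then have "(\<alpha> - \<zeta>) * (\<alpha> + \<zeta>) = 0" using a by (simp add: algebra_simps)
        then have "\<zeta> = \<alpha> \<or> \<zeta> = - \<alpha>" by (auto simp: eq_neg_iff_add_eq_0 add.commute)
        moreover have "inverse \<alpha> = - \<alpha>" using a by (intro inverse_unique) simp
        ultimately have "mat2 \<zeta> 0 0 (cnj \<zeta>) = mat2 \<alpha> 0 0 (inverse \<alpha>) \<or> mat2 \<zeta> 0 0 (cnj \<zeta>) = - mat2 \<alpha> 0 0 (inverse \<alpha>)"
          using z by (auto simp: mat2_eq_iff)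
        then have "pm B = pm A" using pm_frame_eq_iff[OF Q(1) \<alpha>(2) Q(5)] by simp
        then show False using h(5) by (simp add: B(2))
      qed
      ultimately show ?thesis by blast
    qed
  qed
qed

text \<open>The full group has finitely many classes of elliptic elements, and each of them splits
  into finitely many under a subgroup of finite index.\<close>

lemma finite_representatives:
  assumes T: "torsion_representatives P\<Gamma> T"
  shows "finite T"
proof -
  obtain \<kappa> :: "complex ^ 2 ^ 2 \<Rightarrow> complex \<times> complex \<times> complex \<times> complex \<times> complex \<times> complex"
    where \<kappa>: "finite (\<kappa> ` {A. elliptic A})"
      "\<And>A A'. elliptic A \<Longrightarrow> elliptic A' \<Longrightarrow> \<kappa> A = \<kappa> A' \<Longrightarrow> \<exists>X\<in>carrier (SL2 R). X ** A = A' ** X"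
    by (rule elliptic_finitely_many_classes) blast
  let ?S = "T - {\<one>\<^bsub>P\<Gamma>\<^esub>}"
  have fo: "g \<in> finite_order_elements P\<Gamma>" if "g \<in> T" for g using T that by (auto simp: torsion_representatives_def)
  then have sub: "g \<in> \<Gamma>" if "g \<in> T" for g using that by (auto simp: finite_order_elements_def)
  define A where "A g = (SOME A. elliptic A \<and> g = pm A)" for g
  have A: "elliptic (A g)" "g = pm (A g)" if g: "g \<in> ?S" for g
  proof -
    have g': "g \<in> finite_order_elements P\<Gamma>" "g \<noteq> \<one>\<^bsub>P\<Gamma>\<^esub>" using g fo by auto
    have "\<exists>A. elliptic A \<and> g = pm A" by (rule finite_order_elliptic[OF g']) (auto simp: elliptic_def)
    from someI_ex[OF this] show "elliptic (A g)" "g = pm (A g)" by (simp_all add: A_def)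
  qed
  have "finite ?S"
  proof (rule group.finite_index_representatives[OF group_PSL2 \<Gamma> index])
    show "?S \<subseteq> carrier (PSL2 R)" using sub subgroup.subset[OF \<Gamma>] by blast
    show "finite ((\<lambda>g. \<kappa> (A g)) ` ?S)" by (rule finite_subset[OF _ \<kappa>(1)]) (use A(1) in auto)
    show "\<exists>x\<in>carrier (PSL2 R). x \<otimes>\<^bsub>PSL2 R\<^esub> g = g' \<otimes>\<^bsub>PSL2 R\<^esub> x" if g: "g \<in> ?S" "g' \<in> ?S" "\<kappa> (A g) = \<kappa> (A g')" for g g'
    proof -
      obtain X where X: "X \<in> carrier (SL2 R)" "X ** A g = A g' ** X" using \<kappa>(2)[OF A(1)[OF g(1)] A(1)[OF g(2)] g(3)] by blast
      have "A g \<in> carrier (SL2 R)" "A g' \<in> carrier (SL2 R)" using A(1) g by (auto simp: elliptic_def)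
      then have "pm X \<otimes>\<^bsub>PSL2 R\<^esub> pm (A g) = pm (A g') \<otimes>\<^bsub>PSL2 R\<^esub> pm X" using X by (simp add: PSL2_mult)
      then show ?thesis using X(1) A(2)[OF g(1)] A(2)[OF g(2)] PSL2_carrier by (intro bexI[of _ "pm X"]) auto
    qed
    show "g = g'" if g: "g \<in> ?S" "g' \<in> ?S" "y \<in> \<Gamma>" "y \<otimes>\<^bsub>PSL2 R\<^esub> g = g' \<otimes>\<^bsub>PSL2 R\<^esub> y" for g g' y
    proof -
      have yc: "y \<in> carrier P\<Gamma>" "g' \<in> carrier P\<Gamma>" using g sub by auto
      have "P.conj_by y g = g' \<otimes>\<^bsub>P\<Gamma>\<^esub> y \<otimes>\<^bsub>P\<Gamma>\<^esub> inv\<^bsub>P\<Gamma>\<^esub> y" using g(4) by (simp add: P.conj_by_def)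
      also have "\<dots> = g' \<otimes>\<^bsub>P\<Gamma>\<^esub> (y \<otimes>\<^bsub>P\<Gamma>\<^esub> inv\<^bsub>P\<Gamma>\<^esub> y)" by (rule P.m_assoc[OF yc(2,1) P.inv_closed[OF yc(1)]])
      also have "\<dots> = g'" unfolding P.r_inv[OF yc(1)] by (rule P.r_one[OF yc(2)])
      finally have c: "g' = P.conj_by y g" by simp
      have "g' = g" by (rule P.representative_unique[OF T _ _ yc(1) c]) (use g(1,2) in auto)
      then show ?thesis by simp
    qed
  qed
  then show ?thesis by simp
qed

section \<open>Cohomology of the sectors and the final count\<close>

abbreviation "flipped g \<equiv> g \<in> P.torsion 2 \<and> (\<exists>h. dihedral_pair 2 P\<Gamma> g h)"

text \<open>The degree shift 1 moves the degrees 0 and 1 of the model space to \<open>d = 2\<close>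
  and \<open>d = 3\<close>. A flip replaces the circle by an interval and thereby removes degree
  1.\<close>

lemma sector_cohomology:
  fixes d :: int
  assumes g: "g \<in> finite_order_elements P\<Gamma>" "g \<noteq> \<one>\<^bsub>P\<Gamma>\<^esub>"
  defines "M \<equiv> cohomology (of_int d - 2 * degree_shift_of complex_hyperbolic_3_space complex_action affine_chart g)
     (orbit_space (P\<Gamma>\<lparr>carrier := centralizer P\<Gamma> g\<rparr>) complex_action
       (subtopology complex_hyperbolic_3_space (fixed_set complex_hyperbolic_3_space complex_action g)))"
  shows "d = 2 \<or> d = 3 \<and> \<not> flipped g \<Longrightarrow> module_isomorphic M rat_module"
    and "\<not> (d = 2 \<or> d = 3 \<and> \<not> flipped g) \<Longrightarrow> vanishes M"
proof -
  obtain A Q \<zeta> t where A: "A \<in> carrier (SL2 R)" "g = pm A" "elliptic_form A Q \<zeta> t" "pm A \<in> \<Gamma>"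
    by (rule finite_order_elliptic[OF g])
  have dA: "det A = 1" using A(1) by (simp add: SL2_carrier)
  have "0 \<in> strip" by (simp add: strip_def)
  then have "\<exists>y. y \<in> fixed_set complex_hyperbolic_3_space complex_action (pm A)"
    using quotient_map_axis_point(3)[OF A(3)] by blast
  from someI_ex[OF this] have shift: "degree_shift_of complex_hyperbolic_3_space complex_action affine_chart g = 1"
    unfolding degree_shift_of_def A(2) by (rule degree_shift_elliptic[OF A(3) dA])
  define X' where "X' = orbit_space (PSL2 R\<lparr>carrier := centralizer P\<Gamma> (pm A)\<rparr>) complex_action
     (subtopology complex_hyperbolic_3_space (fixed_set complex_hyperbolic_3_space complex_action (pm A)))"
  have M: "M = cohomology (of_int d - 2) X'"
    unfolding M_def X'_def shift by (simp add: A(2))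
  note sector = sector_homotopy_type[OF bianchi_axioms \<Gamma> index A(1,3,4), folded X'_def]
  have flip: "flip_constants (centralizer P\<Gamma> (pm A)) Q \<noteq> {} \<longleftrightarrow> flipped g"
    unfolding A(2) by (rule flip_constants_iff[OF A(1,3,4)])
  have d: "real_of_int d - 2 = 0 \<longleftrightarrow> d = 2" "real_of_int d - 2 = 1 \<longleftrightarrow> d = 3" by auto
  have "(d = 2 \<or> d = 3 \<and> \<not> flipped g \<longrightarrow> module_isomorphic M rat_module) \<and>
    (\<not> (d = 2 \<or> d = 3 \<and> \<not> flipped g) \<longrightarrow> vanishes M)"
  proof (cases "flipped g")
    case False
    then have X': "X' homotopy_equivalent_space nsphere 1" using sector(1) flip by blast
    show ?thesis using False cohomology_circle[OF X' path_connected_nsphere_1, of "of_int d - 2"] unfolding d M by blast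
  next
    case True
    then have X': "X' homotopy_equivalent_space top_of_set {-1..1::real}" using sector(2) flip by blast
    have "contractible_space (top_of_set {-1..1::real})" by (simp add: convex_imp_contractible)
    then have con: "contractible_space X'" using homotopy_equivalent_space_contractibility[OF X'] by simp
    obtain f where "continuous_map (top_of_set {-1..1::real}) X' f"
      using X' unfolding homotopy_equivalent_space_def by blast
    then have "f 0 \<in> topspace X'" unfolding continuous_map_def by auto
    then have ne: "topspace X' \<noteq> {}" by blast
    have "d = 2 \<Longrightarrow> module_isomorphic M rat_module" using cohomology_contractible(1)[OF con ne] unfolding M by simp
    moreover have "d \<noteq> 2 \<Longrightarrow> vanishes M" unfolding M by (rule cohomology_contractible(2)[OF con ne]) (simp add: d)
    ultimately show ?thesis using True by blast
  qed
  then show "d = 2 \<or> d = 3 \<and> \<not> flipped g \<Longrightarrow> module_isomorphic M rat_module"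
    and "\<not> (d = 2 \<or> d = 3 \<and> \<not> flipped g) \<Longrightarrow> vanishes M" by blast+
qed

text \<open>The identity fixes every point, has degree shift 0 and is centralised by the whole
  group, so its sector is the full orbit space.\<close>

lemma identity_sector_cohomology:
  "module_isomorphic
     (cohomology (of_int d - 2 * degree_shift_of complex_hyperbolic_3_space complex_action affine_chart \<one>\<^bsub>P\<Gamma>\<^esub>)
       (orbit_space (P\<Gamma>\<lparr>carrier := centralizer P\<Gamma> \<one>\<^bsub>P\<Gamma>\<^esub>\<rparr>) complex_action
         (subtopology complex_hyperbolic_3_space (fixed_set complex_hyperbolic_3_space complex_action \<one>\<^bsub>P\<Gamma>\<^esub>))))
     (cohomology (of_int d) (orbit_space P\<Gamma> real_action real_hyperbolic_3_space))"
proof -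
  have "acts_on P\<Gamma> complex_action (line ` ccone)" by (rule acts_on_complex[OF \<Gamma>])
  then have fixed: "fixed_set complex_hyperbolic_3_space complex_action \<one>\<^bsub>P\<Gamma>\<^esub> = topspace complex_hyperbolic_3_space"
    unfolding fixed_set_def topspace_complex_hyperbolic acts_on_def by auto
  have "vector [0, 0, 0, 1] \<in> ccone" by (simp add: ccone_def cone_form_def)
  then have "\<exists>y. y \<in> line ` ccone" by blast
  from someI_ex[OF this] obtain z where z: "z \<in> ccone" "(SOME y. y \<in> line ` ccone) = line z" by blast
  have shift: "degree_shift_of complex_hyperbolic_3_space complex_action affine_chart \<one>\<^bsub>P\<Gamma>\<^esub> = 0"
    unfolding degree_shift_of_def fixed topspace_complex_hyperbolic z(2)
    using degree_shift_identity[OF z(1)] by (simp add: PSL2_one)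
  have "centralizer P\<Gamma> \<one>\<^bsub>P\<Gamma>\<^esub> = \<Gamma>"
    unfolding centralizer_def using P.l_one P.r_one by auto
  then show ?thesis
    unfolding shift fixed using cohomology_homotopy_equivalent[OF orbit_spaces_homotopy_equivalent[OF \<Gamma>], of "of_int d"] by simp
qed

theorem chen_ruan_cohomology_isomorphic:
  assumes T: "torsion_representatives P\<Gamma> T"
  shows "module_isomorphic
    (chen_ruan_cohomology P\<Gamma> complex_hyperbolic_3_space complex_action affine_chart T d)
    (direct_sum2
      (cohomology (of_int d) (orbit_space P\<Gamma> real_action real_hyperbolic_3_space))
      (if d = 2 then rat_space (num_cyclic_classes P\<Gamma> 2 + 2 * num_cyclic_classes P\<Gamma> 3 - num_dihedral_cyclic_classes P\<Gamma> 3)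
       else if d = 3 then rat_space (num_cyclic_classes P\<Gamma> 2 - num_dihedral_cyclic_classes P\<Gamma> 2
         + 2 * num_cyclic_classes P\<Gamma> 3 - num_dihedral_cyclic_classes P\<Gamma> 3)
       else rat_space 0))"
proof -
  let ?e = "\<one>\<^bsub>P\<Gamma>\<^esub>"
  define M where "M g = cohomology (of_int d - 2 * degree_shift_of complex_hyperbolic_3_space complex_action affine_chart g)
     (orbit_space (P\<Gamma>\<lparr>carrier := centralizer P\<Gamma> g\<rparr>) complex_action
       (subtopology complex_hyperbolic_3_space (fixed_set complex_hyperbolic_3_space complex_action g)))" for g
  define S where "S = {g \<in> T - {?e}. d = 2 \<or> d = 3 \<and> \<not> flipped g}"
  have fin: "finite T" by (rule finite_representatives[OF T])
  have fo: "g \<in> finite_order_elements P\<Gamma>" if "g \<in> T" for g using T that by (auto simp: torsion_representatives_def)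
  \<comment> \<open>The identity is conjugate only to itself, so \<open>T\<close> has to contain
    it.\<close>
  have "?e \<in> T"
  proof -
    have "?e \<in> finite_order_elements P\<Gamma>"
      unfolding finite_order_elements_def by (intro CollectI conjI exI[of _ 1] P.one_closed P.nat_pow_one) simp
    then obtain h where h: "h \<in> carrier P\<Gamma>" "h \<otimes>\<^bsub>P\<Gamma>\<^esub> ?e \<otimes>\<^bsub>P\<Gamma>\<^esub> inv\<^bsub>P\<Gamma>\<^esub> h \<in> T"
      using T unfolding torsion_representatives_def by blast
    show ?thesis by (rule h(2)[unfolded P.r_one[OF h(1)] P.r_inv[OF h(1)]])
  qed
  have iso: "module_isomorphic (direct_sum T M)
      (direct_sum2 (cohomology (of_int d) (orbit_space P\<Gamma> real_action real_hyperbolic_3_space)) (rat_space (card S)))"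
  proof (rule direct_sum_isomorphic[where ?t0.0 = ?e and S = S, OF fin \<open>?e \<in> T\<close>])
    show "S \<subseteq> T - {?e}" by (auto simp: S_def)
    show "module_isomorphic (M ?e) (cohomology (of_int d) (orbit_space P\<Gamma> real_action real_hyperbolic_3_space))"
      unfolding M_def by (rule identity_sector_cohomology)
    show "module_isomorphic (M g) rat_module" if "g \<in> S" for g
      unfolding M_def by (rule sector_cohomology(1)) (use that fo in \<open>auto simp: S_def\<close>)
    show "vanishes (M g)" if "g \<in> T - {?e} - S" for g
      unfolding M_def by (rule sector_cohomology(2)) (use that fo in \<open>auto simp: S_def\<close>)
  qed simp
  let ?T2 = "T \<inter> P.torsion 2" and ?T3 = "T \<inter> P.torsion 3" and ?T2s = "{t \<in> T \<inter> P.torsion 2. \<exists>h. dihedral_pair 2 P\<Gamma> t h}"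
  have T23: "T - {?e} = ?T2 \<union> ?T3" using finite_order_torsion fo P.torsionD(2) by blast
  have disj: "?T2 \<inter> ?T3 = {}" using torsion_disjoint by blast
  note c2 = P.card_representatives_2[OF T]
  have c3: "card ?T3 + num_dihedral_cyclic_classes P\<Gamma> 3 = 2 * num_cyclic_classes P\<Gamma> 3"
    by (rule P.card_representatives_3[OF T fin]) (rule inverting_involution)
  have fins: "finite ?T2" "finite ?T3" "finite ?T2s" using fin by auto
  have "card S = num_cyclic_classes P\<Gamma> 2 + 2 * num_cyclic_classes P\<Gamma> 3 - num_dihedral_cyclic_classes P\<Gamma> 3" if "d = 2"
  proof -
    have "S = ?T2 \<union> ?T3" unfolding T23[symmetric] S_def using that by blast
    then have "card S = card ?T2 + card ?T3" using card_Un_disjoint[OF fins(1,2) disj] by simp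
    then show ?thesis using c2(1) c3 by linarith
  qed
  \<comment> \<open>The differences of natural numbers are not truncated: the starred classes of
    order 2 are counted by a subset of \<open>?T2\<close>, and \<open>c3\<close> bounds the starred
    count of order 3 by twice the full count.\<close>
  moreover have "card S = num_cyclic_classes P\<Gamma> 2 - num_dihedral_cyclic_classes P\<Gamma> 2
         + 2 * num_cyclic_classes P\<Gamma> 3 - num_dihedral_cyclic_classes P\<Gamma> 3" if "d = 3"
  proof -
    have "S = (?T2 - ?T2s) \<union> ?T3" unfolding S_def T23 using that torsion_disjoint by auto
    then have "card S = card (?T2 - ?T2s) + card ?T3" using card_Un_disjoint[of "?T2 - ?T2s" ?T3] fins disj by auto
    moreover have "card (?T2 - ?T2s) = card ?T2 - card ?T2s" by (rule card_Diff_subset[OF fins(3)]) blast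
    ultimately show ?thesis using c2 c3 by linarith
  qed
  moreover have "card S = 0" if "d \<noteq> 2" "d \<noteq> 3"
  proof -
    have "S = {}" using that by (auto simp: S_def)
    then show ?thesis by simp
  qed
  ultimately have "rat_space (card S) =
      (if d = 2 then rat_space (num_cyclic_classes P\<Gamma> 2 + 2 * num_cyclic_classes P\<Gamma> 3 - num_dihedral_cyclic_classes P\<Gamma> 3)
       else if d = 3 then rat_space (num_cyclic_classes P\<Gamma> 2 - num_dihedral_cyclic_classes P\<Gamma> 2
         + 2 * num_cyclic_classes P\<Gamma> 3 - num_dihedral_cyclic_classes P\<Gamma> 3)
       else rat_space 0)" by simp
  then show ?thesis using iso unfolding chen_ruan_cohomology_def M_def[abs_def] by simp
qed

end

end

theorem corollary2:
  fixes m :: nat and \<Gamma> T :: "(complex ^ 2 ^ 2) set set" and d :: int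
  defines "\<O> \<equiv> imaginary_quadratic_integers m"
  defines "G \<equiv> (PSL2 \<O>)\<lparr>carrier := \<Gamma>\<rparr>"
  defines "L4 \<equiv> num_cyclic_classes G 2"
    and "L6 \<equiv> num_cyclic_classes G 3"
    and "L4_star \<equiv> num_dihedral_cyclic_classes G 2"
    and "L6_star \<equiv> num_dihedral_cyclic_classes G 3"
  assumes "m > 0" and "squarefree m"
    and "units_of_subring \<O> = {1, -1}"
    and "subgroup \<Gamma> (PSL2 \<O>)" and "finite (rcosets\<^bsub>PSL2 \<O>\<^esub> \<Gamma>)"
    and "torsion_representatives G T"
  shows "module_isomorphic
    (chen_ruan_cohomology G complex_hyperbolic_3_space complex_action affine_chart T d)
    (direct_sum2
      (cohomology (of_int d) (orbit_space G real_action real_hyperbolic_3_space))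
      (if d = 2 then rat_space (L4 + 2 * L6 - L6_star)
       else if d = 3 then rat_space (L4 - L4_star + 2 * L6 - L6_star)
       else rat_space 0))"
proof -
  interpret bianchi m
    using \<open>m > 0\<close> \<open>squarefree m\<close> \<open>units_of_subring \<O> = {1, -1}\<close>[unfolded \<O>_def] by unfold_locales
  show ?thesis
    unfolding L4_def L6_def L4_star_def L6_star_def G_def \<O>_def
    by (rule chen_ruan_cohomology_isomorphic[OF \<open>subgroup \<Gamma> (PSL2 \<O>)\<close>[unfolded \<O>_def]
          \<open>finite (rcosets\<^bsub>PSL2 \<O>\<^esub> \<Gamma>)\<close>[unfolded \<O>_def]
          \<open>torsion_representatives G T\<close>[unfolded G_def \<O>_def]])
qed

end
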